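(* For PSBA instances in which $|T|$ is bounded by a polynomial in the input size, the following greedy algorithm runs in polynomial time and is a $\tfrac12$-approximation: start with $\mathcal S=\emptyset$; while some event is unscheduled, for each unscheduled event $e'$ compute $t'\in\arg\max_{t\in T}\big(F(\mathcal S\cup\{(e',t)\})-F(\mathcal S)\big)$, and then add to $\mathcal S$ the pair $(e',t')$ (among these candidates) maximizing $F(\mathcal S\cup\{(e',t')\})-F(\mathcal S)$, where $F(\mathcal S)=\sum_{i\in A}\mathrm{agr}_i(\mathcal S)$. Moreover, for such instances PSBA admits a polynomial-time $(1-\tfrac1e)$-approximation algorithm.
   Context: PSBA: Time is discrete; $T$ is the set of time slots $\{1,\dots,|T|\}$. There is a set $A$ of agents and a set $E$ of events; each event $e$ has length $l(e)\in\mathbb{N}_{\ge1}$ and, if scheduled at slot $t$, occupies slots $\{t,\dots,t+l(e)-1\}$. Each agent $i$ has a job set $J_i$; each job $j$ has release time $r_j$, deadline $d_j$ and processing time $p_j\le d_j-r_j+1$ (positive integers), with job interval $\{r_j,\dots,d_j\}$. A preemptive job schedule for $J_i$ is feasible if each job $j$ gets $p_j$ distinct slots in its interval and each slot holds at most one job of $J_i$; each $J_i$ is assumed feasible. Let $\mathcal L=\{(e,t):e\in E,t\in T\}$. An event schedule is a subset $\mathcal S\subseteq\mathcal L$; it is partial if each event appears in at most one pair and complete if each appears in exactly one (events may overlap). A slot is an agreement slot of agent $i$ (for $\mathcal S$ and a job schedule of $J_i$) if it is occupied by some event of $\mathcal S$ and no job of $J_i$ is processed in it; $\mathrm{agr}_i(\mathcal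 S)$ is the maximum number of agreement slots over feasible job schedules of $J_i$. The goal is a complete event schedule maximizing $\sum_{i\in A}\mathrm{agr}_i(\mathcal S)$; an algorithm is a $\rho$-approximation if its output has total agreement at least $\rho$ times the optimum. *)

theory Defs
  imports Complex_Main "HOL-Library.Log_Nat" "HOL-Computational_Algebra.Polynomial"
begin

section \<open>Instances, schedules and agreement\<close>

record job =
  release :: nat
  deadline :: nat
  ptime :: nat

text \<open>
  The agents, the events and the jobs of an agent are given by lists; agents, events and
  jobs are identified with their positions, so distinct jobs may have equal parameters.
\<close>

record psba =
  horizon :: nat
  ev_lengths :: "nat list"
  agents :: "job list list"

definition slots :: "psba \<Rightarrow> nat set" where
  "slots I = {1..horizon I}"

definition events :: "psba \<Rightarrow> nat set" where
  "events I = {..<length (ev_lengths I)}"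

definition feasible_job_schedule :: "job list \<Rightarrow> (nat \<Rightarrow> nat set) \<Rightarrow> bool" where
  "feasible_job_schedule J \<sigma> \<longleftrightarrow>
     (\<forall>j<length J. \<sigma> j \<subseteq> {release (J ! j)..deadline (J ! j)} \<and> card (\<sigma> j) = ptime (J ! j)) \<and>
     (\<forall>j<length J. \<forall>k<length J. j \<noteq> k \<longrightarrow> \<sigma> j \<inter> \<sigma> k = {})"

text \<open>
  The inequality \<open>release + ptime \<le> deadline + 1\<close> is \<open>p \<le> d - r + 1\<close> without truncated
  subtraction. Job intervals consist of slots of the instance. Events may be longer than
  the horizon.
\<close>

definition psba_instance :: "psba \<Rightarrow> bool" where
  "psba_instance I \<longleftrightarrow>
     horizon I \<ge> 1 \<and>
     (\<forall>l\<in>set (ev_lengths I). l \<ge> 1) \<and>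
     (\<forall>J\<in>set (agents I).
        (\<forall>j\<in>set J. release j \<ge> 1 \<and> ptime j \<ge> 1 \<and> deadline j \<le> horizon I \<and>
                    release j + ptime j \<le> deadline j + 1) \<and>
        (\<exists>\<sigma>. feasible_job_schedule J \<sigma>))"

definition complete_schedule :: "psba \<Rightarrow> (nat \<times> nat) set \<Rightarrow> bool" where
  "complete_schedule I S \<longleftrightarrow>
     S \<subseteq> events I \<times> slots I \<and> (\<forall>e\<in>events I. \<exists>!t. (e, t) \<in> S)"

definition agreement_slots ::
  "psba \<Rightarrow> job list \<Rightarrow> (nat \<times> nat) set \<Rightarrow> (nat \<Rightarrow> nat set) \<Rightarrow> nat set" where
  "agreement_slots I J S \<sigma> =
     {s \<in> slots I. (\<exists>(e, t)\<in>S. s \<in> {t..<t + ev_lengths I ! e}) \<and>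
                   (\<forall>j<length J. s \<notin> \<sigma> j)}"

definition agr :: "psba \<Rightarrow> job list \<Rightarrow> (nat \<times> nat) set \<Rightarrow> nat" where
  "agr I J S = Max {card (agreement_slots I J S \<sigma>) | \<sigma>. feasible_job_schedule J \<sigma>}"

definition total_agreement :: "psba \<Rightarrow> (nat \<times> nat) set \<Rightarrow> nat" where
  "total_agreement I S = (\<Sum>J\<leftarrow>agents I. agr I J S)"

definition optimum :: "psba \<Rightarrow> nat" where
  "optimum I = Max (total_agreement I ` {S. complete_schedule I S})"

definition approximates :: "real \<Rightarrow> psba \<Rightarrow> (nat \<times> nat) set \<Rightarrow> bool" where
  "approximates \<rho> I S \<longleftrightarrow>
     complete_schedule I S \<and> real (total_agreement I S) \<ge> \<rho> * real (optimum I)"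


section \<open>The greedy algorithm\<close>

definition unscheduled :: "psba \<Rightarrow> (nat \<times> nat) set \<Rightarrow> nat set" where
  "unscheduled I S = {e \<in> events I. \<forall>t. (e, t) \<notin> S}"

definition gain :: "psba \<Rightarrow> (nat \<times> nat) set \<Rightarrow> nat \<Rightarrow> nat \<Rightarrow> int" where
  "gain I S e t = int (total_agreement I (insert (e, t) S)) - int (total_agreement I S)"

text \<open>
  Ties are broken arbitrarily, both in the choice of a slot \<open>cand e'\<close> for each unscheduled
  event \<open>e'\<close> and in the choice of the event to be scheduled.
\<close>

definition greedy_choice :: "psba \<Rightarrow> (nat \<times> nat) set \<Rightarrow> nat \<Rightarrow> nat \<Rightarrow> bool" where
  "greedy_choice I S e t \<longleftrightarrow>
     (\<exists>cand. (\<forall>e'\<in>unscheduled I S. is_arg_max (gain I S e') (\<lambda>u. u \<in> slots I) (cand e')) \<and>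
             is_arg_max (\<lambda>e'. gain I S e' (cand e')) (\<lambda>e'. e' \<in> unscheduled I S) e \<and>
             t = cand e)"

text \<open>The list records the chosen pairs in the order in which they are chosen.\<close>

inductive greedy_steps :: "psba \<Rightarrow> (nat \<times> nat) list \<Rightarrow> bool" for I where
  start: "greedy_steps I []"
| step: "greedy_steps I xs \<Longrightarrow> greedy_choice I (set xs) e t \<Longrightarrow> greedy_steps I (xs @ [(e, t)])"

definition greedy_run :: "psba \<Rightarrow> (nat \<times> nat) list \<Rightarrow> bool" where
  "greedy_run I xs \<longleftrightarrow> greedy_steps I xs \<and> unscheduled I (set xs) = {}"


section \<open>Polynomial time\<close>

text \<open>
  Algorithms are structured programs for a random access machine with the logarithmic cost
  criterion: the cells of the memory hold natural numbers, and every value that is computed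
  (addresses and constants included) is charged its size in bits. Up to a polynomial, this
  measure of time agrees with the time of Turing machines.
\<close>

type_synonym memory = "nat \<Rightarrow> nat"

definition bit_size :: "nat \<Rightarrow> nat" where
  "bit_size n = nat (bitlen (int n)) + 1"

datatype aexp =
    Const nat
  | Load aexp
  | Plus aexp aexp
  | Minus aexp aexp
  | Times aexp aexp
  | Div aexp aexp

fun aval :: "aexp \<Rightarrow> memory \<Rightarrow> nat" where
  "aval (Const n) m = n"
| "aval (Load a) m = m (aval a m)"
| "aval (Plus a b) m = aval a m + aval b m"
| "aval (Minus a b) m = aval a m - aval b m"
| "aval (Times a b) m = aval a m * aval b m"
| "aval (Div a b) m = aval a m div aval b m"

fun acost :: "aexp \<Rightarrow> memory \<Rightarrow> nat" where
  "acost (Const n) m = bit_size n"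
| "acost (Load a) m = acost a m + bit_size (aval (Load a) m)"
| "acost (Plus a b) m = acost a m + acost b m + bit_size (aval (Plus a b) m)"
| "acost (Minus a b) m = acost a m + acost b m + bit_size (aval (Minus a b) m)"
| "acost (Times a b) m = acost a m + acost b m + bit_size (aval (Times a b) m)"
| "acost (Div a b) m = acost a m + acost b m + bit_size (aval (Div a b) m)"

datatype bexp = Less aexp aexp | Neg bexp | Conj bexp bexp

fun bval :: "bexp \<Rightarrow> memory \<Rightarrow> bool" where
  "bval (Less a b) m \<longleftrightarrow> aval a m < aval b m"
| "bval (Neg b) m \<longleftrightarrow> \<not> bval b m"
| "bval (Conj b c) m \<longleftrightarrow> bval b m \<and> bval c m"

fun bcost :: "bexp \<Rightarrow> memory \<Rightarrow> nat" where
  "bcost (Less a b) m = acost a m + acost b m + 1"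
| "bcost (Neg b) m = bcost b m + 1"
| "bcost (Conj b c) m = bcost b m + bcost c m + 1"

text \<open>\<open>Store a b\<close> writes the value of \<open>b\<close> into the cell whose address is the value of \<open>a\<close>.\<close>

datatype com =
    Skip
  | Store aexp aexp
  | Seq com com
  | Cond bexp com com
  | While bexp com

inductive exec :: "com \<Rightarrow> memory \<Rightarrow> nat \<Rightarrow> memory \<Rightarrow> bool" where
  Skip: "exec Skip m 1 m"
| Store: "exec (Store a b) m (acost a m + acost b m + 1) (m(aval a m := aval b m))"
| Seq: "exec c m k m' \<Longrightarrow> exec d m' n m'' \<Longrightarrow> exec (Seq c d) m (k + n) m''"
| CondTrue: "bval b m \<Longrightarrow> exec c m k m' \<Longrightarrow> exec (Cond b c d) m (bcost b m + k) m'"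
| CondFalse: "\<not> bval b m \<Longrightarrow> exec d m k m' \<Longrightarrow> exec (Cond b c d) m (bcost b m + k) m'"
| WhileFalse: "\<not> bval b m \<Longrightarrow> exec (While b c) m (bcost b m) m"
| WhileTrue: "bval b m \<Longrightarrow> exec c m k m' \<Longrightarrow> exec (While b c) m' n m'' \<Longrightarrow>
    exec (While b c) m (bcost b m + k + n) m''"

lemma exec_deterministic:
  "exec c m k m' \<Longrightarrow> exec c m n m'' \<Longrightarrow> n = k \<and> m'' = m'"
proof (induction arbitrary: n m'' rule: exec.induct)
  case Skip
  from Skip.prems show ?case by cases auto
next
  case Store
  from Store.prems show ?case by cases auto
next
  case Seq
  from Seq.prems show ?case by cases (use Seq.IH in blast)
next
  case CondTrue
  from CondTrue.prems show ?case by cases (use CondTrue.IH CondTrue.hyps in blast)+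
next
  case CondFalse
  from CondFalse.prems show ?case by cases (use CondFalse.IH CondFalse.hyps in blast)+
next
  case WhileFalse
  from WhileFalse.prems show ?case by cases (use WhileFalse.hyps in auto)
next
  case WhileTrue
  from WhileTrue.prems show ?case by cases (use WhileTrue.IH WhileTrue.hyps in blast)+
qed

text \<open>
  A list of numbers is passed to and returned by a program with its length in cell \<open>0\<close> and
  its elements in the cells from \<open>1\<close> on.
\<close>

definition init_memory :: "nat list \<Rightarrow> memory" where
  "init_memory xs = (\<lambda>a. if a = 0 then length xs else if a \<le> length xs then xs ! (a - 1) else 0)"

definition contents :: "memory \<Rightarrow> nat list" where
  "contents m = map m [1..<m 0 + 1]"

definition encode_jobs :: "job list \<Rightarrow> nat list" where
  "encode_jobs J = length J # concat (map (\<lambda>j. [release j, deadline j, ptime j]) J)"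

definition encode_instance :: "psba \<Rightarrow> nat list" where
  "encode_instance I =
     horizon I # length (ev_lengths I) # ev_lengths I @
     length (agents I) # concat (map encode_jobs (agents I))"

definition encode_schedule :: "(nat \<times> nat) list \<Rightarrow> nat list" where
  "encode_schedule xs = concat (map (\<lambda>(e, t). [e, t]) xs)"

definition input_size :: "psba \<Rightarrow> nat" where
  "input_size I = (\<Sum>n\<leftarrow>encode_instance I. bit_size n)"

definition bounded_instances :: "nat poly \<Rightarrow> psba set" where
  "bounded_instances q = {I. psba_instance I \<and> horizon I \<le> poly q (input_size I)}"

definition outputs :: "com \<Rightarrow> psba \<Rightarrow> (nat \<times> nat) list \<Rightarrow> bool" where
  "outputs P I xs \<longleftrightarrow>
     (\<exists>n m. exec P (init_memory (encode_instance I)) n m \<and> contents m = encode_schedule xs)"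

definition polynomial_time :: "com \<Rightarrow> psba set \<Rightarrow> bool" where
  "polynomial_time P C \<longleftrightarrow>
     (\<exists>p :: nat poly. \<forall>I\<in>C. \<exists>n m.
        exec P (init_memory (encode_instance I)) n m \<and> n \<le> poly p (input_size I))"

definition approximation_algorithm :: "real \<Rightarrow> com \<Rightarrow> psba set \<Rightarrow> bool" where
  "approximation_algorithm \<rho> P C \<longleftrightarrow>
     (\<forall>I\<in>C. \<exists>xs. outputs P I xs \<and> approximates \<rho> I (set xs))"

definition implements_greedy :: "com \<Rightarrow> bool" where
  "implements_greedy P \<longleftrightarrow>
     (\<forall>I. psba_instance I \<longrightarrow> (\<exists>xs. outputs P I xs \<and> greedy_run I xs))"

end

theory Submission
  imports Defs
begin

text \<open>
  For one agent, call a set of slots free if some feasible job schedule avoids it. Hall's condition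
  for intervals shows that the largest free part of a set of slots is a submodular function, so
  \<open>total_agreement\<close> is a monotone submodular function of the covered slots. Charging each greedy
  step to the slot of the same event in an optimal schedule gives the factor 1/2.

  For \<open>1 - 1 / exp 1\<close> a local search over single moves uses, instead of the objective, a weighted
  average of the objective over random subsets of the chosen pairs (Filmus and Ward). The usual loss
  of lower order is compensated by guessing the pair of the event with the largest share of an optimum.
  The average is computable exactly: the agreement is determined by the number of uncovered slots
  that unit jobs, served by increasing deadline, leave over; the random set of uncovered slots is a
  path from \<open>0\<close> to \<open>horizon I + 1\<close> weighted by a product of transition weights, and both
  discarding the window of an event with some weight and serving a unit job transform these weights.

  Both algorithms are written in a loop language whose loops have a polynomial number of iterations
  and whose multiplication is clipped, so that running times and bit lengths are polynomial.
\<close>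

section \<open>Free slot sets of an agent\<close>

text \<open>The programs compute \<open>waste\<close>, not agreement: by \<open>tr_add_waste\<close>
  both add up to the constant \<open>capacity\<close>, and waste counts a set obtained from the
  uncovered slots by deletions. The obstacle is that averaging over the presence of an event makes
  slots dependent; the law survives as a product over transitions because an event or a unit job
  matters only in the one transition that crosses its first slot. With \<open>l\<close> levels the
  search reaches \<open>1 - q\<close> for \<open>q = (l / (l + 1)) ^ l\<close>, and \<open>q\<close>
  exceeds \<open>1 / exp 1\<close> by at most the factor \<open>1 + 1 / l\<close>. The guessed event
  has at least the fraction \<open>1 / n\<close> of the optimum and is never dropped from a sample,
  a credit of \<open>q / n\<close>. Taking \<open>l = 4 * n\<close> leaves a slack of about
  \<open>3 / (4 * n) / exp 1\<close>, which absorbs the relative error \<open>1 / l ^ 2\<close>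
  caused by integral level weights and a rounded potential. Rounding keeps the number of passes
  polynomial: divided by \<open>levels ^ n\<close> the potential is below \<open>M ^ 8\<close>, so
  as many passes, run by eight nested loops, reach a local optimum. The greedy program reuses the
  evaluation of the potential with weights \<open>0\<close> and \<open>1\<close>.\<close>

definition demand :: "job list \<Rightarrow> nat \<Rightarrow> nat \<Rightarrow> nat" where
  "demand J a b = (\<Sum>j<length J. if a \<le> release (J ! j) \<and> deadline (J ! j) \<le> b then ptime (J ! j) else 0)"

text \<open>Hall's condition with the slots of \<open>D\<close> counted as occupied;
  \<open>free_iff_schedule\<close> identifies it with the existence of a feasible schedule that
  leaves \<open>D\<close> idle. The counting form is the definition because the later exchange
  arguments compare numbers inside intervals.\<close>

definition free :: "job list \<Rightarrow> nat set \<Rightarrow> bool" where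
  "free J D \<longleftrightarrow> (\<forall>a b. card (D \<inter> {a..b}) + demand J a b \<le> b + 1 - a)"

text \<open>The schedule is built by the earliest-deadline rule, serving the first available slot.\<close>

lemma interval_hall:
  fixes r d p :: "nat \<Rightarrow> nat"
  assumes "finite K" "finite A"
    and "\<And>a b. (\<Sum>j\<in>K. if a \<le> r j \<and> d j \<le> b then p j else 0) \<le> card (A \<inter> {a..b})"
  shows "\<exists>\<sigma>. (\<forall>j\<in>K. \<sigma> j \<subseteq> A \<inter> {r j..d j} \<and> card (\<sigma> j) = p j) \<and>
             (\<forall>j\<in>K. \<forall>k\<in>K. j \<noteq> k \<longrightarrow> \<sigma> j \<inter> \<sigma> k = {})"
  using assms(2,3)
proof (induction "card A" arbitrary: A p)
  case 0
  then have "A = {}" by simp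
  have "p j = 0" if "j \<in> K" for j
  proof -
    have "(if r j \<le> r j \<and> d j \<le> d j then p j else 0)
        \<le> (\<Sum>i\<in>K. if r j \<le> r i \<and> d i \<le> d j then p i else 0)"
      using that \<open>finite K\<close> by (intro member_le_sum) auto
    with 0(3)[of "r j" "d j"] \<open>A = {}\<close> show ?thesis by simp
  qed
  then show ?case by (intro exI[of _ "\<lambda>_. {}"]) auto
next
  case (Suc n)
  let ?dem = "\<lambda>p a b. \<Sum>j\<in>K. if a \<le> r j \<and> d j \<le> b then p j else 0"
  define t where "t = Min A"
  have "A \<noteq> {}" using Suc(2) by auto
  then have t: "t \<in> A" "\<And>u. u \<in> A \<Longrightarrow> t \<le> u" using Suc(3) by (auto simp: t_def)
  have cardA': "n = card (A - {t})" using Suc(2) t(1) Suc(3) by simp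
  have finA': "finite (A - {t})" using Suc(3) by simp
  have inter_t: "card (A \<inter> {a..b}) = Suc (card ((A - {t}) \<inter> {a..b}))" if "a \<le> t" "t \<le> b" for a b
  proof -
    have "A \<inter> {a..b} = insert t ((A - {t}) \<inter> {a..b})" using that t by auto
    then show ?thesis using Suc(3) by simp
  qed
  have inter_nt: "(A - {t}) \<inter> {a..b} = A \<inter> {a..b}" if "\<not> (a \<le> t \<and> t \<le> b)" for a b
    using that by auto
  \<comment> \<open>Jobs released after \<open>t\<close> have room without \<open>t\<close>; both
    cases end by showing that the demand inside a critical interval comes from such jobs
    only.\<close>
  have late: "?dem p (Suc t) b \<le> card ((A - {t}) \<inter> {a..b})" if "a \<le> t" for a b
  proof -
    have "A \<inter> {Suc t..b} \<subseteq> (A - {t}) \<inter> {a..b}" using that by auto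
    then have "card (A \<inter> {Suc t..b}) \<le> card ((A - {t}) \<inter> {a..b})"
      by (intro card_mono) (use Suc(3) in auto)
    with Suc(4)[of "Suc t" b] show ?thesis by simp
  qed
  show ?case
  proof (cases "\<exists>j\<in>K. r j \<le> t \<and> p j > 0")
    case False
    have "?dem p a b \<le> card ((A - {t}) \<inter> {a..b})" for a b
    proof (cases "a \<le> t \<and> t \<le> b")
      case True
      have "?dem p a b \<le> ?dem p (Suc t) b"
        by (rule sum_mono) (use False True in \<open>auto simp: not_less_eq_eq\<close>)
      with late[of a b] True show ?thesis by linarith
    next
      case False
      then show ?thesis using Suc(4)[of a b] inter_nt[OF False] by simp
    qed
    from Suc(1)[OF cardA' finA' this] obtain \<sigma> where
      "(\<forall>i\<in>K. \<sigma> i \<subseteq> (A - {t}) \<inter> {r i..d i} \<and> card (\<sigma> i) = p i) \<and>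
       (\<forall>i\<in>K. \<forall>k\<in>K. i \<noteq> k \<longrightarrow> \<sigma> i \<inter> \<sigma> k = {})" by (rule exE)
    then show ?thesis by (intro exI[of _ \<sigma>]) auto
  next
    case True
    then obtain j0 where "j0 \<in> K \<and> r j0 \<le> t \<and> p j0 > 0" by blast
    from ex_has_least_nat[of "\<lambda>j. j \<in> K \<and> r j \<le> t \<and> p j > 0", OF this, of d]
    obtain j where j: "j \<in> K" "r j \<le> t" "p j > 0"
      and jmin: "\<And>i. i \<in> K \<Longrightarrow> r i \<le> t \<Longrightarrow> p i > 0 \<Longrightarrow> d j \<le> d i"
      by auto
    define p' where "p' = p(j := p j - 1)"
    have dj: "t \<le> d j"
    proof -
      have "p j \<le> ?dem p (r j) (d j)"
        using member_le_sum[of j K "\<lambda>i. if r j \<le> r i \<and> d i \<le> d j then p i else 0"] j \<open>finite K\<close>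
        by simp
      with Suc(4)[of "r j" "d j"] j(3) have "card (A \<inter> {r j..d j}) > 0" by linarith
      then obtain u where "u \<in> A" "u \<le> d j" by (fastforce simp: card_gt_0_iff)
      then show ?thesis using t(2) by fastforce
    qed
    have le: "?dem p' a b \<le> ?dem p a b" for a b
      by (rule sum_mono) (auto simp: p'_def)
    have "?dem p' a b \<le> card ((A - {t}) \<inter> {a..b})" for a b
    proof (cases "a \<le> t \<and> t \<le> b")
      case ab: True
      show ?thesis
      proof (rule ccontr)
        assume contr: "\<not> ?thesis"
        \<comment> \<open>An interval violated after serving \<open>j\<close> must have been tight
          before, and \<open>j\<close> cannot lie inside it, since otherwise its demand would have
          dropped together with its slots.\<close>
        have tight: "?dem p' a b = ?dem p a b" "?dem p a b = card (A \<inter> {a..b})"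
          using contr le[of a b] Suc(4)[of a b] inter_t[of a b] ab by linarith+
        have notin: "\<not> (a \<le> r j \<and> d j \<le> b)"
        proof
          assume "a \<le> r j \<and> d j \<le> b"
          then have "?dem p' a b < ?dem p a b"
            by (intro sum_strict_mono_ex1) (use j \<open>finite K\<close> in \<open>auto simp: p'_def\<close>)
          with tight show False by simp
        qed
        \<comment> \<open>\<open>A\<close> has no slot below \<open>t\<close>, so
          \<open>{a..b}\<close> and \<open>{0..b}\<close> offer the same slots. Tightness then
          forces every unfinished job due by \<open>b\<close> to be released at or after
          \<open>a\<close>, which leaves \<open>b < d j\<close>; by the choice of \<open>j\<close>
          the whole demand is released after \<open>t\<close>, contradicting
          \<open>late\<close>.\<close>
        have eq0: "?dem p 0 b = ?dem p a b"
        proof -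
          have "A \<inter> {0..b} = A \<inter> {a..b}" using ab t(2) by fastforce
          then have "?dem p 0 b \<le> ?dem p a b" using Suc(4)[of 0 b] tight by simp
          moreover have "?dem p a b \<le> ?dem p 0 b" by (rule sum_mono) auto
          ultimately show ?thesis by simp
        qed
        have "a \<le> r i" if "i \<in> K" "p i > 0" "d i \<le> b" for i
        proof (rule ccontr)
          assume "\<not> a \<le> r i"
          then have "?dem p a b < ?dem p 0 b"
            by (intro sum_strict_mono_ex1) (use that \<open>finite K\<close> in auto)
          with eq0 show False by simp
        qed
        with notin j have "b < d j" by force
        then have "?dem p a b \<le> ?dem p (Suc t) b"
          by (intro sum_mono) (auto simp: not_less_eq_eq dest!: jmin)
        with late[of a b] ab tight inter_t[of a b] show False by simp
      qed
    next
      case False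
      then show ?thesis using Suc(4)[of a b] le[of a b] inter_nt[OF False] by simp
    qed
    from Suc(1)[OF cardA' finA' this] obtain \<sigma> where
      \<sigma>: "\<forall>i\<in>K. \<sigma> i \<subseteq> (A - {t}) \<inter> {r i..d i} \<and> card (\<sigma> i) = p' i"
         "\<forall>i\<in>K. \<forall>k\<in>K. i \<noteq> k \<longrightarrow> \<sigma> i \<inter> \<sigma> k = {}" by (elim exE conjE)
    have "finite (\<sigma> j)" "t \<notin> \<sigma> j"
      using \<sigma>(1) j(1) Suc(3) by (meson finite_subset finite_Int finite_Diff, blast)
    then have "card (insert t (\<sigma> j)) = p j" using \<sigma>(1) j by (simp add: p'_def)
    then show ?thesis
      using \<sigma> j t(1) dj
      by (intro exI[of _ "\<sigma>(j := insert t (\<sigma> j))"]) (auto simp: p'_def)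
  qed
qed

section \<open>Tight intervals and maximal free sets\<close>

lemma demand_supermodular:
  "demand J a b + demand J a' b'
    \<le> demand J (min a a') (max b b') + demand J (max a a') (min b b')"
  unfolding demand_def sum.distrib[symmetric] by (rule sum_mono) auto

lemma free_subset: "free J D \<Longrightarrow> D' \<subseteq> D \<Longrightarrow> free J D'"
  unfolding free_def
  by (meson add_le_mono1 card_mono finite_Int finite_atLeastAtMost Int_mono order_refl le_trans)

text \<open>Uncrossing step used for tight intervals and again for saturated ones: since overlapping
  members have their hull in the family, two distinct inclusion-maximal members cannot meet, so
  counts over the maximal members can simply be added.\<close>

lemma maximal_intervals:
  fixes F :: "(nat \<times> nat) set"
  assumes "finite F"
    and hull: "\<And>a b a' b' x. (a, b) \<in> F \<Longrightarrow> (a', b') \<in> F \<Longrightarrow> x \<in> {a..b} \<Longrightarrow> x \<in> {a'..b'} \<Longrightarrow>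
      (min a a', max b b') \<in> F"
    and le: "\<And>a b. (a, b) \<in> F \<Longrightarrow> a \<le> b"
  shows "\<exists>G\<subseteq>F. (\<forall>I\<in>F. \<exists>I'\<in>G. {fst I..snd I} \<subseteq> {fst I'..snd I'}) \<and>
    (\<forall>I\<in>G. \<forall>I'\<in>G. I \<noteq> I' \<longrightarrow> {fst I..snd I} \<inter> {fst I'..snd I'} = {})"
proof -
  let ?s = "\<lambda>I::nat \<times> nat. {fst I..snd I}"
  define G where "G = {I \<in> F. \<forall>I'\<in>F. ?s I \<subseteq> ?s I' \<longrightarrow> I' = I}"
  have g1: "G \<subseteq> F" by (auto simp: G_def)
  have g2: "\<exists>I'\<in>G. ?s I \<subseteq> ?s I'" if I: "I \<in> F" for I
  proof -
    let ?U = "{I' \<in> F. ?s I \<subseteq> ?s I'}"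
    have "finite ?U" "?U \<noteq> {}" using assms(1) I by (simp, blast)
    let ?c = "\<lambda>I. card (?s I)"
    have "Max (?c ` ?U) \<in> ?c ` ?U" using \<open>finite ?U\<close> \<open>?U \<noteq> {}\<close> by (intro Max_in) auto
    then obtain K where "K \<in> ?U" "?c K = Max (?c ` ?U)" by (metis (no_types, lifting) imageE)
    then have K: "K \<in> ?U" "\<And>I'. I' \<in> ?U \<Longrightarrow> ?c I' \<le> ?c K"
      using \<open>finite ?U\<close> by simp_all
    have "I' = K" if "I' \<in> F" "?s K \<subseteq> ?s I'" for I'
    proof -
      have "card (?s I') \<le> card (?s K)" using K that by blast
      then have "?s K = ?s I'" using that(2) by (intro card_seteq) auto
      then show ?thesis using le[of "fst K" "snd K"] K(1) by (simp add: prod_eq_iff Icc_eq_Icc)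
    qed
    then show ?thesis using K(1) unfolding G_def by blast
  qed
  have g3: "?s I \<inter> ?s I' = {}" if "I \<in> G" "I' \<in> G" "I \<noteq> I'" for I I'
  proof (rule ccontr)
    assume "?s I \<inter> ?s I' \<noteq> {}"
    then obtain x where x: "x \<in> ?s I" "x \<in> ?s I'" by blast
    let ?K = "(min (fst I) (fst I'), max (snd I) (snd I'))"
    have "?K \<in> F" using hull[of "fst I" "snd I" "fst I'" "snd I'" x] x that by (simp add: G_def)
    moreover have "?s I \<subseteq> ?s ?K" "?s I' \<subseteq> ?s ?K" by auto
    ultimately have "?K = I" "?K = I'" using that unfolding G_def by blast+
    then show False using that by simp
  qed
  show ?thesis by (intro exI[of _ G] conjI ballI impI g1 g2 g3)
qed

lemma card_UN_intervals:
  assumes "finite G" "\<forall>I\<in>G. \<forall>I'\<in>G. I \<noteq> I' \<longrightarrow> {fst I..snd I} \<inter> {fst I'..snd I'} = {}"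
    "finite (S :: nat set)"
  shows "card (S \<inter> (\<Union>I\<in>G. {fst I..snd I})) = (\<Sum>I\<in>G. card (S \<inter> {fst I..snd I}))"
  unfolding Int_UN_distrib
proof (rule card_UN_disjoint[OF assms(1)])
  show "\<forall>I\<in>G. \<forall>I'\<in>G. I \<noteq> I' \<longrightarrow> (S \<inter> {fst I..snd I}) \<inter> (S \<inter> {fst I'..snd I'}) = {}"
  proof (intro ballI impI)
    fix I I' assume "I \<in> G" "I' \<in> G" "I \<noteq> I'"
    then have "{fst I..snd I} \<inter> {fst I'..snd I'} = {}" using assms(2) by (elim ballE impE) auto
    then show "(S \<inter> {fst I..snd I}) \<inter> (S \<inter> {fst I'..snd I'}) = {}" by blast
  qed
qed (use assms(3) in auto)

locale agent =
  fixes J :: "job list" and T :: nat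
  assumes deadline_le: "j < length J \<Longrightarrow> deadline (J ! j) \<le> T"
    and feasible: "\<exists>\<sigma>. feasible_job_schedule J \<sigma>"
begin

lemma demand_beyond: "b \<ge> T \<Longrightarrow> demand J a b = demand J a T"
  unfolding demand_def using deadline_le by (intro sum.cong) (auto intro: order_trans)

text \<open>One direction is \<open>interval_hall\<close> for the slots \<open>{..T} - D\<close>,
  where intervals reaching past \<open>T\<close> reduce to those ending at \<open>T\<close>; the
  other counts, inside \<open>{a..b}\<close>, the slots of \<open>D\<close> and the disjoint slots
  of the jobs confined there.\<close>

lemma free_iff_schedule:
  assumes "D \<subseteq> {..T}"
  shows "free J D \<longleftrightarrow> (\<exists>\<sigma>. feasible_job_schedule J \<sigma> \<and> (\<forall>j<length J. \<sigma> j \<inter> D = {}))"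
proof
  assume D: "free J D"
  have inter: "card (({..T} - D) \<inter> {a..b}) + card (D \<inter> {a..b}) = b + 1 - a" if "b \<le> T" for a b
  proof -
    have "card (({..T} - D) \<inter> {a..b}) + card (D \<inter> {a..b})
        = card ((({..T} - D) \<inter> {a..b}) \<union> (D \<inter> {a..b}))"
      by (subst card_Un_disjoint) auto
    also have "(({..T} - D) \<inter> {a..b}) \<union> (D \<inter> {a..b}) = {a..b}" using that by auto
    finally show ?thesis by simp
  qed
  have hall: "demand J a b \<le> card (({..T} - D) \<inter> {a..b})" for a b
  proof (cases "b \<le> T")
    case True
    with D inter[OF True, of a] show ?thesis unfolding free_def by (metis add_le_cancel_right add.commute)
  next
    case False
    have "demand J a T \<le> card (({..T} - D) \<inter> {a..T})"
      using D inter[of T a] unfolding free_def by (metis order_refl add_le_cancel_right add.commute)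
    moreover have "({..T} - D) \<inter> {a..T} = ({..T} - D) \<inter> {a..b}" using False by auto
    ultimately show ?thesis using False demand_beyond[of b a] by simp
  qed
  from interval_hall[of "{..<length J}" "{..T} - D" "\<lambda>j. release (J ! j)" "\<lambda>j. deadline (J ! j)"
      "\<lambda>j. ptime (J ! j)"] hall[unfolded demand_def]
  obtain \<sigma> where "\<forall>j\<in>{..<length J}. \<sigma> j \<subseteq> ({..T} - D) \<inter> {release (J ! j)..deadline (J ! j)}
        \<and> card (\<sigma> j) = ptime (J ! j)"
     "\<forall>j\<in>{..<length J}. \<forall>k\<in>{..<length J}. j \<noteq> k \<longrightarrow> \<sigma> j \<inter> \<sigma> k = {}" by auto
  then show "\<exists>\<sigma>. feasible_job_schedule J \<sigma> \<and> (\<forall>j<length J. \<sigma> j \<inter> D = {})"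
    unfolding feasible_job_schedule_def by (intro exI[of _ \<sigma>]) blast
next
  assume "\<exists>\<sigma>. feasible_job_schedule J \<sigma> \<and> (\<forall>j<length J. \<sigma> j \<inter> D = {})"
  then obtain \<sigma> where fs: "feasible_job_schedule J \<sigma>"
    and disj: "\<forall>j<length J. \<sigma> j \<inter> D = {}" by blast
  have \<sigma>: "\<sigma> j \<subseteq> {release (J ! j)..deadline (J ! j)}" "card (\<sigma> j) = ptime (J ! j)" "\<sigma> j \<inter> D = {}"
    if "j < length J" for j
    using fs disj that unfolding feasible_job_schedule_def by auto
  have pairwise: "\<sigma> j \<inter> \<sigma> k = {}" if "j < length J" "k < length J" "j \<noteq> k" for j k
    using fs that unfolding feasible_job_schedule_def by auto
  show "free J D" unfolding free_def
  proof (intro allI)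
    fix a b
    let ?K = "{j. j < length J \<and> a \<le> release (J ! j) \<and> deadline (J ! j) \<le> b}"
    have fin: "finite (\<sigma> j)" if "j < length J" for j
      using \<sigma>(1)[OF that] finite_subset by blast
    have "demand J a b = (\<Sum>j\<in>?K. card (\<sigma> j))"
      unfolding demand_def by (rule sum.mono_neutral_cong_right) (auto simp: \<sigma>(2))
    also have "\<dots> = card (\<Union>j\<in>?K. \<sigma> j)"
      by (subst card_UN_disjoint) (use fin pairwise in auto)
    finally have "card (D \<inter> {a..b}) + demand J a b = card ((D \<inter> {a..b}) \<union> (\<Union>j\<in>?K. \<sigma> j))"
      by (subst card_Un_disjoint) (use fin \<sigma>(3) in auto)
    also have "\<dots> \<le> card {a..b}"
      using \<sigma>(1) by (intro card_mono) fastforce+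
    finally show "card (D \<inter> {a..b}) + demand J a b \<le> b + 1 - a" by simp
  qed
qed

lemma free_empty: "free J {}"
  using feasible free_iff_schedule[of "{}"] by simp

definition tight :: "nat set \<Rightarrow> (nat \<times> nat) set" where
  "tight D = {(a, b). a \<le> b \<and> b \<le> T \<and> card (D \<inter> {a..b}) + demand J a b = b + 1 - a}"

lemma finite_tight: "finite (tight D)"
  by (rule finite_subset[of _ "{..T} \<times> {..T}"]) (auto simp: tight_def)

text \<open>Counting slots of \<open>D\<close> is modular on two overlapping intervals,
  \<open>demand\<close> is supermodular, and neither the hull nor the intersection may exceed its
  length; so two equalities force equality on the hull.\<close>

lemma tight_hull:
  assumes D: "finite D" "free J D"
    and t: "(a, b) \<in> tight D" "(a', b') \<in> tight D" and x: "x \<in> {a..b}" "x \<in> {a'..b'}"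
  shows "(min a a', max b b') \<in> tight D"
proof -
  have freeD: "card (D \<inter> {a..b}) + demand J a b \<le> b + 1 - a" for a b
    using D(2) unfolding free_def by blast
  have "(D \<inter> {a..b}) \<union> (D \<inter> {a'..b'}) = D \<inter> {min a a'..max b b'}"
    "(D \<inter> {a..b}) \<inter> (D \<inter> {a'..b'}) = D \<inter> {max a a'..min b b'}"
    using x by auto
  then have "card (D \<inter> {a..b}) + card (D \<inter> {a'..b'})
      = card (D \<inter> {min a a'..max b b'}) + card (D \<inter> {max a a'..min b b'})"
    using card_Un_Int[of "D \<inter> {a..b}" "D \<inter> {a'..b'}"] D(1) by simp
  moreover have "(b + 1 - a) + (b' + 1 - a')
      = (max b b' + 1 - min a a') + (min b b' + 1 - max a a')"
    using x by simp linarith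
  moreover have "card (D \<inter> {a..b}) + demand J a b = b + 1 - a"
    "card (D \<inter> {a'..b'}) + demand J a' b' = b' + 1 - a'" "b \<le> T" "b' \<le> T" "a \<le> b"
    using t by (auto simp: tight_def)
  ultimately have "card (D \<inter> {min a a'..max b b'}) + demand J (min a a') (max b b')
      = max b b' + 1 - min a a'"
    using demand_supermodular[of J a b a' b'] freeD[of "min a a'" "max b b'"]
      freeD[of "max a a'" "min b b'"] by linarith
  then show ?thesis using \<open>b \<le> T\<close> \<open>b' \<le> T\<close> \<open>a \<le> b\<close> by (auto simp: tight_def)
qed

lemma blocked_tight:
  assumes D: "D \<subseteq> {..T}" "free J D" and x: "x \<le> T" "x \<notin> D" "\<not> free J (insert x D)"
  obtains I where "I \<in> tight D" "x \<in> {fst I..snd I}"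
proof -
  have finD: "finite D" using D(1) finite_subset by blast
  have freeD: "card (D \<inter> {a..b}) + demand J a b \<le> b + 1 - a" for a b
    using D(2) unfolding free_def by blast
  obtain a b where ab: "card (insert x D \<inter> {a..b}) + demand J a b > b + 1 - a"
    using x(3) unfolding free_def by (auto simp: not_le)
  have "x \<in> {a..b}"
  proof (rule ccontr)
    assume "x \<notin> {a..b}"
    then have "insert x D \<inter> {a..b} = D \<inter> {a..b}" by auto
    with ab freeD[of a b] show False by simp
  qed
  then have "insert x D \<inter> {a..b} = insert x (D \<inter> {a..b})" by auto
  then have "card (insert x D \<inter> {a..b}) = Suc (card (D \<inter> {a..b}))" using x(2) finD by simp
  with ab freeD[of a b] have eq: "card (D \<inter> {a..b}) + demand J a b = b + 1 - a" by simp
  have "b \<le> T"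
  proof (rule ccontr)
    assume "\<not> b \<le> T"
    moreover have "D \<inter> {a..b} = D \<inter> {a..T}" using D(1) \<open>\<not> b \<le> T\<close> by auto
    ultimately show False
      using eq freeD[of a T] demand_beyond[of b a] \<open>x \<in> {a..b}\<close> x(1) by simp
  qed
  with eq \<open>x \<in> {a..b}\<close> show ?thesis by (intro that[of "(a, b)"]) (auto simp: tight_def)
qed

text \<open>Certificate of maximality: each slot of \<open>X\<close> that cannot be added lies in a
  tight interval, because one more slot raises a count by at most one; the maximal tight intervals
  are pairwise disjoint.\<close>

lemma maximal_free_cover:
  assumes X: "X \<subseteq> {..T}" and D: "D \<subseteq> X" "free J D"
    and max: "\<forall>x\<in>X - D. \<not> free J (insert x D)"
  shows "\<exists>G\<subseteq>tight D. finite G \<and> X - D \<subseteq> (\<Union>I\<in>G. {fst I..snd I}) \<and>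
    (\<forall>I\<in>G. \<forall>I'\<in>G. I \<noteq> I' \<longrightarrow> {fst I..snd I} \<inter> {fst I'..snd I'} = {})"
proof -
  have finD: "finite D" "D \<subseteq> {..T}" using X D(1) finite_subset[of D "{..T}"] by auto
  have "\<exists>G\<subseteq>tight D. (\<forall>I\<in>tight D. \<exists>I'\<in>G. {fst I..snd I} \<subseteq> {fst I'..snd I'}) \<and>
    (\<forall>I\<in>G. \<forall>I'\<in>G. I \<noteq> I' \<longrightarrow> {fst I..snd I} \<inter> {fst I'..snd I'} = {})"
    by (rule maximal_intervals[OF finite_tight[of D] tight_hull[OF finD(1) D(2)]])
      (assumption+, simp add: tight_def)
  then obtain G where G: "G \<subseteq> tight D"
    "\<forall>I\<in>tight D. \<exists>I'\<in>G. {fst I..snd I} \<subseteq> {fst I'..snd I'}"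
    "\<forall>I\<in>G. \<forall>I'\<in>G. I \<noteq> I' \<longrightarrow> {fst I..snd I} \<inter> {fst I'..snd I'} = {}" by (elim exE conjE)
  have "x \<in> (\<Union>I\<in>G. {fst I..snd I})" if x: "x \<in> X - D" for x
  proof -
    have "x \<le> T" "x \<notin> D" using x X by auto
    then obtain I where "I \<in> tight D" "x \<in> {fst I..snd I}"
      by (rule blocked_tight[OF finD(2) D(2) _ _ max[rule_format, OF x]])
    then show ?thesis using G(2) by blast
  qed
  then show ?thesis using G(1,3) finite_subset[OF G(1) finite_tight] by (intro exI[of _ G]) auto
qed

text \<open>The matroid property of maximal free subsets: inside a tight interval no free set has
  more slots than \<open>D\<close>, and outside these intervals \<open>D\<close> already contains
  all of \<open>X\<close>.\<close>

lemma card_le_maximal_free: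
  assumes X: "X \<subseteq> {..T}" and D: "D \<subseteq> X" "free J D"
    and max: "\<And>x. x \<in> X - D \<Longrightarrow> \<not> free J (insert x D)"
    and D': "D' \<subseteq> X" "free J D'"
  shows "card D' \<le> card D"
proof -
  have max': "\<forall>x\<in>X - D. \<not> free J (insert x D)" using max by blast
  obtain G where G: "G \<subseteq> tight D" "finite G" "X - D \<subseteq> (\<Union>I\<in>G. {fst I..snd I})"
    "\<forall>I\<in>G. \<forall>I'\<in>G. I \<noteq> I' \<longrightarrow> {fst I..snd I} \<inter> {fst I'..snd I'} = {}"
    using maximal_free_cover[OF X D max'] by (elim exE conjE)
  let ?U = "\<Union>I\<in>G. {fst I..snd I}"
  have finX: "finite X" using X finite_subset by blast
  then have fin: "finite D" "finite D'" using D D' finite_subset by auto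
  have "card (D' \<inter> {fst I..snd I}) \<le> card (D \<inter> {fst I..snd I})" if "I \<in> G" for I
  proof -
    have "card (D \<inter> {fst I..snd I}) + demand J (fst I) (snd I) = snd I + 1 - fst I"
      using that G(1) by (auto simp: tight_def)
    moreover have "card (D' \<inter> {fst I..snd I}) + demand J (fst I) (snd I) \<le> snd I + 1 - fst I"
      using D'(2) unfolding free_def by blast
    ultimately show ?thesis by simp
  qed
  then have "card (D' \<inter> ?U) \<le> card (D \<inter> ?U)"
    unfolding card_UN_intervals[OF G(2,4) fin(1)] card_UN_intervals[OF G(2,4) fin(2)]
    by (rule sum_mono)
  moreover have "card (D' - ?U) \<le> card (D - ?U)"
    using G(3) D'(1) fin by (intro card_mono) auto
  moreover have "card E = card (E \<inter> ?U) + card (E - ?U)" if "finite E" for E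
    using that card_Un_disjoint[of "E \<inter> ?U" "E - ?U"] by (auto simp: Int_Diff_Un)
  note this[OF fin(1)] this[OF fin(2)]
  ultimately show ?thesis by linarith
qed

lemma extend_maximal:
  assumes "finite X" "D \<subseteq> X" "free J D"
  shows "\<exists>D'. D \<subseteq> D' \<and> D' \<subseteq> X \<and> free J D' \<and> (\<forall>x\<in>X - D'. \<not> free J (insert x D'))"
  using assms(2,3)
proof (induction "card (X - D)" arbitrary: D rule: less_induct)
  case less
  show ?case
  proof (cases "\<forall>x\<in>X - D. \<not> free J (insert x D)")
    case True
    then show ?thesis using less.prems by blast
  next
    case False
    then obtain x where x: "x \<in> X - D" "free J (insert x D)" by blast
    then have "card (X - insert x D) < card (X - D)"
      using \<open>finite X\<close> by (intro psubset_card_mono) auto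
    moreover have "insert x D \<subseteq> X" using x less.prems by auto
    ultimately obtain D' where "insert x D \<subseteq> D' \<and> D' \<subseteq> X \<and> free J D' \<and>
        (\<forall>x\<in>X - D'. \<not> free J (insert x D'))"
      using less.hyps[of "insert x D"] x(2) by metis
    then show ?thesis by (intro exI[of _ D']) auto
  qed
qed

end

section \<open>Rank of a set of slots\<close>

definition rk :: "job list \<Rightarrow> nat set \<Rightarrow> nat" where
  "rk J X = Max (card ` {D. D \<subseteq> X \<and> free J D})"

context agent
begin

lemma rk_maximal:
  assumes "X \<subseteq> {..T}" "D \<subseteq> X" "free J D" "\<And>x. x \<in> X - D \<Longrightarrow> \<not> free J (insert x D)"
  shows "rk J X = card D"
  unfolding rk_def
proof (rule Max_eqI)
  have "finite X" using assms(1) finite_subset by blast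
  then have "finite {D. D \<subseteq> X \<and> free J D}" by (rule_tac finite_subset[OF _ finite_Pow_iff[THEN iffD2]]) auto
  then show "finite (card ` {D. D \<subseteq> X \<and> free J D})" by simp
  show "y \<le> card D" if "y \<in> card ` {D. D \<subseteq> X \<and> free J D}" for y
    using that card_le_maximal_free[OF assms] by auto
qed (use assms in auto)

lemma card_le_rk:
  assumes "X \<subseteq> {..T}" "D \<subseteq> X" "free J D"
  shows "card D \<le> rk J X"
proof -
  have fin: "finite X" using assms(1) finite_subset by blast
  from extend_maximal[OF fin assms(2,3)] obtain D' where
    D': "D \<subseteq> D'" "D' \<subseteq> X" "free J D'" "\<forall>x\<in>X - D'. \<not> free J (insert x D')" by blast
  then have "rk J X = card D'" using rk_maximal[OF assms(1), of D'] by blast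
  with D' fin show ?thesis by (simp add: card_mono finite_subset)
qed

lemma rk_witness:
  assumes "X \<subseteq> {..T}"
  obtains D where "D \<subseteq> X" "free J D" "\<And>x. x \<in> X - D \<Longrightarrow> \<not> free J (insert x D)" "rk J X = card D"
proof -
  have "finite X" using assms finite_subset by blast
  from extend_maximal[OF this empty_subsetI free_empty] show ?thesis
    using that rk_maximal[OF assms] by blast
qed

lemma rk_mono: "X \<subseteq> Y \<Longrightarrow> Y \<subseteq> {..T} \<Longrightarrow> rk J X \<le> rk J Y"
  by (rule rk_witness[of X], blast) (use card_le_rk in \<open>force\<close>)

lemma rk_le_card: "X \<subseteq> {..T} \<Longrightarrow> rk J X \<le> card X"
  by (rule rk_witness[of X], blast) (simp add: card_mono finite_subset)

text \<open>The matroid argument: a maximal free \<open>D\<close> of the intersection extends to a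
  maximal free \<open>E\<close> of the union, and maximality of \<open>D\<close> gives
  \<open>E \<inter> (X \<inter> Y) = D\<close>. The traces of \<open>E\<close> on \<open>X\<close>
  and on \<open>Y\<close> are free, which bounds the two ranks from below.\<close>

lemma rk_submodular:
  assumes "X \<subseteq> {..T}" "Y \<subseteq> {..T}"
  shows "rk J (X \<union> Y) + rk J (X \<inter> Y) \<le> rk J X + rk J Y"
proof -
  have sub: "X \<inter> Y \<subseteq> {..T}" "X \<union> Y \<subseteq> {..T}" using assms by auto
  obtain D where D: "D \<subseteq> X \<inter> Y" "free J D" "\<And>x. x \<in> X \<inter> Y - D \<Longrightarrow> \<not> free J (insert x D)"
    "rk J (X \<inter> Y) = card D" by (rule rk_witness[OF sub(1)]) blast
  have fin: "finite (X \<union> Y)" using sub(2) finite_subset by blast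
  have "D \<subseteq> X \<union> Y" using D(1) by auto
  from extend_maximal[OF fin this D(2)] obtain E where
    E: "D \<subseteq> E" "E \<subseteq> X \<union> Y" "free J E" "\<forall>x\<in>X \<union> Y - E. \<not> free J (insert x E)" by blast
  have rkE: "rk J (X \<union> Y) = card E" using E rk_maximal[OF sub(2), of E] by blast
  have "E \<inter> (X \<inter> Y) = D"
  proof -
    have "x \<in> D" if "x \<in> E \<inter> (X \<inter> Y)" for x
      using D(3)[of x] free_subset[OF E(3), of "insert x D"] that E(1) by blast
    then show ?thesis using D(1) E(1) by blast
  qed
  then have "(E \<inter> X) \<inter> (E \<inter> Y) = D" "(E \<inter> X) \<union> (E \<inter> Y) = E" using E(2) by auto
  then have "card E + card D = card (E \<inter> X) + card (E \<inter> Y)"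
    using card_Un_Int[of "E \<inter> X" "E \<inter> Y"] finite_subset[OF E(2) fin] by simp
  also have "\<dots> \<le> rk J X + rk J Y"
    by (intro add_mono card_le_rk assms free_subset[OF E(3)]) auto
  finally show ?thesis using rkE D(4) by simp
qed

end

section \<open>Total agreement as a submodular function of the covered slots\<close>

text \<open>The intersection with \<open>slots I\<close> cuts off the part of a long event beyond
  the horizon, where no agreement is counted.\<close>

definition window :: "psba \<Rightarrow> nat \<Rightarrow> nat \<Rightarrow> nat set" where
  "window I e t = slots I \<inter> {t..<t + ev_lengths I ! e}"

definition cover :: "psba \<Rightarrow> (nat \<times> nat) set \<Rightarrow> nat set" where
  "cover I S = (\<Union>(e, t)\<in>S. window I e t)"

definition tr :: "psba \<Rightarrow> nat set \<Rightarrow> nat" where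
  "tr I X = (\<Sum>J\<leftarrow>agents I. rk J X)"

lemma cover_subset: "cover I S \<subseteq> slots I"
  by (auto simp: cover_def window_def)

lemma window_subset: "window I e t \<subseteq> slots I"
  by (auto simp: window_def)

lemma cover_simps [simp]:
  "cover I {} = {}"
  "cover I (insert (e, t) S) = window I e t \<union> cover I S"
  "cover I (S \<union> S') = cover I S \<union> cover I S'"
  by (auto simp: cover_def)

lemma slots_subset: "slots I \<subseteq> {..horizon I}"
  by (auto simp: slots_def)

lemma agentI: "psba_instance I \<Longrightarrow> J \<in> set (agents I) \<Longrightarrow> agent J (horizon I)"
  unfolding psba_instance_def by unfold_locales auto

text \<open>The agreement slots of a schedule are covered slots that it leaves idle, hence a free
  set; conversely a largest free subset of the covered slots is left idle by some feasible
  schedule.\<close>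

lemma agr_eq_rk:
  assumes "psba_instance I" "J \<in> set (agents I)"
  shows "agr I J S = rk J (cover I S)"
proof -
  interpret agent J "horizon I" using agentI[OF assms] .
  have sub: "cover I S \<subseteq> {..horizon I}" using cover_subset slots_subset by blast
  have ag: "agreement_slots I J S \<sigma> = {s \<in> cover I S. \<forall>j<length J. s \<notin> \<sigma> j}" for \<sigma>
    unfolding agreement_slots_def cover_def window_def split_beta by blast
  obtain D where D: "D \<subseteq> cover I S" "free J D" "rk J (cover I S) = card D"
    by (rule rk_witness[OF sub]) blast
  have finc: "finite (cover I S)" using sub finite_subset by blast
  let ?M = "{card (agreement_slots I J S \<sigma>) | \<sigma>. feasible_job_schedule J \<sigma>}"
  have le: "y \<le> rk J (cover I S)" if y: "y \<in> ?M" for y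
  proof -
    obtain \<sigma> where \<sigma>: "feasible_job_schedule J \<sigma>" "y = card (agreement_slots I J S \<sigma>)"
      using y by blast
    let ?D = "agreement_slots I J S \<sigma>"
    have "?D \<subseteq> cover I S" by (auto simp: ag)
    moreover have "free J ?D"
      using \<sigma>(1) sub calculation by (subst free_iff_schedule) (auto simp: ag)
    ultimately show ?thesis using card_le_rk[OF sub] \<sigma>(2) by simp
  qed
  obtain \<sigma> where \<sigma>: "feasible_job_schedule J \<sigma>" "\<forall>j<length J. \<sigma> j \<inter> D = {}"
    using D(1,2) sub free_iff_schedule[of D] by auto
  have "card D \<le> card (agreement_slots I J S \<sigma>)"
    by (intro card_mono) (use \<sigma>(2) D(1) finc in \<open>auto simp: ag\<close>)
  with le[of "card (agreement_slots I J S \<sigma>)"] \<sigma>(1) D(3)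
  have "rk J (cover I S) = card (agreement_slots I J S \<sigma>)" by (intro antisym) auto
  then have "rk J (cover I S) \<in> ?M" using \<sigma>(1) by blast
  moreover have "finite ?M" using le finite_nat_set_iff_bounded_le by blast
  ultimately show ?thesis unfolding agr_def using le by (intro Max_eqI) auto
qed

lemma total_agreement_eq_tr:
  "psba_instance I \<Longrightarrow> total_agreement I S = tr I (cover I S)"
  unfolding total_agreement_def tr_def
  by (intro arg_cong[of _ _ sum_list] map_cong) (auto simp: agr_eq_rk)

lemma tr_mono:
  assumes "psba_instance I" "X \<subseteq> Y" "Y \<subseteq> slots I"
  shows "tr I X \<le> tr I Y"
  unfolding tr_def
  using assms slots_subset[of I] by (intro sum_list_mono agent.rk_mono[OF agentI]) auto

lemma tr_submodular:
  assumes "psba_instance I" "X \<subseteq> slots I" "Y \<subseteq> slots I"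
  shows "tr I (X \<union> Y) + tr I (X \<inter> Y) \<le> tr I X + tr I Y"
proof -
  have "rk J (X \<union> Y) + rk J (X \<inter> Y) \<le> rk J X + rk J Y" if "J \<in> set (agents I)" for J
    using agent.rk_submodular[OF agentI[OF assms(1) that], of X Y] assms slots_subset[of I] by auto
  then show ?thesis unfolding tr_def sum_list_addf[symmetric] by (rule sum_list_mono)
qed

section \<open>Serving unit jobs by increasing deadline\<close>

text \<open>A unit job \<open>(a, w)\<close> takes the first slot of the interval \<open>{a..w}\<close> that is still available.\<close>

definition serve :: "nat \<times> nat \<Rightarrow> nat set \<Rightarrow> nat set" where
  "serve u Y = (if Y \<inter> {fst u..snd u} = {} then Y else Y - {Min (Y \<inter> {fst u..snd u})})"

definition served_all :: "(nat \<times> nat) list \<Rightarrow> nat set \<Rightarrow> nat set" where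
  "served_all us Y = fold serve us Y"

text \<open>A rejected unit job \<open>(a, w)\<close> witnesses an interval \<open>{z..w}\<close> whose available slots are all
  taken by unit jobs that have to be processed inside of it.\<close>

lemma served_structure:
  assumes "finite Y" "sorted (map snd us)"
  shows "\<exists>M \<tau>. M \<subseteq> {..<length us} \<and> inj_on \<tau> M \<and> served_all us Y = Y - \<tau> ` M \<and>
    (\<forall>i\<in>M. \<tau> i \<in> Y \<inter> {fst (us ! i)..snd (us ! i)}) \<and>
    (\<forall>i\<in>M. served_all us Y \<inter> {fst (us ! i)..<\<tau> i} = {}) \<and>
    (\<forall>i\<in>{..<length us} - M. \<exists>z\<le>fst (us ! i). \<forall>v\<in>Y \<inter> {z..snd (us ! i)}.
        \<exists>k\<in>M. \<tau> k = v \<and> z \<le> fst (us ! k) \<and> snd (us ! k) \<le> snd (us ! i))"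
  using assms(2)
proof (induction us rule: rev_induct)
  case Nil
  then show ?case by (intro exI[of _ "{}"]) (simp add: served_all_def)
next
  case (snoc u us)
  let ?L = "served_all us Y" and ?n = "length us"
  have last: "snd (us ! k) \<le> snd u" if "k < ?n" for k
    using snoc.prems that by (auto simp: sorted_append)
  from snoc obtain M \<tau> where M: "M \<subseteq> {..<?n}" "inj_on \<tau> M" "?L = Y - \<tau> ` M"
    and taken: "\<forall>i\<in>M. \<tau> i \<in> Y \<inter> {fst (us ! i)..snd (us ! i)}"
    and first: "\<forall>i\<in>M. ?L \<inter> {fst (us ! i)..<\<tau> i} = {}"
    and rej: "\<forall>i\<in>{..<?n} - M. \<exists>z\<le>fst (us ! i). \<forall>v\<in>Y \<inter> {z..snd (us ! i)}.
        \<exists>k\<in>M. \<tau> k = v \<and> z \<le> fst (us ! k) \<and> snd (us ! k) \<le> snd (us ! i)"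
    by (auto simp: sorted_append)
  have eq: "served_all (us @ [u]) Y = serve u ?L" by (simp add: served_all_def)
  have finL: "finite ?L" using M(3) assms(1) by simp
  have nth_M: "(us @ [u]) ! i = us ! i" if "i \<in> M" for i
    using that M(1) by (auto simp: nth_append)
  show ?case
  proof (cases "?L \<inter> {fst u..snd u} = {}")
    case True
    \<comment> \<open>\<open>z\<close> is the slot right after the last leftover slot below the
      interval of the rejected unit, or \<open>0\<close> if there is none.\<close>
    define z where "z = (if ?L \<inter> {..<fst u} = {} then 0 else Suc (Max (?L \<inter> {..<fst u})))"
    have fin: "finite (?L \<inter> {..<fst u})" by simp
    have z_le: "z \<le> fst u"
    proof (cases "?L \<inter> {..<fst u} = {}")
      case False
      then have "Max (?L \<inter> {..<fst u}) \<in> ?L \<inter> {..<fst u}" using fin Max_in by blast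
      then have "Max (?L \<inter> {..<fst u}) < fst u" by blast
      then show ?thesis using False by (simp add: z_def Suc_le_eq)
    qed (simp add: z_def)
    have new: "\<exists>k\<in>M. \<tau> k = v \<and> z \<le> fst (us ! k) \<and> snd (us ! k) \<le> snd u"
      if v: "v \<in> Y \<inter> {z..snd u}" for v
    proof -
      have "v \<notin> ?L"
      proof
        assume vL: "v \<in> ?L"
        then have "v < fst u" using True v by auto
        then have "v \<in> ?L \<inter> {..<fst u}" using vL by simp
        then have "v \<le> Max (?L \<inter> {..<fst u})" "?L \<inter> {..<fst u} \<noteq> {}" by auto
        then show False using v by (simp add: z_def)
      qed
      then obtain k where k: "k \<in> M" "\<tau> k = v" using v M(3) by auto
      \<comment> \<open>A unit released before \<open>z\<close> whose slot is \<open>z\<close> or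
        later would have met the leftover slot \<open>z - 1\<close> first.\<close>
      have "z \<le> fst (us ! k)"
      proof (rule ccontr)
        assume neg: "\<not> z \<le> fst (us ! k)"
        then have ne: "?L \<inter> {..<fst u} \<noteq> {}" by (auto simp: z_def split: if_splits)
        then have "Max (?L \<inter> {..<fst u}) \<in> ?L" using Max_in[OF fin] by blast
        moreover have "Suc (Max (?L \<inter> {..<fst u})) = z" using ne by (simp add: z_def)
        ultimately have "z - 1 \<in> ?L" by (metis diff_Suc_1)
        moreover have "z \<noteq> 0" using neg by simp
        then have "z - 1 \<in> {fst (us ! k)..<\<tau> k}" using neg k v by auto
        ultimately show False using first k(1) by blast
      qed
      then show ?thesis using k last M(1) by blast
    qed
    have "served_all (us @ [u]) Y = ?L" using True by (simp add: eq serve_def)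
    moreover have "\<exists>z\<le>fst ((us @ [u]) ! i). \<forall>v\<in>Y \<inter> {z..snd ((us @ [u]) ! i)}.
        \<exists>k\<in>M. \<tau> k = v \<and> z \<le> fst ((us @ [u]) ! k) \<and> snd ((us @ [u]) ! k) \<le> snd ((us @ [u]) ! i)"
      if i: "i \<in> {..<length (us @ [u])} - M" for i
    proof (cases "i = ?n")
      case True
      then show ?thesis using new z_le nth_M by (intro exI[of _ z]) fastforce
    next
      case False
      then have "i \<in> {..<?n} - M" "(us @ [u]) ! i = us ! i" using i by (auto simp: nth_append)
      then obtain z' where "z' \<le> fst (us ! i)" "\<forall>v\<in>Y \<inter> {z'..snd (us ! i)}.
        \<exists>k\<in>M. \<tau> k = v \<and> z' \<le> fst (us ! k) \<and> snd (us ! k) \<le> snd (us ! i)" using rej by blast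
      then show ?thesis using \<open>(us @ [u]) ! i = us ! i\<close> nth_M by (intro exI[of _ z']) fastforce
    qed
    ultimately show ?thesis
      using M taken first nth_M by (intro exI[of _ M] exI[of _ \<tau>]) (auto simp: less_Suc_eq)
  next
    case False
    define m where "m = Min (?L \<inter> {fst u..snd u})"
    have m: "m \<in> ?L" "m \<in> {fst u..snd u}" using False Min_in[of "?L \<inter> {fst u..snd u}"] finL
      unfolding m_def by auto
    have m_le: "m \<le> v" if "v \<in> ?L" "v \<in> {fst u..snd u}" for v
      using that finL unfolding m_def by (intro Min_le) auto
    have left: "served_all (us @ [u]) Y = ?L - {m}" using False by (simp add: eq serve_def m_def)
    have nM: "?n \<notin> M" using M(1) by auto
    let ?\<tau> = "\<tau>(?n := m)" and ?M = "insert ?n M"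
    have \<tau>_eq: "?\<tau> i = \<tau> i" if "i \<in> M" for i using that nM by auto
    have "insert ?n M - {?n} = M" using nM by auto
    then have img: "?\<tau> ` ?M = insert m (\<tau> ` M)" by (simp only: fun_upd_image insertI1 if_True)
    have "m \<notin> \<tau> ` M" using m(1) M(3) by auto
    then have "inj_on ?\<tau> ?M" using M(2) nM \<tau>_eq by (auto simp: inj_on_def)
    moreover have "served_all (us @ [u]) Y = Y - ?\<tau> ` ?M" using left M(3) img by auto
    moreover have "\<forall>i\<in>?M. ?\<tau> i \<in> Y \<inter> {fst ((us @ [u]) ! i)..snd ((us @ [u]) ! i)}"
      using taken m M(3) nth_M \<tau>_eq by auto
    moreover have "\<forall>i\<in>?M. served_all (us @ [u]) Y \<inter> {fst ((us @ [u]) ! i)..<?\<tau> i} = {}"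
    proof
      fix i assume "i \<in> ?M"
      show "served_all (us @ [u]) Y \<inter> {fst ((us @ [u]) ! i)..<?\<tau> i} = {}"
      proof (cases "i = ?n")
        case True
        have "v \<notin> ?L" if "v \<in> {fst u..<m}" for v using that m(2) m_le[of v] by fastforce
        then show ?thesis using True left by auto
      next
        case F: False
        then have "i \<in> M" using \<open>i \<in> ?M\<close> by simp
        then show ?thesis using first left nth_M \<tau>_eq by auto
      qed
    qed
    moreover have rej': "\<exists>z\<le>fst ((us @ [u]) ! i). \<forall>v\<in>Y \<inter> {z..snd ((us @ [u]) ! i)}.
        \<exists>k\<in>?M. ?\<tau> k = v \<and> z \<le> fst ((us @ [u]) ! k) \<and> snd ((us @ [u]) ! k) \<le> snd ((us @ [u]) ! i)"
      if i: "i \<in> {..<length (us @ [u])} - ?M" for i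
    proof -
      have "i \<in> {..<?n} - M" "(us @ [u]) ! i = us ! i" using i by (auto simp: nth_append)
      then obtain z' where z': "z' \<le> fst (us ! i)" "\<forall>v\<in>Y \<inter> {z'..snd (us ! i)}.
        \<exists>k\<in>M. \<tau> k = v \<and> z' \<le> fst (us ! k) \<and> snd (us ! k) \<le> snd (us ! i)" using rej by blast
      have "\<exists>k\<in>?M. ?\<tau> k = v \<and> z' \<le> fst ((us @ [u]) ! k) \<and> snd ((us @ [u]) ! k) \<le> snd (us ! i)"
        if "v \<in> Y \<inter> {z'..snd (us ! i)}" for v
        using z'(2) that nth_M \<tau>_eq by (metis insertI2)
      then show ?thesis unfolding \<open>(us @ [u]) ! i = us ! i\<close>
        using z'(1) by (intro exI[of _ z'] conjI ballI)
    qed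
    moreover have "?M \<subseteq> {..<length (us @ [u])}" using M(1) by auto
    ultimately show ?thesis
      by (intro exI[of _ ?M] exI[of _ ?\<tau>] conjI) (assumption | rule ballI, rule rej', assumption)+
  qed
qed


context agent
begin

text \<open>Between two maximal disjoint families of intervals the numbers of rejected unit jobs and of
  slots lost by a maximal free set are compared in both directions.\<close>

theorem rk_add_card_served:
  assumes us: "sorted (map snd us)" "\<And>u. u \<in> set us \<Longrightarrow> fst u \<le> snd u"
      "\<And>u. u \<in> set us \<Longrightarrow> 1 \<le> fst u" "\<And>u. u \<in> set us \<Longrightarrow> snd u \<le> T"
    and demand_us: "\<And>a b. demand J a b = length (filter (\<lambda>u. a \<le> fst u \<and> snd u \<le> b) us)"
    and X: "X \<subseteq> {1..T}"
  shows "rk J X + length us + card (served_all us ({1..T} - X)) = T"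
proof -
  define Y where "Y = {1..T} - X"
  have finX: "finite X" "finite Y" using X finite_subset unfolding Y_def by auto
  have XT: "X \<subseteq> {..T}" using X by auto
  obtain M \<tau> where M: "M \<subseteq> {..<length us}" "inj_on \<tau> M" "served_all us Y = Y - \<tau> ` M"
    and taken: "\<forall>i\<in>M. \<tau> i \<in> Y \<inter> {fst (us ! i)..snd (us ! i)}"
    and rej: "\<forall>i\<in>{..<length us} - M. \<exists>z\<le>fst (us ! i). \<forall>v\<in>Y \<inter> {z..snd (us ! i)}.
        \<exists>k\<in>M. \<tau> k = v \<and> z \<le> fst (us ! k) \<and> snd (us ! k) \<le> snd (us ! i)"
    using served_structure[OF finX(2) us(1)] by (elim exE conjE)
  have finM: "finite M" using M(1) finite_subset by blast
  let ?in = "\<lambda>a b i. a \<le> fst (us ! i) \<and> snd (us ! i) \<le> b"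
  \<comment> \<open>With \<open>R\<close> the rejected units the claim reads
    \<open>card X = card D + card R\<close>: a maximal free set loses exactly as many covered slots
    as there are units without an uncovered slot.\<close>
  define R where "R = {..<length us} - M"
  have dem: "demand J a b = card {i \<in> M. ?in a b i} + card {i \<in> R. ?in a b i}" for a b
  proof -
    have "demand J a b = card {i. i < length us \<and> ?in a b i}"
      unfolding demand_us by (rule length_filter_conv_card)
    also have "{i. i < length us \<and> ?in a b i} = {i \<in> M. ?in a b i} \<union> {i \<in> R. ?in a b i}"
      using M(1) by (auto simp: R_def)
    also have "card \<dots> = card {i \<in> M. ?in a b i} + card {i \<in> R. ?in a b i}"
      using finM by (intro card_Un_disjoint) (auto simp: R_def)
    finally show ?thesis .
  qed
  have inside: "card {i \<in> M. ?in a b i} \<le> card (Y \<inter> {a..b})" for a b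
  proof -
    have "\<tau> ` {i \<in> M. ?in a b i} \<subseteq> Y \<inter> {a..b}" using taken by fastforce
    then have "card (\<tau> ` {i \<in> M. ?in a b i}) \<le> card (Y \<inter> {a..b})" by (intro card_mono) auto
    then show ?thesis using M(2) by (simp add: card_image inj_on_subset)
  qed
  have split: "card (X \<inter> {a..b}) + card (Y \<inter> {a..b}) = b + 1 - a" if "1 \<le> a" "b \<le> T" for a b
  proof -
    have "card (X \<inter> {a..b}) + card (Y \<inter> {a..b}) = card ((X \<inter> {a..b}) \<union> (Y \<inter> {a..b}))"
      using finX by (intro card_Un_disjoint[symmetric]) (auto simp: Y_def)
    also have "(X \<inter> {a..b}) \<union> (Y \<inter> {a..b}) = {a..b}" using that X by (auto simp: Y_def)
    finally show ?thesis by simp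
  qed
  obtain D where D: "D \<subseteq> X" "free J D" "\<And>x. x \<in> X - D \<Longrightarrow> \<not> free J (insert x D)" "rk J X = card D"
    by (rule rk_witness[OF XT]) blast
  have D3: "\<forall>x\<in>X - D. \<not> free J (insert x D)" using D(3) by blast
  have finD: "finite D" using D(1) finX finite_subset by blast
  have freeD: "card (D \<inter> {a..b}) + demand J a b \<le> b + 1 - a" for a b
    using D(2) unfolding free_def by blast
  \<comment> \<open>The length of a tight interval is its number of slots of \<open>D\<close> plus
    its demand, and the served units inside cannot outnumber its uncovered slots; the slots of
    \<open>X\<close> missing from \<open>D\<close> are therefore paid for by rejected units of that
    interval.\<close>
  have upper: "card X \<le> card D + card R"
  proof -
    obtain G where G: "G \<subseteq> tight D" "finite G" "X - D \<subseteq> (\<Union>I\<in>G. {fst I..snd I})"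
      "\<forall>I\<in>G. \<forall>I'\<in>G. I \<noteq> I' \<longrightarrow> {fst I..snd I} \<inter> {fst I'..snd I'} = {}"
      using maximal_free_cover[OF XT D(1,2) D3] by (elim exE conjE)
    let ?U = "\<Union>I\<in>G. {fst I..snd I}"
    have each: "card (X \<inter> {fst I..snd I}) \<le> card (D \<inter> {fst I..snd I}) + card {i \<in> R. ?in (fst I) (snd I) i}"
      if I: "I \<in> G" for I
    proof -
      have t: "fst I \<le> snd I" "snd I \<le> T"
        "card (D \<inter> {fst I..snd I}) + demand J (fst I) (snd I) = snd I + 1 - fst I"
        using I G(1) by (auto simp: tight_def)
      \<comment> \<open>Slot \<open>0\<close> lies neither in \<open>X\<close> nor in the interval
        of a unit, so an interval starting there has a spare slot and cannot be tight.\<close>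
      have "1 \<le> fst I"
      proof (rule ccontr)
        assume "\<not> 1 \<le> fst I"
        then have 0: "fst I = 0" by simp
        have "filter (\<lambda>u. 0 \<le> fst u \<and> snd u \<le> snd I) us = filter (\<lambda>u. 1 \<le> fst u \<and> snd u \<le> snd I) us"
          using us(3) by (intro filter_cong) auto
        then have "demand J 0 (snd I) = demand J 1 (snd I)" unfolding demand_us by simp
        moreover have "D \<inter> {0..snd I} = D \<inter> {1..snd I}" using D(1) X by auto
        ultimately show False using t(3) freeD[of 1 "snd I"] 0 by simp
      qed
      with split[OF this t(2)] t(3) dem[of "fst I" "snd I"] inside[of "fst I" "snd I"]
      show ?thesis by linarith
    qed
    have "card (X \<inter> ?U) \<le> (\<Sum>I\<in>G. card (D \<inter> {fst I..snd I}) + card {i \<in> R. ?in (fst I) (snd I) i})"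
      unfolding card_UN_intervals[OF G(2,4) finX(1)] by (rule sum_mono[OF each])
    also have "\<dots> = card (D \<inter> ?U) + (\<Sum>I\<in>G. card {i \<in> R. ?in (fst I) (snd I) i})"
      unfolding card_UN_intervals[OF G(2,4) finD] by (rule sum.distrib)
    also have "(\<Sum>I\<in>G. card {i \<in> R. ?in (fst I) (snd I) i}) = card (\<Union>I\<in>G. {i \<in> R. ?in (fst I) (snd I) i})"
    proof (rule card_UN_disjoint[symmetric])
      show "\<forall>I\<in>G. \<forall>I'\<in>G. I \<noteq> I' \<longrightarrow>
        {i \<in> R. ?in (fst I) (snd I) i} \<inter> {i \<in> R. ?in (fst I') (snd I') i} = {}"
      proof (intro ballI impI equals0I)
        fix I I' i assume *: "I \<in> G" "I' \<in> G" "I \<noteq> I'"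
          "i \<in> {i \<in> R. ?in (fst I) (snd I) i} \<inter> {i \<in> R. ?in (fst I') (snd I') i}"
        then have "i < length us" by (auto simp: R_def)
        then have "fst (us ! i) \<le> snd (us ! i)" using us(2) by simp
        then have "fst (us ! i) \<in> {fst I..snd I} \<inter> {fst I'..snd I'}" using *(4) by auto
        moreover have "{fst I..snd I} \<inter> {fst I'..snd I'} = {}" using G(4) *(1-3) by (elim ballE impE) auto
        ultimately show False by blast
      qed
    qed (use G(2) in \<open>auto simp: R_def\<close>)
    also have "\<dots> \<le> card R" by (intro card_mono) (auto simp: R_def)
    finally have "card (X \<inter> ?U) \<le> card (D \<inter> ?U) + card R" by simp
    moreover have "card (X - ?U) \<le> card (D - ?U)" using G(3) finD by (intro card_mono) auto
    moreover have "card E = card (E \<inter> ?U) + card (E - ?U)" if "finite E" for E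
      using that card_Un_disjoint[of "E \<inter> ?U" "E - ?U"] by (auto simp: Int_Diff_Un)
    note this[OF finD] this[OF finX(1)]
    ultimately show ?thesis by linarith
  qed
  have lower: "card D + card R \<le> card X"
  proof -
    \<comment> \<open>These intervals are saturated: their uncovered slots are all used by units
      confined to them, so a free set must leave room for the rejected units among the covered
      slots. By \<open>served_structure\<close> every rejected unit lies in such an
      interval.\<close>
    define F where "F = {(a, b). 1 \<le> a \<and> a \<le> b \<and> b \<le> T \<and> (\<forall>v\<in>Y \<inter> {a..b}. \<exists>k\<in>M. \<tau> k = v \<and> ?in a b k)}"
    have finF: "finite F" by (rule finite_subset[of _ "{..T} \<times> {..T}"]) (auto simp: F_def)
    have hull: "(min a a', max b b') \<in> F"
      if ab: "(a, b) \<in> F" "(a', b') \<in> F" "x \<in> {a..b}" "x \<in> {a'..b'}" for a b a' b' x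
    proof -
      have "\<exists>k\<in>M. \<tau> k = v \<and> ?in (min a a') (max b b') k" if v: "v \<in> Y \<inter> {min a a'..max b b'}" for v
      proof -
        have "v \<in> Y \<inter> {a..b} \<or> v \<in> Y \<inter> {a'..b'}" using v ab(3,4) by auto
        then have "\<exists>k\<in>M. \<tau> k = v \<and> (?in a b k \<or> ?in a' b' k)" using ab(1,2) unfolding F_def by blast
        then show ?thesis by fastforce
      qed
      then show ?thesis using ab by (auto simp: F_def)
    qed
    have "\<exists>G\<subseteq>F. (\<forall>I\<in>F. \<exists>I'\<in>G. {fst I..snd I} \<subseteq> {fst I'..snd I'}) \<and>
      (\<forall>I\<in>G. \<forall>I'\<in>G. I \<noteq> I' \<longrightarrow> {fst I..snd I} \<inter> {fst I'..snd I'} = {})"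
      by (rule maximal_intervals[OF finF hull]) (assumption+, simp add: F_def)
    then obtain G where G: "G \<subseteq> F"
      "\<forall>I\<in>F. \<exists>I'\<in>G. {fst I..snd I} \<subseteq> {fst I'..snd I'}"
      "\<forall>I\<in>G. \<forall>I'\<in>G. I \<noteq> I' \<longrightarrow> {fst I..snd I} \<inter> {fst I'..snd I'} = {}" by (elim exE conjE)
    have finG: "finite G" using G(1) finF finite_subset by blast
    let ?U = "\<Union>I\<in>G. {fst I..snd I}"
    have each: "card (D \<inter> {fst I..snd I}) + card {i \<in> R. ?in (fst I) (snd I) i} \<le> card (X \<inter> {fst I..snd I})"
      if I: "I \<in> G" for I
    proof -
      have b: "1 \<le> fst I" "fst I \<le> snd I" "snd I \<le> T"
        "\<forall>v\<in>Y \<inter> {fst I..snd I}. \<exists>k\<in>M. \<tau> k = v \<and> ?in (fst I) (snd I) k"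
        using I G(1) by (auto simp: F_def)
      have "Y \<inter> {fst I..snd I} \<subseteq> \<tau> ` {i \<in> M. ?in (fst I) (snd I) i}"
      proof
        fix v assume "v \<in> Y \<inter> {fst I..snd I}"
        from bspec[OF b(4) this] show "v \<in> \<tau> ` {i \<in> M. ?in (fst I) (snd I) i}" by (elim bexE) auto
      qed
      then have "card (Y \<inter> {fst I..snd I}) \<le> card {i \<in> M. ?in (fst I) (snd I) i}"
        using finM by (intro surj_card_le) auto
      with split[OF b(1,3)] freeD[of "fst I" "snd I"] dem[of "fst I" "snd I"]
      show ?thesis by linarith
    qed
    have R_sub: "R \<subseteq> (\<Union>I\<in>G. {i \<in> R. ?in (fst I) (snd I) i})"
    proof
      fix i assume i: "i \<in> R"
      then obtain z where z: "z \<le> fst (us ! i)" "\<forall>v\<in>Y \<inter> {z..snd (us ! i)}.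
        \<exists>k\<in>M. \<tau> k = v \<and> z \<le> fst (us ! k) \<and> snd (us ! k) \<le> snd (us ! i)"
        using rej unfolding R_def by blast
      have ui: "us ! i \<in> set us" using i by (simp add: R_def)
      then have bi: "1 \<le> fst (us ! i)" "fst (us ! i) \<le> snd (us ! i)" "snd (us ! i) \<le> T"
        using us(2,3) us(4) by auto
      have uk: "1 \<le> fst (us ! k)" if "k \<in> M" for k using us(3)[OF nth_mem, of k] that M(1) by auto
      \<comment> \<open>The witness of a rejection may start at \<open>0\<close>, which is not a
        slot; shifting it to \<open>1\<close> loses nothing because every unit starts at
        \<open>1\<close> or later.\<close>
      have "(max 1 z, snd (us ! i)) \<in> F"
        unfolding F_def using z uk bi by fastforce
      then obtain I where I: "I \<in> G" "{max 1 z..snd (us ! i)} \<subseteq> {fst I..snd I}" using G(2) by fastforce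
      moreover have "max 1 z \<le> snd (us ! i)" using z(1) bi by simp
      ultimately have "fst I \<le> max 1 z" "snd (us ! i) \<le> snd I" by auto
      then show "i \<in> (\<Union>I\<in>G. {i \<in> R. ?in (fst I) (snd I) i})"
        using I(1) i z(1) bi(1) by (intro UN_I[of I]) auto
    qed
    have "card R \<le> card (\<Union>I\<in>G. {i \<in> R. ?in (fst I) (snd I) i})"
      using R_sub finG by (intro card_mono) (auto simp: R_def)
    also have "\<dots> \<le> (\<Sum>I\<in>G. card {i \<in> R. ?in (fst I) (snd I) i})" by (rule card_UN_le[OF finG])
    finally have "card (D \<inter> ?U) + card R
        \<le> (\<Sum>I\<in>G. card (D \<inter> {fst I..snd I}) + card {i \<in> R. ?in (fst I) (snd I) i})"
      unfolding card_UN_intervals[OF finG G(3) finD] sum.distrib by simp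
    also have "\<dots> \<le> card (X \<inter> ?U)"
      unfolding card_UN_intervals[OF finG G(3) finX(1)] by (rule sum_mono[OF each])
    finally have "card (D \<inter> ?U) + card R \<le> card (X \<inter> ?U)" .
    moreover have "card (D - ?U) \<le> card (X - ?U)" using D(1) finX by (intro card_mono) auto
    moreover have "card E = card (E \<inter> ?U) + card (E - ?U)" if "finite E" for E
      using that card_Un_disjoint[of "E \<inter> ?U" "E - ?U"] by (auto simp: Int_Diff_Un)
    note this[OF finD] this[OF finX(1)]
    ultimately show ?thesis by linarith
  qed
  have "card (\<tau> ` M) = card M" by (rule card_image[OF M(2)])
  moreover have "\<tau> ` M \<subseteq> Y" using taken by auto
  ultimately have "card (served_all us Y) + card M = card Y"
    unfolding M(3) using finX(2) by (metis card_Diff_subset card_mono finite_subset le_add_diff_inverse2)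
  moreover have "card R + card M = length us"
    unfolding R_def using M(1) finM card_mono[OF _ M(1)] by (simp add: card_Diff_subset)
  moreover have "card X + card Y = T"
    unfolding Y_def using X card_mono[OF _ X] finX(1) by (simp add: card_Diff_subset)
  ultimately show ?thesis using upper lower D(4) unfolding Y_def by linarith
qed

end

section \<open>Non-oblivious local search\<close>

text \<open>The multilinear extension without normalisation: an element is drawn with weight
  \<open>u e\<close> and left out with weight \<open>v e\<close>. The value type is general because
  the program works in \<open>nat\<close> and the analysis in \<open>real\<close>.\<close>

definition wsum :: "('e \<Rightarrow> 'a::comm_semiring_1) \<Rightarrow> ('e \<Rightarrow> 'a) \<Rightarrow> 'e set \<Rightarrow> ('e set \<Rightarrow> 'a) \<Rightarrow> 'a" where
  "wsum u v E h = (\<Sum>J\<in>Pow E. prod u J * prod v (E - J) * h J)"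

lemma wsum_empty [simp]: "wsum u v {} h = h {}"
  by (simp add: wsum_def)

lemma wsum_insert:
  assumes "finite E" "x \<notin> E"
  shows "wsum u v (insert x E) h = u x * wsum u v E (\<lambda>J. h (insert x J)) + v x * wsum u v E h"
proof -
  have fin: "finite J" if "J \<subseteq> E" for J using that assms(1) finite_subset by blast
  have "wsum u v (insert x E) h
      = (\<Sum>J\<in>Pow E. prod u J * prod v (insert x E - J) * h J)
      + (\<Sum>J\<in>insert x ` Pow E. prod u J * prod v (insert x E - J) * h J)"
    unfolding wsum_def Pow_insert using assms by (intro sum.union_disjoint) auto
  also have "(\<Sum>J\<in>Pow E. prod u J * prod v (insert x E - J) * h J) = v x * wsum u v E h"
    unfolding wsum_def sum_distrib_left
  proof (rule sum.cong[OF refl])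
    fix J assume "J \<in> Pow E"
    then have "insert x E - J = insert x (E - J)" "x \<notin> E - J" "finite (E - J)" using assms by auto
    then show "prod u J * prod v (insert x E - J) * h J = v x * (prod u J * prod v (E - J) * h J)"
      by (simp add: ac_simps)
  qed
  also have "(\<Sum>J\<in>insert x ` Pow E. prod u J * prod v (insert x E - J) * h J)
      = (\<Sum>J\<in>Pow E. prod u (insert x J) * prod v (insert x E - insert x J) * h (insert x J))"
    using assms by (subst sum.reindex) (auto intro!: inj_onI simp: insert_ident)
  also have "\<dots> = u x * wsum u v E (\<lambda>J. h (insert x J))"
    unfolding wsum_def sum_distrib_left
  proof (rule sum.cong[OF refl])
    fix J assume J: "J \<in> Pow E"
    then have "insert x E - insert x J = E - J" "x \<notin> J" "finite J" using assms fin by auto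
    then show "prod u (insert x J) * prod v (insert x E - insert x J) * h (insert x J)
        = u x * (prod u J * prod v (E - J) * h (insert x J))"
      by (simp add: ac_simps)
  qed
  finally show ?thesis by (simp add: add.commute)
qed

lemma wsum_cong: "(\<And>J. J \<subseteq> E \<Longrightarrow> h J = h' J) \<Longrightarrow> wsum u v E h = wsum u v E h'"
  unfolding wsum_def by (intro sum.cong) auto

lemma wsum_add: "wsum u v E (\<lambda>J. h J + h' J) = wsum u v E h + wsum u v E h'"
  unfolding wsum_def by (simp add: distrib_left sum.distrib)

lemma wsum_diff:
  fixes h :: "'e set \<Rightarrow> 'a::comm_ring_1"
  shows "wsum u v E (\<lambda>J. h J - h' J) = wsum u v E h - wsum u v E h'"
  unfolding wsum_def by (simp add: right_diff_distrib sum_subtractf)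

lemma wsum_sum: "wsum u v E (\<lambda>J. \<Sum>i\<in>S. h i J) = (\<Sum>i\<in>S. wsum u v E (h i))"
  unfolding wsum_def sum_distrib_left by (rule sum.swap)

lemma wsum_const: "finite E \<Longrightarrow> wsum u v E (\<lambda>_. c) = (\<Prod>e\<in>E. u e + v e) * c"
  by (induction E rule: finite_induct) (simp_all add: wsum_insert algebra_simps)

lemma wsum_zero: "finite E \<Longrightarrow> wsum u (\<lambda>_. 0) E h = prod u E * h E"
  by (induction E arbitrary: h rule: finite_induct) (simp_all add: wsum_insert ac_simps)

lemma wsum_mono:
  fixes h :: "'e set \<Rightarrow> 'a::linordered_idom"
  assumes "\<And>e. e \<in> E \<Longrightarrow> 0 \<le> u e" "\<And>e. e \<in> E \<Longrightarrow> 0 \<le> v e" "\<And>J. J \<subseteq> E \<Longrightarrow> h J \<le> h' J"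
  shows "wsum u v E h \<le> wsum u v E h'"
  unfolding wsum_def using assms
  by (intro sum_mono mult_left_mono mult_nonneg_nonneg prod_nonneg) auto

text \<open>Up to the factor \<open>l ^ card E\<close>, the expectation for a random subset of \<open>E\<close> that contains each
  element independently with probability \<open>k / l\<close>.\<close>

definition expect :: "real \<Rightarrow> real \<Rightarrow> 'e set \<Rightarrow> ('e set \<Rightarrow> real) \<Rightarrow> real" where
  "expect l k E h = wsum (\<lambda>_. k) (\<lambda>_. l - k) E h"

lemmas expect_insert = wsum_insert[where u = "\<lambda>_. k" and v = "\<lambda>_. l - k" for k l :: real,
    folded expect_def]

lemmas expect_diff = wsum_diff[where u = "\<lambda>_. k" and v = "\<lambda>_. l - k" for k l :: real,
    folded expect_def]

lemmas expect_add = wsum_add[where u = "\<lambda>_. k" and v = "\<lambda>_. l - k" for k l :: real,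
    folded expect_def]

lemma expect_mono:
  "0 \<le> k \<Longrightarrow> k \<le> l \<Longrightarrow> (\<And>J. J \<subseteq> E \<Longrightarrow> h J \<le> h' J) \<Longrightarrow> expect l k E h \<le> expect l k E h'"
  unfolding expect_def by (rule wsum_mono) auto

text \<open>Both sides carry the same total weight \<open>l ^ card E\<close>, so they compare
  expectations at the rates \<open>k / l\<close> and \<open>(k - 1) / l\<close>; sparser samples are
  better for an antitone function.\<close>

lemma expect_antimono:
  assumes "finite E" "1 \<le> k" "k \<le> l"
    and "\<And>J K. J \<subseteq> K \<Longrightarrow> K \<subseteq> E \<Longrightarrow> h K \<le> h J"
  shows "expect l k E h \<le> expect l (k - 1) E h"
  using assms(1,4)
proof (induction E arbitrary: h rule: finite_induct)
  case empty
  then show ?case by (simp add: expect_def)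
next
  case (insert x E)
  let ?h = "\<lambda>J. h (insert x J)"
  have IH: "expect l k E h \<le> expect l (k - 1) E h" "expect l k E ?h \<le> expect l (k - 1) E ?h"
    by (rule insert.IH, rule insert.prems, auto)+
  have "expect l (k - 1) E ?h \<le> expect l (k - 1) E h"
    using assms(2,3) by (intro expect_mono insert.prems) auto
  moreover have "k * expect l k E ?h \<le> k * expect l (k - 1) E ?h"
    "(l - k) * expect l k E h \<le> (l - k) * expect l (k - 1) E h"
    using IH assms(2,3) by (intro mult_left_mono; simp)+
  ultimately show ?case using insert.hyps by (simp add: expect_insert algebra_simps)
qed

text \<open>The factor \<open>l\<close> is the total weight \<open>k + (l - k)\<close> of the
  coordinate \<open>e\<close>; the samples that contain \<open>e\<close> can only lower the
  average.\<close>

lemma expect_remove: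
  assumes "finite E" "e \<in> E" "0 \<le> k" "k \<le> l"
    and "\<And>J K. J \<subseteq> K \<Longrightarrow> K \<subseteq> E \<Longrightarrow> h K \<le> h J"
  shows "expect l k E h \<le> l * expect l k (E - {e}) h"
proof -
  have "expect l k E h = expect l k (insert e (E - {e})) h" using assms(2) by (simp add: insert_absorb)
  also have "\<dots> = k * expect l k (E - {e}) (\<lambda>J. h (insert e J)) + (l - k) * expect l k (E - {e}) h"
    using assms(1) by (intro expect_insert) auto
  also have "\<dots> \<le> k * expect l k (E - {e}) h + (l - k) * expect l k (E - {e}) h"
    using assms(2-4) by (intro add_right_mono mult_left_mono expect_mono assms(5)) auto
  finally show ?thesis by (simp add: algebra_simps)
qed

text \<open>As a polynomial in \<open>k\<close>, \<open>expect l k E h\<close> has the left side as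
  its derivative. Diminishing marginals make it concave, so the derivative at \<open>k\<close> is at
  most the backward difference; the induction on \<open>E\<close> proves this without
  calculus.\<close>

lemma sum_marginals_le_expect_diff:
  assumes "finite E" "1 \<le> k" "k \<le> l"
    and "\<And>e J K. e \<in> E \<Longrightarrow> J \<subseteq> K \<Longrightarrow> K \<subseteq> E - {e} \<Longrightarrow> h (insert e K) - h K \<le> h (insert e J) - h J"
  shows "(\<Sum>e\<in>E. expect l k (E - {e}) (\<lambda>J. h (insert e J) - h J)) \<le> expect l k E h - expect l (k - 1) E h"
  using assms(1,4)
proof (induction E arbitrary: h rule: finite_induct)
  case empty
  then show ?case by (simp add: expect_def)
next
  case (insert x E)
  let ?h = "\<lambda>J. h (insert x J)"
  have IH1: "(\<Sum>e\<in>E. expect l k (E - {e}) (\<lambda>J. h (insert e J) - h J)) \<le> expect l k E h - expect l (k - 1) E h"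
    by (rule insert.IH, rule insert.prems) auto
  have IH2: "(\<Sum>e\<in>E. expect l k (E - {e}) (\<lambda>J. ?h (insert e J) - ?h J)) \<le> expect l k E ?h - expect l (k - 1) E ?h"
  proof (rule insert.IH)
    fix e J K assume *: "e \<in> E" "J \<subseteq> K" "K \<subseteq> E - {e}"
    have "h (insert e (insert x K)) - h (insert x K) \<le> h (insert e (insert x J)) - h (insert x J)"
      using * insert.hyps by (intro insert.prems) auto
    then show "?h (insert e K) - ?h K \<le> ?h (insert e J) - ?h J" by (simp add: insert_commute)
  qed
  have new: "expect l k E (\<lambda>J. ?h J - h J) \<le> expect l (k - 1) E (\<lambda>J. ?h J - h J)"
    using insert.hyps assms(2,3) by (intro expect_antimono insert.prems) auto
  have split: "expect l k (insert x E - {e}) (\<lambda>J. h (insert e J) - h J)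
      = k * expect l k (E - {e}) (\<lambda>J. ?h (insert e J) - ?h J)
      + (l - k) * expect l k (E - {e}) (\<lambda>J. h (insert e J) - h J)" if "e \<in> E" for e
  proof -
    have "insert x E - {e} = insert x (E - {e})" using that insert.hyps by auto
    then show ?thesis using insert.hyps by (simp add: expect_insert insert_commute)
  qed
  have "(\<Sum>e\<in>insert x E. expect l k (insert x E - {e}) (\<lambda>J. h (insert e J) - h J))
      = expect l k E (\<lambda>J. ?h J - h J) + (\<Sum>e\<in>E. expect l k (insert x E - {e}) (\<lambda>J. h (insert e J) - h J))"
    using insert.hyps by simp
  also have "(\<Sum>e\<in>E. expect l k (insert x E - {e}) (\<lambda>J. h (insert e J) - h J))
      = k * (\<Sum>e\<in>E. expect l k (E - {e}) (\<lambda>J. ?h (insert e J) - ?h J))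
      + (l - k) * (\<Sum>e\<in>E. expect l k (E - {e}) (\<lambda>J. h (insert e J) - h J))"
    by (simp add: split sum.distrib sum_distrib_left)
  also have "\<dots> \<le> k * (expect l k E ?h - expect l (k - 1) E ?h) + (l - k) * (expect l k E h - expect l (k - 1) E h)"
    using IH1 IH2 assms(2,3) by (intro add_mono mult_left_mono) auto
  finally show ?case
    using new insert.hyps by (simp add: expect_insert expect_diff algebra_simps)
qed

section \<open>Monotone submodular functions and single exchanges\<close>

locale monotone_submodular =
  fixes V :: "'a set" and r :: "'a set \<Rightarrow> real"
  assumes finite_V: "finite V"
    and empty: "r {} = 0"
    and mono: "X \<subseteq> Y \<Longrightarrow> Y \<subseteq> V \<Longrightarrow> r X \<le> r Y"
    and submodular: "X \<subseteq> V \<Longrightarrow> Y \<subseteq> V \<Longrightarrow> r (X \<union> Y) + r (X \<inter> Y) \<le> r X + r Y"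
begin

lemma nonneg: "X \<subseteq> V \<Longrightarrow> 0 \<le> r X"
  using mono[of "{}" X] empty by simp

lemma marginal_antimono:
  assumes "X \<subseteq> Y" "Y \<subseteq> V" "Z \<subseteq> V"
  shows "r (Y \<union> Z) - r Y \<le> r (X \<union> Z) - r X"
proof -
  have "r ((X \<union> Z) \<union> Y) + r ((X \<union> Z) \<inter> Y) \<le> r (X \<union> Z) + r Y"
    using assms by (intro submodular) auto
  moreover have "r X \<le> r ((X \<union> Z) \<inter> Y)" using assms by (intro mono) auto
  moreover have "(X \<union> Z) \<union> Y = Y \<union> Z" using assms by auto
  ultimately show ?thesis by simp
qed

lemma subadditive: "X \<subseteq> V \<Longrightarrow> Y \<subseteq> V \<Longrightarrow> r (X \<union> Y) \<le> r X + r Y"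
  using submodular[of X Y] nonneg[of "X \<inter> Y"] by fastforce

lemma UN_le_sum:
  assumes "finite E" "\<And>e. e \<in> E \<Longrightarrow> X e \<subseteq> V"
  shows "r (\<Union>e\<in>E. X e) \<le> (\<Sum>e\<in>E. r (X e))"
  using assms
proof (induction E)
  case (insert e E)
  have "r (X e \<union> (\<Union>e\<in>E. X e)) \<le> r (X e) + r (\<Union>e\<in>E. X e)"
    using insert.prems by (intro subadditive) auto
  with insert show ?case by simp
qed (simp add: empty)

text \<open>Needed twice: relative to the union of a sampled family in \<open>swap_sum\<close>, and
  relative to the window of the guessed event in \<open>tr_contraction\<close>.\<close>

lemma contraction:
  assumes "B \<subseteq> V"
  shows "monotone_submodular V (\<lambda>X. r (B \<union> X) - r B)"
proof
  fix X Y assume XY: "X \<subseteq> V" "Y \<subseteq> V"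
  have "r ((B \<union> X) \<union> (B \<union> Y)) + r ((B \<union> X) \<inter> (B \<union> Y)) \<le> r (B \<union> X) + r (B \<union> Y)"
    using assms XY by (intro submodular) auto
  moreover have "(B \<union> X) \<union> (B \<union> Y) = B \<union> (X \<union> Y)" "(B \<union> X) \<inter> (B \<union> Y) = B \<union> (X \<inter> Y)" by auto
  ultimately show "r (B \<union> (X \<union> Y)) - r B + (r (B \<union> (X \<inter> Y)) - r B)
      \<le> r (B \<union> X) - r B + (r (B \<union> Y) - r B)" by simp
next
  fix X Y assume "X \<subseteq> Y" "Y \<subseteq> V"
  then have "r (B \<union> X) \<le> r (B \<union> Y)" using assms by (intro mono) auto
  then show "r (B \<union> X) - r B \<le> r (B \<union> Y) - r B" by simp
qed (auto simp: finite_V)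

end

text \<open>The sets \<open>A e\<close> are the current choices, the sets \<open>B e\<close> those of a competing solution.\<close>

locale exchange = monotone_submodular V r
  for V :: "'a set" and r :: "'a set \<Rightarrow> real" +
  fixes E :: "'e set" and A B :: "'e \<Rightarrow> 'a set"
  assumes finite_E: "finite E"
    and A_sub: "e \<in> E \<Longrightarrow> A e \<subseteq> V"
    and B_sub: "e \<in> E \<Longrightarrow> B e \<subseteq> V"
begin

definition val :: "('e \<Rightarrow> 'a set) \<Rightarrow> 'e set \<Rightarrow> real" where
  "val C J = r (\<Union>e\<in>J. C e)"

lemma union_sub: "J \<subseteq> E \<Longrightarrow> (\<Union>e\<in>J. A e) \<subseteq> V"
  using A_sub by blast

lemma marginal_sub:
  assumes "C \<subseteq> V" "J \<subseteq> K" "K \<subseteq> E"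
  shows "r ((\<Union>e\<in>K. A e) \<union> C) - r (\<Union>e\<in>K. A e) \<le> r ((\<Union>e\<in>J. A e) \<union> C) - r (\<Union>e\<in>J. A e)"
  using assms union_sub[OF assms(3)] by (intro marginal_antimono) auto

text \<open>A swap at \<open>e\<close> changes the sample only if \<open>e\<close> is drawn, which
  has weight \<open>k\<close>. The gains add up to at least what the competitor has over the sample,
  by monotonicity and subadditivity; the losses are marginals of the current sets, bounded by the
  difference of two neighbouring rates.\<close>

lemma swap_sum:
  assumes k: "1 \<le> k" "k \<le> l"
  shows "(k / l) * (l ^ card E * r (\<Union>e\<in>E. B e) - expect l k E (val A))
      - k * (expect l k E (val A) - expect l (k - 1) E (val A))
    \<le> (\<Sum>e\<in>E. expect l k E (val (A(e := B e))) - expect l k E (val A))"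
proof -
  define g where "g e J = r ((\<Union>e\<in>J. A e) \<union> B e) - r (\<Union>e\<in>J. A e)" for e J
  have swap: "expect l k E (val (A(e := B e))) - expect l k E (val A)
      = k * expect l k (E - {e}) (g e) - k * expect l k (E - {e}) (\<lambda>J. val A (insert e J) - val A J)"
    if e: "e \<in> E" for e
  proof -
    have E: "E = insert e (E - {e})" using e by auto
    have rec: "expect l k E h = k * expect l k (E - {e}) (\<lambda>J. h (insert e J)) + (l - k) * expect l k (E - {e}) h" for h
      by (subst E, rule expect_insert) (use finite_E in auto)
    have "expect l k (E - {e}) (val (A(e := B e))) = expect l k (E - {e}) (val A)"
      unfolding expect_def val_def by (intro wsum_cong arg_cong[of _ _ r]) auto
    moreover have "expect l k (E - {e}) (\<lambda>J. val (A(e := B e)) (insert e J)) = expect l k (E - {e}) (\<lambda>J. g e J + val A J)"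
      unfolding expect_def val_def g_def
    proof (rule wsum_cong)
      fix J assume "J \<subseteq> E - {e}"
      then have "(\<Union>e'\<in>insert e J. (A(e := B e)) e') = (\<Union>e\<in>J. A e) \<union> B e" by auto
      then show "r (\<Union>e'\<in>insert e J. (A(e := B e)) e') = r ((\<Union>e\<in>J. A e) \<union> B e) - r (\<Union> (A ` J)) + r (\<Union> (A ` J))"
        by simp
    qed
    ultimately show ?thesis
      using rec[of "val A"] rec[of "val (A(e := B e))"]
      by (simp add: expect_diff expect_add algebra_simps)
  qed
  \<comment> \<open>\<open>g e\<close> is wanted on samples without \<open>e\<close>, while
    subadditivity treats one sample for all \<open>e\<close> at once; \<open>expect_remove\<close>
    passes between the two at the price of \<open>l\<close>, the origin of the factor
    \<open>k / l\<close>.\<close>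
  have "expect l k E (\<lambda>J. r (\<Union>e\<in>E. B e) - val A J) \<le> expect l k E (\<lambda>J. \<Sum>e\<in>E. g e J)"
  proof (rule expect_mono)
    fix J assume J: "J \<subseteq> E"
    interpret h: monotone_submodular V "\<lambda>X. r ((\<Union>e\<in>J. A e) \<union> X) - r (\<Union>e\<in>J. A e)"
      using union_sub[OF J] by (rule contraction)
    have "r (\<Union>e\<in>E. B e) \<le> r ((\<Union>e\<in>J. A e) \<union> (\<Union>e\<in>E. B e))"
      using union_sub[OF J] B_sub by (intro mono) auto
    moreover have "r ((\<Union>e\<in>J. A e) \<union> (\<Union>e\<in>E. B e)) - r (\<Union>e\<in>J. A e) \<le> (\<Sum>e\<in>E. g e J)"
      unfolding g_def by (rule h.UN_le_sum[OF finite_E B_sub])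
    ultimately show "r (\<Union>e\<in>E. B e) - val A J \<le> (\<Sum>e\<in>E. g e J)" by (simp add: val_def)
  qed (use k in auto)
  also have "\<dots> = (\<Sum>e\<in>E. expect l k E (g e))" unfolding expect_def by (rule wsum_sum)
  also have "\<dots> \<le> (\<Sum>e\<in>E. l * expect l k (E - {e}) (g e))"
    unfolding g_def using k finite_E B_sub by (intro sum_mono expect_remove marginal_sub) auto
  finally have "l ^ card E * r (\<Union>e\<in>E. B e) - expect l k E (val A) \<le> l * (\<Sum>e\<in>E. expect l k (E - {e}) (g e))"
    using finite_E by (simp add: expect_def wsum_diff wsum_const sum_distrib_left)
  then have "(k / l) * (l ^ card E * r (\<Union>e\<in>E. B e) - expect l k E (val A))
      \<le> (k / l) * (l * (\<Sum>e\<in>E. expect l k (E - {e}) (g e)))"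
    using k by (intro mult_left_mono) auto
  also have "\<dots> = (\<Sum>e\<in>E. k * expect l k (E - {e}) (g e))" using k by (simp add: sum_distrib_left)
  finally have gain: "(k / l) * (l ^ card E * r (\<Union>e\<in>E. B e) - expect l k E (val A))
      \<le> (\<Sum>e\<in>E. k * expect l k (E - {e}) (g e))" .
  have "(\<Sum>e\<in>E. expect l k (E - {e}) (\<lambda>J. val A (insert e J) - val A J))
      \<le> expect l k E (val A) - expect l (k - 1) E (val A)"
  proof (rule sum_marginals_le_expect_diff[OF finite_E k])
    fix e J K assume *: "e \<in> E" "J \<subseteq> K" "K \<subseteq> E - {e}"
    then show "val A (insert e K) - val A K \<le> val A (insert e J) - val A J"
      using marginal_sub[of "A e" J K] A_sub by (auto simp: val_def Un_commute)
  qed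
  then have "(\<Sum>e\<in>E. k * expect l k (E - {e}) (\<lambda>J. val A (insert e J) - val A J))
      \<le> k * (expect l k E (val A) - expect l (k - 1) E (val A))"
    using k unfolding sum_distrib_left[symmetric] by (intro mult_left_mono) auto
  with gain show ?thesis by (simp add: swap sum_subtractf)
qed

text \<open>In the sum of the inequalities of \<open>swap_sum\<close> with weights
  \<open>b k\<close>, the terms for the current sets at levels below \<open>l\<close> have the
  favourable sign by the condition on \<open>b\<close>. Only level \<open>l\<close>, where every
  element is drawn, survives. The slack \<open>l ^ card E\<close> makes room for a rounded
  potential.\<close>

theorem local_optimum_bound:
  fixes l :: nat and b :: "nat \<Rightarrow> real"
  assumes l: "1 \<le> l" and b0: "\<And>k. 0 \<le> b k"
    and b: "\<And>k. 1 \<le> k \<Longrightarrow> k < l \<Longrightarrow> (l + 1) * (k * b k) \<le> l * (Suc k * b (Suc k))"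
    and local_opt: "\<And>e. e \<in> E \<Longrightarrow>
      (\<Sum>k=1..l. b k * expect l k E (val (A(e := B e)))) \<le> (\<Sum>k=1..l. b k * expect l k E (val A)) + l ^ card E"
  shows "(\<Sum>k=1..l. k * b k) * r (\<Union>e\<in>E. B e) \<le> (l + 1) * (l * b l) * r (\<Union>e\<in>E. A e) + l * card E"
proof -
  define G where "G k = expect l (real k) E (val A)" for k
  define R where "R = r (\<Union>e\<in>E. B e)"
  define m where "m = card E"
  have lpos: "0 < real l ^ m" using l by simp
  have G0: "0 \<le> G k" if "k \<le> l" for k
  proof -
    have "expect l (real k) E (\<lambda>_. 0) \<le> G k"
      unfolding G_def val_def using that by (intro expect_mono nonneg union_sub) auto
    then show ?thesis using finite_E by (simp add: expect_def wsum_const)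
  qed
  have Gl: "G l = l ^ m * r (\<Union>e\<in>E. A e)"
    unfolding G_def expect_def m_def using finite_E by (simp add: wsum_zero val_def)
  have "(\<Sum>k=1..l. b k * ((k / l) * (l ^ m * R - G k) - k * (G k - G (k - 1))))
      \<le> (\<Sum>k=1..l. b k * (\<Sum>e\<in>E. expect l k E (val (A(e := B e))) - G k))"
  proof (intro sum_mono mult_left_mono b0)
    fix k assume "k \<in> {1..l}"
    then show "(k / l) * (l ^ m * R - G k) - k * (G k - G (k - 1))
        \<le> (\<Sum>e\<in>E. expect l k E (val (A(e := B e))) - G k)"
      using swap_sum[of "real k" "real l"] unfolding G_def R_def m_def by (auto simp: of_nat_diff)
  qed
  also have "\<dots> = (\<Sum>e\<in>E. (\<Sum>k=1..l. b k * expect l k E (val (A(e := B e)))) - (\<Sum>k=1..l. b k * G k))"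
    unfolding sum_distrib_left right_diff_distrib sum_subtractf
    by (subst sum.swap) (subst (2) sum.swap, rule refl)
  also have "\<dots> \<le> (\<Sum>e\<in>E. real l ^ m)"
    using local_opt unfolding G_def m_def by (intro sum_mono) (simp add: algebra_simps)
  also have "\<dots> = m * l ^ m" by (simp add: m_def)
  finally have "l * (\<Sum>k=1..l. b k * ((k / l) * (l ^ m * R - G k) - k * (G k - G (k - 1)))) \<le> l * real (m * l ^ m)"
    by (intro mult_left_mono) auto
  moreover have "l * (\<Sum>k=1..l. b k * ((k / l) * (l ^ m * R - G k) - k * (G k - G (k - 1))))
      = (\<Sum>k=1..l. k * b k) * (l ^ m * R) - (\<Sum>k=1..l. k * b k * ((l + 1) * G k - l * G (k - 1)))"
    unfolding sum_distrib_left sum_distrib_right sum_subtractf[symmetric]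
    using l by (intro sum.cong) (auto simp: field_simps)
  moreover have "(\<Sum>k=1..j. k * b k * ((l + 1) * G k - l * G (k - 1))) \<le> (l + 1) * (j * b j) * G j"
    if "1 \<le> j" "j \<le> l" for j
    using that
  proof (induction j rule: dec_induct)
    case base
    have "0 \<le> b 1 * (l * G 0)" using b0 G0[of 0] by simp
    then show ?case by (simp add: algebra_simps)
  next
    case (step j)
    have "(l + 1) * (j * b j) * G j \<le> l * (Suc j * b (Suc j)) * G j"
      using step by (intro mult_right_mono b G0) auto
    then show ?case using step by (simp add: algebra_simps)
  qed
  from this[of l] have "(\<Sum>k=1..l. k * b k * ((l + 1) * G k - l * G (k - 1))) \<le> (l + 1) * (l * b l) * (l ^ m * r (\<Union>e\<in>E. A e))"
    using l Gl by simp
  ultimately have "l ^ m * ((\<Sum>k=1..l. k * b k) * R) \<le> l ^ m * ((l + 1) * (l * b l) * r (\<Union>e\<in>E. A e) + l * m)"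
    by (simp add: algebra_simps)
  then show ?thesis using lpos unfolding R_def m_def by (simp add: mult_le_cancel_left_pos)
qed

end

section \<open>Transition kernels for random slot sets\<close>

text \<open>A kernel \<open>F\<close> gives a subset of \<open>{t<..N}\<close> that contains \<open>N\<close> the product of the weights of
  its consecutive elements, starting at \<open>t\<close>; \<open>kernel_sum\<close> is the resulting weighted sum over all
  subsets. Uncovered slots are renewal points, so such product weights survive both the insertion
  of an event and the service of a unit job.\<close>

function kernel_sum :: "nat \<Rightarrow> (nat \<Rightarrow> nat \<Rightarrow> nat) \<Rightarrow> nat \<Rightarrow> (nat set \<Rightarrow> nat) \<Rightarrow> nat" where
  "kernel_sum N F t \<phi> = (if t < N then \<Sum>t'\<in>{t<..N}. F t t' * kernel_sum N F t' (\<lambda>Y. \<phi> (insert t' Y)) else \<phi> {})"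
  by auto
termination by (relation "measure (\<lambda>(N, F, t, \<phi>). N - t)") auto

declare kernel_sum.simps [simp del]

lemma kernel_sum_step:
  "t < N \<Longrightarrow> kernel_sum N F t \<phi> = (\<Sum>t'\<in>{t<..N}. F t t' * kernel_sum N F t' (\<lambda>Y. \<phi> (insert t' Y)))"
  by (subst kernel_sum.simps) simp

lemma kernel_sum_end: "N \<le> t \<Longrightarrow> kernel_sum N F t \<phi> = \<phi> {}"
  by (subst kernel_sum.simps) simp

lemma kernel_induct [case_names step]:
  assumes "\<And>t. (\<And>t'. t < t' \<Longrightarrow> t' \<le> N \<Longrightarrow> P t') \<Longrightarrow> P t"
  shows "P (t :: nat)"
proof (induction "N - t" arbitrary: t rule: less_induct)
  case less
  show ?case by (rule assms) (use less in auto)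
qed

lemma kernel_sum_cong:
  assumes "\<And>s t'. t \<le> s \<Longrightarrow> s < t' \<Longrightarrow> t' \<le> N \<Longrightarrow> F s t' = F' s t'"
    and "\<And>Y. Y \<subseteq> {t<..N} \<Longrightarrow> \<phi> Y = \<phi>' Y"
  shows "kernel_sum N F t \<phi> = kernel_sum N F' t \<phi>'"
  using assms
proof (induction t arbitrary: \<phi> \<phi>' rule: kernel_induct[of N])
  case (step t)
  show ?case
  proof (cases "t < N")
    case True
    have "F t t' * kernel_sum N F t' (\<lambda>Y. \<phi> (insert t' Y)) = F' t t' * kernel_sum N F' t' (\<lambda>Y. \<phi>' (insert t' Y))"
      if t': "t' \<in> {t<..N}" for t'
    proof -
      have "kernel_sum N F t' (\<lambda>Y. \<phi> (insert t' Y)) = kernel_sum N F' t' (\<lambda>Y. \<phi>' (insert t' Y))"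
      proof (rule step.IH)
        show "\<phi> (insert t' Y) = \<phi>' (insert t' Y)" if "Y \<subseteq> {t'<..N}" for Y
          by (rule step.prems(2)) (use that t' in auto)
      qed (use t' step.prems(1) in auto)
      then show ?thesis using t' step.prems(1)[of t t'] by simp
    qed
    then show ?thesis using True by (simp add: kernel_sum_step)
  next
    case False
    then show ?thesis using step.prems(2)[of "{}"] by (simp add: kernel_sum_end)
  qed
qed

lemma kernel_sum_add:
  "kernel_sum N F t (\<lambda>Y. \<phi> Y + \<psi> Y) = kernel_sum N F t \<phi> + kernel_sum N F t \<psi>"
proof (induction t arbitrary: \<phi> \<psi> rule: kernel_induct[of N])
  case (step t)
  show ?case
  proof (cases "t < N")
    case True
    have "kernel_sum N F t (\<lambda>Y. \<phi> Y + \<psi> Y) = (\<Sum>t'\<in>{t<..N}. F t t' * kernel_sum N F t' (\<lambda>Y. \<phi> (insert t' Y))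
        + F t t' * kernel_sum N F t' (\<lambda>Y. \<psi> (insert t' Y)))"
      unfolding kernel_sum_step[OF True]
      by (intro sum.cong refl) (auto simp: step.IH distrib_left)
    then show ?thesis using True by (simp add: kernel_sum_step sum.distrib)
  qed (simp add: kernel_sum_end)
qed

definition total_weight :: "nat \<Rightarrow> (nat \<Rightarrow> nat \<Rightarrow> nat) \<Rightarrow> nat \<Rightarrow> nat" where
  "total_weight N F t = kernel_sum N F t (\<lambda>_. 1)"

lemma total_weight_step: "t < N \<Longrightarrow> total_weight N F t = (\<Sum>t'\<in>{t<..N}. F t t' * total_weight N F t')"
  unfolding total_weight_def by (subst kernel_sum_step) auto

lemma total_weight_end: "N \<le> t \<Longrightarrow> total_weight N F t = 1"
  unfolding total_weight_def by (simp add: kernel_sum_end)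

lemma kernel_le_total:
  assumes "1 \<le> total_weight N F t'" "t < t'" "t' \<le> N"
  shows "F t t' \<le> total_weight N F t"
proof -
  have "F t t' \<le> F t t' * total_weight N F t'" using assms(1) by simp
  also have "\<dots> \<le> (\<Sum>t'\<in>{t<..N}. F t t' * total_weight N F t')"
    using assms by (intro member_le_sum) auto
  finally show ?thesis using assms by (simp add: total_weight_step)
qed

lemma kernel_sum_card_step:
  assumes "t < N"
  shows "kernel_sum N F t card = (\<Sum>t'\<in>{t<..N}. F t t' * (kernel_sum N F t' card + total_weight N F t'))"
proof -
  have "kernel_sum N F t' (\<lambda>Y. card (insert t' Y)) = kernel_sum N F t' card + total_weight N F t'" for t'
    unfolding total_weight_def kernel_sum_add[symmetric]
  proof (rule kernel_sum_cong)
    fix Y assume "Y \<subseteq> {t'<..N}"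
    then have "finite Y" "t' \<notin> Y" using finite_subset by auto
    then show "card (insert t' Y) = card Y + 1" by simp
  qed simp
  then show ?thesis using assms by (simp add: kernel_sum_step)
qed

text \<open>All weight lies on the path through every slot: no event has been inserted yet.\<close>

definition unit_kernel :: "nat \<Rightarrow> nat \<Rightarrow> nat" where
  "unit_kernel t t' = of_bool (t' = Suc t)"

lemma kernel_sum_unit: "t \<le> N \<Longrightarrow> kernel_sum N unit_kernel t \<phi> = \<phi> {t<..N}"
proof (induction t arbitrary: \<phi> rule: kernel_induct[of N])
  case (step t)
  show ?case
  proof (cases "t < N")
    case True
    have "kernel_sum N unit_kernel t \<phi> = (\<Sum>t'\<in>{t<..N}. if t' = Suc t then kernel_sum N unit_kernel t' (\<lambda>Y. \<phi> (insert t' Y)) else 0)"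
      unfolding kernel_sum_step[OF True] by (intro sum.cong) (auto simp: unit_kernel_def)
    also have "\<dots> = kernel_sum N unit_kernel (Suc t) (\<lambda>Y. \<phi> (insert (Suc t) Y))" using True by simp
    also have "\<dots> = \<phi> (insert (Suc t) {Suc t<..N})" using True by (intro step.IH) auto
    also have "insert (Suc t) {Suc t<..N} = {t<..N}" using True by auto
    finally show ?thesis .
  qed (use step.prems in \<open>simp add: kernel_sum_end\<close>)
qed

text \<open>Elimination of the point \<open>x\<close>: a passage \<open>t\<close>, \<open>x\<close>,
  \<open>t'\<close> is merged into the direct transition. Transitions out of \<open>x\<close> stay,
  as they then matter only for paths that start there.\<close>

definition skip :: "nat \<Rightarrow> (nat \<Rightarrow> nat \<Rightarrow> nat) \<Rightarrow> nat \<Rightarrow> nat \<Rightarrow> nat" where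
  "skip x F t t' = (if t < x then if t' = x then 0 else if x < t' then F t t' + F t x * F x t' else F t t' else F t t')"

lemma kernel_sum_skip:
  assumes "x < N"
  shows "kernel_sum N (skip x F) t \<phi> = kernel_sum N F t (\<lambda>Y. \<phi> (Y - {x}))"
proof (induction t arbitrary: \<phi> rule: kernel_induct[of N])
  case (step t)
  have above: "kernel_sum N (skip x F) s \<psi> = kernel_sum N F s \<psi>" if "x \<le> s" for s \<psi>
    by (rule kernel_sum_cong) (use that in \<open>auto simp: skip_def\<close>)
  have rm: "kernel_sum N F s (\<lambda>Y. \<psi> (insert s' Y - {x})) = kernel_sum N F s (\<lambda>Y. \<psi> (insert s' Y))"
    if "x \<le> s" "x < s'" for s s' \<psi>
    by (rule kernel_sum_cong) (use that in \<open>auto intro!: arg_cong[of _ _ \<psi>]\<close>)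
  show ?case
  proof (cases "t < x")
    case True
    let ?g = "\<lambda>t'. kernel_sum N F t' (\<lambda>Y. \<phi> (insert t' Y))"
    have split: "{t<..N} = {t<..<x} \<union> insert x {x<..N}" using True assms by auto
    have t: "t < N" using True assms by simp
    have x: "kernel_sum N F x (\<lambda>Y. \<phi> (Y - {x})) = (\<Sum>t'\<in>{x<..N}. F x t' * ?g t')"
    proof -
      have "kernel_sum N F x (\<lambda>Y. \<phi> (Y - {x})) = kernel_sum N F x \<phi>"
      proof (rule kernel_sum_cong)
        fix Y assume "Y \<subseteq> {x<..N}"
        then have "Y - {x} = Y" by auto
        then show "\<phi> (Y - {x}) = \<phi> Y" by simp
      qed simp
      then show ?thesis using assms by (simp add: kernel_sum_step)
    qed
    have "kernel_sum N (skip x F) t \<phi> = (\<Sum>t'\<in>{t<..N}. skip x F t t' * kernel_sum N (skip x F) t' (\<lambda>Y. \<phi> (insert t' Y)))"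
      by (rule kernel_sum_step[OF t])
    also have "\<dots> = (\<Sum>t'\<in>{t<..<x}. F t t' * kernel_sum N F t' (\<lambda>Y. \<phi> (insert t' Y - {x})))
        + (\<Sum>t'\<in>{x<..N}. (F t t' + F t x * F x t') * ?g t')"
    proof -
      have "(\<Sum>t'\<in>{t<..<x}. skip x F t t' * kernel_sum N (skip x F) t' (\<lambda>Y. \<phi> (insert t' Y)))
          = (\<Sum>t'\<in>{t<..<x}. F t t' * kernel_sum N F t' (\<lambda>Y. \<phi> (insert t' Y - {x})))"
      proof (rule sum.cong[OF refl])
        fix t' assume t': "t' \<in> {t<..<x}"
        have "kernel_sum N (skip x F) t' (\<lambda>Y. \<phi> (insert t' Y)) = kernel_sum N F t' (\<lambda>Y. \<phi> (insert t' (Y - {x})))"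
          using t' assms by (intro step.IH) auto
        moreover have "insert t' (Y - {x}) = insert t' Y - {x}" for Y using t' by auto
        ultimately show "skip x F t t' * kernel_sum N (skip x F) t' (\<lambda>Y. \<phi> (insert t' Y))
          = F t t' * kernel_sum N F t' (\<lambda>Y. \<phi> (insert t' Y - {x}))" using t' True by (simp add: skip_def)
      qed
      moreover have "(\<Sum>t'\<in>{x<..N}. skip x F t t' * kernel_sum N (skip x F) t' (\<lambda>Y. \<phi> (insert t' Y)))
          = (\<Sum>t'\<in>{x<..N}. (F t t' + F t x * F x t') * ?g t')"
        using True by (intro sum.cong) (auto simp: skip_def above)
      moreover have "skip x F t x = 0" using True by (simp add: skip_def)
      ultimately show ?thesis unfolding split by (subst sum.union_disjoint) auto
    qed
    also have "\<dots> = (\<Sum>t'\<in>{t<..N}. F t t' * kernel_sum N F t' (\<lambda>Y. \<phi> (insert t' Y - {x})))"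
      unfolding split by (subst sum.union_disjoint)
        (auto simp: x rm distrib_right sum.distrib sum_distrib_left mult.assoc)
    also have "\<dots> = kernel_sum N F t (\<lambda>Y. \<phi> (Y - {x}))" by (rule kernel_sum_step[OF t, symmetric])
    finally show ?thesis .
  next
    case False
    have "kernel_sum N F t (\<lambda>Y. \<phi> (Y - {x})) = kernel_sum N F t \<phi>"
      by (rule kernel_sum_cong) (use False in \<open>auto intro!: arg_cong[of _ _ \<phi>]\<close>)
    then show ?thesis using above[of t \<phi>] False by simp
  qed
qed

definition skip_window :: "nat \<Rightarrow> nat \<Rightarrow> (nat \<Rightarrow> nat \<Rightarrow> nat) \<Rightarrow> nat \<Rightarrow> nat \<Rightarrow> nat" where
  "skip_window a b F = fold skip [a..<b] F"

lemma skip_window_Suc: "a \<le> b \<Longrightarrow> skip_window a (Suc b) F = skip b (skip_window a b F)"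
  by (simp add: skip_window_def)

lemma skip_window_empty: "b \<le> a \<Longrightarrow> skip_window a b F = F"
  by (simp add: skip_window_def)

lemma kernel_sum_skip_window:
  "b \<le> N \<Longrightarrow> kernel_sum N (skip_window a b F) t \<phi> = kernel_sum N F t (\<lambda>Y. \<phi> (Y - {a..<b}))"
proof (induction b arbitrary: \<phi>)
  case (Suc b)
  show ?case
  proof (cases "a \<le> b")
    case True
    have "Y - {a..<b} - {b} = Y - {a..<Suc b}" for Y using True by auto
    then show ?thesis using Suc True by (simp add: skip_window_Suc kernel_sum_skip)
  qed (simp add: skip_window_empty)
qed (simp add: skip_window_empty)

lemma skip_window_below: "t' < a \<Longrightarrow> skip_window a b F t t' = F t t'"
proof (induction b)
  case (Suc b)
  then show ?case by (cases "a \<le> b") (auto simp: skip_window_empty skip_window_Suc skip_def)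
qed (simp add: skip_window_empty)

lemma skip_window_inside: "t < a \<Longrightarrow> a \<le> t' \<Longrightarrow> t' < b \<Longrightarrow> skip_window a b F t t' = 0"
proof (induction b)
  case (Suc b)
  then show ?case by (cases "t' = b") (auto simp: skip_window_Suc skip_def)
qed simp

text \<open>A path from below \<open>a\<close> to an end at or beyond \<open>a\<close> crosses
  \<open>a\<close> in exactly one transition. Mixing the old and the window-skipping weights in that
  transition alone therefore mixes the two laws of whole paths and keeps the product form.\<close>

definition insert_event :: "nat \<Rightarrow> nat \<Rightarrow> nat \<Rightarrow> nat \<Rightarrow> (nat \<Rightarrow> nat \<Rightarrow> nat) \<Rightarrow> nat \<Rightarrow> nat \<Rightarrow> nat" where
  "insert_event u v a b F t t' =
     (if t < a \<and> a \<le> t' then v * F t t' + u * skip_window a b F t t' else F t t')"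

lemma kernel_sum_insert_event_above:
  "a \<le> t \<Longrightarrow> kernel_sum N (insert_event u v a b F) t \<phi> = kernel_sum N F t \<phi>"
  by (rule kernel_sum_cong) (auto simp: insert_event_def)

lemma kernel_sum_insert_event:
  assumes "b \<le> N" "a < N" "t < a"
  shows "kernel_sum N (insert_event u v a b F) t \<phi>
    = u * kernel_sum N F t (\<lambda>Y. \<phi> (Y - {a..<b})) + v * kernel_sum N F t \<phi>"
  using assms(3)
proof (induction t arbitrary: \<phi> rule: kernel_induct[of N])
  case (step t)
  let ?H = "skip_window a b F" and ?K = "insert_event u v a b F"
  let ?f = "\<lambda>t'. kernel_sum N F t' (\<lambda>Y. \<phi> (insert t' Y))"
  let ?h = "\<lambda>t'. kernel_sum N ?H t' (\<lambda>Y. \<phi> (insert t' Y))"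
  have t: "t < N" using step.prems assms by simp
  have each: "?K t t' * kernel_sum N ?K t' (\<lambda>Y. \<phi> (insert t' Y)) = u * (?H t t' * ?h t') + v * (F t t' * ?f t')"
    if t': "t' \<in> {t<..N}" for t'
  proof (cases "t' < a")
    case True
    have "kernel_sum N ?K t' (\<lambda>Y. \<phi> (insert t' Y)) = u * ?h t' + v * ?f t'"
      using t' True assms by (subst step.IH) (auto simp: kernel_sum_skip_window)
    then show ?thesis using True step.prems
      by (simp add: insert_event_def skip_window_below algebra_simps)
  next
    case False
    then have K: "?K t t' = v * F t t' + u * ?H t t'" "kernel_sum N ?K t' (\<lambda>Y. \<phi> (insert t' Y)) = ?f t'"
      using step.prems by (simp_all add: insert_event_def kernel_sum_insert_event_above)
    show ?thesis
    proof (cases "t' < b")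
      case True
      then show ?thesis unfolding K using False step.prems by (simp add: skip_window_inside)
    next
      case ge: False
      have "?h t' = kernel_sum N F t' (\<lambda>Y. \<phi> (insert t' (Y - {a..<b})))"
        by (rule kernel_sum_skip_window[OF assms(1)])
      also have "\<dots> = ?f t'"
      proof (rule kernel_sum_cong)
        fix Y assume "Y \<subseteq> {t'<..N}"
        then have "Y - {a..<b} = Y" using ge by auto
        then show "\<phi> (insert t' (Y - {a..<b})) = \<phi> (insert t' Y)" by simp
      qed simp
      finally show ?thesis unfolding K by (simp add: algebra_simps)
    qed
  qed
  have "kernel_sum N ?K t \<phi> = u * kernel_sum N ?H t \<phi> + v * kernel_sum N F t \<phi>"
    unfolding kernel_sum_step[OF t] sum_distrib_left sum.distrib[symmetric]
    by (intro sum.cong refl each)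
  then show ?case by (simp add: kernel_sum_skip_window[OF assms(1)])
qed

text \<open>As in \<open>insert_event\<close>, only the transition across \<open>a\<close> changes:
  its target is the first available slot from \<open>a\<close> on. A target \<open>z\<close> up to
  \<open>w\<close> is taken by the unit and bypassed; a target beyond \<open>w\<close> means
  rejection.\<close>

definition serve_kernel :: "nat \<Rightarrow> nat \<Rightarrow> (nat \<Rightarrow> nat \<Rightarrow> nat) \<Rightarrow> nat \<Rightarrow> nat \<Rightarrow> nat" where
  "serve_kernel a w F t t' =
     (if t < a \<and> a \<le> t' then (if t' \<le> w then 0 else F t t') + (\<Sum>z\<in>{a..w}. if z < t' then F t z * F z t' else 0)
      else F t t')"

lemma kernel_sum_serve_above:
  "a \<le> t \<Longrightarrow> kernel_sum N (serve_kernel a w F) t \<phi> = kernel_sum N F t \<phi>"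
  by (rule kernel_sum_cong) (auto simp: serve_kernel_def)

lemma serve_insert:
  assumes "Y \<subseteq> {t<..N}"
  shows "t < a \<Longrightarrow> serve (a, w) (insert t Y) = insert t (serve (a, w) Y)"
    and "a \<le> t \<Longrightarrow> t \<le> w \<Longrightarrow> serve (a, w) (insert t Y) = Y"
    and "w < t \<Longrightarrow> serve (a, w) (insert t Y) = insert t Y"
proof -
  have fin: "finite Y" using assms finite_subset by blast
  show "serve (a, w) (insert t Y) = insert t (serve (a, w) Y)" if "t < a"
  proof -
    have eq: "insert t Y \<inter> {a..w} = Y \<inter> {a..w}" using that by auto
    have "t \<noteq> Min (Y \<inter> {a..w})" if ne: "Y \<inter> {a..w} \<noteq> {}"
    proof -
      have "Min (Y \<inter> {a..w}) \<in> {a..w}" using Min_in[OF _ ne] fin by blast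
      then show ?thesis using \<open>t < a\<close> by force
    qed
    then show ?thesis unfolding serve_def fst_conv snd_conv eq by auto
  qed
  show "serve (a, w) (insert t Y) = Y" if "a \<le> t" "t \<le> w"
  proof -
    have "Min (insert t Y \<inter> {a..w}) = t" using that assms fin by (intro Min_eqI) auto
    moreover have "t \<notin> Y" using assms by auto
    ultimately show ?thesis unfolding serve_def fst_conv snd_conv using that by auto
  qed
  show "serve (a, w) (insert t Y) = insert t Y" if "w < t"
  proof -
    have "insert t Y \<inter> {a..w} = {}" using that assms by auto
    then show ?thesis by (simp add: serve_def)
  qed
qed

lemma kernel_sum_serve:
  assumes "a \<le> w" "w < N" "t < a"
  shows "kernel_sum N (serve_kernel a w F) t \<phi> = kernel_sum N F t (\<lambda>Y. \<phi> (serve (a, w) Y))"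
  using assms(3)
proof (induction t arbitrary: \<phi> rule: kernel_induct[of N])
  case (step t)
  let ?K = "serve_kernel a w F"
  let ?f = "\<lambda>t'. kernel_sum N F t' (\<lambda>Y. \<phi> (insert t' Y))"
  let ?s = "\<lambda>t'. kernel_sum N F t' (\<lambda>Y. \<phi> (serve (a, w) (insert t' Y)))"
  have t: "t < N" using step.prems assms by simp
  have split3: "{a..N} = {a..w} \<union> {w<..N}" using assms by auto
  have low: "?K t t' * kernel_sum N ?K t' (\<lambda>Y. \<phi> (insert t' Y)) = F t t' * ?s t'" if t': "t' \<in> {t<..<a}" for t'
  proof -
    have "kernel_sum N ?K t' (\<lambda>Y. \<phi> (insert t' Y)) = kernel_sum N F t' (\<lambda>Y. \<phi> (insert t' (serve (a, w) Y)))"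
      using t' assms by (intro step.IH) auto
    also have "\<dots> = ?s t'"
      by (rule kernel_sum_cong) (use t' in \<open>auto simp: serve_insert(1)\<close>)
    finally show ?thesis using t' by (simp add: serve_kernel_def)
  qed
  have mid: "?s z = (\<Sum>t'\<in>{a..N}. if z < t' then F z t' * ?f t' else 0)" if z: "z \<in> {a..w}" for z
  proof -
    have "?s z = kernel_sum N F z \<phi>"
      by (rule kernel_sum_cong) (use z in \<open>auto simp: serve_insert(2)\<close>)
    also have "\<dots> = (\<Sum>t'\<in>{z<..N}. F z t' * ?f t')" using z assms by (intro kernel_sum_step) auto
    also have "\<dots> = (\<Sum>t'\<in>{a..N}. if z < t' then F z t' * ?f t' else 0)"
      using z by (intro sum.mono_neutral_cong_left) auto
    finally show ?thesis .
  qed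
  have high: "?s t' = ?f t'" if "t' \<in> {w<..N}" for t'
    by (rule kernel_sum_cong) (use that in \<open>auto simp: serve_insert(3)\<close>)
  have "(\<Sum>t'\<in>{a..N}. ?K t t' * kernel_sum N ?K t' (\<lambda>Y. \<phi> (insert t' Y)))
      = (\<Sum>t'\<in>{a..N}. (if t' \<le> w then 0 else F t t' * ?f t')
          + (\<Sum>z\<in>{a..w}. F t z * (if z < t' then F z t' * ?f t' else 0)))"
  proof (rule sum.cong[OF refl])
    fix t' assume t': "t' \<in> {a..N}"
    have "(\<Sum>z\<in>{a..w}. if z < t' then F t z * F z t' else 0) * ?f t'
        = (\<Sum>z\<in>{a..w}. F t z * (if z < t' then F z t' * ?f t' else 0))"
      unfolding sum_distrib_right by (intro sum.cong) auto
    then show "?K t t' * kernel_sum N ?K t' (\<lambda>Y. \<phi> (insert t' Y)) = (if t' \<le> w then 0 else F t t' * ?f t')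
          + (\<Sum>z\<in>{a..w}. F t z * (if z < t' then F z t' * ?f t' else 0))"
      using t' step.prems by (simp add: serve_kernel_def kernel_sum_serve_above distrib_right)
  qed
  also have "\<dots> = (\<Sum>t'\<in>{w<..N}. F t t' * ?f t') + (\<Sum>z\<in>{a..w}. F t z * ?s z)"
  proof -
    have "(\<Sum>t'\<in>{a..N}. if t' \<le> w then 0 else F t t' * ?f t') = (\<Sum>t'\<in>{w<..N}. F t t' * ?f t')"
      using assms by (intro sum.mono_neutral_cong_right) auto
    moreover have "(\<Sum>t'\<in>{a..N}. \<Sum>z\<in>{a..w}. F t z * (if z < t' then F z t' * ?f t' else 0)) = (\<Sum>z\<in>{a..w}. F t z * ?s z)"
      by (subst sum.swap) (simp add: mid sum_distrib_left)
    ultimately show ?thesis by (simp add: sum.distrib)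
  qed
  finally have upper: "(\<Sum>t'\<in>{a..N}. ?K t t' * kernel_sum N ?K t' (\<lambda>Y. \<phi> (insert t' Y)))
    = (\<Sum>t'\<in>{w<..N}. F t t' * ?s t') + (\<Sum>z\<in>{a..w}. F t z * ?s z)"
    by (simp add: high)
  have split2: "{t<..N} = {t<..<a} \<union> {a..N}" using step.prems assms by auto
  have "kernel_sum N ?K t \<phi> = (\<Sum>t'\<in>{t<..<a}. F t t' * ?s t')
      + (\<Sum>t'\<in>{a..N}. ?K t t' * kernel_sum N ?K t' (\<lambda>Y. \<phi> (insert t' Y)))"
    unfolding kernel_sum_step[OF t] split2 by (subst sum.union_disjoint) (auto simp: low)
  also have "\<dots> = (\<Sum>t'\<in>{t<..N}. F t t' * ?s t')"
  proof -
    have "(\<Sum>t'\<in>{a..N}. F t t' * ?s t') = (\<Sum>z\<in>{a..w}. F t z * ?s z) + (\<Sum>t'\<in>{w<..N}. F t t' * ?s t')"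
      unfolding split3 by (rule sum.union_disjoint) auto
    moreover have "(\<Sum>t'\<in>{t<..N}. F t t' * ?s t') = (\<Sum>t'\<in>{t<..<a}. F t t' * ?s t') + (\<Sum>t'\<in>{a..N}. F t t' * ?s t')"
      unfolding split2 by (rule sum.union_disjoint) auto
    ultimately show ?thesis unfolding upper by simp
  qed
  also have "\<dots> = kernel_sum N F t (\<lambda>Y. \<phi> (serve (a, w) Y))" by (rule kernel_sum_step[OF t, symmetric])
  finally show ?case .
qed

section \<open>Uncovered slots left over by the jobs\<close>

text \<open>Each job is split into \<open>ptime\<close> unit jobs, bucket by bucket; stage
  \<open>d\<close> contains the deadlines below \<open>d\<close>. The list is sorted by construction
  and mirrors the loop of \<open>jobs_stmt\<close>.\<close>

fun units :: "job list \<Rightarrow> nat \<Rightarrow> (nat \<times> nat) list" where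
  "units J 0 = []"
| "units J (Suc d) = units J d @ concat (map (\<lambda>j. if deadline j = d then replicate (ptime j) (release j, d) else []) J)"

lemma snd_units: "u \<in> set (units J d) \<Longrightarrow> snd u < d"
  by (induction d) (auto split: if_splits)

lemma mem_units: "u \<in> set (units J d) \<Longrightarrow> \<exists>j\<in>set J. u = (release j, deadline j)"
  by (induction d) (auto split: if_splits)

lemma sorted_units: "sorted (map snd (units J d))"
proof (induction d)
  case (Suc d)
  let ?us = "concat (map (\<lambda>j. if deadline j = d then replicate (ptime j) (release j, d) else []) J)"
  have snd_us: "y = d" if "y \<in> set (map snd ?us)" for y using that by (auto split: if_splits)
  have const: "sorted xs" if "\<forall>y\<in>set xs. y = d" for xs :: "nat list"
    using that by (induction xs) auto
  have "sorted (map snd ?us)" by (rule const, rule ballI, rule snd_us)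
  moreover have "x \<le> y" if "x \<in> set (map snd (units J d))" "y \<in> set (map snd ?us)" for x y
    using that(1) snd_units[of _ J d] snd_us[OF that(2)] by (auto intro: less_imp_le)
  ultimately show ?case using Suc unfolding units.simps map_append sorted_append
    by (intro conjI ballI)
qed simp

lemma length_filter_units:
  "length (filter P (units J d)) = (\<Sum>j\<leftarrow>J. if deadline j < d \<and> P (release j, deadline j) then ptime j else 0)"
proof (induction d)
  case (Suc d)
  have block: "length (filter P (concat (map (\<lambda>j. if deadline j = d then replicate (ptime j) (release j, d) else []) K)))
      = (\<Sum>j\<leftarrow>K. if deadline j = d \<and> P (release j, deadline j) then ptime j else 0)" for K
    by (induction K) auto
  then show ?case
    unfolding units.simps filter_append length_append Suc block sum_list_addf[symmetric]
    by (auto intro!: arg_cong[of _ _ sum_list] map_cong simp: less_Suc_eq)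
qed (simp add: sum_list_0)

lemma sum_list_nth: "(\<Sum>x\<leftarrow>xs. f x) = (\<Sum>i<length xs. f (xs ! i))"
  by (simp add: sum_list_sum_nth atLeast0LessThan)

lemma demand_units:
  assumes "\<And>j. j \<in> set J \<Longrightarrow> deadline j \<le> T"
  shows "demand J a b = length (filter (\<lambda>u. a \<le> fst u \<and> snd u \<le> b) (units J (Suc T)))"
  unfolding length_filter_units demand_def sum_list_nth using assms
  by (intro sum.cong) (auto simp: less_Suc_eq_le)

text \<open>The extra slot \<open>Suc T\<close>, which no event covers and no job uses, marks the end of the horizon.\<close>

definition waste_job :: "nat \<Rightarrow> job list \<Rightarrow> nat set \<Rightarrow> nat" where
  "waste_job T J X = card (served_all (units J (Suc T)) ({1..Suc T} - X))"

definition waste :: "psba \<Rightarrow> nat set \<Rightarrow> nat" where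
  "waste I X = (\<Sum>J\<leftarrow>agents I. waste_job (horizon I) J X)"

text \<open>By \<open>tr_add_waste\<close> this is the sum of agreement and waste for every covered
  set, so maximising agreement is minimising waste.\<close>

definition capacity :: "psba \<Rightarrow> nat" where
  "capacity I = tr I {} + waste I {}"

lemma served_all_insert:
  assumes "\<And>u. u \<in> set us \<Longrightarrow> snd u \<le> T" "x > T"
  shows "served_all us (insert x Y) = insert x (served_all us Y)"
proof -
  have "serve u (insert x Y) = insert x (serve u Y)" if "snd u \<le> T" for u Y
  proof -
    have "insert x Y \<inter> {fst u..snd u} = Y \<inter> {fst u..snd u}" using that assms(2) by auto
    moreover have "x \<noteq> Min (Y \<inter> {fst u..snd u})" if ne: "Y \<inter> {fst u..snd u} \<noteq> {}"
    proof -
      have "Min (Y \<inter> {fst u..snd u}) \<in> {fst u..snd u}" using Min_in[OF _ ne] by blast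
      then show ?thesis using \<open>snd u \<le> T\<close> assms(2) by force
    qed
    ultimately show ?thesis unfolding serve_def by auto
  qed
  then show ?thesis using assms(1) unfolding served_all_def by (induction us arbitrary: Y) auto
qed

lemma served_all_subset: "served_all us Y \<subseteq> Y"
proof -
  have "serve u Y \<subseteq> Y" for u Y by (auto simp: serve_def)
  then show ?thesis unfolding served_all_def
    by (induction us arbitrary: Y) (simp, metis fold_simps(2) order_trans)
qed

lemma rk_add_waste:
  assumes "psba_instance I" "J \<in> set (agents I)" "X \<subseteq> slots I"
  shows "rk J X + length (units J (Suc (horizon I))) + waste_job (horizon I) J X = Suc (horizon I)"
proof -
  let ?T = "horizon I" and ?us = "units J (Suc (horizon I))"
  interpret agent J ?T using agentI[OF assms(1,2)] .
  have job: "1 \<le> release j \<and> release j \<le> deadline j \<and> deadline j \<le> ?T" if "j \<in> set J" for j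
    using assms(1,2) that unfolding psba_instance_def by fastforce
  have u: "1 \<le> fst u" "fst u \<le> snd u" "snd u \<le> ?T" if "u \<in> set ?us" for u
    using mem_units[OF that] job by auto
  have X: "X \<subseteq> {1..?T}" using assms(3) by (simp add: slots_def)
  have eq: "rk J X + length ?us + card (served_all ?us ({1..?T} - X)) = ?T"
    using job by (intro rk_add_card_served sorted_units u demand_units X) auto
  \<comment> \<open>The end marker is never served, so it adds one to the waste and turns
    \<open>horizon I\<close> into its successor.\<close>
  have "{1..Suc ?T} - X = insert (Suc ?T) ({1..?T} - X)" using X by auto
  then have "served_all ?us ({1..Suc ?T} - X) = insert (Suc ?T) (served_all ?us ({1..?T} - X))"
    using served_all_insert[of ?us ?T "Suc ?T"] u(3) by simp
  moreover have "Suc ?T \<notin> served_all ?us ({1..?T} - X)" "finite (served_all ?us ({1..?T} - X))"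
    using served_all_subset[of ?us "{1..?T} - X"] finite_subset by auto
  ultimately show ?thesis using eq by (simp add: waste_job_def)
qed

lemma tr_add_waste:
  assumes "psba_instance I" "X \<subseteq> slots I"
  shows "tr I X + waste I X = capacity I"
proof -
  have "rk J X + waste_job (horizon I) J X = rk J {} + waste_job (horizon I) J {}"
    if "J \<in> set (agents I)" for J
    using rk_add_waste[OF assms(1) that assms(2)] rk_add_waste[OF assms(1) that, of "{}"] by simp
  then show ?thesis
    unfolding tr_def waste_def capacity_def sum_list_addf[symmetric]
    by (intro arg_cong[of _ _ sum_list] map_cong) auto
qed

lemma waste_le: "waste I X \<le> length (agents I) * Suc (horizon I)"
proof -
  have "waste_job (horizon I) J X \<le> Suc (horizon I)" for J
  proof -
    have "served_all (units J (Suc (horizon I))) ({1..Suc (horizon I)} - X) \<subseteq> {1..Suc (horizon I)}"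
      using served_all_subset by blast
    then have "waste_job (horizon I) J X \<le> card {1..Suc (horizon I)}"
      unfolding waste_job_def by (intro card_mono) auto
    then show ?thesis by simp
  qed
  then have "waste I X \<le> (\<Sum>J\<leftarrow>agents I. Suc (horizon I))" unfolding waste_def by (intro sum_list_mono) auto
  then show ?thesis by (simp add: sum_list_triv)
qed

text \<open>The end of each window is cut at \<open>Suc (horizon I)\<close>, so that the end marker
  stays uncovered.\<close>

definition event_kernel :: "psba \<Rightarrow> (nat \<Rightarrow> nat) \<Rightarrow> (nat \<Rightarrow> nat) \<Rightarrow> (nat \<Rightarrow> nat) \<Rightarrow> nat \<Rightarrow> nat \<Rightarrow> nat \<Rightarrow> nat" where
  "event_kernel I u v sl n =
     fold (\<lambda>e. insert_event (u e) (v e) (sl e) (min (sl e + ev_lengths I ! e) (Suc (horizon I)))) [0..<n] unit_kernel"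

definition job_kernel :: "(nat \<times> nat) list \<Rightarrow> (nat \<Rightarrow> nat \<Rightarrow> nat) \<Rightarrow> nat \<Rightarrow> nat \<Rightarrow> nat" where
  "job_kernel us F = fold (\<lambda>(a, w). serve_kernel a w) us F"

lemma kernel_sum_event_kernel:
  assumes "\<And>e. e < n \<Longrightarrow> sl e \<in> slots I"
  shows "kernel_sum (Suc (horizon I)) (event_kernel I u v sl n) 0 \<phi>
    = wsum u v {..<n} (\<lambda>E. \<phi> ({1..Suc (horizon I)} - (\<Union>e\<in>E. window I e (sl e))))"
  using assms
proof (induction n arbitrary: \<phi>)
  case 0
  have "{0<..Suc (horizon I)} = {1..Suc (horizon I)}" by auto
  then show ?case by (simp add: event_kernel_def kernel_sum_unit)
next
  case (Suc n)
  let ?b = "min (sl n + ev_lengths I ! n) (Suc (horizon I))"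
  have sl: "0 < sl n" "sl n < Suc (horizon I)" using Suc.prems[of n] by (auto simp: slots_def)
  have W: "{sl n..<?b} = window I n (sl n)" using sl by (auto simp: window_def slots_def)
  have "kernel_sum (Suc (horizon I)) (event_kernel I u v sl (Suc n)) 0 \<phi>
      = kernel_sum (Suc (horizon I)) (insert_event (u n) (v n) (sl n) ?b (event_kernel I u v sl n)) 0 \<phi>"
    by (simp add: event_kernel_def)
  also have "\<dots> = u n * kernel_sum (Suc (horizon I)) (event_kernel I u v sl n) 0 (\<lambda>Y. \<phi> (Y - window I n (sl n)))
      + v n * kernel_sum (Suc (horizon I)) (event_kernel I u v sl n) 0 \<phi>"
    unfolding W[symmetric] using sl by (intro kernel_sum_insert_event) auto
  also have "\<dots> = u n * wsum u v {..<n} (\<lambda>E. \<phi> ({1..Suc (horizon I)} - (\<Union>e\<in>insert n E. window I e (sl e))))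
      + v n * wsum u v {..<n} (\<lambda>E. \<phi> ({1..Suc (horizon I)} - (\<Union>e\<in>E. window I e (sl e))))"
    using Suc.prems by (simp add: Suc.IH Diff_Diff_Int Un_commute Diff_eq Int_ac)
  also have "\<dots> = wsum u v {..<Suc n} (\<lambda>E. \<phi> ({1..Suc (horizon I)} - (\<Union>e\<in>E. window I e (sl e))))"
    by (simp add: lessThan_Suc wsum_insert)
  finally show ?case .
qed

lemma kernel_sum_job_kernel:
  assumes "\<And>a w. (a, w) \<in> set us \<Longrightarrow> 1 \<le> a \<and> a \<le> w \<and> w < N"
  shows "kernel_sum N (job_kernel us F) 0 \<phi> = kernel_sum N F 0 (\<lambda>Y. \<phi> (served_all us Y))"
  using assms
proof (induction us arbitrary: F)
  case Nil
  then show ?case by (simp add: job_kernel_def served_all_def)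
next
  case (Cons u us)
  obtain a w where u: "u = (a, w)" by (cases u)
  have "kernel_sum N (job_kernel (u # us) F) 0 \<phi> = kernel_sum N (job_kernel us (serve_kernel a w F)) 0 \<phi>"
    by (simp add: job_kernel_def u)
  also have "\<dots> = kernel_sum N (serve_kernel a w F) 0 (\<lambda>Y. \<phi> (served_all us Y))"
    using Cons.prems by (intro Cons.IH) auto
  also have "\<dots> = kernel_sum N F 0 (\<lambda>Y. \<phi> (served_all us (serve (a, w) Y)))"
    using Cons.prems[of a w] u by (intro kernel_sum_serve) auto
  finally show ?case by (simp add: served_all_def u)
qed

definition agent_kernel :: "psba \<Rightarrow> (nat \<Rightarrow> nat) \<Rightarrow> (nat \<Rightarrow> nat) \<Rightarrow> (nat \<Rightarrow> nat) \<Rightarrow> job list \<Rightarrow> nat \<Rightarrow> nat \<Rightarrow> nat" where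
  "agent_kernel I u v sl J =
     job_kernel (units J (Suc (horizon I))) (event_kernel I u v sl (length (ev_lengths I)))"

lemma units_bounds:
  assumes "psba_instance I" "J \<in> set (agents I)" "(a, w) \<in> set (units J d)"
  shows "1 \<le> a \<and> a \<le> w \<and> w < Suc (horizon I)"
  using assms mem_units[OF assms(3)] unfolding psba_instance_def by fastforce

text \<open>Here a sum over all subsets of events is replaced by kernel operations; the kernel of
  the events is common to all agents and only the service of the jobs differs.\<close>

theorem kernel_sum_agents:
  assumes "psba_instance I" "\<And>e. e \<in> events I \<Longrightarrow> sl e \<in> slots I"
  shows "(\<Sum>J\<leftarrow>agents I. kernel_sum (Suc (horizon I)) (agent_kernel I u v sl J) 0 card)
    = wsum u v (events I) (\<lambda>E. waste I (\<Union>e\<in>E. window I e (sl e)))"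
proof -
  have "kernel_sum (Suc (horizon I)) (agent_kernel I u v sl J) 0 card
      = wsum u v (events I) (\<lambda>E. waste_job (horizon I) J (\<Union>e\<in>E. window I e (sl e)))"
    if J: "J \<in> set (agents I)" for J
    unfolding agent_kernel_def waste_job_def events_def
    using assms units_bounds[OF assms(1) J]
    by (subst kernel_sum_job_kernel) (auto simp: kernel_sum_event_kernel events_def simp del: units.simps)
  then have "(\<Sum>J\<leftarrow>agents I. kernel_sum (Suc (horizon I)) (agent_kernel I u v sl J) 0 card)
      = (\<Sum>J\<leftarrow>agents I. wsum u v (events I) (\<lambda>E. waste_job (horizon I) J (\<Union>e\<in>E. window I e (sl e))))"
    by (intro arg_cong[of _ _ sum_list] map_cong) auto
  also have "\<dots> = wsum u v (events I) (\<lambda>E. waste I (\<Union>e\<in>E. window I e (sl e)))"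
    unfolding waste_def sum_list_nth by (rule wsum_sum[symmetric])
  finally show ?thesis .
qed

text \<open>The entries of a kernel are bounded by its total weights; this keeps the second factors of
  products below the cap.\<close>

lemma total_weight_skip_window: "b \<le> N \<Longrightarrow> total_weight N (skip_window a b F) t = total_weight N F t"
  unfolding total_weight_def by (simp add: kernel_sum_skip_window)

lemma total_weight_insert_event:
  assumes "b \<le> N" "a < N"
  shows "total_weight N (insert_event u v a b F) t = (if t < a then (u + v) * total_weight N F t else total_weight N F t)"
  unfolding total_weight_def using assms
  by (auto simp: kernel_sum_insert_event kernel_sum_insert_event_above algebra_simps)

lemma total_weight_serve_kernel:
  assumes "a \<le> w" "w < N"
  shows "total_weight N (serve_kernel a w F) t = total_weight N F t"
  unfolding total_weight_def using assms by (cases "t < a") (auto simp: kernel_sum_serve kernel_sum_serve_above)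

lemma total_weight_event_kernel:
  assumes "\<And>e. e < n \<Longrightarrow> sl e \<in> slots I" "\<And>e. e < n \<Longrightarrow> 1 \<le> u e + v e" "t \<le> Suc (horizon I)"
  shows "1 \<le> total_weight (Suc (horizon I)) (event_kernel I u v sl n) t \<and>
    total_weight (Suc (horizon I)) (event_kernel I u v sl n) t \<le> (\<Prod>e<n. u e + v e)"
  using assms(1,2)
proof (induction n)
  case 0
  then show ?case using assms(3) by (simp add: event_kernel_def total_weight_def kernel_sum_unit)
next
  case (Suc n)
  let ?t = "total_weight (Suc (horizon I)) (event_kernel I u v sl n) t"
  have IH: "1 \<le> ?t" "?t \<le> (\<Prod>e<n. u e + v e)" using Suc by auto
  have "sl n < Suc (horizon I)" using Suc.prems(1)[of n] by (auto simp: slots_def)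
  then have "total_weight (Suc (horizon I)) (event_kernel I u v sl (Suc n)) t
      = (if t < sl n then (u n + v n) * ?t else ?t)"
    by (simp add: event_kernel_def total_weight_insert_event)
  moreover have "1 \<le> u n + v n" using Suc.prems(2)[of n] by simp
  moreover have "1 * 1 \<le> (u n + v n) * ?t" using calculation(2) IH by (intro mult_le_mono) auto
  moreover have "(u n + v n) * ?t \<le> (u n + v n) * (\<Prod>e<n. u e + v e)" using IH by (intro mult_le_mono2)
  moreover have "1 * ?t \<le> (u n + v n) * (\<Prod>e<n. u e + v e)" using calculation(2) IH by (intro mult_le_mono) auto
  ultimately show ?case by (auto simp: ac_simps)
qed

section \<open>The greedy algorithm\<close>

definition assign_of :: "(nat \<Rightarrow> nat) \<Rightarrow> nat set \<Rightarrow> (nat \<times> nat) set" where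
  "assign_of sl E = (\<lambda>e. (e, sl e)) ` E"

lemma assign_of_insert: "assign_of sl (insert e E) = insert (e, sl e) (assign_of sl E)"
  by (simp add: assign_of_def)

lemma cover_assign_of: "cover I (assign_of sl E) = (\<Union>e\<in>E. window I e (sl e))"
  by (auto simp: cover_def assign_of_def)

lemma complete_assign_of:
  "(\<And>e. e \<in> events I \<Longrightarrow> sl e \<in> slots I) \<Longrightarrow> complete_schedule I (assign_of sl (events I))"
  by (auto simp: complete_schedule_def assign_of_def)

lemma complete_schedule_assign:
  assumes "complete_schedule I S"
  obtains sl where "S = assign_of sl (events I)" "\<And>e. e \<in> events I \<Longrightarrow> sl e \<in> slots I"
proof
  let ?sl = "\<lambda>e. THE t. (e, t) \<in> S"
  have S: "S \<subseteq> events I \<times> slots I" "\<And>e. e \<in> events I \<Longrightarrow> \<exists>!t. (e, t) \<in> S"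
    using assms by (auto simp: complete_schedule_def)
  have the: "(e, ?sl e) \<in> S" if "e \<in> events I" for e using theI'[OF S(2)[OF that]] .
  then show "?sl e \<in> slots I" if "e \<in> events I" for e using that S(1) by blast
  show "S = assign_of ?sl (events I)"
  proof
    show "S \<subseteq> assign_of ?sl (events I)"
    proof
      fix x assume x: "x \<in> S"
      obtain e t where et: "x = (e, t)" by (cases x)
      then have "e \<in> events I" using x S(1) by auto
      then have "t = ?sl e" using the S(2) x et by blast
      then show "x \<in> assign_of ?sl (events I)" using \<open>e \<in> events I\<close> et by (simp add: assign_of_def)
    qed
  qed (use the in \<open>auto simp: assign_of_def\<close>)
qed

lemma finite_complete: "finite {S. complete_schedule I S}"
  by (rule finite_subset[of _ "Pow (events I \<times> slots I)"])
    (auto simp: complete_schedule_def events_def slots_def)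

lemma approximatesI:
  fixes \<rho> :: real
  assumes "psba_instance I" "complete_schedule I S"
    and "\<And>sl. (\<And>e. e \<in> events I \<Longrightarrow> sl e \<in> slots I) \<Longrightarrow>
      \<rho> * tr I (\<Union>e\<in>events I. window I e (sl e)) \<le> tr I (cover I S)"
  shows "approximates \<rho> I S"
proof -
  have "optimum I \<in> total_agreement I ` {S. complete_schedule I S}"
    unfolding optimum_def using finite_complete assms(2) by (intro Max_in) auto
  then obtain S' where S': "complete_schedule I S'" "optimum I = total_agreement I S'" by auto
  obtain sl where "S' = assign_of sl (events I)" "\<And>e. e \<in> events I \<Longrightarrow> sl e \<in> slots I"
    by (rule complete_schedule_assign[OF S'(1)]) blast
  then show ?thesis
    using assms(2,3) S'(2) unfolding approximates_def
    by (auto simp: total_agreement_eq_tr[OF assms(1)] cover_assign_of)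
qed

text \<open>Diminishing returns, written with sums in order to stay in \<open>nat\<close>.\<close>

lemma tr_marginal_antimono:
  assumes "psba_instance I" "X \<subseteq> Y" "Y \<subseteq> slots I" "Z \<subseteq> slots I"
  shows "tr I (Z \<union> Y) + tr I X \<le> tr I (Z \<union> X) + tr I Y"
proof -
  have "tr I ((Z \<union> X) \<union> Y) + tr I ((Z \<union> X) \<inter> Y) \<le> tr I (Z \<union> X) + tr I Y"
    using assms by (intro tr_submodular) auto
  moreover have "tr I X \<le> tr I ((Z \<union> X) \<inter> Y)" using assms by (intro tr_mono) auto
  moreover have "(Z \<union> X) \<union> Y = Z \<union> Y" using assms(2) by auto
  ultimately show ?thesis by simp
qed

lemma greedy_choice_props:
  assumes "greedy_choice I S e t"
  shows "e \<in> unscheduled I S" "t \<in> slots I"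
    "\<And>u. u \<in> slots I \<Longrightarrow> total_agreement I (insert (e, u) S) \<le> total_agreement I (insert (e, t) S)"
proof -
  from assms obtain cand where c: "\<And>e'. e' \<in> unscheduled I S \<Longrightarrow> is_arg_max (gain I S e') (\<lambda>u. u \<in> slots I) (cand e')"
    "is_arg_max (\<lambda>e'. gain I S e' (cand e')) (\<lambda>e'. e' \<in> unscheduled I S) e" "t = cand e"
    unfolding greedy_choice_def by blast
  then show e: "e \<in> unscheduled I S" by (simp add: is_arg_max_def)
  from c(1)[OF this] show "t \<in> slots I" using c(3) by (simp add: is_arg_max_def)
  fix u assume "u \<in> slots I"
  then have "gain I S e u \<le> gain I S e t" using c(1)[OF e] c(3) by (auto simp: is_arg_max_def not_less)
  then show "total_agreement I (insert (e, u) S) \<le> total_agreement I (insert (e, t) S)"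
    by (simp add: gain_def)
qed

lemma greedy_steps_schedule:
  "greedy_steps I xs \<Longrightarrow> set xs \<subseteq> events I \<times> slots I \<and> (\<forall>e t u. (e, t) \<in> set xs \<longrightarrow> (e, u) \<in> set xs \<longrightarrow> t = u)"
proof (induction rule: greedy_steps.induct)
  case (step xs e t)
  then show ?case using greedy_choice_props(1,2)[OF step.hyps(2)] by (auto simp: unscheduled_def)
qed simp

lemma greedy_run_complete: "greedy_run I xs \<Longrightarrow> complete_schedule I (set xs)"
  unfolding complete_schedule_def
proof (intro conjI ballI)
  assume xs: "greedy_run I xs"
  then show "set xs \<subseteq> events I \<times> slots I"
    using greedy_steps_schedule[of I xs] by (simp add: greedy_run_def)
  fix e assume "e \<in> events I"
  then obtain t where "(e, t) \<in> set xs" using xs by (auto simp: greedy_run_def unscheduled_def)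
  then show "\<exists>!t. (e, t) \<in> set xs"
    using greedy_steps_schedule[of I xs] xs by (intro ex1I[of _ t]) (auto simp: greedy_run_def)
qed

text \<open>Each step gains at least as much as the slot of the same event in the competing schedule would.\<close>

lemma greedy_steps_bound:
  assumes "psba_instance I" "\<And>e. e \<in> events I \<Longrightarrow> sl e \<in> slots I" "greedy_steps I xs"
  shows "tr I (cover I (set xs) \<union> cover I (assign_of sl (fst ` set xs))) \<le> 2 * tr I (cover I (set xs))"
  using assms(3)
proof (induction rule: greedy_steps.induct)
  case (step xs e t)
  note props = greedy_choice_props[OF step.hyps(2)]
  let ?S = "cover I (set xs)" and ?O = "cover I (assign_of sl (fst ` set xs))"
  let ?A = "window I e t" and ?B = "window I e (sl e)"
  have sub: "?S \<subseteq> slots I" "?O \<subseteq> slots I" "?A \<subseteq> slots I" "?B \<subseteq> slots I"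
    by (simp_all add: cover_subset window_subset)
  have "e \<in> events I" using props(1) by (simp add: unscheduled_def)
  then have "tr I (?B \<union> ?S) \<le> tr I (?A \<union> ?S)"
    using props(3)[of "sl e"] assms(2) by (simp add: total_agreement_eq_tr[OF assms(1)])
  moreover have "tr I (?B \<union> (?S \<union> ?O)) + tr I ?S \<le> tr I (?B \<union> ?S) + tr I (?S \<union> ?O)"
    using sub by (intro tr_marginal_antimono[OF assms(1)]) auto
  moreover have "tr I (?A \<union> (?B \<union> (?S \<union> ?O))) + tr I ?S \<le> tr I (?A \<union> ?S) + tr I (?B \<union> (?S \<union> ?O))"
    using sub by (intro tr_marginal_antimono[OF assms(1)]) auto
  moreover have c1: "cover I (set (xs @ [(e, t)])) \<union> cover I (assign_of sl (fst ` set (xs @ [(e, t)])))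
      = ?A \<union> (?B \<union> (?S \<union> ?O))" by (auto simp: assign_of_insert)
  moreover have c2: "cover I (set (xs @ [(e, t)])) = ?A \<union> ?S" by simp
  ultimately show ?case unfolding c1 unfolding c2 using step.IH by linarith
qed (simp add: assign_of_def)

theorem greedy_half:
  assumes "psba_instance I" "greedy_run I xs"
  shows "approximates (1 / 2) I (set xs)"
proof (rule approximatesI[OF assms(1) greedy_run_complete[OF assms(2)]])
  fix sl assume sl: "\<And>e. e \<in> events I \<Longrightarrow> sl e \<in> slots I"
  have xs: "greedy_steps I xs" "unscheduled I (set xs) = {}" using assms(2) by (auto simp: greedy_run_def)
  have ev: "fst ` set xs = events I"
  proof
    show "fst ` set xs \<subseteq> events I" using greedy_steps_schedule[OF xs(1)] by auto
    show "events I \<subseteq> fst ` set xs"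
    proof
      fix e assume "e \<in> events I"
      then obtain t where "(e, t) \<in> set xs" using xs(2) by (auto simp: unscheduled_def)
      then show "e \<in> fst ` set xs" by force
    qed
  qed
  have "tr I (\<Union>e\<in>events I. window I e (sl e)) \<le> tr I (cover I (set xs) \<union> cover I (assign_of sl (fst ` set xs)))"
    unfolding ev cover_assign_of
    by (intro tr_mono[OF assms(1)]) (auto dest: subsetD[OF cover_subset] subsetD[OF window_subset])
  also have "\<dots> \<le> 2 * tr I (cover I (set xs))" by (rule greedy_steps_bound[OF assms(1) sl xs(1)])
  finally show "1 / 2 * real (tr I (\<Union>e\<in>events I. window I e (sl e))) \<le> real (tr I (cover I (set xs)))"
    by simp
qed

section \<open>The approximation ratio of the local search\<close>

text \<open>Runs from the top level downwards, index \<open>i\<close> standing for level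
  \<open>l - i\<close>. Without rounding the products of level and weight would shrink by the factor
  \<open>l / (l + 1)\<close> per level, which is equality in the condition of
  \<open>local_optimum_bound\<close>; \<open>div\<close> keeps the weights integral.\<close>

fun weight_seq :: "nat \<Rightarrow> nat \<Rightarrow> nat \<Rightarrow> nat" where
  "weight_seq l B 0 = B"
| "weight_seq l B (Suc i) = (l * (l - i) * weight_seq l B i) div ((l + 1) * (l - Suc i))"

definition level_weight :: "nat \<Rightarrow> nat \<Rightarrow> nat \<Rightarrow> nat" where
  "level_weight l B k = weight_seq l B (l - k)"

lemma level_weight_top: "level_weight l B l = B"
  by (simp add: level_weight_def)

lemma level_weight_rec:
  assumes "1 \<le> k" "k < l"
  shows "level_weight l B k = (l * Suc k * level_weight l B (Suc k)) div ((l + 1) * k)"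
proof -
  have "l - k = Suc (l - Suc k)" "l - (l - Suc k) = Suc k" "l - Suc (l - Suc k) = k" using assms by auto
  then show ?thesis by (simp add: level_weight_def)
qed

text \<open>Rounding down keeps the inequality that \<open>local_optimum_bound\<close> asks for;
  \<open>level_weight_ge\<close> measures what it loses.\<close>

lemma level_weight_le:
  assumes "1 \<le> k" "k < l"
  shows "(l + 1) * (k * level_weight l B k) \<le> l * (Suc k * level_weight l B (Suc k))"
  unfolding level_weight_rec[OF assms] using div_times_less_eq_dividend[of "l * Suc k * level_weight l B (Suc k)" "(l + 1) * k"]
  by (simp only: ac_simps)

lemma level_weight_ge:
  assumes "1 \<le> k" "k < l"
  shows "l * (Suc k * level_weight l B (Suc k)) \<le> (l + 1) * (k * level_weight l B k) + (l + 1) * k"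
proof -
  let ?x = "l * Suc k * level_weight l B (Suc k)" and ?d = "(l + 1) * k"
  have "?x = ?d * (?x div ?d) + ?x mod ?d" by simp
  moreover have "?x mod ?d < ?d" using assms by (intro mod_less_divisor) auto
  ultimately have "?x \<le> ?d * (?x div ?d) + ?d" by linarith
  then show ?thesis unfolding level_weight_rec[OF assms] by (simp only: ac_simps)
qed

lemma level_weight_bound:
  assumes "k \<le> l" "1 \<le> k"
  shows "k * level_weight l B k \<le> l * B"
  using assms
proof (induction k rule: inc_induct)
  case base
  show ?case by (simp add: level_weight_top)
next
  case (step k)
  have "l * (k * level_weight l B k) \<le> (l + 1) * (k * level_weight l B k)" by simp
  also have "\<dots> \<le> l * (Suc k * level_weight l B (Suc k))" by (rule level_weight_le) (use step in auto)
  finally have "k * level_weight l B k \<le> Suc k * level_weight l B (Suc k)" using step by simp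
  then show ?case using step by simp
qed

text \<open>Up to rounding the summands form a geometric series with ratio
  \<open>q = l / (l + 1)\<close>, whose sum is \<open>(l + 1) * (1 - q ^ l)\<close> times
  \<open>l * B\<close>. Rounding costs at most \<open>l\<close> per level and accumulates to
  \<open>i * l\<close> after \<open>i\<close> levels, hence to at most \<open>l ^ 3\<close> in
  all.\<close>

lemma sum_level_weight_ge:
  assumes "1 \<le> l"
  shows "real ((l + 1) * (l * B)) * (1 - (l / (l + 1)) ^ l) - l ^ 3 \<le> (\<Sum>k=1..l. real (k * level_weight l B k))"
proof -
  define q where "q = real l / (real l + 1)"
  have q: "0 \<le> q" "q \<le> 1" "(l + 1) * (1 - q) = 1" using assms by (auto simp: q_def field_simps)
  have each: "q ^ i * (l * B) - i * l \<le> real ((l - i) * level_weight l B (l - i))" if "i < l" for i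
    using that
  proof (induction i)
    case 0
    then show ?case by (simp add: level_weight_top)
  next
    case (Suc i)
    let ?k = "l - Suc i"
    have k: "1 \<le> ?k" "?k < l" "Suc ?k = l - i" using Suc.prems by auto
    have "real (l * ((l - i) * level_weight l B (l - i))) \<le> real ((l + 1) * (?k * level_weight l B ?k) + (l + 1) * ?k)"
      using level_weight_ge[OF k(1,2), of B] unfolding k(3) by (rule of_nat_mono)
    then have "q * real ((l - i) * level_weight l B (l - i)) \<le> real (?k * level_weight l B ?k) + ?k"
      by (simp add: q_def field_simps)
    moreover have "q * (q ^ i * (l * B) - i * l) \<le> q * real ((l - i) * level_weight l B (l - i))"
      using Suc q by (intro mult_left_mono) auto
    moreover have "q * (real i * real l) \<le> 1 * (real i * real l)" using q by (intro mult_right_mono) auto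
    moreover have "real ?k \<le> l" by simp
    moreover have "q ^ Suc i * real (l * B) = q * (q ^ i * (l * B) - i * l) + q * (real i * real l)"
      by (simp add: algebra_simps)
    moreover have "real (Suc i * l) = real i * real l + real l" by (simp add: algebra_simps)
    ultimately show ?case by linarith
  qed
  have "(\<Sum>i<l. q ^ i * (l * B) - l * l) \<le> (\<Sum>i<l. real ((l - i) * level_weight l B (l - i)))"
  proof (rule sum_mono)
    fix i assume i: "i \<in> {..<l}"
    have "real (i * l) \<le> real (l * l)" using i by (intro of_nat_mono mult_le_mono1) auto
    then show "q ^ i * (l * B) - l * l \<le> real ((l - i) * level_weight l B (l - i))"
      using each[of i] i unfolding lessThan_iff by linarith
  qed
  also have "\<dots> = (\<Sum>k=1..l. real (k * level_weight l B k))"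
    by (rule sum.reindex_bij_witness[of _ "\<lambda>k. l - k" "\<lambda>i. l - i"]) auto
  finally have le: "(\<Sum>i<l. q ^ i) * (l * B) - l * (l * l) \<le> (\<Sum>k=1..l. real (k * level_weight l B k))"
    by (simp add: sum_subtractf sum_distrib_right)
  have "(\<Sum>i<l. q ^ i) = (l + 1) * (1 - q) * (\<Sum>i<l. q ^ i)" using q(3) by simp
  also have "\<dots> = (l + 1) * (1 - q ^ l)" by (simp add: one_diff_power_eq mult.assoc)
  finally have S: "(\<Sum>i<l. q ^ i) = (l + 1) * (1 - q ^ l)" .
  have "(\<Sum>i<l. q ^ i) * (l * B) = real ((l + 1) * (l * B)) * (1 - q ^ l)"
    unfolding S of_nat_mult by (simp only: mult_ac)
  then show ?thesis using le unfolding q_def[symmetric] by (simp add: power3_eq_cube mult.assoc)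
qed

lemma of_nat_wsum: "real (wsum u v E h) = wsum (\<lambda>e. real (u e)) (\<lambda>e. real (v e)) E (\<lambda>J. real (h J))"
  by (simp add: wsum_def)

lemma wsum_cong_weights:
  "(\<And>e. e \<in> E \<Longrightarrow> u e = u' e) \<Longrightarrow> (\<And>e. e \<in> E \<Longrightarrow> v e = v' e) \<Longrightarrow> wsum u v E h = wsum u' v' E h"
  unfolding wsum_def by (intro sum.cong refl arg_cong2[of _ _ _ _ "(*)"] prod.cong) auto

text \<open>The event \<open>e0\<close> is always present; the others are sampled with probability \<open>k / l\<close>.\<close>

definition include_weight :: "nat \<Rightarrow> nat \<Rightarrow> nat \<Rightarrow> nat \<Rightarrow> nat" where
  "include_weight l e0 k e = (if e = e0 then l else k)"

definition exclude_weight :: "nat \<Rightarrow> nat \<Rightarrow> nat \<Rightarrow> nat \<Rightarrow> nat" where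
  "exclude_weight l e0 k e = (if e = e0 then 0 else l - k)"

text \<open>Formulated with waste, so the search minimises it, and all values are natural numbers
  that the program obtains with \<open>eval_stmt\<close>.\<close>

definition potential :: "psba \<Rightarrow> nat \<Rightarrow> (nat \<Rightarrow> nat) \<Rightarrow> nat \<Rightarrow> (nat \<Rightarrow> nat) \<Rightarrow> nat" where
  "potential I l b e0 sl = (\<Sum>k=1..l. b k * wsum (include_weight l e0 k) (exclude_weight l e0 k)
     (events I) (\<lambda>E. waste I (\<Union>e\<in>E. window I e (sl e))))"

lemma finite_events [simp]: "finite (events I)"
  by (simp add: events_def)

lemma tr_empty:
  assumes "psba_instance I"
  shows "tr I {} = 0"
proof -
  have "rk J {} = 0" if "J \<in> set (agents I)" for J
    using agent.rk_le_card[OF agentI[OF assms that], of "{}"] by simp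
  then show ?thesis by (simp add: tr_def)
qed

lemma tr_contraction:
  assumes "psba_instance I" "A0 \<subseteq> slots I"
  shows "monotone_submodular (slots I) (\<lambda>X. real (tr I (A0 \<union> X)) - real (tr I A0))"
proof -
  interpret monotone_submodular "slots I" "\<lambda>X. real (tr I X) - real (tr I {})"
  proof
    show "finite (slots I)" by (simp add: slots_def)
    show "real (tr I X) - real (tr I {}) \<le> real (tr I Y) - real (tr I {})" if "X \<subseteq> Y" "Y \<subseteq> slots I" for X Y
      using tr_mono[OF assms(1) that] by simp
    show "real (tr I (X \<union> Y)) - real (tr I {}) + (real (tr I (X \<inter> Y)) - real (tr I {}))
        \<le> real (tr I X) - real (tr I {}) + (real (tr I Y) - real (tr I {}))"
      if "X \<subseteq> slots I" "Y \<subseteq> slots I" for X Y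
      using tr_submodular[OF assms(1) that] by simp
  qed simp
  show ?thesis using contraction[OF assms(2)] by simp
qed

text \<open>Up to terms fixed by the slot of \<open>e0\<close> and the factor \<open>l\<close>
  contributed by the always present \<open>e0\<close>, the potential is the negative of the quantity
  in \<open>local_optimum_bound\<close>, taken for the agreement gained beyond the window of
  \<open>e0\<close>.\<close>

lemma real_potential:
  fixes sl :: "nat \<Rightarrow> nat"
  assumes I: "psba_instance I" and e0: "e0 \<in> events I"
  defines "A0 \<equiv> window I e0 (sl e0)" and "E \<equiv> events I - {e0}"
  shows "real (potential I l b e0 sl) = (\<Sum>k=1..l. b k * (l * (l ^ card E * (real (capacity I) - tr I A0)
    - expect l k E (\<lambda>J. real (tr I (A0 \<union> (\<Union>e\<in>J. window I e (sl e)))) - real (tr I A0)))))"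
proof -
  have ev: "events I = insert e0 E" "e0 \<notin> E" "finite E" using e0 by (auto simp: E_def)
  have "real (wsum (include_weight l e0 k) (exclude_weight l e0 k) (events I) (\<lambda>E. waste I (\<Union>e\<in>E. window I e (sl e))))
      = l * (l ^ card E * (real (capacity I) - tr I A0)
        - expect l k E (\<lambda>J. real (tr I (A0 \<union> (\<Union>e\<in>J. window I e (sl e)))) - real (tr I A0)))"
    if k: "k \<in> {1..l}" for k
  proof -
    let ?h = "\<lambda>J. real (tr I (A0 \<union> (\<Union>e\<in>J. window I e (sl e)))) - real (tr I A0)"
    have waste: "real (waste I X) = real (capacity I) - real (tr I X)" if "X \<subseteq> slots I" for X
      using tr_add_waste[OF I that] by linarith
    have "real (wsum (include_weight l e0 k) (exclude_weight l e0 k) (events I) (\<lambda>E. waste I (\<Union>e\<in>E. window I e (sl e))))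
        = l * wsum (\<lambda>e. real (include_weight l e0 k e)) (\<lambda>e. real (exclude_weight l e0 k e)) E
            (\<lambda>J. real (waste I (\<Union>e\<in>insert e0 J. window I e (sl e))))"
      unfolding of_nat_wsum ev(1) wsum_insert[OF ev(3,2)]
      by (simp add: of_nat_wsum include_weight_def exclude_weight_def)
    also have "wsum (\<lambda>e. real (include_weight l e0 k e)) (\<lambda>e. real (exclude_weight l e0 k e)) E
            (\<lambda>J. real (waste I (\<Union>e\<in>insert e0 J. window I e (sl e))))
        = expect l k E (\<lambda>J. real (waste I (\<Union>e\<in>insert e0 J. window I e (sl e))))"
      unfolding expect_def using ev(2) k
      by (intro wsum_cong_weights) (auto simp: include_weight_def exclude_weight_def of_nat_diff)
    also have "\<dots> = expect l k E (\<lambda>J. (real (capacity I) - real (tr I A0)) - ?h J)"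
      unfolding expect_def
    proof (rule wsum_cong)
      fix J
      have "A0 \<union> (\<Union>e\<in>J. window I e (sl e)) \<subseteq> slots I" using window_subset by (auto simp: A0_def window_def)
      from waste[OF this] show "real (waste I (\<Union>e\<in>insert e0 J. window I e (sl e))) = (real (capacity I) - real (tr I A0)) - ?h J"
        by (simp add: A0_def)
    qed
    also have "\<dots> = l ^ card E * (real (capacity I) - real (tr I A0)) - expect l k E ?h"
      unfolding expect_diff by (simp add: expect_def wsum_const ev(3) algebra_simps)
    finally show ?thesis .
  qed
  then show ?thesis unfolding potential_def by (simp only: of_nat_sum of_nat_mult) (intro sum.cong, auto)
qed

text \<open>Local optimality is assumed for the rounded potential only. Comparing quotients may hide
  a difference below \<open>l ^ card (events I)\<close>, that is \<open>l * l ^ card E\<close>;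
  divided by \<open>l\<close> this is the slack allowed in
  \<open>local_optimum_bound\<close>.\<close>

lemma local_search_bound:
  assumes I: "psba_instance I" and e0: "e0 \<in> events I" and l: "1 \<le> l"
    and sl: "\<And>e. e \<in> events I \<Longrightarrow> sl e \<in> slots I"
    and opt: "\<And>e. e \<in> events I \<Longrightarrow> opt e \<in> slots I" "opt e0 = sl e0"
    and b: "b = level_weight l B"
    and local: "\<And>e t. e \<in> events I \<Longrightarrow> e \<noteq> e0 \<Longrightarrow> t \<in> slots I \<Longrightarrow>
      potential I l b e0 sl div l ^ card (events I) \<le> potential I l b e0 (sl(e := t)) div l ^ card (events I)"
  defines "A0 \<equiv> window I e0 (sl e0)"
  shows "(\<Sum>k=1..l. real (k * b k)) * (real (tr I (\<Union>e\<in>events I. window I e (opt e))) - tr I A0)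
    \<le> (l + 1) * (l * B) * (real (tr I (\<Union>e\<in>events I. window I e (sl e))) - tr I A0) + l * card (events I)"
proof -
  define E where "E = events I - {e0}"
  define r where "r = (\<lambda>X. real (tr I (A0 \<union> X)) - real (tr I A0))"
  define A where "A e = window I e (sl e)" for e
  define O' where "O' e = window I e (opt e)" for e
  have ev: "events I = insert e0 E" "e0 \<notin> E" "finite E" using e0 by (auto simp: E_def)
  have "A0 \<subseteq> slots I" by (simp add: A0_def window_subset)
  then interpret monotone_submodular "slots I" r using tr_contraction[OF I] by (simp add: r_def)
  interpret exchange "slots I" r E A O'
    by unfold_locales (auto simp: ev(3) A_def O'_def window_def)
  have Z: "0 < l ^ card (events I)" using l by simp
  have "(\<Sum>k=1..l. real k * real (b k)) * r (\<Union>e\<in>E. O' e)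
      \<le> real (l + 1) * (real l * real (b l)) * r (\<Union>e\<in>E. A e) + real (l * card E)"
  proof (rule local_optimum_bound[where b = "\<lambda>k. real (b k)", OF l])
    show "real (l + 1) * (real k * real (b k)) \<le> real l * (real (Suc k) * real (b (Suc k)))" if "1 \<le> k" "k < l" for k
      using of_nat_mono[OF level_weight_le[OF that, of B], where 'a = real] unfolding b by (simp add: algebra_simps)
    fix e assume e: "e \<in> E"
    then have e': "e \<in> events I" "e \<noteq> e0" by (auto simp: E_def)
    have val_eq: "val C = (\<lambda>J. real (tr I (A0 \<union> (\<Union>e\<in>J. C e))) - real (tr I A0))" for C
      unfolding val_def unfolding r_def by (rule refl)
    let ?P = "potential I l b e0 sl" and ?Q = "potential I l b e0 (sl(e := opt e))" and ?Z = "l ^ card (events I)"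
    have "?P = ?Z * (?P div ?Z) + ?P mod ?Z" "?P mod ?Z < ?Z" "?Z * (?P div ?Z) \<le> ?Z * (?Q div ?Z)" "?Z * (?Q div ?Z) \<le> ?Q"
      using Z local[OF e' opt(1)[OF e'(1)]] by simp_all
    then have "?P \<le> ?Q + ?Z" by linarith
    then have "real ?P \<le> real ?Q + real ?Z" by linarith
    moreover have "real ?P = (\<Sum>k=1..l. b k * (l * (real l ^ card E * (real (capacity I) - tr I A0) - expect l k E (val A))))"
      unfolding real_potential[OF I e0] val_eq by (simp add: E_def A0_def A_def)
    moreover have "real ?Q = (\<Sum>k=1..l. b k * (l * (real l ^ card E * (real (capacity I) - tr I A0) - expect l k E (val (A(e := O' e))))))"
    proof -
      have "window I e' ((sl(e := opt e)) e') = (A(e := O' e)) e'" for e' by (simp add: A_def O'_def)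
      moreover have "(sl(e := opt e)) e0 = sl e0" using e'(2) by simp
      ultimately show ?thesis
        unfolding real_potential[OF I e0] val_eq by (simp add: E_def A0_def)
    qed
    moreover have "real ?Z = l * l ^ card E" unfolding ev(1) using ev(2,3) by simp
    ultimately have "l * (\<Sum>k=1..l. b k * expect l k E (val (A(e := O' e)))) \<le> l * ((\<Sum>k=1..l. b k * expect l k E (val A)) + l ^ card E)"
      by (simp add: right_diff_distrib sum_subtractf sum.distrib sum_distrib_left algebra_simps)
    then show "(\<Sum>k=1..l. real (b k) * expect l k E (val (A(e := O' e)))) \<le> (\<Sum>k=1..l. real (b k) * expect l k E (val A)) + real (l ^ card E)"
      using l by (simp add: mult_le_cancel_left_pos)
  qed simp
  moreover have "r (\<Union>e\<in>E. O' e) = real (tr I (\<Union>e\<in>events I. window I e (opt e))) - tr I A0"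
    by (simp add: r_def O'_def A0_def ev(1) opt(2))
  moreover have "r (\<Union>e\<in>E. A e) = real (tr I (\<Union>e\<in>events I. window I e (sl e))) - tr I A0"
    by (simp add: r_def A_def A0_def ev(1))
  moreover have "real l * card E \<le> l * card (events I)" by (auto simp: ev(1) card_insert_if ev(2,3) intro!: mult_left_mono)
  ultimately show ?thesis by (simp add: b level_weight_top add.commute[of 1])
qed

text \<open>From \<open>1 + x \<le> exp x\<close> at \<open>x = - (1 / (l + 1))\<close>, raised to
  the power \<open>l + 1\<close>; the surplus factor \<open>l / (l + 1)\<close> is then
  cleared.\<close>

lemma power_ratio_le:
  assumes "1 \<le> l"
  shows "(real l / (l + 1)) ^ l \<le> (1 + 1 / l) / exp 1"
proof -
  have "real l / (l + 1) \<le> exp (- (1 / (l + 1)))"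
    using exp_ge_add_one_self[of "- (1 / (real l + 1))"] assms by (simp add: field_simps)
  then have "(real l / (l + 1)) ^ (l + 1) \<le> exp (- (1 / (l + 1))) ^ (l + 1)"
    by (intro power_mono) auto
  also have "\<dots> = exp (- 1)" unfolding exp_of_nat_mult[symmetric] by simp
  finally have h: "(real l / (l + 1)) ^ l * (real l / (l + 1)) \<le> exp (- 1)" by (simp add: mult.commute)
  have imp: "p \<le> (1 + 1 / l) / exp 1" if p: "p * (real l / (l + 1)) \<le> exp (- 1)" for p
  proof -
    have c: "real l / (l + 1) * (1 + 1 / l) = 1" using assms by (simp add: divide_simps)
    have "p * (real l / (l + 1)) * (1 + 1 / l) \<le> exp (- 1) * (1 + 1 / l)" by (rule mult_right_mono[OF p]) simp
    then have "p \<le> exp (- 1) * (1 + 1 / l)" unfolding mult.assoc c by simp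
    then show ?thesis by (simp only: exp_minus divide_inverse mult.commute)
  qed
  show ?thesis by (rule imp) (use h in \<open>simp add: add.commute\<close>)
qed

text \<open>The plain bound \<open>1 - q\<close> falls short of \<open>1 - 1 / exp 1\<close> by
  order \<open>1 / l\<close>. The guessed event keeps its full share, at least \<open>f / n\<close>,
  which improves the bound by \<open>q / n\<close>; \<open>l = 4 * n\<close> and the top weight
  \<open>l ^ 3\<close> make this credit dominate all rounding.\<close>

theorem local_search_ratio:
  assumes I: "psba_instance I" and e0: "e0 \<in> events I" and n: "n = card (events I)" and l: "l = 4 * n"
    and sl: "\<And>e. e \<in> events I \<Longrightarrow> sl e \<in> slots I"
    and opt: "\<And>e. e \<in> events I \<Longrightarrow> opt e \<in> slots I" "opt e0 = sl e0"
    and b: "b = level_weight l (l ^ 3)"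
    and local: "\<And>e t. e \<in> events I \<Longrightarrow> e \<noteq> e0 \<Longrightarrow> t \<in> slots I \<Longrightarrow>
      potential I l b e0 sl div l ^ n \<le> potential I l b e0 (sl(e := t)) div l ^ n"
    and guess: "tr I (\<Union>e\<in>events I. window I e (opt e)) \<le> n * tr I (window I e0 (opt e0))"
  shows "(1 - 1 / exp 1) * tr I (\<Union>e\<in>events I. window I e (opt e)) \<le> tr I (\<Union>e\<in>events I. window I e (sl e))"
proof -
  define f where "f = real (tr I (\<Union>e\<in>events I. window I e (opt e)))"
  define f0 where "f0 = real (tr I (window I e0 (sl e0)))"
  define s where "s = real (tr I (\<Union>e\<in>events I. window I e (sl e)))"
  define L where "L = real l"
  define q where "q = (L / (L + 1)) ^ l"
  have n1: "1 \<le> n" using e0 n by (metis One_nat_def Suc_leI card_gt_0_iff empty_iff finite_events)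
  then have l1: "1 \<le> l" "1 \<le> L" "L = 4 * n" using l by (auto simp: L_def)
  have q0: "0 \<le> q" using l1 by (simp add: q_def)
  have "window I e0 (sl e0) \<subseteq> (\<Union>e\<in>events I. window I e (opt e))" using e0 opt(2) by (metis UN_upper)
  then have "tr I (window I e0 (sl e0)) \<le> tr I (\<Union>e\<in>events I. window I e (opt e))"
    by (rule tr_mono[OF I]) (auto simp: window_def)
  then have f0f: "f0 \<le> f" "0 \<le> f0" by (simp_all add: f_def f0_def)
  have guess': "f \<le> n * f0" using guess opt(2) unfolding f_def f0_def by (metis of_nat_le_iff of_nat_mult)
  show ?thesis
  proof (cases "f = 0")
    case True
    then show ?thesis by (simp add: f_def)
  next
    case False
    then have f1: "1 \<le> f" by (simp add: f_def)
    define W where "W = (L + 1) * (L * L ^ 3)"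
    have W: "0 < W" using l1 by (simp add: W_def)
    have "W * (1 - q) - L ^ 3 \<le> (\<Sum>k=1..l. real (k * b k))"
      using sum_level_weight_ge[OF l1(1), of "l ^ 3"] unfolding b W_def q_def L_def by (simp add: algebra_simps)
    then have "(W * (1 - q) - L ^ 3) * (f - f0) \<le> (\<Sum>k=1..l. real (k * b k)) * (f - f0)"
      using f0f by (intro mult_right_mono) auto
    also have "\<dots> \<le> W * (s - f0) + L * n"
      using local_search_bound[where I = I and ?e0.0 = e0 and l = l and sl = sl and opt = opt and b = b
          and B = "l ^ 3", OF I e0 l1(1) sl opt b local[unfolded n]]
      unfolding f_def f0_def s_def W_def L_def n by (simp add: algebra_simps)
    finally have main: "W * ((1 - q) * (f - f0)) \<le> W * (s - f0) + (L ^ 3 * (f - f0) + L * n)"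
      by (simp add: algebra_simps)
    \<comment> \<open>Integrality gives \<open>1 \<le> f\<close> here, so the absolute rounding
      terms are bounded by multiples of \<open>f\<close>; together they are the fraction
      \<open>1 / L ^ 2\<close> of \<open>W * f\<close>.\<close>
    have "L ^ 3 * (f - f0) + L * n \<le> L ^ 3 * f + L * L * f"
    proof -
      have "L ^ 3 * (f - f0) \<le> L ^ 3 * f" using f0f l1 by (intro mult_left_mono) auto
      moreover have "L * n \<le> L * L" using l1 by (intro mult_left_mono) auto
      moreover have "L * L * 1 \<le> L * L * f" using f1 l1 by (intro mult_left_mono) auto
      ultimately show ?thesis by linarith
    qed
    also have "\<dots> = W * (f / L ^ 2)"
      using l1 by (simp add: W_def power2_eq_square power3_eq_cube field_simps)
    finally have "W * ((1 - q) * (f - f0)) \<le> W * (s - f0 + f / L ^ 2)"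
      using main by (simp add: algebra_simps)
    then have s: "(1 - q) * (f - f0) \<le> s - f0 + f / L ^ 2" using W by (simp add: mult_le_cancel_left_pos)
    have "q * (f / n) \<le> q * f0" using guess' n1 q0 by (intro mult_left_mono) (auto simp: field_simps)
    then have s': "f * (1 - q * (1 - 1 / n) - 1 / L ^ 2) \<le> s"
      using s by (simp add: algebra_simps)
    have "q * (1 - 1 / n) \<le> (1 + 1 / L) / exp 1 * (1 - 1 / n)"
      using power_ratio_le[OF l1(1)] n1 unfolding q_def L_def by (intro mult_right_mono) auto
    also have "\<dots> = ((1 + 1 / L) * (1 - 1 / n)) / exp 1" by simp
    \<comment> \<open>\<open>(1 + 1 / (4 * n)) * (1 - 1 / n)\<close> is
      \<open>1 - 3 / (4 * n)\<close> minus \<open>1 / (4 * n ^ 2)\<close>.\<close>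
    also have "\<dots> \<le> (1 - 3 / (4 * n)) / exp 1"
      using n1 unfolding l1(3) by (intro divide_right_mono) (auto simp: field_simps)
    finally have q': "q * (1 - 1 / n) \<le> (1 - 3 / (4 * n)) / exp 1" .
    have "1 / L ^ 2 \<le> 1 / (16 * n)"
      using n1 unfolding l1(3) by (auto simp: power2_eq_square field_simps)
    \<comment> \<open>The remaining slack is at least \<open>1 / (4 * n)\<close>, because
      \<open>exp 1 \<le> 3\<close>.\<close>
    also have "\<dots> \<le> 3 / (4 * n) / exp 1" using exp_le n1 by (auto simp: field_simps)
    finally have "q * (1 - 1 / n) + 1 / L ^ 2 \<le> 1 / exp 1"
      using q' by (simp add: diff_divide_distrib)
    then have "f * (1 - 1 / exp 1) \<le> f * (1 - q * (1 - 1 / n) - 1 / L ^ 2)"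
      using f1 by (intro mult_left_mono) auto
    then show ?thesis using s' unfolding f_def s_def by (simp add: mult.commute)
  qed
qed

text \<open>By subadditivity the largest single share is at least the average. This supplies the
  hypothesis \<open>guess\<close> of \<open>local_search_ratio\<close>.\<close>

lemma exists_heavy_event:
  assumes I: "psba_instance I" and ne: "events I \<noteq> {}"
  shows "\<exists>e\<in>events I. tr I (\<Union>e\<in>events I. window I e (sl e)) \<le> card (events I) * tr I (window I e (sl e))"
proof -
  interpret monotone_submodular "slots I" "\<lambda>X. real (tr I ({} \<union> X)) - real (tr I {})"
    by (rule tr_contraction[OF I]) simp
  have "tr I {} = 0" by (rule tr_empty[OF I])
  let ?m = "Max ((\<lambda>e. tr I (window I e (sl e))) ` events I)"
  have "?m \<in> (\<lambda>e. tr I (window I e (sl e))) ` events I" using ne by (intro Max_in) auto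
  then obtain e where e: "e \<in> events I" "tr I (window I e (sl e)) = ?m" by auto
  have "real (tr I (\<Union>e\<in>events I. window I e (sl e))) \<le> (\<Sum>e\<in>events I. real (tr I (window I e (sl e))))"
    using UN_le_sum[of "events I" "\<lambda>e. window I e (sl e)"] \<open>tr I {} = 0\<close> by (simp add: window_subset)
  also have "\<dots> = real (\<Sum>e\<in>events I. tr I (window I e (sl e)))" by (rule of_nat_sum[symmetric])
  finally have "tr I (\<Union>e\<in>events I. window I e (sl e)) \<le> (\<Sum>e\<in>events I. tr I (window I e (sl e)))"
    by (simp only: of_nat_le_iff)
  also have "\<dots> \<le> (\<Sum>e\<in>events I. ?m)" by (intro sum_mono Max_ge) simp_all
  finally have "tr I (\<Union>e\<in>events I. window I e (sl e)) \<le> card (events I) * ?m" by (simp only: sum_constant of_nat_id)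
  then show ?thesis using e by (intro bexI[of _ e]) (simp_all only:)
qed

section \<open>A loop language and its compilation\<close>

type_synonym state = "nat \<Rightarrow> nat \<Rightarrow> nat"

datatype expr =
    Num nat
  | Bound
  | Inp expr
  | Arr nat expr
  | Add expr expr
  | Sub expr expr
  | Mul expr expr
  | Quot expr expr

datatype stmt =
    Nop
  | Upd nat expr expr
  | Then stmt stmt
  | IfLess expr expr stmt stmt
  | For nat stmt

text \<open>
  Capping the second factor of a product by the scalar \<open>s 0 0\<close> makes the number of bits of the
  computed values grow only linearly with the number of executed statements.
\<close>

primrec val_of :: "(nat \<Rightarrow> nat) \<Rightarrow> expr \<Rightarrow> state \<Rightarrow> nat" where
  "val_of inp (Num n) s = n"
| "val_of inp Bound s = inp 0 + inp 1"
| "val_of inp (Inp e) s = inp (val_of inp e s)"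
| "val_of inp (Arr j e) s = s j (val_of inp e s)"
| "val_of inp (Add a b) s = val_of inp a s + val_of inp b s"
| "val_of inp (Sub a b) s = val_of inp a s - val_of inp b s"
| "val_of inp (Mul a b) s = val_of inp a s * min (val_of inp b s) (s 0 0)"
| "val_of inp (Quot a b) s = val_of inp a s div val_of inp b s"

definition put :: "nat \<Rightarrow> nat \<Rightarrow> nat \<Rightarrow> state \<Rightarrow> state" where
  "put j i v s = s(j := (s j)(i := v))"

text \<open>The value left in a loop variable is the one at which the compiled loop stops, so that
  states and memories match exactly.\<close>

primrec run :: "(nat \<Rightarrow> nat) \<Rightarrow> stmt \<Rightarrow> state \<Rightarrow> state" where
  "run inp Nop = (\<lambda>s. s)"
| "run inp (Upd j a b) = (\<lambda>s. put j (val_of inp a s) (val_of inp b s) s)"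
| "run inp (Then c d) = (\<lambda>s. run inp d (run inp c s))"
| "run inp (IfLess a b c d) =
     (\<lambda>s. if val_of inp a s < val_of inp b s then run inp c s else run inp d s)"
| "run inp (For x c) =
     (\<lambda>s. put x 0 (inp 0 + inp 1) (fold (\<lambda>i s. run inp c (put x 0 i s)) [0..<inp 0 + inp 1] s))"

primrec reads :: "expr \<Rightarrow> nat set" where
  "reads (Num n) = {}"
| "reads Bound = {}"
| "reads (Inp e) = reads e"
| "reads (Arr j e) = insert j (reads e)"
| "reads (Add a b) = reads a \<union> reads b"
| "reads (Sub a b) = reads a \<union> reads b"
| "reads (Mul a b) = insert 0 (reads a \<union> reads b)"
| "reads (Quot a b) = reads a \<union> reads b"

primrec assigned :: "stmt \<Rightarrow> nat set" where
  "assigned Nop = {}"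
| "assigned (Upd j a b) = {j}"
| "assigned (Then c d) = assigned c \<union> assigned d"
| "assigned (IfLess a b c d) = assigned c \<union> assigned d"
| "assigned (For x c) = insert x (assigned c)"

lemma put_other: "j \<noteq> x \<Longrightarrow> put x i v s j = s j"
  by (simp add: put_def)

lemma put_self: "put x i v s x = (s x)(i := v)"
  by (simp add: put_def)

lemma run_frame: "j \<notin> assigned c \<Longrightarrow> run inp c s j = s j"
proof (induction c arbitrary: s)
  case (For x c)
  have "fold (\<lambda>i s. run inp c (put x 0 i s)) is s j = s j" for "is"
    by (induction "is" arbitrary: s) (use For in \<open>simp_all add: put_other\<close>)
  then show ?case using For.prems by (simp add: put_other)
qed (simp_all add: put_other)

text \<open>Product-free code is analysed without a bound on the cap. This covers
  \<open>power_stage\<close>, which is still computing the cap.\<close>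

primrec mulfree_expr :: "expr \<Rightarrow> bool" where
  "mulfree_expr (Num n) \<longleftrightarrow> True"
| "mulfree_expr Bound \<longleftrightarrow> True"
| "mulfree_expr (Inp e) \<longleftrightarrow> mulfree_expr e"
| "mulfree_expr (Arr j e) \<longleftrightarrow> mulfree_expr e"
| "mulfree_expr (Add a b) \<longleftrightarrow> mulfree_expr a \<and> mulfree_expr b"
| "mulfree_expr (Sub a b) \<longleftrightarrow> mulfree_expr a \<and> mulfree_expr b"
| "mulfree_expr (Mul a b) \<longleftrightarrow> False"
| "mulfree_expr (Quot a b) \<longleftrightarrow> mulfree_expr a \<and> mulfree_expr b"

primrec mulfree :: "stmt \<Rightarrow> bool" where
  "mulfree Nop \<longleftrightarrow> True"
| "mulfree (Upd j a b) \<longleftrightarrow> mulfree_expr a \<and> mulfree_expr b"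
| "mulfree (Then c d) \<longleftrightarrow> mulfree c \<and> mulfree d"
| "mulfree (IfLess a b c d) \<longleftrightarrow> mulfree_expr a \<and> mulfree_expr b \<and> mulfree c \<and> mulfree d"
| "mulfree (For x c) \<longleftrightarrow> mulfree c"

text \<open>The condition \<open>x \<notin> assigned c\<close> protects the counter, since the
  compiled loop tests and increments it in memory.\<close>

primrec scoped :: "nat \<Rightarrow> stmt \<Rightarrow> bool" where
  "scoped R Nop \<longleftrightarrow> True"
| "scoped R (Upd j a b) \<longleftrightarrow> j < R \<and> reads a \<subseteq> {..<R} \<and> reads b \<subseteq> {..<R}"
| "scoped R (Then c d) \<longleftrightarrow> scoped R c \<and> scoped R d"
| "scoped R (IfLess a b c d) \<longleftrightarrow> reads a \<subseteq> {..<R} \<and> reads b \<subseteq> {..<R} \<and> scoped R c \<and> scoped R d"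
| "scoped R (For x c) \<longleftrightarrow> x < R \<and> x \<notin> assigned c \<and> scoped R c"

text \<open>
  The input occupies the cells up to \<open>inp 0\<close>, and element \<open>i\<close> of the array \<open>j\<close> is stored
  in cell \<open>inp 0 + 1 + (i * R + j)\<close>, so all \<open>R\<close> arrays are unbounded.
\<close>

definition cell :: "nat \<Rightarrow> aexp \<Rightarrow> nat \<Rightarrow> aexp" where
  "cell R a j = Plus (Plus (Load (Const 0)) (Const (j + 1))) (Times a (Const R))"

text \<open>\<open>x - (x - y)\<close> is the minimum of \<open>x\<close> and \<open>y\<close>.\<close>

primrec compile_expr :: "nat \<Rightarrow> expr \<Rightarrow> aexp" where
  "compile_expr R (Num n) = Const n"
| "compile_expr R Bound = Plus (Load (Const 0)) (Load (Const 1))"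
| "compile_expr R (Inp e) =
     Load (Minus (compile_expr R e) (Minus (compile_expr R e) (Load (Const 0))))"
| "compile_expr R (Arr j e) = Load (cell R (compile_expr R e) j)"
| "compile_expr R (Add a b) = Plus (compile_expr R a) (compile_expr R b)"
| "compile_expr R (Sub a b) = Minus (compile_expr R a) (compile_expr R b)"
| "compile_expr R (Mul a b) = Times (compile_expr R a)
     (Minus (compile_expr R b) (Minus (compile_expr R b) (Load (cell R (Const 0) 0))))"
| "compile_expr R (Quot a b) = Div (compile_expr R a) (compile_expr R b)"

primrec compile :: "nat \<Rightarrow> stmt \<Rightarrow> com" where
  "compile R Nop = Skip"
| "compile R (Upd j a b) = Store (cell R (compile_expr R a) j) (compile_expr R b)"
| "compile R (Then c d) = Seq (compile R c) (compile R d)"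
| "compile R (IfLess a b c d) =
     Cond (Less (compile_expr R a) (compile_expr R b)) (compile R c) (compile R d)"
| "compile R (For x c) = Seq (Store (cell R (Const 0) x) (Const 0))
     (While (Less (Load (cell R (Const 0) x)) (compile_expr R Bound))
       (Seq (compile R c)
         (Store (cell R (Const 0) x) (Plus (Load (cell R (Const 0) x)) (Const 1)))))"

section \<open>Bit lengths and running times of compiled code\<close>

primrec asize :: "aexp \<Rightarrow> nat" where
  "asize (Const n) = n + 1"
| "asize (Load a) = asize a + 1"
| "asize (Plus a b) = asize a + asize b + 1"
| "asize (Minus a b) = asize a + asize b + 1"
| "asize (Times a b) = asize a + asize b + 1"
| "asize (Div a b) = asize a + asize b + 1"

text \<open>With second factors below \<open>2 ^ w\<close>, every node of an expression lengthens
  values by at most \<open>w\<close> bits; this is what \<open>aval_bound\<close> adds up.\<close>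

primrec tame :: "nat \<Rightarrow> memory \<Rightarrow> aexp \<Rightarrow> bool" where
  "tame w m (Const n) \<longleftrightarrow> True"
| "tame w m (Load a) \<longleftrightarrow> tame w m a"
| "tame w m (Plus a b) \<longleftrightarrow> tame w m a \<and> tame w m b"
| "tame w m (Minus a b) \<longleftrightarrow> tame w m a \<and> tame w m b"
| "tame w m (Times a b) \<longleftrightarrow> tame w m a \<and> tame w m b \<and> aval b m < 2 ^ w"
| "tame w m (Div a b) \<longleftrightarrow> tame w m a \<and> tame w m b"

lemma less_power_mono: "x < (2::nat) ^ a \<Longrightarrow> a \<le> b \<Longrightarrow> x < 2 ^ b"
  by (meson less_le_trans one_le_numeral power_increasing)

lemma aval_bound:
  assumes "tame w m a" "\<And>x. m x < 2 ^ h" "1 \<le> w"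
  shows "aval a m < 2 ^ (h + asize a * w)"
  using assms(1)
proof (induction a)
  case (Const n)
  \<comment> \<open>\<open>asize\<close> counts a constant by its value, a crude bound for its
    bits.\<close>
  have "n < 2 ^ n" by simp
  moreover have "n \<le> n * w" using assms(3) by simp
  then have "n \<le> h + asize (Const n) * w" unfolding asize.simps add_mult_distrib by linarith
  ultimately show ?case unfolding aval.simps by (rule less_power_mono)
next
  case (Load a)
  show ?case using assms(2)[of "aval a m"] by (auto intro: less_power_mono)
next
  case (Plus a b)
  have "aval a m < 2 ^ (h + (asize a + asize b) * w)" "aval b m < 2 ^ (h + (asize a + asize b) * w)"
    using Plus by (auto elim!: less_power_mono simp: algebra_simps)
  then have "aval (Plus a b) m < 2 ^ (h + (asize a + asize b) * w + 1)" by simp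
  then show ?case by (rule less_power_mono) (use assms(3) in \<open>simp add: algebra_simps\<close>)
next
  case (Minus a b)
  then have "aval (Minus a b) m < 2 ^ (h + asize a * w)" by (simp add: less_imp_diff_less)
  then show ?case by (rule less_power_mono) (simp add: algebra_simps)
next
  case (Times a b)
  then have "aval a m < 2 ^ (h + asize a * w)" "aval b m < 2 ^ w" by simp_all
  then have "aval a m * aval b m < 2 ^ (h + asize a * w) * 2 ^ w" by (intro mult_strict_mono) auto
  then have "aval (Times a b) m < 2 ^ (h + asize a * w + w)" by (simp add: power_add)
  then show ?case by (rule less_power_mono) (simp add: algebra_simps)
next
  case (Div a b)
  then have "aval (Div a b) m < 2 ^ (h + asize a * w)" by (simp add: le_less_trans[OF div_le_dividend])
  then show ?case by (rule less_power_mono) (simp add: algebra_simps)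
qed

lemma bit_size_le: "n < 2 ^ k \<Longrightarrow> bit_size n \<le> k + 1"
  using bitlen_le_iff_power[of "int n" k] by (simp add: bit_size_def nat_le_iff)

lemma acost_bound:
  assumes "tame w m a" "\<And>x. m x < 2 ^ h" "1 \<le> w" "asize a \<le> A"
  shows "acost a m \<le> asize a * (h + A * w + 1)"
proof -
  have bits: "bit_size (aval a m) \<le> h + A * w + 1" if "tame w m a" "asize a \<le> A" for a
  proof (rule bit_size_le)
    have "aval a m < 2 ^ (h + asize a * w)" by (rule aval_bound[OF that(1) assms(2,3)])
    then show "aval a m < 2 ^ (h + A * w)" by (rule less_power_mono) (use that(2) in simp)
  qed
  show ?thesis using assms(1,4)
  proof (induction a)
    case (Const n)
    then show ?case using bits[of "Const n"] by simp
  next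
    case (Load a)
    then show ?case using bits[of "Load a"] by (simp add: algebra_simps)
  next
    case (Plus a b)
    then show ?case using bits[of "Plus a b"] by (simp add: algebra_simps)
  next
    case (Minus a b)
    then show ?case using bits[of "Minus a b"] by (simp add: algebra_simps)
  next
    case (Times a b)
    then show ?case using bits[of "Times a b"] by (simp add: algebra_simps)
  next
    case (Div a b)
    then show ?case using bits[of "Div a b"] by (simp add: algebra_simps)
  qed
qed

primrec weight :: "nat \<Rightarrow> stmt \<Rightarrow> nat" where
  "weight R Nop = 1"
| "weight R (Upd j a b) = asize (cell R (compile_expr R a) j) + asize (compile_expr R b) + 1"
| "weight R (Then c d) = weight R c + weight R d"
| "weight R (IfLess a b c d) =
     asize (compile_expr R a) + asize (compile_expr R b) + 1 + weight R c + weight R d"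
| "weight R (For x c) = 2 * asize (cell R (Const 0) x) + asize (compile_expr R Bound) + 5 + weight R c"

primrec steps :: "stmt \<Rightarrow> nat poly" where
  "steps Nop = 1"
| "steps (Upd j a b) = 1"
| "steps (Then c d) = steps c + steps d"
| "steps (IfLess a b c d) = 1 + steps c + steps d"
| "steps (For x c) = [:0, 1:] * (steps c + 2) + 2"

text \<open>Time for \<open>k\<close> statements of size at most \<open>D\<close>: bit lengths start
  at \<open>h\<close> and grow by at most \<open>D * w\<close> per statement, so each statement
  costs at most \<open>D\<close> times the final bit length plus \<open>2\<close>. The form is
  superadditive under sequencing, see \<open>duration_add\<close>.\<close>

definition duration :: "nat \<Rightarrow> nat \<Rightarrow> nat \<Rightarrow> nat \<Rightarrow> nat" where
  "duration D w k h = k * (D * (h + k * (D * w) + 2))"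

lemma duration_add: "duration D w k h + duration D w k' (h + k * (D * w)) \<le> duration D w (k + k') h"
proof -
  have "duration D w k h \<le> k * (D * (h + (k + k') * (D * w) + 2))"
    unfolding duration_def by (intro mult_le_mono le_refl add_mono) simp
  moreover have "duration D w k' (h + k * (D * w)) = k' * (D * (h + (k + k') * (D * w) + 2))"
    unfolding duration_def by (simp add: algebra_simps)
  moreover have "duration D w (k + k') h = k * (D * (h + (k + k') * (D * w) + 2)) + k' * (D * (h + (k + k') * (D * w) + 2))"
    unfolding duration_def by (rule add_mult_distrib)
  ultimately show ?thesis by linarith
qed

lemma duration_mono: "k \<le> k' \<Longrightarrow> h \<le> h' \<Longrightarrow> duration D w k h \<le> duration D w k' h'"
  unfolding duration_def by (intro mult_le_mono add_mono) simp_all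

definition holds :: "nat \<Rightarrow> nat \<Rightarrow> state \<Rightarrow> memory \<Rightarrow> bool" where
  "holds B R s m \<longleftrightarrow> m 0 = B \<and> (\<forall>j<R. \<forall>i. m (B + 1 + (i * R + j)) = s j i)"

definition safe :: "nat \<Rightarrow> stmt \<Rightarrow> state \<Rightarrow> bool" where
  "safe w c s \<longleftrightarrow> mulfree c \<or> 0 \<notin> assigned c \<and> s 0 0 < 2 ^ w"

definition safe_expr :: "nat \<Rightarrow> expr \<Rightarrow> state \<Rightarrow> bool" where
  "safe_expr w e s \<longleftrightarrow> mulfree_expr e \<or> s 0 0 < 2 ^ w"

text \<open>Division with remainder by \<open>R\<close> shows that distinct pairs
  \<open>(i, j)\<close> with \<open>j < R\<close> occupy distinct cells.\<close>

lemma holds_put: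
  assumes "holds B R s m" "j < R"
  shows "holds B R (put j i v s) (m(B + 1 + (i * R + j) := v))"
proof -
  have "i' * R + j' = i * R + j \<longleftrightarrow> i' = i \<and> j' = j" if "j' < R" for i' j'
  proof
    assume eq: "i' * R + j' = i * R + j"
    have "(i' * R + j') mod R = (i * R + j) mod R" "(i' * R + j') div R = (i * R + j) div R" using eq by simp_all
    then show "i' = i \<and> j' = j" using that assms(2) by (simp add: mod_mult_self3 div_mult_self3)
  qed simp
  then show ?thesis using assms by (auto simp: holds_def put_def)
qed

locale compilation =
  fixes inp :: "nat \<Rightarrow> nat" and R :: nat and w :: nat
  assumes inp_pos: "1 \<le> inp 0" and inp_zero: "inp 0 \<le> a \<Longrightarrow> inp a = 0"
    and R_pos: "1 \<le> R" and R_less: "R < 2 ^ w"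
begin

lemma w_pos: "1 \<le> w"
  using R_pos R_less by (cases w) auto

definition represents :: "state \<Rightarrow> memory \<Rightarrow> bool" where
  "represents s m \<longleftrightarrow> holds (inp 0) R s m \<and> (\<forall>a\<le>inp 0. m a = inp a)"

lemma aval_cell: "m 0 = B \<Longrightarrow> aval (cell R a j) m = B + 1 + (aval a m * R + j)"
  by (simp add: cell_def)

lemma scalar_cell: "represents s m \<Longrightarrow> m (Suc (inp 0)) = s 0 0"
  using R_pos unfolding represents_def holds_def by (metis Suc_eq_plus1 add_0_right less_le_trans mult_0 zero_less_one)

lemma tame_cell: "tame w m a \<Longrightarrow> tame w m (cell R a j)"
  using R_less by (simp add: cell_def)

lemma represents_put:
  assumes "represents s m" "j < R"
  shows "represents (put j i v s) (m(inp 0 + 1 + (i * R + j) := v))"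
  using assms holds_put by (auto simp: represents_def)

lemma aval_compile_expr:
  assumes "represents s m" "reads e \<subseteq> {..<R}"
  shows "aval (compile_expr R e) m = val_of inp e s"
  using assms(2)
proof (induction e)
  case Bound
  then show ?case using assms(1) inp_pos by (simp add: represents_def)
next
  case (Inp e)
  have m0: "m 0 = inp 0" and m: "\<And>a. a \<le> inp 0 \<Longrightarrow> m a = inp a" using assms(1) by (auto simp: represents_def)
  show ?case
  proof (cases "val_of inp e s \<le> inp 0")
    case True
    then show ?thesis using Inp by (simp add: m0 m)
  next
    \<comment> \<open>The compiled address is clipped to \<open>inp 0\<close>; the value of that
      cell, like everything beyond it, is \<open>0\<close>.\<close>
    case False
    then show ?thesis using Inp m[of "inp 0"] inp_zero[of "inp 0"] inp_zero[of "val_of inp e s"]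
      by (simp add: m0)
  qed
next
  case (Arr j e)
  then show ?case using assms(1) by (simp add: represents_def holds_def aval_cell)
next
  case (Mul a b)
  then show ?case using assms(1) scalar_cell[OF assms(1)] by (simp add: represents_def holds_def aval_cell min_def)
qed simp_all

lemma tame_compile_expr:
  assumes "represents s m" "reads e \<subseteq> {..<R}" "safe_expr w e s"
  shows "tame w m (compile_expr R e)"
  using assms(2,3)
proof (induction e)
  case (Arr j e)
  then show ?case by (simp add: tame_cell safe_expr_def)
next
  case (Mul a b)
  have "aval (Load (cell R (Const 0) 0)) m = s 0 0"
    using assms(1) scalar_cell[OF assms(1)] by (simp add: represents_def holds_def aval_cell)
  then have "aval (Minus (compile_expr R b) (Minus (compile_expr R b) (Load (cell R (Const 0) 0)))) m < 2 ^ w"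
    using Mul.prems by (auto simp: safe_expr_def)
  then show ?case using Mul by (simp add: tame_cell safe_expr_def)
qed (auto simp: safe_expr_def)

abbreviation bits :: "memory \<Rightarrow> nat \<Rightarrow> bool" where
  "bits m h \<equiv> \<forall>a. m a < 2 ^ h"

lemma exec_Store:
  assumes "tame w m a" "tame w m b" "bits m h" "asize a + asize b + 1 \<le> D"
  shows "\<exists>t. exec (Store a b) m t (m(aval a m := aval b m)) \<and> t \<le> duration D w 1 h
    \<and> bits (m(aval a m := aval b m)) (h + D * w)"
proof (intro exI conjI)
  show "exec (Store a b) m (acost a m + acost b m + 1) (m(aval a m := aval b m))" by (rule exec.Store)
  have "acost a m \<le> asize a * (h + D * w + 1)" "acost b m \<le> asize b * (h + D * w + 1)"
    using assms w_pos by (intro acost_bound; simp)+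
  then have "acost a m + acost b m + 1 \<le> (asize a + asize b + 1) * (h + D * w + 2)" by (simp add: algebra_simps)
  also have "\<dots> \<le> D * (h + D * w + 2)" using assms(4) by (rule mult_le_mono1)
  finally show "acost a m + acost b m + 1 \<le> duration D w 1 h" by (simp add: duration_def)
  have "aval b m < 2 ^ (h + asize b * w)" using assms w_pos by (intro aval_bound) auto
  moreover have "asize b * w \<le> D * w" using assms(4) by simp
  ultimately have "aval b m < 2 ^ (h + D * w)" by (auto intro: less_power_mono)
  moreover have "m x < 2 ^ (h + D * w)" for x using assms(3) by (auto intro: less_power_mono)
  ultimately show "bits (m(aval a m := aval b m)) (h + D * w)" by simp
qed

lemma bcost_Less:
  assumes "tame w m a" "tame w m b" "bits m h" "asize a + asize b + 1 \<le> D"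
  shows "bcost (Less a b) m \<le> duration D w 1 h"
proof -
  have "acost a m \<le> asize a * (h + D * w + 1)" "acost b m \<le> asize b * (h + D * w + 1)"
    using assms w_pos by (intro acost_bound; simp)+
  then have "acost a m + acost b m + 1 \<le> (asize a + asize b + 1) * (h + D * w + 2)" by (simp add: algebra_simps)
  also have "\<dots> \<le> D * (h + D * w + 2)" using assms(4) by (rule mult_le_mono1)
  finally show ?thesis by (simp add: duration_def)
qed

text \<open>Time, bit length and state are tracked together, because the cost of a statement depends
  on the bit lengths reached before it.\<close>

definition simulates :: "com \<Rightarrow> state \<Rightarrow> memory \<Rightarrow> state \<Rightarrow> nat \<Rightarrow> nat \<Rightarrow> nat \<Rightarrow> bool" where
  "simulates p s m s' D k h \<longleftrightarrow> (\<exists>t m'. exec p m t m' \<and> represents s' m' \<and>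
     bits m' (h + k * (D * w)) \<and> t \<le> duration D w k h)"

lemma simulates_Seq:
  assumes "simulates p s m s' D k h" "\<And>m'. represents s' m' \<Longrightarrow> bits m' (h + k * (D * w)) \<Longrightarrow>
    simulates q s' m' s'' D k' (h + k * (D * w))"
  shows "simulates (Seq p q) s m s'' D (k + k') h"
proof -
  obtain t m' where 1: "exec p m t m'" "represents s' m'" "bits m' (h + k * (D * w))" "t \<le> duration D w k h"
    using assms(1) by (auto simp: simulates_def)
  obtain t' m'' where 2: "exec q m' t' m''" "represents s'' m''" "bits m'' (h + k * (D * w) + k' * (D * w))"
      "t' \<le> duration D w k' (h + k * (D * w))"
    using assms(2)[OF 1(2,3)] by (auto simp: simulates_def)
  have "exec (Seq p q) m (t + t') m''" by (rule exec.Seq[OF 1(1) 2(1)])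
  moreover have "t + t' \<le> duration D w (k + k') h" using 1(4) 2(4) duration_add[of D w k h k'] by linarith
  moreover have "bits m'' (h + (k + k') * (D * w))" using 2(3) by (simp add: add_mult_distrib add.assoc)
  ultimately show ?thesis using 2(2) by (auto simp: simulates_def)
qed

lemma simulates_mono:
  assumes "simulates p s m s' D k h" "k \<le> k'"
  shows "simulates p s m s' D k' h"
proof -
  obtain t m' where 1: "exec p m t m'" "represents s' m'" "bits m' (h + k * (D * w))" "t \<le> duration D w k h"
    using assms(1) by (auto simp: simulates_def)
  have "h + k * (D * w) \<le> h + k' * (D * w)" using assms(2) by simp
  then have "bits m' (h + k' * (D * w))" using 1(3) less_power_mono by blast
  moreover have "t \<le> duration D w k' h" using 1(4) duration_mono[OF assms(2) le_refl] le_trans by blast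
  ultimately show ?thesis using 1 by (auto simp: simulates_def)
qed

lemma simulates_Upd:
  assumes "represents s m" "bits m h" "j < R" "reads a \<subseteq> {..<R}" "reads b \<subseteq> {..<R}"
    and "safe_expr w a s" "safe_expr w b s"
    and "asize (cell R (compile_expr R a) j) + asize (compile_expr R b) + 1 \<le> D"
  shows "simulates (Store (cell R (compile_expr R a) j) (compile_expr R b)) s m
    (put j (val_of inp a s) (val_of inp b s) s) D 1 h"
proof -
  have "tame w m (cell R (compile_expr R a) j)" "tame w m (compile_expr R b)"
    using assms by (auto intro!: tame_cell tame_compile_expr)
  from exec_Store[OF this assms(2,8)]
  obtain t where t: "exec (Store (cell R (compile_expr R a) j) (compile_expr R b)) m t
      (m(aval (cell R (compile_expr R a) j) m := aval (compile_expr R b) m))" "t \<le> duration D w 1 h"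
      "bits (m(aval (cell R (compile_expr R a) j) m := aval (compile_expr R b) m)) (h + D * w)" by blast
  have m0: "m 0 = inp 0" using assms(1) by (simp add: represents_def)
  have "aval (cell R (compile_expr R a) j) m = inp 0 + 1 + (val_of inp a s * R + j)"
    using aval_cell[where m = m, OF m0] aval_compile_expr[OF assms(1,4)] by simp
  then show ?thesis unfolding simulates_def
    using t represents_put[OF assms(1,3), of "val_of inp a s" "val_of inp b s"] aval_compile_expr[OF assms(1,5)]
    by (intro exI[of _ t] exI) auto
qed

lemma simulates_test:
  assumes "represents s m" "bits m h" "reads a \<subseteq> {..<R}" "reads b \<subseteq> {..<R}" "safe_expr w a s" "safe_expr w b s"
    and "asize (compile_expr R a) + asize (compile_expr R b) + 1 \<le> D"
  shows "bval (Less (compile_expr R a) (compile_expr R b)) m \<longleftrightarrow> val_of inp a s < val_of inp b s"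
    and "bcost (Less (compile_expr R a) (compile_expr R b)) m \<le> duration D w 1 h"
  using assms bcost_Less[OF tame_compile_expr tame_compile_expr, OF assms(1,3,5,1,4,6,2,7)]
  by (simp_all add: aval_compile_expr del: bcost.simps)

lemma duration_Suc: "duration D w 1 h + duration D w k h \<le> duration D w (Suc k) h"
  using duration_add[of D w 1 h k] duration_mono[of k k h "h + 1 * (D * w)" D w] by simp

text \<open>The number of steps is bounded by a polynomial read off from the syntax, as every loop
  runs \<open>inp 0 + inp 1\<close> times; \<open>duration\<close> turns steps into time.\<close>

theorem compile_simulates:
  assumes "scoped R c" "weight R c \<le> D" "represents s m" "safe w c s" "bits m h"
  shows "simulates (compile R c) s m (run inp c s) D (poly (steps c) (inp 0 + inp 1)) h"
  using assms
proof (induction c arbitrary: s m h)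
  case Nop
  then show ?case unfolding simulates_def
    by (intro exI[of _ 1] exI[of _ m]) (auto simp: duration_def intro: exec.Skip[unfolded One_nat_def] less_power_mono)
next
  case (Upd j a b)
  then show ?case
    using simulates_Upd[OF Upd.prems(3,5), of j a b D] by (auto simp: safe_def safe_expr_def)
next
  case (Then c d)
  have s: "safe w c s" "safe w d (run inp c s)"
    using Then.prems(4) run_frame[of 0 c inp s] by (auto simp: safe_def)
  show ?case unfolding compile.simps steps.simps poly_add run.simps
  proof (rule simulates_Seq)
    show "simulates (compile R c) s m (run inp c s) D (poly (steps c) (inp 0 + inp 1)) h"
      using Then s by simp
    fix m' assume "represents (run inp c s) m'" "bits m' (h + poly (steps c) (inp 0 + inp 1) * (D * w))"
    then show "simulates (compile R d) (run inp c s) m' (run inp d (run inp c s)) D (poly (steps d) (inp 0 + inp 1))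
      (h + poly (steps c) (inp 0 + inp 1) * (D * w))" using Then.IH(2) Then.prems s by simp
  qed
next
  case (IfLess a b c d)
  let ?k = "poly (steps c) (inp 0 + inp 1)" and ?l = "poly (steps d) (inp 0 + inp 1)"
  let ?t = "Less (compile_expr R a) (compile_expr R b)"
  have s: "safe w c s" "safe w d s" "safe_expr w a s" "safe_expr w b s"
    using IfLess.prems(4) by (auto simp: safe_def safe_expr_def)
  have test: "bval ?t m \<longleftrightarrow> val_of inp a s < val_of inp b s" "bcost ?t m \<le> duration D w 1 h"
    using simulates_test[OF IfLess.prems(3,5) _ _ s(3,4)] IfLess.prems(1,2) by auto
  have *: "simulates (Cond ?t (compile R c) (compile R d)) s m s' D (1 + ?k + ?l) h"
    if "simulates p s m s' D k h" "k \<le> ?k + ?l" "p = (if bval ?t m then compile R c else compile R d)" for p k s'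
  proof -
    have "simulates p s m s' D (?k + ?l) h" by (rule simulates_mono[OF that(1,2)])
    then obtain t m' where 1: "exec p m t m'" "represents s' m'" "bits m' (h + (?k + ?l) * (D * w))"
        "t \<le> duration D w (?k + ?l) h"
      by (auto simp: simulates_def)
    have "exec (Cond ?t (compile R c) (compile R d)) m (bcost ?t m + t) m'"
      using 1(1) that(3) exec.CondTrue exec.CondFalse by (metis (full_types))
    moreover have "bcost ?t m + t \<le> duration D w (1 + ?k + ?l) h"
      using test(2) 1(4) duration_Suc[of D h "?k + ?l"] by simp
    moreover have "bits m' (h + (1 + ?k + ?l) * (D * w))"
    proof
      fix a
      have "m' a < 2 ^ (h + (?k + ?l) * (D * w))" using 1(3) by blast
      then show "m' a < 2 ^ (h + (1 + ?k + ?l) * (D * w))" by (rule less_power_mono) simp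
    qed
    ultimately show ?thesis using 1(2) by (auto simp: simulates_def)
  qed
  show ?case
  proof (cases "bval ?t m")
    case True
    have "simulates (compile R c) s m (run inp c s) D ?k h" using IfLess s by simp
    from *[OF this] True show ?thesis using test(1) by simp
  next
    case False
    have "simulates (compile R d) s m (run inp d s) D ?l h" using IfLess s by simp
    from *[OF this] False show ?thesis using test(1) by simp
  qed
next
  case (For x c)
  define M where "M = inp 0 + inp 1"
  define k where "k = poly (steps c) M"
  define W where "W = While (Less (Load (cell R (Const 0) x)) (compile_expr R Bound))
       (Seq (compile R c) (Store (cell R (Const 0) x) (Plus (Load (cell R (Const 0) x)) (Const 1))))"
  have x: "x < R" "x \<notin> assigned c" "scoped R c" using For.prems by simp_all
  have var: "compile_expr R (Arr x (Num 0)) = Load (cell R (Const 0) x)" by simp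
  \<comment> \<open>Induction on the number \<open>n\<close> of remaining iterations, with counter
    \<open>M - n\<close>. An iteration counts the body \<open>k\<close>, one increment and one test;
    the last \<open>1\<close> is the failing test.\<close>
  have loop: "simulates W s m (put x 0 M (fold (\<lambda>i s. run inp c (put x 0 i s)) [M - n..<M] s)) D (n * (k + 2) + 1) h"
    if "n \<le> M" "represents s m" "safe w (For x c) s" "bits m h" "s x 0 = M - n" for n s m h
    using that
  proof (induction n arbitrary: s m h)
    case 0
    have t: "bval (Less (Load (cell R (Const 0) x)) (compile_expr R Bound)) m \<longleftrightarrow> s x 0 < M"
      "bcost (Less (Load (cell R (Const 0) x)) (compile_expr R Bound)) m \<le> duration D w 1 h"
      using simulates_test[OF 0(2,4), of "Arr x (Num 0)" Bound D] x For.prems(2)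
      unfolding var by (auto simp: safe_expr_def M_def simp del: bcost.simps bval.simps)
    have e: "exec W m (bcost (Less (Load (cell R (Const 0) x)) (compile_expr R Bound)) m) m"
      unfolding W_def using t(1) 0(5) by (intro exec.WhileFalse) simp
    have "put x 0 M s = s" using 0(5) by (auto simp: put_def fun_eq_iff)
    moreover have "bits m (h + 1 * (D * w))" using 0(4) by (auto intro: less_power_mono)
    ultimately show ?case using e t(2) 0(2) by (auto simp: simulates_def simp del: bcost.simps)
  next
    case (Suc n)
    let ?t = "Less (Load (cell R (Const 0) x)) (compile_expr R Bound)"
    have t: "bval ?t m \<longleftrightarrow> s x 0 < M" "bcost ?t m \<le> duration D w 1 h"
      using simulates_test[OF Suc.prems(2,4), of "Arr x (Num 0)" Bound D] x For.prems(2)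
      unfolding var by (auto simp: safe_expr_def M_def simp del: bcost.simps bval.simps)
    let ?s' = "run inp c s" and ?i = "M - Suc n"
    have s'x: "?s' x = s x" using x(2) by (rule run_frame)
    have sf: "safe w c s" using Suc.prems(3) by (auto simp: safe_def)
    have body: "simulates (compile R c) s m ?s' D k h"
      unfolding k_def M_def using For.IH[OF x(3) _ Suc.prems(2) sf Suc.prems(4)] For.prems(2) by simp
    let ?s'' = "put x 0 (M - n) ?s'"
    have both: "simulates (Seq (compile R c) (Store (cell R (Const 0) x) (Plus (Load (cell R (Const 0) x)) (Const 1)))) s m ?s'' D (k + 1) h"
    proof (rule simulates_Seq[OF body])
      fix m' assume m': "represents ?s' m'" "bits m' (h + k * (D * w))"
      have "Suc (M - Suc n) = M - n" using Suc.prems(1) by simp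
      then have "val_of inp (Add (Arr x (Num 0)) (Num 1)) ?s' = M - n" using s'x Suc.prems(5) by simp
      then show "simulates (Store (cell R (Const 0) x) (Plus (Load (cell R (Const 0) x)) (Const 1))) ?s' m' ?s'' D 1 (h + k * (D * w))"
        using simulates_Upd[OF m', of x "Num 0" "Add (Arr x (Num 0)) (Num 1)" D] x For.prems(2)
        by (simp add: safe_expr_def)
    qed
    then obtain t1 m1 where 1: "exec (Seq (compile R c) (Store (cell R (Const 0) x) (Plus (Load (cell R (Const 0) x)) (Const 1)))) m t1 m1"
        "represents ?s'' m1" "bits m1 (h + (k + 1) * (D * w))" "t1 \<le> duration D w (k + 1) h"
      by (auto simp: simulates_def)
    have "safe w (For x c) ?s''"
      using Suc.prems(3) run_frame[of 0 c inp s] by (auto simp: safe_def put_other)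
    then have "simulates W ?s'' m1 (put x 0 M (fold (\<lambda>i s. run inp c (put x 0 i s)) [M - n..<M] ?s'')) D (n * (k + 2) + 1)
        (h + (k + 1) * (D * w))"
      using Suc.IH[OF _ 1(2) _ 1(3)] Suc.prems(1) by (simp add: put_self)
    then obtain t2 m2 where 2: "exec W m1 t2 m2"
        "represents (put x 0 M (fold (\<lambda>i s. run inp c (put x 0 i s)) [M - n..<M] ?s'')) m2"
        "bits m2 (h + (k + 1) * (D * w) + (n * (k + 2) + 1) * (D * w))"
        "t2 \<le> duration D w (n * (k + 2) + 1) (h + (k + 1) * (D * w))"
      by (auto simp: simulates_def)
    have "bval ?t m" using t(1) Suc.prems(1,5) by simp
    then have e: "exec W m (bcost ?t m + t1 + t2) m2"
      unfolding W_def by (rule exec.WhileTrue) (use 1(1) 2(1) in \<open>simp_all add: W_def\<close>)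
    have st: "fold (\<lambda>i s. run inp c (put x 0 i s)) [M - Suc n..<M] s = fold (\<lambda>i s. run inp c (put x 0 i s)) [M - n..<M] ?s'"
    proof -
      have "put x 0 (M - Suc n) s = s" using Suc.prems(5) by (auto simp: put_def fun_eq_iff)
      moreover have "[M - Suc n..<M] = (M - Suc n) # [M - n..<M]"
        using Suc.prems(1) by (subst upt_conv_Cons) (auto simp: Suc_diff_Suc)
      ultimately show ?thesis by simp
    qed
    have put: "put x 0 M (fold (\<lambda>i s. run inp c (put x 0 i s)) [M - n..<M] ?s'') =
        put x 0 M (fold (\<lambda>i s. run inp c (put x 0 i s)) [M - n..<M] ?s')"
    proof (cases "n = 0")
      case True
      then show ?thesis by (simp add: put_def)
    next
      case False
      then have "[M - n..<M] = (M - n) # [Suc (M - n)..<M]" using Suc.prems(1) by (subst upt_conv_Cons) auto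
      then show ?thesis by (simp add: put_def)
    qed
    have time: "bcost ?t m + t1 + t2 \<le> duration D w (1 + (k + 1) + (n * (k + 2) + 1)) h"
    proof -
      have "bcost ?t m + (t1 + t2) \<le> duration D w 1 h + duration D w ((k + 1) + (n * (k + 2) + 1)) h"
        using t(2) 1(4) 2(4) duration_add[of D w "k + 1" h "n * (k + 2) + 1"] by linarith
      then show ?thesis using duration_Suc[of D h "(k + 1) + (n * (k + 2) + 1)"] by simp
    qed
    have eq: "1 + (k + 1) + (n * (k + 2) + 1) = Suc n * (k + 2) + 1" by simp
    have bits: "bits m2 (h + (Suc n * (k + 2) + 1) * (D * w))"
    proof
      fix a
      have "m2 a < 2 ^ (h + (k + 1) * (D * w) + (n * (k + 2) + 1) * (D * w))" using 2(3) by blast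
      then show "m2 a < 2 ^ (h + (Suc n * (k + 2) + 1) * (D * w))" by (rule less_power_mono) (simp add: algebra_simps)
    qed
    show ?case unfolding st put[symmetric] simulates_def
      by (intro exI conjI, rule e, rule 2(2), rule bits, rule time[unfolded eq])
  qed
  have init: "simulates (Store (cell R (Const 0) x) (Const 0)) s m (put x 0 0 s) D 1 h"
    using simulates_Upd[OF For.prems(3,5) x(1), of "Num 0" "Num 0" D] For.prems(2) by (simp add: safe_expr_def)
  have "simulates (Seq (Store (cell R (Const 0) x) (Const 0)) W) s m
      (put x 0 M (fold (\<lambda>i s. run inp c (put x 0 i s)) [M - M..<M] (put x 0 0 s))) D (1 + (M * (k + 2) + 1)) h"
  proof (rule simulates_Seq[OF init])
    fix m' assume m': "represents (put x 0 0 s) m'" "bits m' (h + 1 * (D * w))"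
    have "safe w (For x c) (put x 0 0 s)" using For.prems(4) by (auto simp: safe_def put_other)
    then show "simulates W (put x 0 0 s) m' (put x 0 M (fold (\<lambda>i s. run inp c (put x 0 i s)) [M - M..<M] (put x 0 0 s))) D
        (M * (k + 2) + 1) (h + 1 * (D * w))"
      using loop[OF le_refl m'(1) _ m'(2)] by (simp add: put_self)
  qed
  moreover have "put x 0 M (fold (\<lambda>i s. run inp c (put x 0 i s)) [M - M..<M] (put x 0 0 s)) = run inp (For x c) s"
    unfolding run.simps M_def[symmetric] by (cases "M = 0") (simp_all add: upt_conv_Cons put_def)
  moreover have "1 + (M * (k + 2) + 1) = poly (steps (For x c)) (inp 0 + inp 1)"
    unfolding M_def[symmetric] by (simp add: k_def algebra_simps)
  ultimately show ?case by (simp add: W_def)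
qed

end

lemma poly_mono_nat: "x \<le> y \<Longrightarrow> poly p x \<le> poly p (y :: nat)" for p :: "nat poly"
  by (induction p) (auto intro!: mult_le_mono)

section \<open>Cap of the products, output and complete programs\<close>

definition power_stage :: stmt where
  "power_stage = Then (Upd 0 (Num 0) (Num 1))
     (For 1 (For 2 (Upd 0 (Num 0) (Add (Arr 0 (Num 0)) (Arr 0 (Num 0))))))"

text \<open>With \<open>M = inp 0 + inp 1\<close>, the value is doubled \<open>M\<close> times in
  each of \<open>M\<close> rounds; it is doubled by addition because products are clipped at the
  very cell that is being computed. The result dominates \<open>M ^ k\<close> for
  \<open>k \<le> M\<close>.\<close>

lemma run_power_stage: "run inp power_stage s 0 0 = 2 ^ ((inp 0 + inp 1) * (inp 0 + inp 1))"
proof -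
  let ?u = "Upd 0 (Num 0) (Add (Arr 0 (Num 0)) (Arr 0 (Num 0)))"
  have 1: "fold (\<lambda>i s. run inp ?u (put 2 0 i s)) is s 0 0 = 2 ^ length is * s 0 0" for "is" s
    by (induction "is" arbitrary: s) (simp_all add: put_def)
  have 2: "run inp (For 2 ?u) s 0 0 = 2 ^ (inp 0 + inp 1) * s 0 0" for s
    using 1[of "[0..<inp 0 + inp 1]" s] by (simp add: put_other)
  have "fold (\<lambda>i s. run inp (For 2 ?u) (put 1 0 i s)) is s 0 0 = 2 ^ ((inp 0 + inp 1) * length is) * s 0 0" for "is" s
    by (induction "is" arbitrary: s) (simp_all add: 2 put_other power_add algebra_simps del: run.simps)
  from this[of "[0..<inp 0 + inp 1]"] show ?thesis
    unfolding power_stage_def run.simps(3) run.simps(5)[of inp 1] by (simp add: put_def)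
qed

text \<open>The output overwrites the input region, and cell \<open>0\<close> is written last since
  all array addresses are relative to it. Array \<open>1\<close> serves as counter, hence the
  conditions \<open>out \<noteq> 1\<close> and \<open>len \<noteq> 1\<close> later on.\<close>

definition emit :: "nat \<Rightarrow> nat \<Rightarrow> nat \<Rightarrow> com" where
  "emit R out len = Seq (Store (cell R (Const 0) 1) (Const 0))
     (Seq
       (While (Less (Load (cell R (Const 0) 1)) (Load (cell R (Const 0) len)))
         (Seq (Store (Plus (Load (cell R (Const 0) 1)) (Const 1)) (Load (cell R (Load (cell R (Const 0) 1)) out)))
           (Store (cell R (Const 0) 1) (Plus (Load (cell R (Const 0) 1)) (Const 1)))))
       (Store (Const 0) (Load (cell R (Const 0) len))))"

definition emit_weight :: "nat \<Rightarrow> nat \<Rightarrow> nat \<Rightarrow> nat" where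
  "emit_weight R out len = 3 * asize (cell R (Const 0) 1) + asize (cell R (Load (cell R (Const 0) 1)) out)
     + asize (cell R (Const 0) len) + 20"

context compilation
begin

lemma emit_correct:
  assumes m: "holds B R s m" "bits m h" and N: "N = s len 0" "N \<le> B"
    and names: "1 < R" "out < R" "len < R" "out \<noteq> 1" "len \<noteq> 1" and D: "emit_weight R out len \<le> D"
  shows "\<exists>t m'. exec (emit R out len) m t m' \<and> contents m' = map (s out) [0..<N]
    \<and> t \<le> (3 * N + 3) * duration D w 1 h"
proof -
  define U where "U = duration D w 1 h"
  let ?K = "cell R (Const 0) 1" and ?N = "Load (cell R (Const 0) len)"
  let ?O = "Load (cell R (Load ?K) out)"
  let ?b = "Less (Load ?K) ?N"
  let ?c = "Seq (Store (Plus (Load ?K) (Const 1)) ?O) (Store ?K (Plus (Load ?K) (Const 1)))"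
  define inv where "inv i m \<longleftrightarrow> holds B R (put 1 0 i s) m \<and> bits m h \<and> (\<forall>a<i. m (a + 1) = s out a)" for i m
  have tame: "tame w m (Load ?K)" "tame w m ?N" "tame w m ?O" "tame w m (Plus (Load ?K) (Const 1))" "tame w m ?K" for m
    by (simp_all add: tame_cell)
  have store: "\<exists>t. exec (Store a b) m t (m(aval a m := aval b m)) \<and> t \<le> U"
    if "tame w m a" "tame w m b" "bits m h" "asize a + asize b + 1 \<le> D" for a b m
    using exec_Store[OF that] unfolding U_def by blast
  have vals: "aval ?K m = B + 1 + 1" "aval (Load ?K) m = i" "aval ?N m = N" "aval ?O m = s out i"
    if "inv i m" for i m
  proof -
    have h: "m 0 = B" and h': "\<And>j i'. j < R \<Longrightarrow> m (B + 1 + (i' * R + j)) = put 1 0 i s j i'"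
      using that by (auto simp: inv_def holds_def)
    show "aval ?K m = B + 1 + 1" using h by (simp add: cell_def)
    show 2: "aval (Load ?K) m = i" using h h'[of 1 0] names by (simp add: cell_def put_self)
    show "aval ?N m = N" using h h'[of len 0] names N by (simp add: cell_def put_other)
    show "aval ?O m = s out i" using h h'[of out i] names 2 by (simp add: cell_def put_other add_ac)
  qed
  have Nh: "N < 2 ^ h" if "inv i m" for i m
    using vals(3)[OF that] that by (metis aval.simps(2) inv_def)
  have loop: "\<exists>t m'. exec (While ?b ?c) m t m' \<and> inv N m' \<and> t \<le> (3 * n + 1) * U" if "inv (N - n) m" "n \<le> N" for n m
    using that
  proof (induction n arbitrary: m)
    case 0
    then have i: "inv N m" by simp
    have "\<not> bval ?b m" using vals[OF i] by simp
    then have "exec (While ?b ?c) m (bcost ?b m) m" by (rule exec.WhileFalse)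
    moreover have "bcost ?b m \<le> U" unfolding U_def
      by (rule bcost_Less) (use i D in \<open>auto simp: tame_cell inv_def emit_weight_def\<close>)
    ultimately show ?case using i by (intro exI[of _ "bcost ?b m"] exI[of _ m]) simp
  next
    case (Suc n)
    let ?i = "N - Suc n"
    have v: "aval ?K m = B + 1 + 1" "aval (Load ?K) m = ?i" "aval ?N m = N" "aval ?O m = s out ?i"
      by (rule vals[OF Suc.prems(1)])+
    have i: "holds B R (put 1 0 ?i s) m" "bits m h" "\<forall>a<?i. m (a + 1) = s out a"
      using Suc.prems(1) by (auto simp: inv_def)
    have iN: "?i < N" "Suc ?i = N - n" using Suc.prems(2) by auto
    have b: "bval ?b m" using v iN by simp
    have bc: "bcost ?b m \<le> U" unfolding U_def
      by (rule bcost_Less) (use i D in \<open>auto simp: tame_cell emit_weight_def\<close>)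
    obtain t1 where t1: "exec (Store (Plus (Load ?K) (Const 1)) ?O) m t1 (m(?i + 1 := s out ?i))" "t1 \<le> U"
      using store[OF tame(4,3) i(2)] D v(2,4) by (auto simp: emit_weight_def)
    let ?m = "m(?i + 1 := s out ?i)"
    have sb: "s out ?i < 2 ^ h" using v(4) i(2) by (metis aval.simps(2))
    \<comment> \<open>Output cells lie at or below \<open>B\<close> and the arrays above it, so
      copying leaves the arrays intact.\<close>
    have h1: "holds B R (put 1 0 ?i s) ?m" using i(1) iN N(2) by (auto simp: holds_def)
    have "bits ?m h" using i(2) sb by simp
    moreover have "\<forall>a<?i. ?m (a + 1) = s out a" using i(3) by simp
    ultimately have i1: "inv ?i ?m" using h1 by (simp add: inv_def)
    have v1: "aval ?K ?m = B + 1 + 1" "aval (Load ?K) ?m = ?i" by (rule vals[OF i1])+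
    obtain t2 where t2: "exec (Store ?K (Plus (Load ?K) (Const 1))) ?m t2 (?m(B + 1 + 1 := N - n))" "t2 \<le> U"
    proof -
      have "aval (Plus (Load ?K) (Const 1)) ?m = N - n" using v1(2) iN(2) by (simp only: aval.simps)
      moreover have "asize ?K + asize (Plus (Load ?K) (Const 1)) + 1 \<le> D" using D by (simp add: emit_weight_def)
      ultimately show ?thesis using store[OF tame(5,4), of ?m] i1 v1(1) that unfolding inv_def by metis
    qed
    let ?n = "?m(B + 1 + 1 := N - n)"
    have "holds B R (put 1 0 (N - n) (put 1 0 ?i s)) ?n"
      using holds_put[OF h1 names(1), of 0 "N - n"] by simp
    moreover have "put 1 0 (N - n) (put 1 0 ?i s) = put 1 0 (N - n) s" by (simp add: put_def)
    moreover have "N - n < 2 ^ h" using Nh[OF i1] by simp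
    then have "bits ?n h" using i1 by (simp add: inv_def)
    moreover have "?n (a + 1) = s out a" if "a < N - n" for a
    proof -
      have "a < ?i \<or> a = ?i" using that iN(2) by linarith
      then show ?thesis using iN N(2) i(3) by auto
    qed
    ultimately have i2: "inv (N - n) ?n" by (simp add: inv_def)
    obtain t3 m' where t3: "exec (While ?b ?c) ?n t3 m'" "inv N m'" "t3 \<le> (3 * n + 1) * U"
      using Suc.IH[OF i2 Suc_leD[OF Suc.prems(2)]] by (elim exE conjE) (rule that)
    have "exec (While ?b ?c) m (bcost ?b m + (t1 + t2) + t3) m'"
      by (rule exec.WhileTrue[OF b exec.Seq[OF t1(1) t2(1)] t3(1)])
    moreover have "bcost ?b m + (t1 + t2) + t3 \<le> (3 * Suc n + 1) * U"
      using bc t1(2) t2(2) t3(3) by (simp add: algebra_simps)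
    ultimately show ?case using t3(2) by blast
  qed
  have K0: "aval ?K m = B + 1 + 1" using m(1) by (simp add: cell_def holds_def)
  obtain t1 where t1: "exec (Store ?K (Const 0)) m t1 (m(B + 1 + 1 := 0))" "t1 \<le> U"
    using store[OF tame(5) _ m(2), of "Const 0"] D K0 by (auto simp: emit_weight_def)
  have "inv (N - N) (m(B + 1 + 1 := 0))" using holds_put[OF m(1) names(1), of 0 0] m(2) by (simp add: inv_def)
  from loop[OF this le_refl] obtain t2 m' where t2: "exec (While ?b ?c) (m(B + 1 + 1 := 0)) t2 m'" "inv N m'" "t2 \<le> (3 * N + 1) * U"
    by (elim exE conjE) (rule that)
  obtain t3 where t3: "exec (Store (Const 0) ?N) m' t3 (m'(0 := N))" "t3 \<le> U"
    using store[where a = "Const 0" and m = m', OF _ tame(2)] D t2(2) vals(3)[OF t2(2)] by (auto simp: emit_weight_def inv_def)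
  have "exec (emit R out len) m (t1 + (t2 + t3)) (m'(0 := N))"
    unfolding emit_def by (rule exec.Seq[OF t1(1) exec.Seq[OF t2(1) t3(1)]])
  moreover have "contents (m'(0 := N)) = map (s out) [0..<N]"
    using t2(2) by (simp add: contents_def inv_def map_Suc_upt[symmetric] del: upt_Suc map_Suc_upt)
  moreover have "t1 + (t2 + t3) \<le> (3 * N + 3) * U" using t1(2) t2(3) t3(2) by (simp add: algebra_simps)
  ultimately show ?thesis unfolding U_def by blast
qed

end

definition input_of :: "nat list \<Rightarrow> nat \<Rightarrow> nat" where
  "input_of xs a = (if a = 0 then 8 * length xs else if a \<le> length xs then xs ! (a - 1) else 0)"

text \<open>
  Cell \<open>0\<close> is multiplied by \<open>8\<close> so that \<open>Bound\<close> exceeds the number of levels of the potential and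
  the output fits into the cells of the input. The power stage computes the cap of the products.
\<close>

definition program :: "nat \<Rightarrow> nat \<Rightarrow> nat \<Rightarrow> stmt \<Rightarrow> com" where
  "program R out len c = Seq (Store (Const 0) (Times (Load (Const 0)) (Const 8)))
     (Seq (compile R power_stage) (Seq (compile R c) (emit R out len)))"

definition final_state :: "nat list \<Rightarrow> stmt \<Rightarrow> state" where
  "final_state xs c = run (input_of xs) c (run (input_of xs) power_stage (\<lambda>_ _. 0))"

text \<open>One polynomial serves all inputs; its argument adds a bound \<open>H\<close> on the bits
  of the entries to the loop bound. In an encoded instance \<open>hd xs\<close> is the horizon, so
  its value, not its length, enters the running time.\<close>

theorem program_correct:
  assumes c: "scoped R c" "0 \<notin> assigned c"
    and names: "8 \<le> R" "out < R" "len < R" "out \<noteq> 1" "len \<noteq> 1"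
  shows "\<exists>P :: nat poly. \<forall>xs H. xs \<noteq> [] \<longrightarrow> (\<forall>x\<in>set xs. x < 2 ^ H) \<longrightarrow>
    final_state xs c len 0 \<le> 8 * length xs \<longrightarrow>
    (\<exists>t m. exec (program R out len c) (init_memory xs) t m \<and>
      contents m = map (final_state xs c out) [0..<final_state xs c len 0] \<and>
      t \<le> poly P (H + (8 * length xs + hd xs)))"
proof -
  define D where "D = weight R power_stage + weight R c + emit_weight R out len + 20"
  define pX :: "nat poly" where "pX = [:0, 1:]"
  define pw where "pw = pX * pX + [:1 + R:]"
  define pd where "pd k h = k * ([:D:] * (h + k * ([:D:] * pw) + 2))" for k h
  define h1 where "h1 = pX + steps power_stage * ([:D:] * pw)"
  define h2 where "h2 = h1 + steps c * ([:D:] * pw)"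
  define P where "P = pd 1 pX + (pd (steps power_stage) pX + (pd (steps c) h1 + (3 * pX + 3) * pd 1 h2))"
  have pd: "poly (pd k h) x = duration D (x * x + 1 + R) (poly k x) (poly h x)" for k h x
    by (simp add: pd_def duration_def pw_def pX_def algebra_simps)
  have "\<exists>t m. exec (program R out len c) (init_memory xs) t m \<and>
      contents m = map (final_state xs c out) [0..<final_state xs c len 0] \<and>
      t \<le> poly P (H + (8 * length xs + hd xs))"
    if xs: "xs \<noteq> []" "\<forall>x\<in>set xs. x < 2 ^ H" "final_state xs c len 0 \<le> 8 * length xs" for xs H
  proof -
    let ?inp = "input_of xs"
    define M where "M = ?inp 0 + ?inp 1"
    have M: "M = 8 * length xs + hd xs" using xs(1) by (cases xs) (auto simp: M_def input_of_def)
    define X where "X = H + M"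
    \<comment> \<open>\<open>2 ^ w\<close> exceeds the cap \<open>2 ^ (M * M)\<close> and the
      constants \<open>R\<close> and \<open>8\<close> that occur as factors.\<close>
    define w where "w = X * X + 1 + R"
    interpret compilation ?inp R w
    proof
      show "1 \<le> ?inp 0" using xs(1) by (cases xs) (auto simp: input_of_def)
      show "?inp a = 0" if "?inp 0 \<le> a" for a using that xs(1) by (cases xs) (auto simp: input_of_def)
      show "1 \<le> R" using names by simp
      have "R < 2 ^ R" by simp
      then show "R < 2 ^ w" by (rule less_power_mono) (simp add: w_def)
    qed
    let ?m0 = "init_memory xs"
    have b0: "bits ?m0 X"
    proof
      fix a
      have "?m0 a < 2 ^ H \<or> ?m0 a < 2 ^ M"
      proof -
        have "length xs \<le> M" "M < 2 ^ M" using M by simp_all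
        then have "length xs < 2 ^ M" by (rule le_less_trans)
        then show ?thesis using xs(2) by (auto simp: init_memory_def)
      qed
      then show "?m0 a < 2 ^ X" by (auto simp: X_def elim: less_power_mono)
    qed
    let ?m1 = "?m0(0 := 8 * length xs)"
    have "8 < (2::nat) ^ 4" by simp
    then have "8 < (2::nat) ^ w" by (rule less_power_mono) (use names in \<open>simp add: w_def\<close>)
    then have "tame w ?m0 (Times (Load (Const 0)) (Const 8))" by simp
    from exec_Store[of _ "Const 0", OF _ this b0, of D]
    obtain t1 where t1: "exec (Store (Const 0) (Times (Load (Const 0)) (Const 8))) ?m0 t1 ?m1" "t1 \<le> duration D w 1 X"
      by (auto simp: D_def init_memory_def mult.commute)
    have "8 * length xs \<le> M" "M < 2 ^ M" using M by simp_all
    then have "8 * length xs < 2 ^ M" by (rule le_less_trans)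
    then have "8 * length xs < 2 ^ X" by (rule less_power_mono) (simp add: X_def)
    then have b1: "bits ?m1 X" using b0 by simp
    let ?z = "\<lambda>_ _. 0 :: nat"
    have r1: "represents ?z ?m1"
      using xs(1) by (auto simp: represents_def holds_def init_memory_def input_of_def)
    have MX: "M \<le> X" by (simp add: X_def)
    let ?s1 = "run ?inp power_stage ?z"
    let ?k1 = "poly (steps power_stage) X" and ?k2 = "poly (steps c) X"
    have kX: "poly (steps power_stage) (?inp 0 + ?inp 1) \<le> ?k1" "poly (steps c) (?inp 0 + ?inp 1) \<le> ?k2"
      using MX unfolding M_def by (auto intro: poly_mono_nat)
    have ms: "mulfree power_stage" by (simp add: power_stage_def)
    have "scoped R power_stage" using names by (simp add: power_stage_def)
    then have "simulates (compile R power_stage) ?z ?m1 ?s1 D ?k1 X"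
      by (rule simulates_mono[OF compile_simulates])
        (use r1 b1 kX ms in \<open>auto simp: D_def safe_def\<close>)
    then obtain t2 m2 where t2: "exec (compile R power_stage) ?m1 t2 m2" "represents ?s1 m2"
        "bits m2 (X + ?k1 * (D * w))" "t2 \<le> duration D w ?k1 X"
      by (auto simp: simulates_def)
    have "M * M \<le> X * X" using MX by (intro mult_le_mono)
    then have "(2::nat) ^ (M * M) < 2 ^ w" unfolding w_def by (intro power_strict_increasing) auto
    then have "?s1 0 0 < 2 ^ w" using run_power_stage[of ?inp ?z] by (simp add: M_def)
    then have "simulates (compile R c) ?s1 m2 (run ?inp c ?s1) D ?k2 (X + ?k1 * (D * w))"
      by (intro simulates_mono[OF compile_simulates[OF c(1) _ t2(2) _ t2(3)]])
        (use c kX in \<open>auto simp: D_def safe_def\<close>)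
    then obtain t3 m3 where t3: "exec (compile R c) m2 t3 m3" "represents (final_state xs c) m3"
        "bits m3 (X + ?k1 * (D * w) + ?k2 * (D * w))" "t3 \<le> duration D w ?k2 (X + ?k1 * (D * w))"
      by (auto simp: simulates_def final_state_def)
    have "holds (8 * length xs) R (final_state xs c) m3" using t3(2) by (simp add: represents_def input_of_def)
    from emit_correct[OF this t3(3) refl xs(3), of out D] names
    obtain t4 m4 where t4: "exec (emit R out len) m3 t4 m4"
        "contents m4 = map (final_state xs c out) [0..<final_state xs c len 0]"
        "t4 \<le> (3 * final_state xs c len 0 + 3) * duration D w 1 (X + ?k1 * (D * w) + ?k2 * (D * w))"
      by (auto simp: D_def)
    have "exec (program R out len c) ?m0 (t1 + (t2 + (t3 + t4))) m4"
      unfolding program_def by (rule exec.Seq[OF t1(1) exec.Seq[OF t2(1) exec.Seq[OF t3(1) t4(1)]]])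
    moreover have "t1 + (t2 + (t3 + t4)) \<le> poly P X"
    proof -
      have "final_state xs c len 0 \<le> X" using xs(3) M MX by simp
      then have "(3 * final_state xs c len 0 + 3) * duration D w 1 (X + ?k1 * (D * w) + ?k2 * (D * w))
        \<le> (3 * X + 3) * duration D w 1 (X + ?k1 * (D * w) + ?k2 * (D * w))" by (intro mult_le_mono1) simp
      moreover have hs: "poly h1 X = X + ?k1 * (D * w)" "poly h2 X = X + ?k1 * (D * w) + ?k2 * (D * w)"
        by (simp_all add: h1_def h2_def pX_def pw_def w_def algebra_simps)
      have "poly P X = duration D w 1 X + (duration D w ?k1 X + (duration D w ?k2 (X + ?k1 * (D * w)) +
          (3 * X + 3) * duration D w 1 (X + ?k1 * (D * w) + ?k2 * (D * w))))"
        unfolding P_def poly_add poly_mult pd hs w_def[symmetric] by (simp add: pX_def)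
      ultimately show ?thesis using t1(2) t2(4) t3(4) t4(3) by linarith
    qed
    ultimately show ?thesis using t4(2) unfolding X_def M by blast
  qed
  then show ?thesis by blast
qed

lemma less_power_bit_size: "n < 2 ^ bit_size n"
proof -
  have "int n < 2 ^ nat (bitlen (int n))" using bitlen_le_iff_power[of "int n" "nat (bitlen (int n))"] bitlen_nonneg[of "int n"] by simp
  then have "n < 2 ^ nat (bitlen (int n))" by (metis of_nat_less_iff of_nat_numeral of_nat_power)
  then show ?thesis by (rule less_power_mono) (simp add: bit_size_def)
qed

theorem polynomial_time_program:
  assumes c: "scoped R c" "0 \<notin> assigned c"
    and names: "8 \<le> R" "out < R" "len < R" "out \<noteq> 1" "len \<noteq> 1"
    and len: "\<And>I. I \<in> bounded_instances q \<Longrightarrow>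
      final_state (encode_instance I) c len 0 \<le> 8 * length (encode_instance I)"
  shows "polynomial_time (program R out len c) (bounded_instances q)"
proof -
  obtain P :: "nat poly" where P: "\<forall>xs H. xs \<noteq> [] \<longrightarrow> (\<forall>x\<in>set xs. x < 2 ^ H) \<longrightarrow>
    final_state xs c len 0 \<le> 8 * length xs \<longrightarrow>
    (\<exists>t m. exec (program R out len c) (init_memory xs) t m \<and>
      contents m = map (final_state xs c out) [0..<final_state xs c len 0] \<and>
      t \<le> poly P (H + (8 * length xs + hd xs)))"
    using program_correct[OF c names] by (elim exE)
  show ?thesis unfolding polynomial_time_def
  \<comment> \<open>The factor \<open>9\<close> collects \<open>input_size I\<close> once as the
    bound on bits and eight times as the bound on the length of the code; \<open>q\<close> bounds
    the horizon.\<close>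
  proof (intro exI[of _ "pcompose P ([:0, 9:] + q)"] ballI)
    fix I assume I: "I \<in> bounded_instances q"
    let ?xs = "encode_instance I"
    have sz: "bit_size x \<le> input_size I" if "x \<in> set ?xs" for x
      unfolding input_size_def using that member_le_sum_list[of "bit_size x" "map bit_size ?xs"] by simp
    have "\<forall>x\<in>set ?xs. x < 2 ^ input_size I"
      using sz less_power_mono[OF less_power_bit_size] by blast
    moreover have "?xs \<noteq> []" "hd ?xs = horizon I" by (simp_all add: encode_instance_def)
    ultimately obtain t m where t: "exec (program R out len c) (init_memory ?xs) t m"
        "t \<le> poly P (input_size I + (8 * length ?xs + horizon I))"
      using P len[OF I] by metis
    have "length ?xs \<le> input_size I"
    proof -
      have "length xs \<le> sum_list (map bit_size xs)" for xs by (induction xs) (auto simp: bit_size_def)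
      then show ?thesis by (simp add: input_size_def)
    qed
    moreover have "horizon I \<le> poly q (input_size I)" using I by (simp add: bounded_instances_def)
    ultimately have "input_size I + (8 * length ?xs + horizon I) \<le> poly ([:0, 9:] + q) (input_size I)" by simp
    then have "t \<le> poly P (poly ([:0, 9:] + q) (input_size I))" using t(2) poly_mono_nat le_trans by blast
    then show "\<exists>n m. exec (program R out len c) (init_memory ?xs) n m \<and> n \<le> poly (pcompose P ([:0, 9:] + q)) (input_size I)"
      using t(1) by (auto simp: poly_pcompose)
  qed
qed

theorem outputs_program:
  assumes c: "scoped R c" "0 \<notin> assigned c"
    and names: "8 \<le> R" "out < R" "len < R" "out \<noteq> 1" "len \<noteq> 1"
    and len: "final_state (encode_instance I) c len 0 \<le> 8 * length (encode_instance I)"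
    and xs: "map (final_state (encode_instance I) c out) [0..<final_state (encode_instance I) c len 0] = encode_schedule xs"
  shows "outputs (program R out len c) I xs"
proof -
  obtain P :: "nat poly" where P: "\<forall>xs H. xs \<noteq> [] \<longrightarrow> (\<forall>x\<in>set xs. x < 2 ^ H) \<longrightarrow>
    final_state xs c len 0 \<le> 8 * length xs \<longrightarrow>
    (\<exists>t m. exec (program R out len c) (init_memory xs) t m \<and>
      contents m = map (final_state xs c out) [0..<final_state xs c len 0] \<and>
      t \<le> poly P (H + (8 * length xs + hd xs)))"
    using program_correct[OF c names] by (elim exE)
  let ?xs = "encode_instance I"
  have "x < 2 ^ sum_list ?xs" if "x \<in> set ?xs" for x
    using member_le_sum_list[OF that] less_exp[of "sum_list ?xs"] by linarith
  moreover have "?xs \<noteq> []" by (simp add: encode_instance_def)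
  ultimately show ?thesis using P len xs unfolding outputs_def by metis
qed

section \<open>Computing the potential\<close>

text \<open>
  Arrays are named by numbers: scalars start with \<open>v\<close> (only element \<open>0\<close> is used), vectors with
  \<open>a\<close>, and matrices with \<open>m\<close>; element \<open>(t, t')\<close> of a matrix has index \<open>t * M + t'\<close>.
\<close>

abbreviation (input) "vX \<equiv> 1 :: nat"
abbreviation (input) "vY \<equiv> 2 :: nat"
abbreviation (input) "vZ \<equiv> 3 :: nat"
abbreviation (input) "vS \<equiv> 4 :: nat"
abbreviation (input) "mF \<equiv> 5 :: nat"
abbreviation (input) "mG \<equiv> 6 :: nat"
abbreviation (input) "mH \<equiv> 7 :: nat"
abbreviation (input) "mK \<equiv> 8 :: nat"
abbreviation (input) "vE \<equiv> 9 :: nat"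
abbreviation (input) "vO \<equiv> 10 :: nat"
abbreviation (input) "vA \<equiv> 11 :: nat"
abbreviation (input) "vC \<equiv> 12 :: nat"
abbreviation (input) "vP \<equiv> 13 :: nat"
abbreviation (input) "vL \<equiv> 14 :: nat"
abbreviation (input) "vD \<equiv> 15 :: nat"
abbreviation (input) "vJ \<equiv> 16 :: nat"
abbreviation (input) "vQ \<equiv> 17 :: nat"
abbreviation (input) "aB \<equiv> 18 :: nat"
abbreviation (input) "aC \<equiv> 19 :: nat"
abbreviation (input) "vAcc \<equiv> 20 :: nat"
abbreviation (input) "vW \<equiv> 21 :: nat"
abbreviation (input) "aInc \<equiv> 22 :: nat"
abbreviation (input) "aExc \<equiv> 23 :: nat"
abbreviation (input) "aSl \<equiv> 24 :: nat"
abbreviation (input) "aOut \<equiv> 25 :: nat"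
abbreviation (input) "vLen \<equiv> 26 :: nat"

abbreviation Var :: "nat \<Rightarrow> expr" where
  "Var x \<equiv> Arr x (Num 0)"

definition At :: "nat \<Rightarrow> expr \<Rightarrow> expr \<Rightarrow> expr" where
  "At j a b = Arr j (Add (Mul a Bound) b)"

text \<open>Truncated subtraction turns the comparison into a factor \<open>0\<close> or
  \<open>1\<close>; as the second operand of \<open>Mul\<close> it is not clipped once the cap is
  positive.\<close>

definition When_le :: "expr \<Rightarrow> expr \<Rightarrow> expr \<Rightarrow> expr" where
  "When_le a b e = Mul e (Sub (Num 1) (Sub a b))"

definition When_less :: "expr \<Rightarrow> expr \<Rightarrow> expr \<Rightarrow> expr" where
  "When_less a b e = When_le (Add a (Num 1)) b e"

definition SumZ :: "expr \<Rightarrow> stmt" where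
  "SumZ e = Then (Upd vS (Num 0) (Num 0)) (For vZ (Upd vS (Num 0) (Add (Var vS) e)))"

text \<open>Both loops run to \<open>Bound\<close>; correctness is claimed for the entries
  \<open>t < t' \<le> N\<close>, see \<open>table\<close>.\<close>

definition Tab :: "nat \<Rightarrow> expr \<Rightarrow> expr \<Rightarrow> stmt" where
  "Tab j d e = For vX (For vY (Then (SumZ e)
     (Upd j (Add (Mul (Var vX) Bound) (Var vY)) (Add d (Var vS)))))"

definition Copy :: "nat \<Rightarrow> nat \<Rightarrow> stmt" where
  "Copy k j = Tab k (At j (Var vX) (Var vY)) (Num 0)"

text \<open>A guarded loop of the fixed length, which is why each use has to show that the number of
  iterations is at most \<open>M\<close>.\<close>

definition ForTo :: "nat \<Rightarrow> expr \<Rightarrow> stmt \<Rightarrow> stmt" where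
  "ForTo x e c = For x (IfLess (Var x) e c Nop)"

definition IfEq :: "expr \<Rightarrow> expr \<Rightarrow> stmt \<Rightarrow> stmt" where
  "IfEq a b c = IfLess a b Nop (IfLess b a Nop c)"

lemma assigned_macros [simp]:
  "assigned (SumZ e) = {vS, vZ}"
  "assigned (Tab j d e) = {vX, vY, vZ, vS, j}"
  "assigned (Copy j k) = {vX, vY, vZ, vS, j}"
  "assigned (ForTo x e c) = insert x (assigned c)"
  "assigned (IfEq a b c) = assigned c"
  by (auto simp: SumZ_def Tab_def Copy_def ForTo_def IfEq_def)

lemma reads_macros [simp]:
  "reads (At j a b) = {0, j} \<union> reads a \<union> reads b"
  "reads (When_le a b e) = {0} \<union> reads a \<union> reads b \<union> reads e"
  "reads (When_less a b e) = {0} \<union> reads a \<union> reads b \<union> reads e"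
  by (auto simp: At_def When_le_def When_less_def)

lemma scoped_macros [simp]:
  "scoped R (SumZ e) \<longleftrightarrow> vS < R \<and> reads e \<subseteq> {..<R}"
  "scoped R (Tab j d e) \<longleftrightarrow> vS < R \<and> j < R \<and> j \<noteq> vX \<and> j \<noteq> vY \<and> reads d \<subseteq> {..<R} \<and> reads e \<subseteq> {..<R}"
  "scoped R (Copy j k) \<longleftrightarrow> vS < R \<and> j < R \<and> j \<noteq> vX \<and> j \<noteq> vY \<and> k < R"
  "scoped R (ForTo x e c) \<longleftrightarrow> x < R \<and> x \<notin> assigned c \<and> reads e \<subseteq> {..<R} \<and> scoped R c"
  "scoped R (IfEq a b c) \<longleftrightarrow> reads a \<subseteq> {..<R} \<and> reads b \<subseteq> {..<R} \<and> scoped R c"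
  by (auto simp: SumZ_def Tab_def Copy_def ForTo_def IfEq_def)

lemma run_IfEq: "run inp (IfEq a b c) s = (if val_of inp a s = val_of inp b s then run inp c s else s)"
  by (simp add: IfEq_def)

text \<open>Frame relation that carries the untouched arrays through loop invariants.\<close>

definition eqoff :: "nat set \<Rightarrow> state \<Rightarrow> state \<Rightarrow> bool" where
  "eqoff A s s' \<longleftrightarrow> (\<forall>j. j \<notin> A \<longrightarrow> s' j = s j)"

lemma eqoff_refl [simp]: "eqoff A s s"
  by (simp add: eqoff_def)

lemma eqoffD: "eqoff A s s' \<Longrightarrow> j \<notin> A \<Longrightarrow> s' j = s j"
  by (simp add: eqoff_def)

lemma eqoff_put [simp]: "x \<in> A \<Longrightarrow> eqoff A s s' \<Longrightarrow> eqoff A s (put x i v s')"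
  by (auto simp: eqoff_def put_def)

lemma eqoff_run: "eqoff A s s' \<Longrightarrow> assigned c \<subseteq> A \<Longrightarrow> eqoff A s (run inp c s')"
  unfolding eqoff_def using run_frame by (metis subsetD)

lemma eqoff_trans: "eqoff A s s' \<Longrightarrow> eqoff B s' s'' \<Longrightarrow> A \<union> B \<subseteq> C \<Longrightarrow> eqoff C s s''"
  unfolding eqoff_def by (metis UnCI subsetD)

section \<open>Proof rules for the loop language\<close>

locale machine =
  fixes inp :: "nat \<Rightarrow> nat" and M N :: nat
  assumes M: "M = inp 0 + inp 1" and N_less: "N < M"
begin

lemma For_rule:
  assumes "P 0 s" "\<And>i s v. P i s \<Longrightarrow> P i (put x 0 v s)"
    and "\<And>i s. i < M \<Longrightarrow> P i s \<Longrightarrow> s x 0 = i \<Longrightarrow> P (Suc i) (run inp c s)"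
  shows "P M (run inp (For x c) s)"
proof -
  have "P k (fold (\<lambda>i s. run inp c (put x 0 i s)) [0..<k] s)" if "k \<le> M" for k
    using that
  proof (induction k)
    case (Suc k)
    then show ?case using assms(2,3) by (simp add: put_self)
  qed (simp add: assms(1))
  from this[of M] show ?thesis using assms(2) by (simp add: M)
qed

lemma ForTo_rule:
  assumes "P 0 s" "K \<le> M" "\<And>i s v. P i s \<Longrightarrow> P i (put x 0 v s)"
    and "\<And>i s. i \<le> K \<Longrightarrow> P i s \<Longrightarrow> val_of inp e s = K"
    and "\<And>i s. i < K \<Longrightarrow> P i s \<Longrightarrow> s x 0 = i \<Longrightarrow> P (Suc i) (run inp c s)"
  shows "P K (run inp (ForTo x e c) s)"
proof -
  have "P (min M K) (run inp (For x (IfLess (Var x) e c Nop)) s)"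
  proof (rule For_rule[of "\<lambda>i. P (min i K)"])
    fix i s assume i: "i < M" "P (min i K) s" "s x 0 = i"
    have "val_of inp e s = K" using assms(4)[OF _ i(2)] by simp
    then show "P (min (Suc i) K) (run inp (IfLess (Var x) e c Nop) s)"
      using i assms(5) by (cases "i < K") (auto simp: min_def le_Suc_eq split: if_splits)
  qed (use assms in auto)
  then show ?thesis using assms(2) by (simp add: ForTo_def min_absorb2)
qed

text \<open>The cap left by \<open>power_stage\<close>; under it products with second factor up to
  \<open>2 ^ (M * M)\<close> are exact.\<close>

definition ready :: "state \<Rightarrow> bool" where
  "ready s \<longleftrightarrow> s 0 0 = 2 ^ (M * M)"

lemma ready_eqoff: "eqoff A s s' \<Longrightarrow> 0 \<notin> A \<Longrightarrow> ready s \<Longrightarrow> ready s'"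
  by (simp add: ready_def eqoff_def)

lemma M_le_power: "M \<le> 2 ^ (M * M)"
proof -
  have "M \<le> M * M" by (cases M) auto
  also have "\<dots> < 2 ^ (M * M)" by simp
  finally show ?thesis by simp
qed

lemma val_At: "ready s \<Longrightarrow> val_of inp (At j a b) s = s j (val_of inp a s * M + val_of inp b s)"
  using M_le_power unfolding At_def ready_def val_of.simps M[symmetric] by (simp add: min_absorb1)

lemma val_When_le: "ready s \<Longrightarrow> val_of inp (When_le a b e) s = (if val_of inp a s \<le> val_of inp b s then val_of inp e s else 0)"
  by (auto simp: When_le_def ready_def min_def)

lemma val_When_less: "ready s \<Longrightarrow> val_of inp (When_less a b e) s = (if val_of inp a s < val_of inp b s then val_of inp e s else 0)"
  by (auto simp: When_less_def val_When_le)

lemma val_Mul: "ready s \<Longrightarrow> val_of inp b s \<le> 2 ^ (M * M) \<Longrightarrow> val_of inp (Mul a b) s = val_of inp a s * val_of inp b s"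
  by (simp add: ready_def min_absorb1)

lemma run_SumZ:
  assumes "\<And>s' z. z < M \<Longrightarrow> eqoff {vS, vZ} s s' \<Longrightarrow> s' vZ 0 = z \<Longrightarrow> val_of inp e s' = g z"
  shows "run inp (SumZ e) s vS 0 = (\<Sum>z<M. g z)"
proof -
  let ?P = "\<lambda>i s'. eqoff {vS, vZ} s s' \<and> s' vS 0 = (\<Sum>z<i. g z)"
  have "?P M (run inp (For vZ (Upd vS (Num 0) (Add (Var vS) e))) (put vS 0 0 s))"
    by (rule For_rule[of ?P]) (use assms in \<open>auto simp: put_self put_other\<close>)
  then show ?thesis by (simp add: SumZ_def)
qed

definition table :: "state \<Rightarrow> nat \<Rightarrow> (nat \<Rightarrow> nat \<Rightarrow> nat) \<Rightarrow> bool" where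
  "table s j F \<longleftrightarrow> (\<forall>t t'. t < t' \<longrightarrow> t' \<le> N \<longrightarrow> s j (t * M + t') = F t t')"

lemma table_put: "x \<noteq> j \<Longrightarrow> table (put x i v s) j F \<longleftrightarrow> table s j F"
  by (simp add: table_def put_other)

lemma table_eqoff: "eqoff A s s' \<Longrightarrow> j \<notin> A \<Longrightarrow> table s' j F \<longleftrightarrow> table s j F"
  by (simp add: table_def eqoff_def)

lemma tableD: "table s j F \<Longrightarrow> t < t' \<Longrightarrow> t' \<le> N \<Longrightarrow> s j (t * M + t') = F t t'"
  by (simp add: table_def)

lemma run_Tab:
  assumes j: "j \<notin> {0, vX, vY, vZ, vS}" and s: "ready s"
    and g: "\<And>s' t t'. t < t' \<Longrightarrow> t' \<le> N \<Longrightarrow> eqoff {vX, vY, vZ, vS, j} s s' \<Longrightarrow> s' vX 0 = t \<Longrightarrow> s' vY 0 = t' \<Longrightarrow>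
        val_of inp d s' + (\<Sum>z<M. g t t' z) = G t t'"
    and e: "\<And>s' t t' z. t < t' \<Longrightarrow> t' \<le> N \<Longrightarrow> z < M \<Longrightarrow> eqoff {vX, vY, vZ, vS, j} s s' \<Longrightarrow>
        s' vX 0 = t \<Longrightarrow> s' vY 0 = t' \<Longrightarrow> s' vZ 0 = z \<Longrightarrow> val_of inp e s' = g t t' z"
  shows "table (run inp (Tab j d e) s) j G"
proof -
  let ?A = "{vX, vY, vZ, vS, j}"
  let ?c = "Then (SumZ e) (Upd j (Add (Mul (Var vX) Bound) (Var vY)) (Add d (Var vS)))"
  let ?Q = "\<lambda>x y s'. eqoff ?A s s' \<and> (\<forall>t t'. t < t' \<longrightarrow> t' \<le> N \<longrightarrow> t < x \<or> t = x \<and> t' < y \<longrightarrow> s' j (t * M + t') = G t t')"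
  have "?Q M 0 (run inp (For vX (For vY ?c)) s)"
  proof (rule For_rule[of "\<lambda>x. ?Q x 0"])
    fix x s1 assume s1: "x < M" "?Q x 0 s1" "s1 vX 0 = x"
    have "?Q x M (run inp (For vY ?c) s1) \<and> run inp (For vY ?c) s1 vX 0 = x"
    proof (rule For_rule[of "\<lambda>y s'. ?Q x y s' \<and> s' vX 0 = x"])
      fix y s2 assume s2: "y < M" "?Q x y s2 \<and> s2 vX 0 = x" "s2 vY 0 = y"
      let ?s = "run inp (SumZ e) s2"
      have frame: "?s k = s2 k" if "k \<noteq> vS" "k \<noteq> vZ" for k using that by (intro run_frame) simp
      have eq: "eqoff ?A s ?s" using s2(2) by (intro eqoff_run) auto
      have rd: "ready ?s" by (rule ready_eqoff[OF eq _ s]) (use j in auto)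
      have idx: "val_of inp (Add (Mul (Var vX) Bound) (Var vY)) ?s = x * M + y"
        using frame s2 rd M_le_power unfolding ready_def val_of.simps M[symmetric] by (simp add: min_absorb1)
      have val: "val_of inp d ?s + ?s vS 0 = G x y" if xy: "x < y" "y \<le> N"
      proof -
        have "?s vS 0 = (\<Sum>z<M. g x y z)"
        proof (rule run_SumZ)
          fix s' z assume s': "z < M" "eqoff {vS, vZ} s2 s'" "s' vZ 0 = z"
          have "eqoff ?A s s'" using s2(2) s'(2) by (auto intro: eqoff_trans)
          moreover have "s' vX = s2 vX" "s' vY = s2 vY" using s'(2) by (auto intro: eqoffD)
          ultimately show "val_of inp e s' = g x y z" using e[OF xy s'(1)] s2 s'(3) by simp
        qed
        then show ?thesis using g[OF xy eq] frame s2 by simp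
      qed
      have inj: "t * M + t' = x * M + y \<longleftrightarrow> t = x \<and> t' = y" if "t' \<le> N" for t t'
      proof
        assume eq: "t * M + t' = x * M + y"
        have "(t * M + t') mod M = (x * M + y) mod M" "(t * M + t') div M = (x * M + y) div M" using eq by simp_all
        then show "t = x \<and> t' = y" using that N_less s2(1) by (simp add: mod_mult_self3 div_mult_self3)
      qed simp
      have st: "run inp ?c s2 = put j (x * M + y) (val_of inp d ?s + ?s vS 0) ?s" using idx by simp
      have "run inp ?c s2 j (t * M + t') = G t t'" if "t < t'" "t' \<le> N" "t < x \<or> t = x \<and> t' < Suc y" for t t'
      proof (cases "t = x \<and> t' = y")
        case True
        then show ?thesis using val that(1,2) unfolding st by (simp add: put_self)
      next
        case False
        have "?s j = s2 j" using j by (intro frame) auto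
        then show ?thesis unfolding st put_self using inj[OF that(2)] False s2(2) that by (auto simp: less_Suc_eq)
      qed
      moreover have "eqoff ?A s (run inp ?c s2)" unfolding st by (rule eqoff_put[OF _ eq]) simp
      moreover have "run inp ?c s2 vX 0 = x" unfolding st using j frame s2 by (simp add: put_other)
      ultimately show "?Q x (Suc y) (run inp ?c s2) \<and> run inp ?c s2 vX 0 = x" by blast
    next
      fix i s v assume "?Q x i s \<and> s vX 0 = x"
      then show "?Q x i (put vY 0 v s) \<and> put vY 0 v s vX 0 = x" using j by (simp add: put_other)
    qed (use s1 in auto)
    then show "?Q (Suc x) 0 (run inp (For vY ?c) s1)" using N_less by (auto simp: less_Suc_eq)
  next
    fix i s v assume "?Q i 0 s"
    then show "?Q i 0 (put vX 0 v s)" using j by (simp add: put_other)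
  qed simp
  then show ?thesis using N_less by (auto simp: table_def Tab_def)
qed

lemma run_Copy:
  assumes "j \<notin> {0, vX, vY, vZ, vS}" "k \<notin> {vX, vY, vZ, vS, j}" "ready s" "table s k F"
  shows "table (run inp (Copy j k) s) j F"
  unfolding Copy_def
proof (rule run_Tab[where g = "\<lambda>_ _ _. 0"])
  fix s' t t' assume s': "t < t'" "t' \<le> N" "eqoff {vX, vY, vZ, vS, j} s s'" "s' vX 0 = t" "s' vY 0 = t'"
  have "ready s'" by (rule ready_eqoff[OF s'(3) _ assms(3)]) (use assms(1) in auto)
  moreover have "s' k = s k" by (rule eqoffD[OF s'(3)]) (use assms(2) in auto)
  ultimately show "val_of inp (At k (Var vX) (Var vY)) s' + (\<Sum>z<M. 0) = F t t'"
    using assms(4) s' by (simp add: val_At tableD)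
qed (use assms in auto)

end

declare val_of.simps(7) [simp del]

section \<open>Programs for the kernel operations\<close>

abbreviation (input) "eX \<equiv> Var vX"
abbreviation (input) "eY \<equiv> Var vY"
abbreviation (input) "eZ \<equiv> Var vZ"
abbreviation (input) "eA \<equiv> Var vA"

text \<open>The subtraction cancels the entry exactly when \<open>t < x\<close> and
  \<open>t' = x\<close>, the equality being expressed by two comparisons; the product is the merged
  passage through \<open>x\<close>.\<close>

definition skip_at :: "expr \<Rightarrow> expr" where
  "skip_at x = Add (Sub (At mH eX eY) (When_less eX x (When_le eY x (When_le x eY (At mH eX eY)))))
     (When_less eX x (When_less x eY (Mul (At mH eX x) (At mH x eY))))"

text \<open>New entries depend on several old ones, so they are collected in \<open>mG\<close> and
  copied back.\<close>

definition skip_stmt :: stmt where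
  "skip_stmt = Then (Tab mG (skip_at (Add eA (Var vO))) (Num 0)) (Copy mH mG)"

text \<open>The double subtraction is the minimum of \<open>b\<close> and
  \<open>horizon + 1\<close>: the window is cut at the end marker as in
  \<open>event_kernel\<close>.\<close>

definition window_size :: expr where
  "window_size = (let b = Add eA (Inp (Add (Num 3) (Var vE))) in
     Sub (Sub b (Sub b (Add (Inp (Num 1)) (Num 1)))) eA)"

definition insert_stmt :: stmt where
  "insert_stmt = Then (Tab mG (Add (When_less eX eA (When_le eA eY
       (Add (Mul (At mF eX eY) (Arr aExc (Var vE))) (Mul (At mH eX eY) (Arr aInc (Var vE))))))
     (Add (When_le eA eX (At mF eX eY)) (When_less eY eA (At mF eX eY)))) (Num 0)) (Copy mF mG)"

definition event_stmt :: stmt where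
  "event_stmt = Then (Upd vA (Num 0) (Arr aSl (Var vE))) (Then (Copy mH mF)
     (Then (ForTo vO window_size skip_stmt) insert_stmt))"

definition events_stmt :: stmt where
  "events_stmt = Then (Tab mF (When_le (Add eX (Num 1)) eY (When_le eY (Add eX (Num 1)) (Num 1))) (Num 0))
     (ForTo vE (Inp (Num 2)) event_stmt)"

definition serve_stmt :: stmt where
  "serve_stmt = Then (Tab mG (Add (When_less eX eA (When_le eA eY (When_less (Var vD) eY (At mK eX eY))))
       (Add (When_le eA eX (At mK eX eY)) (When_less eY eA (At mK eX eY))))
     (When_less eX eA (When_le eA eY (When_le eA eZ (When_le eZ (Var vD)
       (When_less eZ eY (Mul (At mK eX eZ) (At mK eZ eY)))))))) (Copy mK mG)"

definition job_field :: "nat \<Rightarrow> expr" where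
  "job_field k = Inp (Add (Var vP) (Add (Add (Var vJ) (Add (Var vJ) (Var vJ))) (Num k)))"

definition job_stmt :: stmt where
  "job_stmt = IfEq (job_field 2) (Var vD) (Then (Upd vA (Num 0) (job_field 1)) (ForTo vQ (job_field 3) serve_stmt))"

text \<open>Instead of sorting, all deadlines below \<open>Bound\<close> are tried in increasing
  order and the jobs due at each are served, which is the order of \<open>units\<close>.\<close>

definition jobs_stmt :: stmt where
  "jobs_stmt = Then (Upd vL (Num 0) (Inp (Var vP))) (Then (Copy mK mF) (For vD (ForTo vJ (Var vL) job_stmt)))"

text \<open>Backward dynamic programming over the slots: \<open>aB\<close> holds total weights and
  \<open>aC\<close> sums of cardinalities, following \<open>total_weight_step\<close> and
  \<open>kernel_sum_card_step\<close>.\<close>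

definition count_step :: stmt where
  "count_step = Then (Upd vA (Num 0) (Sub (Inp (Num 1)) (Var vO)))
     (Then (SumZ (When_less eA eZ (When_le eZ (Add (Inp (Num 1)) (Num 1)) (Mul (Arr aB eZ) (At mK eA eZ)))))
     (Then (Upd aB eA (Var vS))
     (Then (SumZ (When_less eA eZ (When_le eZ (Add (Inp (Num 1)) (Num 1)) (Mul (Add (Arr aC eZ) (Arr aB eZ)) (At mK eA eZ)))))
       (Upd aC eA (Var vS)))))"

definition count_stmt :: stmt where
  "count_stmt = Then (Upd aB (Add (Inp (Num 1)) (Num 1)) (Num 1)) (Then (Upd aC (Add (Inp (Num 1)) (Num 1)) (Num 0))
     (ForTo vO (Add (Inp (Num 1)) (Num 1)) count_step))"

definition agent_stmt :: stmt where
  "agent_stmt = Then jobs_stmt (Then count_stmt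
     (Then (Upd vAcc (Num 0) (Add (Var vAcc) (Mul (Arr aC (Num 0)) (Var vW))))
       (Upd vP (Num 0) (Add (Var vP) (Add (Num 1) (Add (Var vL) (Add (Var vL) (Var vL))))))))"

text \<open>Of the input, cells \<open>1\<close> and \<open>2\<close> hold the horizon and the
  number \<open>n\<close> of events; then come the lengths, the number of agents in cell
  \<open>n + 3\<close>, and the job lists from cell \<open>n + 4\<close> on.\<close>

definition eval_stmt :: stmt where
  "eval_stmt = Then events_stmt (Then (Upd vP (Num 0) (Add (Inp (Num 2)) (Num 4)))
     (ForTo vC (Inp (Add (Inp (Num 2)) (Num 3))) agent_stmt))"

lemma assigned_skip_stmt [simp]: "assigned skip_stmt = {vX, vY, vZ, vS, mG, mH}"
  by (auto simp: skip_stmt_def)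

lemma assigned_insert_stmt [simp]: "assigned insert_stmt = {vX, vY, vZ, vS, mG, mF}"
  by (auto simp: insert_stmt_def)

lemma assigned_event_stmt [simp]: "assigned event_stmt = {vX, vY, vZ, vS, mF, mG, mH, vO, vA}"
  by (auto simp: event_stmt_def)

lemma assigned_events_stmt [simp]: "assigned events_stmt = {vX, vY, vZ, vS, mF, mG, mH, vE, vO, vA}"
  by (auto simp: events_stmt_def)

lemma assigned_serve_stmt [simp]: "assigned serve_stmt = {vX, vY, vZ, vS, mG, mK}"
  by (auto simp: serve_stmt_def)

lemma assigned_job_stmt [simp]: "assigned job_stmt = {vX, vY, vZ, vS, mG, mK, vA, vQ}"
  by (auto simp: job_stmt_def)

lemma assigned_jobs_stmt [simp]: "assigned jobs_stmt = {vX, vY, vZ, vS, mG, mK, vA, vL, vD, vJ, vQ}"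
  by (auto simp: jobs_stmt_def)

lemma assigned_count_step [simp]: "assigned count_step = {vZ, vS, vA, aB, aC}"
  by (auto simp: count_step_def)

lemma assigned_count_stmt [simp]: "assigned count_stmt = {vZ, vS, vO, vA, aB, aC}"
  by (auto simp: count_stmt_def)

lemma assigned_agent_stmt [simp]:
  "assigned agent_stmt = {vX, vY, vZ, vS, mG, mK, vO, vA, vP, vL, vD, vJ, vQ, aB, aC, vAcc}"
  by (auto simp: agent_stmt_def)

lemma assigned_eval_stmt [simp]: "assigned eval_stmt =
    {vX, vY, vZ, vS, mF, mG, mH, mK, vE, vO, vA, vC, vP, vL, vD, vJ, vQ, aB, aC, vAcc}"
  by (auto simp: eval_stmt_def)

lemma nth_concat_map:
  assumes "k < length xs" "q < length (f (xs ! k))"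
  shows "concat (map f xs) ! ((\<Sum>i<k. length (f (xs ! i))) + q) = f (xs ! k) ! q"
  using assms
proof (induction xs arbitrary: k)
  case (Cons x xs)
  show ?case
  proof (cases k)
    case 0
    then show ?thesis using Cons.prems by (simp add: nth_append)
  next
    case (Suc k')
    have "(\<Sum>i<k. length (f ((x # xs) ! i))) = length (f x) + (\<Sum>i<k'. length (f (xs ! i)))"
      unfolding Suc by (simp only: sum.lessThan_Suc_shift) simp
    then show ?thesis using Cons Suc by (simp add: nth_append)
  qed
qed simp

lemma length_concat_map: "length (concat (map f xs)) = (\<Sum>i<length xs. length (f (xs ! i)))"
proof (induction xs)
  case (Cons x xs)
  have "(\<Sum>i<length (x # xs). length (f ((x # xs) ! i))) = length (f x) + (\<Sum>i<length xs. length (f (xs ! i)))"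
    by (simp only: length_Cons sum.lessThan_Suc_shift) simp
  then show ?case using Cons by simp
qed simp

lemma length_encode_jobs: "length (encode_jobs J) = Suc (3 * length J)"
  unfolding encode_jobs_def by (induction J) auto

lemma nth_encode_jobs:
  assumes "j < length J" "k < 3"
  shows "encode_jobs J ! (3 * j + Suc k) = [release (J ! j), deadline (J ! j), ptime (J ! j)] ! k"
proof -
  have index: "3 * j + Suc k = Suc (j + (j + j) + k)" by simp
  have "(\<Sum>i<j. length [release (J ! i), deadline (J ! i), ptime (J ! i)]) = 3 * j" by simp
  then show ?thesis
    using nth_concat_map[of j J k "\<lambda>j. [release j, deadline j, ptime j]"] assms
    unfolding encode_jobs_def index by simp
qed

section \<open>Correctness of the evaluation\<close>

locale psba_run =
  fixes I :: psba
  assumes inst: "psba_instance I"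
begin

abbreviation "code \<equiv> encode_instance I"
abbreviation "inp \<equiv> input_of code"
abbreviation "M \<equiv> 8 * length code + horizon I"
abbreviation "N \<equiv> Suc (horizon I)"
abbreviation "n \<equiv> length (ev_lengths I)"

definition pointer :: "nat \<Rightarrow> nat" where
  "pointer k = n + 4 + (\<Sum>i<k. length (encode_jobs (agents I ! i)))"

lemma length_code: "length code = 3 + n + (\<Sum>i<length (agents I). length (encode_jobs (agents I ! i)))"
  by (simp add: encode_instance_def length_concat_map)

lemma code_bounds: "4 * n \<le> M" "N < M" "length (agents I) \<le> M" "24 \<le> M" "2 * n \<le> 8 * length code"
proof -
  have "(\<Sum>i<length (agents I). 1) \<le> (\<Sum>i<length (agents I). length (encode_jobs (agents I ! i)))"
    by (intro sum_mono) (simp add: length_encode_jobs)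
  then show "4 * n \<le> M" "N < M" "length (agents I) \<le> M" "24 \<le> M" "2 * n \<le> 8 * length code"
    unfolding length_code by auto
qed

lemma inp_simps [simp]:
  "inp 0 = 8 * length code" "inp (Suc 0) = horizon I" "inp 2 = n" "inp (n + 3) = length (agents I)"
  by (auto simp: input_of_def encode_instance_def nth_append numeral_eq_Suc)

lemma inp_event: "e < n \<Longrightarrow> inp (3 + e) = ev_lengths I ! e"
  by (auto simp: input_of_def encode_instance_def nth_append numeral_eq_Suc)

lemma inp_agent:
  assumes "k < length (agents I)" "q \<le> 3 * length (agents I ! k)"
  shows "inp (pointer k + q) = encode_jobs (agents I ! k) ! q"
proof -
  let ?s = "(\<Sum>i<k. length (encode_jobs (agents I ! i)))"
  have q: "q < length (encode_jobs (agents I ! k))" using assms(2) by (simp add: length_encode_jobs)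
  have "(\<Sum>i<Suc k. length (encode_jobs (agents I ! i))) \<le> (\<Sum>i<length (agents I). length (encode_jobs (agents I ! i)))"
    using assms(1) by (intro sum_mono2) auto
  then have "pointer k + q \<le> length code" using q by (simp add: pointer_def length_code)
  moreover have "code ! (pointer k + q - 1) = concat (map encode_jobs (agents I)) ! (?s + q)"
    by (simp add: encode_instance_def pointer_def nth_append numeral_eq_Suc)
  ultimately show ?thesis using nth_concat_map[where f = encode_jobs, OF assms(1) q] by (simp add: input_of_def pointer_def)
qed

lemma pointer_Suc: "pointer (Suc k) = pointer k + Suc (3 * length (agents I ! k))"
  by (simp add: pointer_def length_encode_jobs)

sublocale machine inp M N
  by unfold_locales (use code_bounds in simp_all)

lemma M_power_le: "k \<le> M \<Longrightarrow> M ^ k \<le> 2 ^ (M * M)"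
proof -
  assume "k \<le> M"
  have "M ^ k \<le> (2 ^ M) ^ k" by (rule power_mono) simp_all
  also have "\<dots> = 2 ^ (M * k)" by (rule power_mult[symmetric])
  also have "\<dots> \<le> 2 ^ (M * M)" using \<open>k \<le> M\<close> by (intro power_increasing mult_le_mono) simp_all
  finally show ?thesis .
qed

text \<open>Invariant behind unclipped products: the lower bound \<open>1\<close> is what lets
  \<open>kernel_le_total\<close> bound each entry by a total weight.\<close>

definition moderate :: "(nat \<Rightarrow> nat \<Rightarrow> nat) \<Rightarrow> bool" where
  "moderate F \<longleftrightarrow> (\<forall>t\<le>N. 1 \<le> total_weight N F t \<and> total_weight N F t \<le> 2 ^ (M * M))"

lemma moderate_le: "moderate F \<Longrightarrow> t < t' \<Longrightarrow> t' \<le> N \<Longrightarrow> F t t' \<le> 2 ^ (M * M)"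
  using kernel_le_total[of N F t' t] by (auto simp: moderate_def intro: le_trans)

lemma run_skip_stmt:
  assumes s: "ready s" "table s mH F" "moderate F" and x: "x = s vA 0 + s vO 0" "x < N"
  shows "table (run inp skip_stmt s) mH (skip x F)"
proof -
  have t: "table (run inp (Tab mG (skip_at (Add eA (Var vO))) (Num 0)) s) mG (skip x F)"
  proof (rule run_Tab[where g = "\<lambda>_ _ _. 0"])
    fix s' t t' assume t: "t < t'" "t' \<le> N" and eq: "eqoff {vX, vY, vZ, vS, mG} s s'" and regs: "s' vX 0 = t" "s' vY 0 = t'"
    have rd: "ready s'" by (rule ready_eqoff[OF eq _ s(1)]) simp
    have "s' mH = s mH" "s' vA = s vA" "s' vO = s vO" using eq by (simp_all add: eqoff_def)
    then have x': "val_of inp (Add eA (Var vO)) s' = x" and "table s' mH F"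
      using s(2) x by (simp_all add: table_def)
    then have F: "s' mH (u * M + u') = F u u'" if "u < u'" "u' \<le> N" for u u' using that by (auto dest: tableD)
    have m: "F u u' \<le> 2 ^ (M * M)" if "u < u'" "u' \<le> N" for u u' using moderate_le[OF s(3) that] .
    show "val_of inp (skip_at (Add eA (Var vO))) s' + (\<Sum>z<M. 0) = skip x F t t'"
      using t x(2) rd regs F m unfolding skip_at_def val_of.simps(5,6)
      by (cases "t < x"; cases t' x rule: linorder_cases)
        (simp_all add: skip_def val_When_le val_When_less val_Mul val_At x' del: val_of.simps(5))
  qed (use s in auto)
  let ?s = "run inp (Tab mG (skip_at (Add eA (Var vO))) (Num 0)) s"
  have "ready ?s" using s(1) run_frame[of 0 "Tab mG (skip_at (Add eA (Var vO))) (Num 0)" inp s] by (simp add: ready_def)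
  then show ?thesis unfolding skip_stmt_def run.simps using t by (intro run_Copy) auto
qed

lemma moderate_skip_window: "moderate F \<Longrightarrow> b \<le> N \<Longrightarrow> moderate (skip_window a b F)"
  by (simp add: moderate_def total_weight_skip_window)

lemma run_window:
  assumes s: "ready s" "table s mH F" "moderate F" and a: "s vA 0 = a" "s vE 0 = e" "e < n"
  shows "table (run inp (ForTo vO window_size skip_stmt) s) mH (skip_window a (min (a + ev_lengths I ! e) N) F)"
proof -
  define b where "b = min (a + ev_lengths I ! e) N"
  let ?A = "insert vO (assigned skip_stmt)"
  let ?P = "\<lambda>i s'. eqoff ?A s s' \<and> table s' mH (skip_window a (a + i) F)"
  have "?P (b - a) (run inp (ForTo vO window_size skip_stmt) s)"
  proof (rule ForTo_rule[of ?P])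
    show "b - a \<le> M" using code_bounds(2) by (simp add: b_def)
    show "?P i (put vO 0 v s')" if "?P i s'" for i s' v using that by (simp add: table_put)
    fix i s' assume P: "?P i s'"
    have rd: "ready s'" using P s(1) by (auto intro: ready_eqoff)
    have regs: "s' vA 0 = a" "s' vE 0 = e" using P a by (simp_all add: eqoff_def)
    show "val_of inp window_size s' = b - a"
      using regs inp_event[OF a(3)] by (simp add: window_size_def b_def Let_def min_def)
    assume i: "i < b - a" "s' vO 0 = i"
    have "table (run inp skip_stmt s') mH (skip (a + i) (skip_window a (a + i) F))"
      using P rd regs i s(3) by (intro run_skip_stmt moderate_skip_window) (auto simp: b_def)
    moreover have "eqoff ?A s (run inp skip_stmt s')" using P by (intro eqoff_run) auto
    ultimately show "?P (Suc i) (run inp skip_stmt s')" by (simp add: skip_window_Suc)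
  qed (use s in \<open>simp_all add: skip_window_empty\<close>)
  moreover have "skip_window a (a + (b - a)) F = skip_window a b F"
    by (cases "a \<le> b") (simp_all add: skip_window_empty)
  ultimately show ?thesis by (simp add: b_def)
qed

lemma run_insert_stmt:
  assumes s: "ready s" "table s mF F" "table s mH (skip_window a b F)"
    and a: "s vA 0 = a" "s vE 0 = e" "s aInc e = u" "s aExc e = v" "u + v \<le> M"
  shows "table (run inp insert_stmt s) mF (insert_event u v a b F)"
proof -
  let ?d = "Add (When_less eX eA (When_le eA eY
       (Add (Mul (At mF eX eY) (Arr aExc (Var vE))) (Mul (At mH eX eY) (Arr aInc (Var vE))))))
     (Add (When_le eA eX (At mF eX eY)) (When_less eY eA (At mF eX eY)))"
  have t: "table (run inp (Tab mG ?d (Num 0)) s) mG (insert_event u v a b F)"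
  proof (rule run_Tab[where g = "\<lambda>_ _ _. 0"])
    fix s' t t' assume t: "t < t'" "t' \<le> N" and eq: "eqoff {vX, vY, vZ, vS, mG} s s'" and regs: "s' vX 0 = t" "s' vY 0 = t'"
    have rd: "ready s'" by (rule ready_eqoff[OF eq _ s(1)]) simp
    have same: "s' mF = s mF" "s' mH = s mH" "s' vA = s vA" "s' vE = s vE" "s' aInc = s aInc" "s' aExc = s aExc"
      using eq by (simp_all add: eqoff_def)
    have F: "s' mF (t * M + t') = F t t'" "s' mH (t * M + t') = skip_window a b F t t'"
      using s(2,3) t by (simp_all add: tableD same)
    have "u \<le> 2 ^ (M * M)" "v \<le> 2 ^ (M * M)" using a(5) M_le_power by linarith+
    then show "val_of inp ?d s' + (\<Sum>z<M. 0) = insert_event u v a b F t t'"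
      using t rd regs F same a
      by (cases "t < a"; cases "a \<le> t'")
        (simp_all add: insert_event_def val_When_le val_When_less val_Mul val_At)
  qed (use s in auto)
  let ?s = "run inp (Tab mG ?d (Num 0)) s"
  have "ready ?s" using s(1) run_frame[of 0 "Tab mG ?d (Num 0)" inp s] by (simp add: ready_def)
  then show ?thesis unfolding insert_stmt_def run.simps using t by (intro run_Copy) auto
qed

definition valid_choice :: "state \<Rightarrow> bool" where
  "valid_choice s \<longleftrightarrow> (\<forall>e<n. s aSl e \<in> slots I \<and> 1 \<le> s aInc e + s aExc e \<and> s aInc e + s aExc e \<le> M)"

lemma moderate_event_kernel:
  assumes "valid_choice s" "k \<le> n"
  shows "moderate (event_kernel I (s aInc) (s aExc) (s aSl) k)"
  unfolding moderate_def
proof (intro allI impI)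
  fix t assume t: "t \<le> N"
  have "1 \<le> total_weight N (event_kernel I (s aInc) (s aExc) (s aSl) k) t \<and>
      total_weight N (event_kernel I (s aInc) (s aExc) (s aSl) k) t \<le> (\<Prod>e<k. s aInc e + s aExc e)"
    by (rule total_weight_event_kernel) (use assms t in \<open>auto simp: valid_choice_def\<close>)
  moreover have "(\<Prod>e<k. s aInc e + s aExc e) \<le> (\<Prod>e<k. M)"
    using assms by (intro prod_mono) (auto simp: valid_choice_def)
  moreover have "(\<Prod>e<k. M) \<le> 2 ^ (M * M)" using M_power_le[of k] assms(2) code_bounds(1) by simp
  ultimately show "1 \<le> total_weight N (event_kernel I (s aInc) (s aExc) (s aSl) k) t \<and>
      total_weight N (event_kernel I (s aInc) (s aExc) (s aSl) k) t \<le> 2 ^ (M * M)" by linarith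
qed

lemma run_events_stmt:
  assumes s: "ready s" "valid_choice s"
  shows "table (run inp events_stmt s) mF (event_kernel I (s aInc) (s aExc) (s aSl) n)"
proof -
  let ?F = "event_kernel I (s aInc) (s aExc) (s aSl)"
  let ?d = "When_le (Add eX (Num 1)) eY (When_le eY (Add eX (Num 1)) (Num 1))"
  let ?s0 = "run inp (Tab mF ?d (Num 0)) s"
  let ?A = "assigned events_stmt"
  let ?P = "\<lambda>i s'. eqoff ?A s s' \<and> table s' mF (?F i)"
  have "table ?s0 mF unit_kernel"
  proof (rule run_Tab[where g = "\<lambda>_ _ _. 0"])
    fix s' t t' assume t: "t < t'" "t' \<le> N" and eq: "eqoff {vX, vY, vZ, vS, mF} s s'" and regs: "s' vX 0 = t" "s' vY 0 = t'"
    have "ready s'" by (rule ready_eqoff[OF eq _ s(1)]) simp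
    then show "val_of inp ?d s' + (\<Sum>z<M. 0) = unit_kernel t t'"
      using t regs by (auto simp: unit_kernel_def val_When_le)
  qed (use s in auto)
  then have 0: "?P 0 ?s0" by (auto simp: event_kernel_def intro!: eqoff_run)
  have "?P n (run inp (ForTo vE (Inp (Num 2)) event_stmt) ?s0)"
  proof (rule ForTo_rule[of ?P])
    show "n \<le> M" using code_bounds(1) by simp
    show "?P i (put vE 0 v s')" if "?P i s'" for i s' v using that by (simp add: table_put)
    fix i s' assume i: "i < n" "s' vE 0 = i" and P: "?P i s'"
    have rd: "ready s'" using P s(1) by (auto intro: ready_eqoff)
    have same: "s' aSl = s aSl" "s' aInc = s aInc" "s' aExc = s aExc" using P by (simp_all add: eqoff_def)
    let ?a = "s aSl i" and ?b = "min (s aSl i + ev_lengths I ! i) N"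
    define s1 where "s1 = put vA 0 ?a s'"
    define s2 where "s2 = run inp (Copy mH mF) s1"
    define s3 where "s3 = run inp (ForTo vO window_size skip_stmt) s2"
    have run: "run inp event_stmt s' = run inp insert_stmt s3"
      by (simp add: event_stmt_def s1_def s2_def s3_def i(2) same(1))
    have e1: "eqoff {vA} s' s1" by (simp add: s1_def)
    have e2: "eqoff {vA, vX, vY, vZ, vS, mH} s' s2" unfolding s2_def by (intro eqoff_run eqoff_trans[OF e1 eqoff_refl]) auto
    have e3: "eqoff {vA, vX, vY, vZ, vS, mH, mG, vO} s' s3" unfolding s3_def by (intro eqoff_run eqoff_trans[OF e2 eqoff_refl]) auto
    have r: "ready s1" "ready s2" "ready s3" using rd e1 e2 e3 by (auto intro: ready_eqoff)
    have mod: "moderate (?F i)" using i(1) s(2) by (intro moderate_event_kernel) auto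
    have a1: "s1 vA 0 = ?a" by (simp add: s1_def put_self)
    have f2: "s2 vA = s1 vA" by (simp add: s2_def run_frame)
    have f3: "s3 vA = s2 vA" by (simp add: s3_def run_frame)
    have "table s1 mF (?F i)" using P by (simp add: s1_def table_put)
    then have "table s2 mH (?F i)" unfolding s2_def using r by (intro run_Copy) auto
    then have t3: "table s3 mH (skip_window ?a ?b (?F i))"
      unfolding s3_def using r mod i(1,2) a1 f2 e2 by (intro run_window) (auto simp: eqoff_def)
    have F3: "table s3 mF (?F i)" using P e3 by (simp add: table_eqoff)
    have "table (run inp insert_stmt s3) mF (insert_event (s aInc i) (s aExc i) ?a ?b (?F i))"
      using r F3 t3 a1 f2 f3 e3 i same s(2) by (intro run_insert_stmt[where e = i]) (auto simp: eqoff_def valid_choice_def)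
    moreover have "insert_event (s aInc i) (s aExc i) ?a ?b (?F i) = ?F (Suc i)" by (simp add: event_kernel_def)
    moreover have "eqoff ?A s (run inp event_stmt s')" using P by (intro eqoff_run) auto
    ultimately show "?P (Suc i) (run inp event_stmt s')" unfolding run by simp
  qed (use 0 in auto)
  then show ?thesis by (simp add: events_stmt_def)
qed

end

context psba_run
begin

lemma run_serve_stmt:
  assumes s: "ready s" "table s mK F" "moderate F" and a: "s vA 0 = a" "s vD 0 = w" "w < N"
  shows "table (run inp serve_stmt s) mK (serve_kernel a w F)"
proof -
  let ?d = "Add (When_less eX eA (When_le eA eY (When_less (Var vD) eY (At mK eX eY))))
       (Add (When_le eA eX (At mK eX eY)) (When_less eY eA (At mK eX eY)))"
  let ?e = "When_less eX eA (When_le eA eY (When_le eA eZ (When_le eZ (Var vD)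
       (When_less eZ eY (Mul (At mK eX eZ) (At mK eZ eY))))))"
  let ?g = "\<lambda>t t' z. if t < a \<and> a \<le> t' \<and> a \<le> z \<and> z \<le> w \<and> z < t' then F t z * F z t' else 0"
  have t: "table (run inp (Tab mG ?d ?e) s) mG (serve_kernel a w F)"
  proof (rule run_Tab[where g = ?g])
    fix s' t t' assume t: "t < t'" "t' \<le> N" and eq: "eqoff {vX, vY, vZ, vS, mG} s s'" and regs: "s' vX 0 = t" "s' vY 0 = t'"
    have rd: "ready s'" by (rule ready_eqoff[OF eq _ s(1)]) simp
    have same: "s' mK = s mK" "s' vA = s vA" "s' vD = s vD" using eq by (simp_all add: eqoff_def)
    have F: "s' mK (t * M + t') = F t t'" using s(2) t by (simp add: tableD same)
    have "(\<Sum>z<M. ?g t t' z) = (if t < a \<and> a \<le> t' then \<Sum>z\<in>{a..w}. if z < t' then F t z * F z t' else 0 else 0)"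
    proof (cases "t < a \<and> a \<le> t'")
      case True
      have "(\<Sum>z\<in>{a..w}. if z < t' then F t z * F z t' else 0) = (\<Sum>z<M. ?g t t' z)"
        using True a(3) code_bounds(2) by (intro sum.mono_neutral_cong_left) auto
      then show ?thesis using True by simp
    next
      case False
      then show ?thesis by (auto intro!: sum.neutral)
    qed
    then show "val_of inp ?d s' + (\<Sum>z<M. ?g t t' z) = serve_kernel a w F t t'"
      using t rd regs F same a
      by (cases "t < a"; cases "a \<le> t'") (simp_all add: serve_kernel_def val_When_le val_When_less val_At)
  next
    fix s' t t' z assume t: "t < t'" "t' \<le> N" and eq: "eqoff {vX, vY, vZ, vS, mG} s s'"
      and regs: "s' vX 0 = t" "s' vY 0 = t'" "s' vZ 0 = z"
    have rd: "ready s'" by (rule ready_eqoff[OF eq _ s(1)]) simp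
    have same: "s' mK = s mK" "s' vA = s vA" "s' vD = s vD" using eq by (simp_all add: eqoff_def)
    show "val_of inp ?e s' = ?g t t' z"
    proof (cases "t < a \<and> a \<le> t' \<and> a \<le> z \<and> z \<le> w \<and> z < t'")
      case True
      then have "s' mK (t * M + z) = F t z" "s' mK (z * M + t') = F z t'"
        using s(2) t by (simp_all add: tableD same)
      moreover have "F z t' \<le> 2 ^ (M * M)" using True t by (intro moderate_le[OF s(3)]) auto
      ultimately show ?thesis using True rd regs same a by (simp add: val_When_le val_When_less val_At val_Mul)
    next
      case False
      then show ?thesis using rd regs same a by (auto simp: val_When_le val_When_less)
    qed
  qed (use s in auto)
  let ?s = "run inp (Tab mG ?d ?e) s"
  have "ready ?s" using s(1) run_frame[of 0 "Tab mG ?d ?e" inp s] by (simp add: ready_def)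
  then show ?thesis unfolding serve_stmt_def run.simps using t by (intro run_Copy) auto
qed

text \<open>Interpolates between \<open>units J d\<close> and \<open>units J (Suc d)\<close>, giving
  the invariant of the inner loop over jobs.\<close>

definition due :: "job list \<Rightarrow> nat \<Rightarrow> nat \<Rightarrow> (nat \<times> nat) list" where
  "due J d i = units J d @
     concat (map (\<lambda>j. if deadline j = d then replicate (ptime j) (release j, d) else []) (take i J))"

lemma due_0: "due J d 0 = units J d"
  by (simp add: due_def)

lemma due_Suc: "i < length J \<Longrightarrow> due J d (Suc i) =
    due J d i @ (if deadline (J ! i) = d then replicate (ptime (J ! i)) (release (J ! i), d) else [])"
  by (simp add: due_def take_Suc_conv_app_nth)

lemma due_length: "due J d (length J) = units J (Suc d)"
  by (simp add: due_def)

lemma units_beyond: "(\<And>j. j \<in> set J \<Longrightarrow> deadline j < d) \<Longrightarrow> d \<le> d' \<Longrightarrow> units J d' = units J d"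
proof (induction d')
  case (Suc d')
  show ?case
  proof (cases "d = Suc d'")
    case False
    then have d: "d \<le> d'" using Suc.prems(2) by simp
    have "(if deadline j = d' then replicate (ptime j) (release j, d') else []) = []" if "j \<in> set J" for j
      using Suc.prems(1)[OF that] d by simp
    then have "concat (map (\<lambda>j. if deadline j = d' then replicate (ptime j) (release j, d') else []) J) = []"
      by (auto simp: concat_eq_Nil_conv)
    then show ?thesis using Suc.IH[OF Suc.prems(1) d] by simp
  qed simp
qed simp

lemma job_kernel_snoc: "job_kernel (us @ [(a, w)]) F = serve_kernel a w (job_kernel us F)"
  by (simp add: job_kernel_def)

lemma moderate_serve: "moderate F \<Longrightarrow> a \<le> w \<Longrightarrow> w < N \<Longrightarrow> moderate (serve_kernel a w F)"
  by (simp add: moderate_def total_weight_serve_kernel)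

lemma job_bounds:
  assumes "k < length (agents I)" "j < length (agents I ! k)"
  shows "release (agents I ! k ! j) \<le> deadline (agents I ! k ! j)" "deadline (agents I ! k ! j) < N"
    "ptime (agents I ! k ! j) \<le> M"
proof -
  let ?j = "agents I ! k ! j"
  have "?j \<in> set (agents I ! k)" "agents I ! k \<in> set (agents I)" using assms by auto
  then have "1 \<le> ptime ?j" "deadline ?j \<le> horizon I" "release ?j + ptime ?j \<le> deadline ?j + 1" "1 \<le> release ?j"
    using inst by (auto simp: psba_instance_def)
  then show "release ?j \<le> deadline ?j" "deadline ?j < N" "ptime ?j \<le> M" using code_bounds(2) by linarith+
qed

lemma run_job_stmt:
  assumes k: "k < length (agents I)" "j < length (agents I ! k)" and J: "J = agents I ! k"
    and s: "ready s" "table s mK (job_kernel (due J d j) F)" "moderate (job_kernel (due J d j) F)"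
    and regs: "s vP 0 = pointer k" "s vJ 0 = j" "s vD 0 = d"
  shows "table (run inp job_stmt s) mK (job_kernel (due J d (Suc j)) F) \<and> moderate (job_kernel (due J d (Suc j)) F)"
proof -
  have field: "val_of inp (job_field (Suc i)) s' = [release (J ! j), deadline (J ! j), ptime (J ! j)] ! i"
    if "i < 3" "s' vP = s vP" "s' vJ = s vJ" for i s'
  proof -
    have index: "pointer k + (3 * j + Suc i) = pointer k + (j + (j + j) + Suc i)" by simp
    have "val_of inp (job_field (Suc i)) s' = inp (pointer k + (3 * j + Suc i))"
      unfolding index using that regs by (simp add: job_field_def)
    also have "\<dots> = encode_jobs J ! (3 * j + Suc i)" unfolding J using k that(1) by (intro inp_agent) auto
    finally show ?thesis using nth_encode_jobs[of j J i] k(2) that(1) by (simp add: J)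
  qed
  have fields: "val_of inp (job_field 1) s' = release (J ! j)" "val_of inp (job_field 2) s' = deadline (J ! j)"
      "val_of inp (job_field 3) s' = ptime (J ! j)" if "s' vP = s vP" "s' vJ = s vJ" for s'
    using field[of 0 s'] field[of 1 s'] field[of 2 s'] that by (simp_all add: numeral_eq_Suc)
  show ?thesis
  proof (cases "deadline (J ! j) = d")
    case False
    then show ?thesis using s k regs by (simp add: job_stmt_def run_IfEq fields due_Suc J[symmetric])
  next
    case True
    let ?a = "release (J ! j)"
    let ?s = "put vA 0 ?a s"
    let ?A = "insert vQ (assigned serve_stmt)"
    let ?F = "\<lambda>i. job_kernel (due J d j @ replicate i (?a, d)) F"
    let ?P = "\<lambda>i s'. eqoff ?A ?s s' \<and> table s' mK (?F i) \<and> moderate (?F i)"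
    have b: "?a \<le> d" "d < N" using job_bounds(1,2)[OF k] True by (simp_all add: J)
    have run: "run inp job_stmt s = run inp (ForTo vQ (job_field 3) serve_stmt) ?s"
      using True regs fields(1)[of s] by (simp add: job_stmt_def run_IfEq fields(2))
    have "?P (ptime (J ! j)) (run inp (ForTo vQ (job_field 3) serve_stmt) ?s)"
    proof (rule ForTo_rule[of ?P])
      show "ptime (J ! j) \<le> M" using job_bounds(3)[OF k] by (simp add: J)
      show "?P i (put vQ 0 v s')" if "?P i s'" for i s' v using that by (simp add: table_put)
      fix i s' assume P: "?P i s'"
      have same: "s' vP = s vP" "s' vJ = s vJ" "s' vA 0 = ?a" "s' vD = s vD"
        using P by (simp_all add: eqoff_def put_other put_self)
      show "val_of inp (job_field 3) s' = ptime (J ! j)" using fields(3)[of s'] same by simp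
      have "eqoff (insert vA ?A) s s'" using P by (auto simp: eqoff_def put_other)
      then have rd: "ready s'" using s(1) by (auto intro: ready_eqoff)
      have "table (run inp serve_stmt s') mK (serve_kernel ?a d (?F i))"
        using P rd same b(2) regs by (intro run_serve_stmt) auto
      moreover have "moderate (serve_kernel ?a d (?F i))" using P b by (intro moderate_serve) auto
      moreover have "serve_kernel ?a d (?F i) = ?F (Suc i)"
        by (simp add: job_kernel_snoc[symmetric] replicate_append_same)
      moreover have "eqoff ?A ?s (run inp serve_stmt s')" using P by (intro eqoff_run) auto
      ultimately show "?P (Suc i) (run inp serve_stmt s')" by simp
    qed (use s in \<open>simp_all add: table_put\<close>)
    then show ?thesis using True k(2) unfolding run by (simp add: due_Suc J[symmetric])
  qed
qed

lemma run_jobs_stmt: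
  assumes k: "k < length (agents I)" and J: "J = agents I ! k"
    and s: "ready s" "table s mF F" "moderate F" and regs: "s vP 0 = pointer k"
  shows "table (run inp jobs_stmt s) mK (job_kernel (units J N) F)" "moderate (job_kernel (units J N) F)"
    "run inp jobs_stmt s vL 0 = length J"
proof -
  have len: "inp (pointer k) = length J" using inp_agent[of k 0] k by (simp add: J encode_jobs_def)
  let ?s0 = "put vL 0 (length J) s"
  let ?s1 = "run inp (Copy mK mF) ?s0"
  let ?A = "assigned jobs_stmt - {vL}"
  have rd0: "ready ?s0" using s(1) by (simp add: ready_def put_other)
  have t1: "table ?s1 mK F" using s(2) rd0 by (intro run_Copy) (auto simp: table_put)
  have run: "run inp jobs_stmt s = run inp (For vD (ForTo vJ (Var vL) job_stmt)) ?s1"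
    using regs len by (simp add: jobs_stmt_def)
  have eq1: "eqoff ?A ?s0 ?s1" by (intro eqoff_run) auto
  let ?P = "\<lambda>d s'. eqoff ?A ?s0 s' \<and> table s' mK (job_kernel (units J d) F) \<and> moderate (job_kernel (units J d) F)"
  have "?P M (run inp (For vD (ForTo vJ (Var vL) job_stmt)) ?s1)"
  proof (rule For_rule[of ?P])
    show "?P 0 ?s1" using eq1 t1 s(3) by (simp add: job_kernel_def)
    show "?P i (put vD 0 v s')" if "?P i s'" for i s' v using that by (simp add: table_put)
    fix d s' assume P: "?P d s'" and d: "s' vD 0 = d"
    let ?Q = "\<lambda>j s''. eqoff ?A ?s0 s'' \<and> s'' vD 0 = d \<and>
        table s'' mK (job_kernel (due J d j) F) \<and> moderate (job_kernel (due J d j) F)"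
    have "?Q (length J) (run inp (ForTo vJ (Var vL) job_stmt) s')"
    proof (rule ForTo_rule[of ?Q])
      have "Suc (3 * length J) \<le> length code"
        unfolding length_code J using k member_le_sum[of k "{..<length (agents I)}" "\<lambda>i. length (encode_jobs (agents I ! i))"]
        by (simp add: length_encode_jobs)
      then show "length J \<le> M" by simp
      show "?Q i (put vJ 0 v s')" if "?Q i s'" for i s' v using that by (simp add: table_put put_other)
      show "val_of inp (Var vL) s' = length J" if "?Q i s'" for i s' using that by (simp add: eqoff_def put_self)
      fix j s'' assume j: "j < length J" "s'' vJ 0 = j" and Q: "?Q j s''"
      have "ready s''" using Q rd0 by (auto intro: ready_eqoff)
      moreover have "s'' vP 0 = pointer k" using Q regs by (simp add: eqoff_def put_other)
      ultimately have "table (run inp job_stmt s'') mK (job_kernel (due J d (Suc j)) F) \<and> moderate (job_kernel (due J d (Suc j)) F)"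
        using Q j J k by (intro run_job_stmt) auto
      moreover have "eqoff ?A ?s0 (run inp job_stmt s'')" using Q by (intro eqoff_run) auto
      moreover have "run inp job_stmt s'' vD = s'' vD" by (simp add: run_frame)
      ultimately show "?Q (Suc j) (run inp job_stmt s'')" using Q by simp
    qed (use P d in \<open>simp_all add: due_0\<close>)
    then show "?P (Suc d) (run inp (ForTo vJ (Var vL) job_stmt) s')" by (simp add: due_length)
  qed
  \<comment> \<open>The deadline loop runs on to \<open>M\<close>, beyond every deadline, where
    \<open>units\<close> no longer grows.\<close>
  moreover have "units J M = units J N"
  proof (rule units_beyond)
    show "deadline j < N" if "j \<in> set J" for j using that job_bounds(2)[OF k] by (auto simp: J in_set_conv_nth)
    show "N \<le> M" using code_bounds(2) by simp
  qed
  ultimately show "table (run inp jobs_stmt s) mK (job_kernel (units J N) F)" "moderate (job_kernel (units J N) F)"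
    "run inp jobs_stmt s vL 0 = length J"
    unfolding run by (simp_all add: eqoff_def put_self)
qed

lemma sum_above: "(\<Sum>z<M. if t < z \<and> z \<le> N then f z else 0) = (\<Sum>z\<in>{t<..N}. f z :: nat)"
  using code_bounds(2) by (intro sum.mono_neutral_cong_right) auto

lemma run_count_stmt:
  assumes s: "ready s" "table s mK F" "moderate F"
  shows "run inp count_stmt s aC 0 = kernel_sum N F 0 card"
proof -
  let ?s0 = "put aC N 0 (put aB N 1 s)"
  let ?A = "assigned count_stmt"
  let ?P = "\<lambda>i s'. eqoff ?A s s' \<and> (\<forall>t. N - i \<le> t \<and> t \<le> N \<longrightarrow> s' aB t = total_weight N F t \<and> s' aC t = kernel_sum N F t card)"
  have run: "run inp count_stmt s = run inp (ForTo vO (Add (Inp (Num 1)) (Num 1)) count_step) ?s0"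
    by (simp add: count_stmt_def)
  have "?P N (run inp (ForTo vO (Add (Inp (Num 1)) (Num 1)) count_step) ?s0)"
  proof (rule ForTo_rule[of ?P])
    show "?P 0 ?s0" by (auto simp: put_self put_other total_weight_end kernel_sum_end)
    show "N \<le> M" using code_bounds(2) by simp
    show "?P i (put vO 0 v s')" if "?P i s'" for i s' v using that by (simp add: put_other)
    fix i s' assume i: "i < N" "s' vO 0 = i" and P: "?P i s'"
    let ?t = "horizon I - i"
    let ?e = "When_less eA eZ (When_le eZ (Add (Inp (Num 1)) (Num 1)) (Mul (Arr aB eZ) (At mK eA eZ)))"
    let ?e' = "When_less eA eZ (When_le eZ (Add (Inp (Num 1)) (Num 1)) (Mul (Add (Arr aC eZ) (Arr aB eZ)) (At mK eA eZ)))"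
    have t: "?t < N" "N - i = Suc ?t" using i by auto
    define s1 where "s1 = put vA 0 ?t s'"
    define s2 where "s2 = run inp (SumZ ?e) s1"
    define s3 where "s3 = put aB ?t (s2 vS 0) s2"
    define s4 where "s4 = run inp (SumZ ?e') s3"
    have e2: "eqoff {vS, vZ} s1 s2" unfolding s2_def by (intro eqoff_run) auto
    have e4: "eqoff {vS, vZ} s3 s4" unfolding s4_def by (intro eqoff_run) auto
    have regs: "s2 vA 0 = ?t" "s4 vA 0 = ?t" "s4 aB = (s' aB)(?t := s2 vS 0)" "s4 aC = s' aC"
      using e2 e4 by (simp_all add: eqoff_def s1_def s3_def put_self put_other)
    have "run inp (Upd vA (Num 0) (Sub (Inp (Num 1)) (Var vO))) s' = s1"
      "run inp (Upd aB eA (Var vS)) s2 = s3" "run inp (Upd aC eA (Var vS)) s4 = put aC ?t (s4 vS 0) s4"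
      using i regs by (simp_all add: s1_def s3_def)
    then have run': "run inp count_step s' = put aC ?t (s4 vS 0) s4"
      unfolding count_step_def run.simps(3) s2_def s4_def by simp
    have eq1: "eqoff ?A s s1" using P by (simp add: s1_def)
    have eq3: "eqoff ?A s s3" using eqoff_trans[OF eq1 e2, of ?A] by (simp add: s3_def)
    have ih: "s' aB z = total_weight N F z" "s' aC z = kernel_sum N F z card" if "?t < z" "z \<le> N" for z
      using P that t by simp_all
    have 2: "s2 vS 0 = total_weight N F ?t"
    proof -
      have "s2 vS 0 = (\<Sum>z<M. if ?t < z \<and> z \<le> N then F ?t z * total_weight N F z else 0)"
        unfolding s2_def
      proof (rule run_SumZ)
        fix s'' z assume z: "eqoff {vS, vZ} s1 s''" "s'' vZ 0 = z"
        have eq: "eqoff ?A s s''" by (rule eqoff_trans[OF eq1 z(1)]) auto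
        have rd: "ready s''" using s(1) by (auto intro: ready_eqoff[OF eq])
        have same: "s'' mK = s mK" "s'' vA 0 = ?t" "s'' aB = s' aB"
          using eq z(1) by (simp_all add: eqoff_def s1_def put_self put_other)
        show "val_of inp ?e s'' = (if ?t < z \<and> z \<le> N then F ?t z * total_weight N F z else 0)"
          using rd z(2) same ih[of z] moderate_le[OF s(3), of ?t z] s(2)
          by (auto simp: val_When_le val_When_less val_Mul val_At tableD)
      qed
      then show ?thesis unfolding sum_above using t(1) by (simp add: total_weight_step)
    qed
    have 4: "s4 vS 0 = kernel_sum N F ?t card"
    proof -
      have "s4 vS 0 = (\<Sum>z<M. if ?t < z \<and> z \<le> N then F ?t z * (kernel_sum N F z card + total_weight N F z) else 0)"
        unfolding s4_def
      proof (rule run_SumZ)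
        fix s'' z assume z: "eqoff {vS, vZ} s3 s''" "s'' vZ 0 = z"
        have eq: "eqoff ?A s s''" by (rule eqoff_trans[OF eq3 z(1)]) auto
        have rd: "ready s''" using s(1) by (auto intro: ready_eqoff[OF eq])
        have same: "s'' mK = s mK" "s'' vA 0 = ?t" "s'' aB = (s' aB)(?t := s2 vS 0)" "s'' aC = s' aC"
          using eq z(1) e2 by (simp_all add: eqoff_def s1_def s3_def put_self put_other)
        show "val_of inp ?e' s'' = (if ?t < z \<and> z \<le> N then F ?t z * (kernel_sum N F z card + total_weight N F z) else 0)"
          using rd z(2) same ih[of z] moderate_le[OF s(3), of ?t z] s(2)
          by (auto simp: val_When_le val_When_less val_Mul val_At tableD)
      qed
      then show ?thesis unfolding sum_above using t(1) by (simp add: kernel_sum_card_step)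
    qed
    have "eqoff ?A s (run inp count_step s')" using P by (intro eqoff_run) auto
    moreover have "run inp count_step s' aB z = total_weight N F z \<and> run inp count_step s' aC z = kernel_sum N F z card"
      if "N - Suc i \<le> z" "z \<le> N" for z
      using that t regs 2 4 ih[of z] unfolding run' by (cases "z = ?t") (auto simp: put_self put_other)
    ultimately show "?P (Suc i) (run inp count_step s')" by blast
  qed simp
  then show ?thesis by (simp add: run)
qed

text \<open>Adding to the accumulator with the factor \<open>vW\<close> lets the same code serve a
  single evaluation and one level of the potential; the bound on \<open>vW\<close> keeps the last
  product exact.\<close>

theorem run_eval_stmt:
  assumes s: "ready s" "valid_choice s" and W: "s vW 0 \<le> 2 ^ (M * M)"
  shows "run inp eval_stmt s vAcc 0 = s vAcc 0 + s vW 0 *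
    wsum (s aInc) (s aExc) (events I) (\<lambda>E. waste I (\<Union>e\<in>E. window I e (s aSl e)))"
proof -
  let ?F = "event_kernel I (s aInc) (s aExc) (s aSl) n"
  let ?K = "\<lambda>J. kernel_sum N (agent_kernel I (s aInc) (s aExc) (s aSl) J) 0 card"
  let ?s0 = "put vP 0 (n + 4) (run inp events_stmt s)"
  let ?A = "assigned eval_stmt - {mF}"
  let ?P = "\<lambda>i s'. eqoff (assigned eval_stmt) s s' \<and> table s' mF ?F \<and> s' vP 0 = pointer i \<and>
      s' vAcc 0 = s vAcc 0 + s vW 0 * (\<Sum>k<i. ?K (agents I ! k))"
  have run: "run inp eval_stmt s = run inp (ForTo vC (Inp (Add (Inp (Num 2)) (Num 3))) agent_stmt) ?s0"
    by (simp add: eval_stmt_def)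
  have mod: "moderate ?F" using moderate_event_kernel[OF s(2)] by simp
  have "?P (length (agents I)) (run inp (ForTo vC (Inp (Add (Inp (Num 2)) (Num 3))) agent_stmt) ?s0)"
  proof (rule ForTo_rule[of ?P])
    have "eqoff (assigned eval_stmt) s (run inp events_stmt s)" by (intro eqoff_run) auto
    moreover have "run inp events_stmt s vAcc = s vAcc" by (simp add: run_frame)
    ultimately show "?P 0 ?s0" using run_events_stmt[OF s] by (simp add: table_put put_self put_other pointer_def)
    show "length (agents I) \<le> M" using code_bounds by simp
    show "?P i (put vC 0 v s')" if "?P i s'" for i s' v using that by (simp add: table_put put_other)
    fix k s' assume k: "k < length (agents I)" and P: "?P k s'"
    let ?J = "agents I ! k"
    define s1 where "s1 = run inp jobs_stmt s'"
    define s2 where "s2 = run inp count_stmt s1"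
    have rd: "ready s'" using P s(1) by (auto intro: ready_eqoff)
    have e1: "eqoff (assigned jobs_stmt) s' s1" unfolding s1_def by (intro eqoff_run) auto
    have e2: "eqoff (assigned count_stmt) s1 s2" unfolding s2_def by (intro eqoff_run) auto
    have rd1: "ready s1" using rd by (auto intro: ready_eqoff[OF e1])
    then have rd2: "ready s2" by (auto intro: ready_eqoff[OF e2])
    have 1: "table s1 mK (job_kernel (units ?J N) ?F)" "moderate (job_kernel (units ?J N) ?F)" "s1 vL 0 = length ?J"
      unfolding s1_def using run_jobs_stmt[OF k refl rd _ mod] P by auto
    have c: "s2 aC 0 = ?K ?J" unfolding s2_def using run_count_stmt[OF rd1 1(1,2)] by (simp add: agent_kernel_def)
    have regs: "s2 vL 0 = length ?J" "s2 vP = s' vP" "s2 vAcc = s' vAcc" "s2 vW = s vW" "s2 mF = s' mF"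
      using 1(3) e1 e2 P by (simp_all add: eqoff_def)
    have "val_of inp (Mul (Arr aC (Num 0)) (Var vW)) s2 = s2 aC 0 * s vW 0"
      using rd2 W regs by (subst val_Mul) simp_all
    moreover have "pointer (Suc k) = pointer k + Suc (length ?J + (length ?J + length ?J))" by (simp add: pointer_Suc)
    ultimately have run': "run inp agent_stmt s' = put vP 0 (pointer (Suc k)) (put vAcc 0 (s' vAcc 0 + ?K ?J * s vW 0) s2)"
      using P regs c by (simp add: agent_stmt_def s1_def[symmetric] s2_def[symmetric] put_other)
    have "eqoff (assigned eval_stmt) s (run inp agent_stmt s')" using P by (intro eqoff_run) auto
    moreover have "table (run inp agent_stmt s') mF ?F" using P regs unfolding run' by (simp add: table_def put_other)
    ultimately show "?P (Suc k) (run inp agent_stmt s')"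
      using P unfolding run' by (simp add: put_self put_other algebra_simps)
  qed (simp add: eqoff_def)
  moreover have "(\<Sum>k<length (agents I). ?K (agents I ! k)) = (\<Sum>J\<leftarrow>agents I. ?K J)"
    by (simp add: sum_list_sum_nth atLeast0LessThan)
  moreover have "(\<Sum>J\<leftarrow>agents I. ?K J) = wsum (s aInc) (s aExc) (events I) (\<lambda>E. waste I (\<Union>e\<in>E. window I e (s aSl e)))"
    by (rule kernel_sum_agents[OF inst]) (use s(2) in \<open>auto simp: valid_choice_def events_def\<close>)
  ultimately show ?thesis unfolding run by simp
qed

end

section \<open>The greedy program\<close>

abbreviation (input) "vR \<equiv> 27 :: nat"
abbreviation (input) "vF \<equiv> 28 :: nat"
abbreviation (input) "vT \<equiv> 29 :: nat"
abbreviation (input) "vBest \<equiv> 30 :: nat"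
abbreviation (input) "vBestEvent \<equiv> 31 :: nat"
abbreviation (input) "vBestSlot \<equiv> 32 :: nat"

text \<open>Weights \<open>0\<close> and \<open>1\<close> declare an event absent; slot
  \<open>1\<close> is a default that keeps the choice valid before the event is scheduled.\<close>

definition init_stmt :: stmt where
  "init_stmt = Then (Upd vW (Num 0) (Num 1)) (ForTo vF (Inp (Num 2)) (Then (Upd aInc (Var vF) (Num 0))
     (Then (Upd aExc (Var vF) (Num 1)) (Upd aSl (Var vF) (Num 1)))))"

definition try_slot :: stmt where
  "try_slot = Then (Upd aSl (Var vF) (Add (Var vT) (Num 1))) (Then (Upd vAcc (Num 0) (Num 0)) (Then eval_stmt
     (IfLess (Var vAcc) (Var vBest) (Then (Upd vBest (Num 0) (Var vAcc)) (Then (Upd vBestEvent (Num 0) (Var vF))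
       (Upd vBestSlot (Num 0) (Add (Var vT) (Num 1))))) Nop)))"

definition try_event :: stmt where
  "try_event = IfLess (Arr aInc (Var vF)) (Num 1) (Then (Upd aInc (Var vF) (Num 1)) (Then (Upd aExc (Var vF) (Num 0))
     (Then (ForTo vT (Inp (Num 1)) try_slot) (Then (Upd aInc (Var vF) (Num 0)) (Upd aExc (Var vF) (Num 1)))))) Nop"

definition record_stmt :: stmt where
  "record_stmt = Then (Upd aInc (Var vBestEvent) (Num 1)) (Then (Upd aExc (Var vBestEvent) (Num 0))
     (Then (Upd aSl (Var vBestEvent) (Var vBestSlot)) (Then (Upd aOut (Add (Var vR) (Var vR)) (Var vBestEvent))
       (Upd aOut (Add (Add (Var vR) (Var vR)) (Num 1)) (Var vBestSlot)))))"

text \<open>The initial \<open>Bound * Bound\<close> exceeds every waste, see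
  \<open>waste_less\<close>, so the first pair tried replaces it.\<close>

definition round_stmt :: stmt where
  "round_stmt = Then (Upd vBest (Num 0) (Mul Bound Bound)) (Then (ForTo vF (Inp (Num 2)) try_event) record_stmt)"

definition greedy_stmt :: stmt where
  "greedy_stmt = Then init_stmt (Then (ForTo vR (Inp (Num 2)) round_stmt)
     (Upd vLen (Num 0) (Add (Inp (Num 2)) (Inp (Num 2)))))"

lemma assigned_try_slot [simp]: "assigned try_slot = assigned eval_stmt \<union> {aSl, vBest, vBestEvent, vBestSlot}"
  by (auto simp: try_slot_def)

lemma assigned_try_event [simp]: "assigned try_event = assigned try_slot \<union> {vT, aInc, aExc}"
  by (auto simp: try_event_def)

lemma assigned_record_stmt [simp]: "assigned record_stmt = {aInc, aExc, aSl, aOut}"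
  by (auto simp: record_stmt_def)

lemma assigned_round_stmt [simp]: "assigned round_stmt = assigned try_event \<union> {vF, aOut}"
  by (auto simp: round_stmt_def)

text \<open>With weights \<open>0\<close> and \<open>1\<close> the sampled set is deterministic, so
  the greedy program evaluates a partial schedule with the same code as the local search.\<close>

lemma wsum_indicator:
  assumes "finite E" "A \<subseteq> E" "\<And>e. e \<in> E \<Longrightarrow> u e = of_bool (e \<in> A)" "\<And>e. e \<in> E \<Longrightarrow> v e = of_bool (e \<notin> A)"
  shows "wsum u v E h = (h A :: nat)"
proof -
  have "(\<Prod>e\<in>J. u e) * (\<Prod>e\<in>E - J. v e) * h J = (if J = A then h A else 0)" if "J \<subseteq> E" for J
  proof (cases "J = A")
    case True
    have "(\<Prod>e\<in>A. u e) = 1" using assms(2,3) by (intro prod.neutral ballI) (simp add: subsetD)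
    moreover have "(\<Prod>e\<in>E - A. v e) = 1" using assms(4) by (intro prod.neutral ballI) simp
    ultimately show ?thesis using True by simp
  next
    case False
    then consider e where "e \<in> J" "e \<notin> A" | e where "e \<in> A" "e \<notin> J" by blast
    then have "(\<Prod>e\<in>J. u e) = 0 \<or> (\<Prod>e\<in>E - J. v e) = 0"
    proof cases
      case 1
      have "u e = 0" using 1 \<open>J \<subseteq> E\<close> assms(3)[of e] by auto
      then show ?thesis using 1(1) prod_zero[of J u] finite_subset[OF \<open>J \<subseteq> E\<close> assms(1)] by blast
    next
      case 2
      have "v e = 0" "e \<in> E - J" using 2 assms(2) assms(4)[of e] by auto
      moreover have "finite (E - J)" using assms(1) by simp
      ultimately have "prod v (E - J) = 0" by (intro prod_zero bexI[of _ e])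
      then show ?thesis by simp
    qed
    then show ?thesis using False by auto
  qed
  then have "wsum u v E h = (\<Sum>J\<in>Pow E. if J = A then h A else 0)" unfolding wsum_def by (intro sum.cong) auto
  then show ?thesis using assms(1,2) by simp
qed

lemma unscheduled_eq: "unscheduled I S = events I - fst ` S"
  by (force simp: unscheduled_def)

text \<open>A pair that minimises the waste over all unscheduled events and all slots is a
  legitimate two-stage choice: \<open>cand\<close> sends the chosen event to its slot and every
  other event to any best slot.\<close>

lemma greedy_choiceI:
  assumes I: "psba_instance I" and S: "S \<subseteq> events I \<times> slots I"
    and et: "e \<in> unscheduled I S" "t \<in> slots I"
    and least: "\<And>e' t'. e' \<in> unscheduled I S \<Longrightarrow> t' \<in> slots I \<Longrightarrow>
      waste I (cover I (insert (e, t) S)) \<le> waste I (cover I (insert (e', t') S))"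
  shows "greedy_choice I S e t"
proof -
  have gain: "gain I S e' t' = int (capacity I) - int (waste I (cover I (insert (e', t') S))) - int (total_agreement I S)" for e' t'
    using tr_add_waste[OF I cover_subset, of "insert (e', t') S"] total_agreement_eq_tr[OF I, of "insert (e', t') S"]
    by (simp add: gain_def)
  have "\<exists>u. is_arg_max (gain I S e') (\<lambda>u. u \<in> slots I) u" for e'
  proof -
    have "Max (gain I S e' ` slots I) \<in> gain I S e' ` slots I" using et(2) by (intro Max_in) (auto simp: slots_def)
    then obtain u where u: "u \<in> slots I" "gain I S e' u = Max (gain I S e' ` slots I)" by auto
    have "gain I S e' y \<le> gain I S e' u" if "y \<in> slots I" for y
      unfolding u(2) using that by (intro Max_ge) (auto simp: slots_def)
    then show ?thesis using u(1) unfolding is_arg_max_def by (metis not_le)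
  qed
  then obtain c where c: "\<And>e'. is_arg_max (gain I S e') (\<lambda>u. u \<in> slots I) (c e')" by metis
  let ?c = "c(e := t)"
  have le: "gain I S e' t' \<le> gain I S e t" if "e' \<in> unscheduled I S" "t' \<in> slots I" for e' t'
    using least[OF that] by (simp add: gain)
  have "is_arg_max (gain I S e') (\<lambda>u. u \<in> slots I) (?c e')" for e'
  proof (cases "e' = e")
    case True
    then show ?thesis using et le[OF et(1)] by (auto simp: is_arg_max_def not_less)
  qed (simp add: c)
  moreover have "is_arg_max (\<lambda>e'. gain I S e' (?c e')) (\<lambda>e'. e' \<in> unscheduled I S) e"
  proof -
    have "c e' \<in> slots I" for e' using c[of e'] by (simp add: is_arg_max_def)
    then show ?thesis using et le by (auto simp: is_arg_max_def not_less)
  qed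
  ultimately show ?thesis unfolding greedy_choice_def by (intro exI[of _ ?c]) auto
qed

section \<open>Correctness of the greedy program\<close>

context psba_run
begin

definition sched :: "nat set \<Rightarrow> state \<Rightarrow> bool" where
  "sched A s \<longleftrightarrow> ready s \<and> s vW 0 = 1 \<and> A \<subseteq> events I \<and>
     (\<forall>e<n. s aInc e = of_bool (e \<in> A) \<and> s aExc e = of_bool (e \<notin> A) \<and> s aSl e \<in> slots I)"

lemma sched_cong:
  "s' 0 = s 0 \<Longrightarrow> s' vW = s vW \<Longrightarrow> s' aInc = s aInc \<Longrightarrow> s' aExc = s aExc \<Longrightarrow> s' aSl = s aSl \<Longrightarrow> sched A s' \<longleftrightarrow> sched A s"
  by (simp add: sched_def ready_def)

lemma run_waste:
  assumes "sched A s" "s vAcc 0 = 0"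
  shows "run inp eval_stmt s vAcc 0 = waste I (\<Union>e\<in>A. window I e (s aSl e))"
proof -
  have "valid_choice s" using assms code_bounds(4) by (auto simp: sched_def valid_choice_def)
  moreover have "(1::nat) \<le> 2 ^ (M * M)" by simp
  ultimately have "run inp eval_stmt s vAcc 0 = wsum (s aInc) (s aExc) (events I) (\<lambda>E. waste I (\<Union>e\<in>E. window I e (s aSl e)))"
    using assms run_eval_stmt[of s] by (simp add: sched_def)
  also have "\<dots> = waste I (\<Union>e\<in>A. window I e (s aSl e))"
    by (rule wsum_indicator) (use assms in \<open>auto simp: sched_def events_def\<close>)
  finally show ?thesis .
qed

lemma waste_less: "waste I X < M * M"
proof -
  have "waste I X \<le> length (agents I) * N" by (rule waste_le)
  also have "\<dots> \<le> M * N" using code_bounds(3) by (rule mult_le_mono1)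
  also have "\<dots> < M * M" using code_bounds(2,4) by (intro mult_strict_left_mono) linarith+
  finally show ?thesis .
qed

definition regret :: "(nat \<times> nat) list \<Rightarrow> nat \<Rightarrow> nat \<Rightarrow> nat" where
  "regret xs e t = waste I (cover I (insert (e, t) (set xs)))"

definition agrees :: "(nat \<times> nat) list \<Rightarrow> state \<Rightarrow> bool" where
  "agrees xs s \<longleftrightarrow> (\<forall>(e, t)\<in>set xs. e < n \<and> t \<in> slots I \<and> s aSl e = t)"

text \<open>The value \<open>M * M\<close> means that nothing has been recorded yet; by
  \<open>waste_less\<close> it lies above every regret.\<close>

definition best :: "(nat \<times> nat) list \<Rightarrow> (nat \<times> nat) set \<Rightarrow> state \<Rightarrow> bool" where
  "best xs U s \<longleftrightarrow> (\<forall>(e, t)\<in>U. s vBest 0 \<le> regret xs e t) \<and>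
     (s vBest 0 = M * M \<or> s vBestEvent 0 \<in> unscheduled I (set xs) \<and> s vBestSlot 0 \<in> slots I \<and>
        s vBest 0 = regret xs (s vBestEvent 0) (s vBestSlot 0))"

lemma best_cong:
  "s' vBest = s vBest \<Longrightarrow> s' vBestEvent = s vBestEvent \<Longrightarrow> s' vBestSlot = s vBestSlot \<Longrightarrow> best xs U s' \<longleftrightarrow> best xs U s"
  by (simp add: best_def)

lemma agrees_cong: "s' aSl = s aSl \<Longrightarrow> agrees xs s' \<longleftrightarrow> agrees xs s"
  by (simp add: agrees_def)

lemma agrees_upd:
  assumes "agrees xs s" "f \<notin> fst ` set xs" "s' aSl = (s aSl)(f := v)"
  shows "agrees xs s'"
proof -
  have "e < n \<and> t \<in> slots I \<and> s' aSl e = t" if "(e, t) \<in> set xs" for e t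
  proof -
    have "e \<in> fst ` set xs" using that by (rule image_eqI[rotated]) simp
    then have "e \<noteq> f" using assms(2) by metis
    moreover have "e < n \<and> t \<in> slots I \<and> s aSl e = t" using assms(1) that by (auto simp: agrees_def)
    ultimately show ?thesis using assms(3) by simp
  qed
  then show ?thesis by (auto simp: agrees_def)
qed

lemma agrees_cover:
  assumes "agrees xs s"
  shows "(\<Union>e\<in>fst ` set xs. window I e (s aSl e)) = cover I (set xs)"
proof -
  have "window I (fst p) (s aSl (fst p)) = (case p of (e, t) \<Rightarrow> window I e t)" if "p \<in> set xs" for p
    using assms that by (auto simp: agrees_def)
  then show ?thesis unfolding cover_def image_image by simp
qed

lemma run_try_slot:
  assumes f: "f \<in> unscheduled I (set xs)" "A = fst ` set xs" and t: "t < horizon I"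
    and s: "sched (insert f A) s" "agrees xs s" "best xs U s" "s vF 0 = f" "s vT 0 = t"
  shows "sched (insert f A) (run inp try_slot s)" "agrees xs (run inp try_slot s)"
    "best xs (insert (f, Suc t) U) (run inp try_slot s)"
proof -
  define s1 where "s1 = put vAcc 0 0 (put aSl f (Suc t) s)"
  define s2 where "s2 = run inp eval_stmt s1"
  have fn: "f < n" "f \<notin> A" using f by (auto simp: unscheduled_eq events_def)
  have st: "Suc t \<in> slots I" using t by (simp add: slots_def)
  have sc1: "sched (insert f A) s1" using s(1) st by (auto simp: sched_def s1_def put_def ready_def)
  have ag1: "agrees xs s1" using s(2) fn(2) unfolding f(2) by (rule agrees_upd[where v = "Suc t"]) (simp add: s1_def put_other put_self fun_upd_def)
  have b1: "best xs U s1" using s(3) by (simp add: best_def s1_def put_other)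
  have "(\<Union>e\<in>insert f A. window I e (s1 aSl e)) = cover I (insert (f, Suc t) (set xs))"
  proof -
    have "(\<Union>e\<in>A. window I e (s1 aSl e)) = cover I (set xs)"
      unfolding f(2) by (rule agrees_cover[OF ag1])
    moreover have "s1 aSl f = Suc t" by (simp add: s1_def put_def)
    ultimately show ?thesis by simp
  qed
  then have acc: "s2 vAcc 0 = regret xs f (Suc t)"
    unfolding s2_def regret_def using run_waste[OF sc1] by (simp add: s1_def put_self)
  have fr: "s2 0 = s1 0" "s2 vW = s1 vW" "s2 aInc = s1 aInc" "s2 aExc = s1 aExc" "s2 aSl = s1 aSl" "s2 vF = s1 vF" "s2 vT = s1 vT"
    "s2 vBest = s1 vBest" "s2 vBestEvent = s1 vBestEvent" "s2 vBestSlot = s1 vBestSlot"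
    by (simp_all add: s2_def run_frame)
  have regs: "s2 vF 0 = f" "s2 vT 0 = t" using fr s(4,5) by (simp_all add: s1_def put_other)
  have b2: "best xs U s2" using b1 fr by (subst best_cong[of _ s1]) simp_all
  have run: "run inp try_slot s = (if s2 vAcc 0 < s2 vBest 0 then put vBestSlot 0 (Suc t) (put vBestEvent 0 f (put vBest 0 (s2 vAcc 0) s2)) else s2)"
    using regs s(4,5) by (simp add: try_slot_def s1_def s2_def put_other)
  have sc2: "sched (insert f A) s2" using sc1 fr by (subst sched_cong[of _ s1]) simp_all
  have ag2: "agrees xs s2" using ag1 fr by (subst agrees_cong[of _ s1]) simp_all
  show "sched (insert f A) (run inp try_slot s)" using sc2 unfolding run by (simp add: sched_def ready_def put_other)
  show "agrees xs (run inp try_slot s)" using ag2 unfolding run by (simp add: agrees_def put_other)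
  show "best xs (insert (f, Suc t) U) (run inp try_slot s)"
  proof (cases "s2 vAcc 0 < s2 vBest 0")
    case True
    then have "run inp try_slot s vBest 0 = regret xs f (Suc t)" "run inp try_slot s vBestEvent 0 = f"
      "run inp try_slot s vBestSlot 0 = Suc t" unfolding run by (simp_all add: put_self put_other acc)
    moreover have "regret xs f (Suc t) \<le> regret xs e t'" if "(e, t') \<in> U" for e t'
    proof -
      have "s2 vBest 0 \<le> regret xs e t'" using b2 that by (auto simp: best_def)
      then show ?thesis using True acc by simp
    qed
    ultimately show ?thesis using f(1) st unfolding best_def by auto
  next
    case False
    then show ?thesis using b2 acc unfolding run by (simp add: best_def)
  qed
qed

lemma run_try_event:
  assumes A: "A = fst ` set xs" and f: "f < n"
    and s: "sched A s" "agrees xs s" "best xs U s" "s vF 0 = f"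
  shows "sched A (run inp try_event s) \<and> agrees xs (run inp try_event s) \<and>
    best xs (U \<union> (if f \<in> A then {} else {f} \<times> slots I)) (run inp try_event s)"
proof (cases "f \<in> A")
  case True
  then have "run inp try_event s = s" using s f by (simp add: try_event_def sched_def)
  then show ?thesis using s True by simp
next
  case False
  then have un: "f \<in> unscheduled I (set xs)" using A f by (simp add: unscheduled_eq events_def)
  let ?s = "put aExc f 0 (put aInc f 1 s)"
  let ?P = "\<lambda>t s'. sched (insert f A) s' \<and> agrees xs s' \<and> best xs (U \<union> {f} \<times> {1..t}) s' \<and> s' vF 0 = f"
  have "?P (horizon I) (run inp (ForTo vT (Inp (Num 1)) try_slot) ?s)"
  proof (rule ForTo_rule[of ?P])
    show "?P 0 ?s" using s f False by (auto simp: sched_def agrees_def best_def put_def ready_def events_def)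
    show "horizon I \<le> M" by simp
    show "?P i (put vT 0 v s')" if "?P i s'" for i s' v
      using that by (simp add: sched_def agrees_def best_def put_other ready_def)
    show "val_of inp (Inp (Num 1)) s' = horizon I" for s' by simp
    fix t s' assume t: "t < horizon I" "s' vT 0 = t" and P: "?P t s'"
    note r = run_try_slot[OF un A t(1), of s' "U \<union> {f} \<times> {1..t}"]
    have "run inp try_slot s' vF = s' vF" by (simp add: run_frame)
    moreover have "insert (f, Suc t) (U \<union> {f} \<times> {1..t}) = U \<union> {f} \<times> {1..Suc t}" by (auto simp: le_Suc_eq)
    ultimately show "?P (Suc t) (run inp try_slot s')" using r P t(2) by simp
  qed
  moreover define s2 where "s2 = run inp (ForTo vT (Inp (Num 1)) try_slot) ?s"
  ultimately have P: "?P (horizon I) s2" by simp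
  have "s aInc f = 0" using s(1) f False by (simp add: sched_def)
  then have run: "run inp try_event s = put aExc f 1 (put aInc f 0 s2)"
    using s(4) P by (simp add: try_event_def s2_def[symmetric] put_other s2_def)
  have "sched A (put aExc f 1 (put aInc f 0 s2))" using P False by (auto simp: sched_def put_def ready_def)
  then show ?thesis using P False unfolding run by (simp add: agrees_def best_def put_other slots_def)
qed

definition progress :: "nat \<Rightarrow> (nat \<times> nat) list \<Rightarrow> state \<Rightarrow> bool" where
  "progress k xs s \<longleftrightarrow> sched (fst ` set xs) s \<and> agrees xs s \<and> greedy_steps I xs \<and> length xs = k \<and>
     card (fst ` set xs) = k \<and> (\<forall>i<2 * k. s aOut i = encode_schedule xs ! i)"

lemma length_encode_schedule: "length (encode_schedule xs) = 2 * length xs"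
  by (induction xs) (auto simp: encode_schedule_def)

lemma run_round_stmt:
  assumes "progress k xs s" "k < n" "s vR 0 = k"
  shows "\<exists>xs. progress (Suc k) xs (run inp round_stmt s)"
proof -
  let ?A = "fst ` set xs"
  let ?s0 = "put vBest 0 (M * M) s"
  let ?P = "\<lambda>f s'. sched ?A s' \<and> agrees xs s' \<and> best xs (({..<f} - ?A) \<times> slots I) s'"
  have sc: "sched ?A s" and ag: "agrees xs s" and out: "\<And>i. i < 2 * k \<Longrightarrow> s aOut i = encode_schedule xs ! i"
    and k: "greedy_steps I xs" "length xs = k" "card ?A = k" using assms(1) by (auto simp: progress_def)
  define s1 where "s1 = run inp (ForTo vF (Inp (Num 2)) try_event) ?s0"
  have P1: "?P n s1" unfolding s1_def
  proof (rule ForTo_rule[of ?P])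
    show "?P 0 ?s0" using sc ag by (simp add: sched_def agrees_def best_def put_other put_self ready_def)
    show "n \<le> M" using code_bounds(1) by simp
    show "?P i (put vF 0 v s')" if "?P i s'" for i s' v
      using that by (simp add: sched_def agrees_def best_def put_other ready_def)
    show "val_of inp (Inp (Num 2)) s' = n" for s' by simp
    fix f s' assume f: "f < n" "s' vF 0 = f" and P: "?P f s'"
    note r = run_try_event[OF refl f(1), of xs s' "({..<f} - ?A) \<times> slots I"]
    have "({..<f} - B) \<times> slots I \<union> (if f \<in> B then {} else {f} \<times> slots I) = ({..<Suc f} - B) \<times> slots I" for B
      by (auto simp: less_Suc_eq)
    from this[of ?A] show "?P (Suc f) (run inp try_event s')" using r P f(2) by simp
  qed
  \<comment> \<open>Fewer than \<open>n\<close> events are scheduled, so some pair was tried and the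
    initial \<open>M * M\<close> has been replaced.\<close>
  have "\<not> {..<n} \<subseteq> ?A" using card_mono[of ?A "{..<n}"] k(3) assms(2) by auto
  then obtain e0 where e0: "e0 < n" "e0 \<notin> ?A" by auto
  have "1 \<in> slots I" using inst by (simp add: slots_def psba_instance_def)
  then have "s1 vBest 0 \<le> regret xs e0 1" using P1 e0 by (auto simp: best_def)
  then have "s1 vBest 0 < M * M" using waste_less by (simp add: regret_def le_less_trans)
  then have b: "s1 vBestEvent 0 \<in> unscheduled I (set xs)" "s1 vBestSlot 0 \<in> slots I"
      "s1 vBest 0 = regret xs (s1 vBestEvent 0) (s1 vBestSlot 0)" using P1 by (auto simp: best_def)
  let ?e = "s1 vBestEvent 0" and ?t = "s1 vBestSlot 0"
  have en: "?e < n" "?e \<notin> ?A" using b(1) by (auto simp: unscheduled_eq events_def)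
  have sub: "set xs \<subseteq> events I \<times> slots I" using ag by (auto simp: agrees_def events_def)
  have "greedy_choice I (set xs) ?e ?t"
  proof (rule greedy_choiceI[OF inst sub b(1,2)])
    fix e' t' assume "e' \<in> unscheduled I (set xs)" "t' \<in> slots I"
    then show "waste I (cover I (insert (?e, ?t) (set xs))) \<le> waste I (cover I (insert (e', t') (set xs)))"
      using P1 b(3) by (auto simp: best_def regret_def unscheduled_eq events_def)
  qed
  then have gs: "greedy_steps I (xs @ [(?e, ?t)])" by (rule greedy_steps.step[OF k(1)])
  have R: "s1 vR 0 = k" "s1 aOut = s aOut"
    using assms(3) by (simp_all add: s1_def run_frame put_other)
  let ?s2 = "put aOut (Suc (k + k)) ?t (put aOut (k + k) ?e (put aSl ?e ?t (put aExc ?e 0 (put aInc ?e 1 s1))))"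
  have "val_of inp (Mul Bound Bound) s = M * M" using M_le_power sc by (subst val_Mul) (auto simp: sched_def)
  then have run: "run inp round_stmt s = ?s2"
    using R by (simp add: round_stmt_def s1_def[symmetric] record_stmt_def put_other)
  have vals: "?s2 0 = s1 0" "?s2 vW = s1 vW" "?s2 aInc = (s1 aInc)(?e := 1)" "?s2 aExc = (s1 aExc)(?e := 0)"
      "?s2 aSl = (s1 aSl)(?e := ?t)"
    by (simp_all add: put_other put_self fun_upd_def)
  have "sched (insert ?e ?A) ?s2"
    unfolding sched_def ready_def vals
  proof (intro conjI allI impI)
    have sc1: "sched ?A s1" using P1 by simp
    then show "s1 0 0 = 2 ^ (M * M)" "s1 vW 0 = 1" "insert ?e ?A \<subseteq> events I"
      using en(1) by (simp_all add: sched_def ready_def events_def)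
    fix e assume "e < n"
    then have "s1 aInc e = of_bool (e \<in> ?A)" "s1 aExc e = of_bool (e \<notin> ?A)" "s1 aSl e \<in> slots I"
      using sc1 by (simp_all add: sched_def)
    then show "((s1 aInc)(?e := 1)) e = of_bool (e \<in> insert ?e ?A)"
      "((s1 aExc)(?e := 0)) e = of_bool (e \<notin> insert ?e ?A)" "((s1 aSl)(?e := ?t)) e \<in> slots I"
      using b(2) by simp_all
  qed
  moreover have "agrees (xs @ [(?e, ?t)]) ?s2"
  proof -
    have "agrees xs s1" using P1 by simp
    from agrees_upd[where s' = ?s2, OF this en(2) vals(5)] have "agrees xs ?s2" .
    moreover have "?s2 aSl ?e = ?t" by (simp add: put_other put_self)
    ultimately show ?thesis using en(1) b(2) by (simp only: agrees_def set_append list.set ball_Un) simp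
  qed
  moreover have "?s2 aOut i = encode_schedule (xs @ [(?e, ?t)]) ! i" if "i < 2 * Suc k" for i
  proof -
    have enc: "encode_schedule (xs @ [(?e, ?t)]) = encode_schedule xs @ [?e, ?t]" by (simp add: encode_schedule_def)
    have len: "length (encode_schedule xs) = k + k" using k(2) by (simp add: length_encode_schedule)
    have "i < k + k \<or> i = k + k \<or> i = Suc (k + k)" using \<open>i < 2 * Suc k\<close> by arith
    then consider "i < k + k" | "i = k + k" | "i = Suc (k + k)" by blast
    then show ?thesis using len out[of i] R(2) unfolding enc by cases (simp_all add: nth_append put_def)
  qed
  moreover have "card (insert ?e ?A) = Suc k" using en k(3) by simp
  ultimately have "progress (Suc k) (xs @ [(?e, ?t)]) (run inp round_stmt s)"
    unfolding run progress_def using gs k(2) by (simp add: insert_commute)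
  then show ?thesis by blast
qed

lemma run_init_stmt:
  assumes "ready s"
  shows "sched {} (run inp init_stmt s)"
proof -
  let ?c = "Then (Upd aInc (Var vF) (Num 0)) (Then (Upd aExc (Var vF) (Num 1)) (Upd aSl (Var vF) (Num 1)))"
  let ?P = "\<lambda>k s'. ready s' \<and> s' vW 0 = 1 \<and> (\<forall>e<k. s' aInc e = 0 \<and> s' aExc e = 1 \<and> s' aSl e = 1)"
  have "?P n (run inp (ForTo vF (Inp (Num 2)) ?c) (put vW 0 1 s))"
    by (rule ForTo_rule[of ?P]) (use assms code_bounds(1) in \<open>auto simp: ready_def put_def less_Suc_eq\<close>)
  moreover have "1 \<in> slots I" using inst by (simp add: slots_def psba_instance_def)
  ultimately show ?thesis by (simp add: init_stmt_def sched_def)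
qed

lemma run_greedy_stmt:
  assumes "ready s"
  shows "\<exists>xs. greedy_run I xs \<and> run inp greedy_stmt s vLen 0 = 2 * n \<and>
    map (run inp greedy_stmt s aOut) [0..<2 * n] = encode_schedule xs"
proof -
  let ?s = "run inp init_stmt s"
  let ?P = "\<lambda>k s'. \<exists>xs. progress k xs s'"
  have "?P n (run inp (ForTo vR (Inp (Num 2)) round_stmt) ?s)"
  proof (rule ForTo_rule[of ?P])
    have "progress 0 [] ?s" using run_init_stmt[OF assms] by (simp add: progress_def agrees_def greedy_steps.start)
    then show "?P 0 ?s" by blast
    show "n \<le> M" using code_bounds(1) by simp
    show "?P i (put vR 0 v s')" if "?P i s'" for i s' v
      using that by (simp add: progress_def sched_def agrees_def put_other ready_def)
    show "val_of inp (Inp (Num 2)) s' = n" for s' by simp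
    show "?P (Suc k) (run inp round_stmt s')" if "k < n" "?P k s'" "s' vR 0 = k" for k s'
      using that(2) run_round_stmt that(1,3) by blast
  qed
  then obtain xs where P: "progress n xs (run inp (ForTo vR (Inp (Num 2)) round_stmt) ?s)" by blast
  let ?s2 = "run inp (ForTo vR (Inp (Num 2)) round_stmt) ?s"
  have run: "run inp greedy_stmt s = put vLen 0 (2 * n) ?s2" by (simp add: greedy_stmt_def mult_2)
  have "fst ` set xs \<subseteq> events I" using P by (simp add: progress_def sched_def)
  then have "fst ` set xs = events I"
    using P card_subset_eq[of "events I" "fst ` set xs"] by (simp add: progress_def events_def)
  then have "greedy_run I xs" using P by (simp add: greedy_run_def progress_def unscheduled_eq)
  moreover have "map (put vLen 0 (2 * n) ?s2 aOut) [0..<2 * n] = encode_schedule xs"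
    using P by (intro nth_equalityI) (auto simp: progress_def length_encode_schedule put_other)
  ultimately show ?thesis unfolding run by (auto simp: put_self)
qed

lemma ready_power_stage: "ready (run inp power_stage s)"
  using run_power_stage[of inp s] by (simp add: ready_def)

end

text \<open>The number \<open>64\<close> exceeds every array name in use and is the stride of the
  interleaved arrays.\<close>

abbreviation "greedy_program \<equiv> program 64 aOut vLen greedy_stmt"

lemma scoped_eval_stmt [simp]: "scoped 64 eval_stmt"
  by (auto simp: eval_stmt_def events_stmt_def event_stmt_def skip_stmt_def skip_at_def insert_stmt_def window_size_def
    agent_stmt_def jobs_stmt_def job_stmt_def job_field_def serve_stmt_def count_stmt_def count_step_def Let_def)

lemma scoped_greedy_stmt: "scoped 64 greedy_stmt" "0 \<notin> assigned greedy_stmt"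
  by (auto simp: greedy_stmt_def init_stmt_def round_stmt_def try_event_def try_slot_def record_stmt_def)

lemma greedy_final:
  assumes "psba_instance I"
  shows "\<exists>xs. greedy_run I xs \<and>
    final_state (encode_instance I) greedy_stmt vLen 0 = 2 * length (ev_lengths I) \<and>
    2 * length (ev_lengths I) \<le> 8 * length (encode_instance I) \<and>
    map (final_state (encode_instance I) greedy_stmt aOut) [0..<2 * length (ev_lengths I)] = encode_schedule xs"
proof -
  interpret psba_run I using assms by unfold_locales
  show ?thesis unfolding final_state_def using run_greedy_stmt[OF ready_power_stage] code_bounds(5) by blast
qed

theorem greedy_program_correct: "implements_greedy greedy_program"
  unfolding implements_greedy_def
proof (intro allI impI)
  fix I assume I: "psba_instance I"
  obtain xs where xs: "greedy_run I xs"
    "final_state (encode_instance I) greedy_stmt vLen 0 = 2 * length (ev_lengths I)"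
    "2 * length (ev_lengths I) \<le> 8 * length (encode_instance I)"
    "map (final_state (encode_instance I) greedy_stmt aOut) [0..<2 * length (ev_lengths I)] = encode_schedule xs"
    using greedy_final[OF I] by (elim exE conjE)
  have "outputs greedy_program I xs"
    by (rule outputs_program[OF scoped_greedy_stmt]) (simp_all add: xs)
  then show "\<exists>xs. outputs greedy_program I xs \<and> greedy_run I xs" using xs(1) by blast
qed

theorem greedy_program_polynomial: "polynomial_time greedy_program (bounded_instances q)"
proof (rule polynomial_time_program[OF scoped_greedy_stmt])
  fix I assume "I \<in> bounded_instances q"
  then have "psba_instance I" by (simp add: bounded_instances_def)
  from greedy_final[OF this] show "final_state (encode_instance I) greedy_stmt vLen 0 \<le> 8 * length (encode_instance I)"
    by (elim exE conjE) simp
qed simp_all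

section \<open>The local search program\<close>

abbreviation (input) "vK \<equiv> 33 :: nat"
abbreviation (input) "aW \<equiv> 34 :: nat"
abbreviation (input) "vScale \<equiv> 35 :: nat"
abbreviation (input) "vGlobal \<equiv> 36 :: nat"
abbreviation (input) "aBest \<equiv> 37 :: nat"
abbreviation (input) "vE0 \<equiv> 38 :: nat"
abbreviation (input) "vT0 \<equiv> 39 :: nat"
abbreviation (input) "vCur \<equiv> 40 :: nat"
abbreviation (input) "vOld \<equiv> 41 :: nat"
abbreviation (input) "vI \<equiv> 50 :: nat"

abbreviation (input) "eCount \<equiv> Inp (Num 2)"
abbreviation (input) "eLevels \<equiv> Add (Add eCount eCount) (Add eCount eCount)"

definition IfNeq :: "expr \<Rightarrow> expr \<Rightarrow> stmt \<Rightarrow> stmt" where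
  "IfNeq a b c = IfLess a b c (IfLess b a c Nop)"

text \<open>Nesting \<open>k\<close> loops executes the body \<open>M ^ k\<close> times, which
  provides a polynomial number of passes within a language whose single loops have length
  \<open>M\<close>.\<close>

primrec Repeat :: "nat list \<Rightarrow> stmt \<Rightarrow> stmt" where
  "Repeat [] c = c"
| "Repeat (x # xs) c = For x (Repeat xs c)"

definition mix_stmt :: stmt where
  "mix_stmt = ForTo vI eCount
     (Then (Upd aInc (Var vI) (Add (Var vK) (Num 1)))
     (Then (Upd aExc (Var vI) (Sub eLevels (Add (Var vK) (Num 1))))
       (IfEq (Var vI) (Var vE0) (Then (Upd aInc (Var vI) eLevels) (Upd aExc (Var vI) (Num 0))))))"

definition level_stmt :: stmt where
  "level_stmt = Then mix_stmt (Then (Upd vW (Num 0) (Arr aW (Add (Var vK) (Num 1)))) eval_stmt)"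

definition potential_stmt :: stmt where
  "potential_stmt = Then (Upd vAcc (Num 0) (Num 0)) (ForTo vK eLevels level_stmt)"

text \<open>With \<open>vK = i\<close>, level \<open>levels - Suc i\<close> is computed from level
  \<open>levels - i\<close>, the recursion of \<open>weight_seq\<close>.\<close>

definition weights_stmt :: stmt where
  "weights_stmt = Then (Upd aW eLevels (Mul (Mul eLevels eLevels) eLevels))
     (ForTo vK (Sub eLevels (Num 1)) (Upd aW (Sub (Sub eLevels (Num 1)) (Var vK))
       (Quot (Mul (Mul (Arr aW (Sub eLevels (Var vK))) eLevels) (Sub eLevels (Var vK)))
         (Mul (Add eLevels (Num 1)) (Sub (Sub eLevels (Num 1)) (Var vK))))))"

definition scale_stmt :: stmt where
  "scale_stmt = Then (Upd vScale (Num 0) (Num 1)) (ForTo vI eCount (Upd vScale (Num 0) (Mul (Var vScale) eLevels)))"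

text \<open>First-improvement rule: a strictly smaller rounded value is accepted at once, any other
  move is undone from \<open>vOld\<close>.\<close>

definition move_stmt :: stmt where
  "move_stmt = Then (Upd vOld (Num 0) (Arr aSl (Var vF))) (Then (Upd aSl (Var vF) (Add (Var vT) (Num 1)))
     (Then potential_stmt (IfLess (Quot (Var vAcc) (Var vScale)) (Var vCur)
       (Upd vCur (Num 0) (Quot (Var vAcc) (Var vScale))) (Upd aSl (Var vF) (Var vOld)))))"

definition pass_stmt :: stmt where
  "pass_stmt = ForTo vF eCount (IfNeq (Var vF) (Var vE0) (ForTo vT (Inp (Num 1)) move_stmt))"

definition search_stmt :: stmt where
  "search_stmt = Then (ForTo vI eCount (Upd aSl (Var vI) (Num 1))) (Then (Upd aSl (Var vE0) (Add (Var vT0) (Num 1)))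
     (Then potential_stmt (Then (Upd vCur (Num 0) (Quot (Var vAcc) (Var vScale)))
       (Repeat [42, 43, 44, 45, 46, 47, 48, 49] pass_stmt))))"

text \<open>Weights \<open>1\<close> and \<open>0\<close> for all events give the true waste of the
  local optimum, by which the results of the different guesses are compared.\<close>

definition check_stmt :: stmt where
  "check_stmt = Then (ForTo vI eCount (Then (Upd aInc (Var vI) (Num 1)) (Upd aExc (Var vI) (Num 0))))
     (Then (Upd vW (Num 0) (Num 1)) (Then (Upd vAcc (Num 0) (Num 0)) (Then eval_stmt
       (IfLess (Var vAcc) (Var vGlobal) (Then (Upd vGlobal (Num 0) (Var vAcc))
         (ForTo vI eCount (Upd aBest (Var vI) (Arr aSl (Var vI))))) Nop))))"

definition local_stmt :: stmt where
  "local_stmt = Then weights_stmt (Then scale_stmt (Then (Upd vGlobal (Num 0) (Mul Bound Bound))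
     (Then (ForTo vE0 eCount (ForTo vT0 (Inp (Num 1)) (Then search_stmt check_stmt)))
     (Then (ForTo vI eCount (Then (Upd aOut (Add (Var vI) (Var vI)) (Var vI))
         (Upd aOut (Add (Add (Var vI) (Var vI)) (Num 1)) (Arr aBest (Var vI)))))
       (Upd vLen (Num 0) (Add eCount eCount))))))"

lemma assigned_IfNeq [simp]: "assigned (IfNeq a b c) = assigned c"
  by (auto simp: IfNeq_def)

lemma assigned_Repeat [simp]: "assigned (Repeat xs c) = set xs \<union> assigned c"
  by (induction xs) auto

lemma scoped_IfNeq [simp]:
  "scoped R (IfNeq a b c) \<longleftrightarrow> reads a \<subseteq> {..<R} \<and> reads b \<subseteq> {..<R} \<and> scoped R c"
  by (auto simp: IfNeq_def)

lemma scoped_Repeat: "distinct xs \<Longrightarrow> set xs \<subseteq> {..<R} \<Longrightarrow> set xs \<inter> assigned c = {} \<Longrightarrow> scoped R c \<Longrightarrow> scoped R (Repeat xs c)"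
  by (induction xs) auto

lemma run_IfNeq: "run inp (IfNeq a b c) s = (if val_of inp a s = val_of inp b s then s else run inp c s)"
  by (simp add: IfNeq_def)

lemma assigned_mix_stmt [simp]: "assigned mix_stmt = {vI, aInc, aExc}"
  by (auto simp: mix_stmt_def)

lemma assigned_level_stmt [simp]: "assigned level_stmt = assigned eval_stmt \<union> {vI, aInc, aExc, vW}"
  by (auto simp: level_stmt_def)

lemma assigned_potential_stmt [simp]: "assigned potential_stmt = assigned level_stmt \<union> {vK}"
  by (auto simp: potential_stmt_def)

lemma assigned_move_stmt [simp]: "assigned move_stmt = assigned potential_stmt \<union> {vOld, aSl, vCur}"
  by (auto simp: move_stmt_def)

lemma assigned_pass_stmt [simp]: "assigned pass_stmt = assigned move_stmt \<union> {vF, vT}"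
  by (auto simp: pass_stmt_def)

lemma assigned_search_stmt [simp]: "assigned search_stmt = assigned pass_stmt \<union> {42..49}"
  by (auto simp: search_stmt_def)

lemma assigned_check_stmt [simp]:
  "assigned check_stmt = assigned eval_stmt \<union> {vI, aInc, aExc, vW, vGlobal, aBest}"
  by (auto simp: check_stmt_def)

section \<open>Correctness of the local search program\<close>

context machine
begin

lemma Repeat_rule:
  assumes "P k s" "\<And>i s v x. x \<in> set xs \<Longrightarrow> P i s \<Longrightarrow> P i (put x 0 v s)"
    and "\<And>i s. P i s \<Longrightarrow> P (Suc i) (run inp c s)"
  shows "P (k + M ^ length xs) (run inp (Repeat xs c) s)"
  using assms(1,2)
proof (induction xs arbitrary: k s)
  case Nil
  then show ?case using assms(3) by simp
next
  case (Cons x xs)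
  have "P (k + M * M ^ length xs) (run inp (For x (Repeat xs c)) s)"
  proof (rule For_rule[of "\<lambda>i. P (k + i * M ^ length xs)"])
    show "P (k + 0 * M ^ length xs) s" using Cons.prems(1) by simp
    show "P (k + i * M ^ length xs) (put x 0 v s')" if "P (k + i * M ^ length xs) s'" for i s' v
      by (rule Cons.prems(2)[OF _ that]) simp
    fix i s' assume "P (k + i * M ^ length xs) s'"
    then have "P (k + i * M ^ length xs + M ^ length xs) (run inp (Repeat xs c) s')"
      by (rule Cons.IH) (simp add: Cons.prems(2))
    moreover have "k + Suc i * M ^ length xs = k + i * M ^ length xs + M ^ length xs" by simp
    ultimately show "P (k + Suc i * M ^ length xs) (run inp (Repeat xs c) s')" by (simp only:)
  qed
  then show ?case by simp
qed

end

context psba_run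
begin

definition levels :: nat where
  "levels = 4 * n"

abbreviation "level \<equiv> level_weight levels (levels ^ 3)"

text \<open>Dividing by \<open>levels ^ n\<close>, the total weight of all samples at one level,
  brings the potential down to polynomial size and thereby bounds the number of
  improvements.\<close>

definition cost :: "nat \<Rightarrow> (nat \<Rightarrow> nat) \<Rightarrow> nat" where
  "cost e0 sl = potential I levels level e0 sl div levels ^ n"

definition valid :: "(nat \<Rightarrow> nat) \<Rightarrow> bool" where
  "valid sl \<longleftrightarrow> (\<forall>e<n. sl e \<in> slots I)"

lemma levels_sum [simp]: "n + n + (n + n) = levels"
  by (simp add: levels_def)

lemma levels_le: "levels \<le> M"
  using code_bounds(1) by (simp add: levels_def)

lemma levels_pos: "e < n \<Longrightarrow> 1 \<le> levels"
  by (simp add: levels_def)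

lemma val_levels: "val_of inp eLevels s = levels"
  by simp

lemma level_le:
  assumes "1 \<le> k" "k \<le> levels"
  shows "level k \<le> M ^ 4"
proof -
  have "level k \<le> k * level k" using assms(1) by simp
  also have "\<dots> \<le> levels * levels ^ 3" by (rule level_weight_bound[OF assms(2,1)])
  also have "\<dots> \<le> M * M ^ 3" using levels_le by (intro mult_le_mono power_mono) simp_all
  finally show ?thesis by (simp add: numeral_eq_Suc)
qed

lemma run_mix_stmt:
  assumes "s vK 0 = k" "s vE0 0 = e0" "Suc k \<le> levels" "e < n"
  shows "run inp mix_stmt s aInc e = include_weight levels e0 (Suc k) e \<and>
    run inp mix_stmt s aExc e = exclude_weight levels e0 (Suc k) e"
proof -
  let ?c = "Then (Upd aInc (Var vI) (Add (Var vK) (Num 1)))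
     (Then (Upd aExc (Var vI) (Sub eLevels (Add (Var vK) (Num 1))))
       (IfEq (Var vI) (Var vE0) (Then (Upd aInc (Var vI) eLevels) (Upd aExc (Var vI) (Num 0)))))"
  let ?P = "\<lambda>i s'. s' vK 0 = k \<and> s' vE0 0 = e0 \<and> (\<forall>e<i. s' aInc e = include_weight levels e0 (Suc k) e \<and>
    s' aExc e = exclude_weight levels e0 (Suc k) e)"
  have "?P n (run inp (ForTo vI eCount ?c) s)"
  proof (rule ForTo_rule[of ?P])
    fix i s' assume "i < n" and P: "?P i s'" and i: "s' vI 0 = i"
    then show "?P (Suc i) (run inp ?c s')"
      by (simp add: run_IfEq put_other put_self less_Suc_eq include_weight_def exclude_weight_def)
  qed (use assms code_bounds(1) in \<open>simp_all add: put_other\<close>)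
  then show ?thesis using assms(4) by (simp add: mix_stmt_def)
qed

definition base :: "nat \<Rightarrow> nat \<Rightarrow> state \<Rightarrow> bool" where
  "base e0 t0 s \<longleftrightarrow> ready s \<and> s vE0 0 = e0 \<and> valid (s aSl) \<and> s aSl e0 = t0 \<and>
     (\<forall>k. 1 \<le> k \<and> k \<le> levels \<longrightarrow> s aW k = level k) \<and> s vScale 0 = levels ^ n"

lemma base_cong:
  "s' 0 = s 0 \<Longrightarrow> s' vE0 = s vE0 \<Longrightarrow> s' aSl = s aSl \<Longrightarrow> s' aW = s aW \<Longrightarrow> s' vScale = s vScale \<Longrightarrow>
    base e0 t0 s' \<longleftrightarrow> base e0 t0 s"
  by (simp add: base_def ready_def)

lemma run_level_stmt:
  assumes s: "base e0 t0 s" "s vK 0 = k" "k < levels"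
  shows "run inp level_stmt s vAcc 0 = s vAcc 0 + level (Suc k) *
    wsum (include_weight levels e0 (Suc k)) (exclude_weight levels e0 (Suc k)) (events I)
      (\<lambda>E. waste I (\<Union>e\<in>E. window I e (s aSl e)))"
proof -
  define s1 where "s1 = run inp mix_stmt s"
  define s2 where "s2 = put vW 0 (level (Suc k)) s1"
  have b: "ready s" "s vE0 0 = e0" "valid (s aSl)" "s aW (Suc k) = level (Suc k)" using s by (simp_all add: base_def)
  have fr: "s1 0 = s 0" "s1 vK = s vK" "s1 aSl = s aSl" "s1 aW = s aW" "s1 vAcc = s vAcc"
    by (simp_all add: s1_def run_frame)
  have run: "run inp level_stmt s = run inp eval_stmt s2"
    using s(2) b(4) fr by (simp add: level_stmt_def s1_def[symmetric] s2_def)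
  have w: "s2 aInc e = include_weight levels e0 (Suc k) e" "s2 aExc e = exclude_weight levels e0 (Suc k) e" if "e < n" for e
    using run_mix_stmt[where s = s, OF s(2) b(2)] that s(3) by (simp_all add: s1_def s2_def put_other)
  have fr2: "s2 aSl = s aSl" "s2 vW 0 = level (Suc k)" "s2 vAcc = s vAcc" "s2 0 = s 0"
    using fr by (simp_all add: s2_def put_other put_self)
  have "ready s2" using b(1) fr2(4) by (simp add: ready_def)
  moreover have "valid_choice s2"
    unfolding valid_choice_def
  proof (intro allI impI)
    fix e assume e: "e < n"
    have "s2 aInc e + s2 aExc e = levels" using w[OF e] s(3) by (simp add: include_weight_def exclude_weight_def)
    then show "s2 aSl e \<in> slots I \<and> 1 \<le> s2 aInc e + s2 aExc e \<and> s2 aInc e + s2 aExc e \<le> M"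
      using e b(3) levels_le levels_pos[OF e] by (simp add: fr2 valid_def)
  qed
  moreover have "s2 vW 0 \<le> 2 ^ (M * M)"
  proof -
    have "level (Suc k) \<le> M ^ 4" using s(3) by (intro level_le) simp_all
    also have "\<dots> \<le> 2 ^ (M * M)" using code_bounds(4) by (intro M_power_le) simp
    finally show ?thesis by (simp add: fr2)
  qed
  ultimately have "run inp eval_stmt s2 vAcc 0 = s2 vAcc 0 + s2 vW 0 *
    wsum (s2 aInc) (s2 aExc) (events I) (\<lambda>E. waste I (\<Union>e\<in>E. window I e (s2 aSl e)))" by (rule run_eval_stmt)
  moreover have "wsum (s2 aInc) (s2 aExc) (events I) h =
      wsum (include_weight levels e0 (Suc k)) (exclude_weight levels e0 (Suc k)) (events I) h" for h
    by (rule wsum_cong_weights) (simp_all add: w events_def)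
  ultimately show ?thesis unfolding run fr2 by simp
qed

lemma run_potential_stmt:
  assumes s: "base e0 t0 s"
  shows "run inp potential_stmt s vAcc 0 = potential I levels level e0 (s aSl)"
proof -
  let ?g = "\<lambda>k. level k * wsum (include_weight levels e0 k) (exclude_weight levels e0 k)
     (events I) (\<lambda>E. waste I (\<Union>e\<in>E. window I e (s aSl e)))"
  let ?P = "\<lambda>i s'. base e0 t0 s' \<and> s' aSl = s aSl \<and> s' vAcc 0 = (\<Sum>k<i. ?g (Suc k))"
  have "?P levels (run inp (ForTo vK eLevels level_stmt) (put vAcc 0 0 s))"
  proof (rule ForTo_rule[of ?P])
    show "?P 0 (put vAcc 0 0 s)" using s by (simp add: base_def ready_def put_other put_self)
    show "levels \<le> M" by (rule levels_le)
    have "base e0 t0 (put vK 0 v s') \<longleftrightarrow> base e0 t0 s'" for v s' by (rule base_cong) (simp_all add: put_other)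
    then show "?P i (put vK 0 v s')" if "?P i s'" for i s' v using that by (simp add: put_other)
    show "val_of inp eLevels s' = levels" for s' by (rule val_levels)
    fix i s' assume i: "i < levels" "s' vK 0 = i" and P: "?P i s'"
    have "base e0 t0 s'" using P by blast
    from run_level_stmt[OF this i(2,1)]
    have acc: "run inp level_stmt s' vAcc 0 = s' vAcc 0 + ?g (Suc i)" using P by simp
    have "base e0 t0 (run inp level_stmt s') \<longleftrightarrow> base e0 t0 s'" by (rule base_cong) (simp_all add: run_frame)
    moreover have "run inp level_stmt s' aSl = s' aSl" by (simp add: run_frame)
    ultimately show "?P (Suc i) (run inp level_stmt s')" using P acc by simp
  qed
  moreover have "(\<Sum>k<levels. ?g (Suc k)) = (\<Sum>k=1..levels. ?g k)"
    by (rule sum.reindex_bij_witness[of _ "\<lambda>k. k - 1" Suc]) auto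
  ultimately show ?thesis by (simp add: potential_stmt_def potential_def)
qed

lemma base_potential: "base e0 t0 (run inp potential_stmt s) \<longleftrightarrow> base e0 t0 s"
  by (rule base_cong) (simp_all add: run_frame)

lemma run_move_stmt:
  assumes s: "base e0 t0 s" "s vF 0 = e" "s vT 0 = t" "s vCur 0 = cost e0 (s aSl)"
    and e: "e < n" "e \<noteq> e0" "t < horizon I"
  shows "base e0 t0 (run inp move_stmt s) \<and> run inp move_stmt s vCur 0 = cost e0 (run inp move_stmt s aSl) \<and>
    run inp move_stmt s aSl = (if cost e0 ((s aSl)(e := Suc t)) < cost e0 (s aSl) then (s aSl)(e := Suc t) else s aSl)"
proof -
  define s1 where "s1 = put aSl e (Suc t) (put vOld 0 (s aSl e) s)"
  define s2 where "s2 = run inp potential_stmt s1"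
  have sl1: "s1 aSl = (s aSl)(e := Suc t)" by (simp add: s1_def put_def fun_eq_iff)
  have "valid (s1 aSl)" unfolding sl1 using s(1) e by (simp add: base_def valid_def slots_def)
  then have b1: "base e0 t0 s1" using s(1) e by (simp add: base_def ready_def s1_def put_other put_self)
  have b2: "base e0 t0 s2" using b1 by (simp add: s2_def base_potential)
  have "s2 vAcc 0 = potential I levels level e0 ((s aSl)(e := Suc t))"
    unfolding s2_def sl1[symmetric] by (rule run_potential_stmt[OF b1])
  then have c: "s2 vAcc 0 div s2 vScale 0 = cost e0 ((s aSl)(e := Suc t))" using b2 by (simp add: cost_def base_def)
  have fr: "s2 aSl = (s aSl)(e := Suc t)" "s2 vOld 0 = s aSl e" "s2 vCur = s vCur" "s2 vF = s vF"
    unfolding sl1[symmetric] by (simp_all add: s2_def run_frame s1_def put_other put_self fun_upd_def)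
  have "run inp (Upd vOld (Num 0) (Arr aSl (Var vF))) s = put vOld 0 (s aSl e) s"
    "run inp (Upd aSl (Var vF) (Add (Var vT) (Num 1))) (put vOld 0 (s aSl e) s) = s1"
    using s(2,3) by (simp_all add: s1_def put_other)
  then have "run inp move_stmt s = (if s2 vAcc 0 div s2 vScale 0 < s2 vCur 0 then put vCur 0 (s2 vAcc 0 div s2 vScale 0) s2
      else put aSl e (s aSl e) s2)"
    using fr s(2) unfolding move_stmt_def run.simps(3) s2_def[symmetric] by (simp add: s2_def)
  then have run: "run inp move_stmt s = (if cost e0 ((s aSl)(e := Suc t)) < cost e0 (s aSl)
      then put vCur 0 (cost e0 ((s aSl)(e := Suc t))) s2 else put aSl e (s aSl e) s2)"
    using c fr s(4) by simp
  show ?thesis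
  proof (cases "cost e0 ((s aSl)(e := Suc t)) < cost e0 (s aSl)")
    case True
    have "base e0 t0 (put vCur 0 (cost e0 ((s aSl)(e := Suc t))) s2) \<longleftrightarrow> base e0 t0 s2"
      by (rule base_cong) (simp_all add: put_other)
    then show ?thesis using True b2 fr unfolding run by (simp add: put_other put_self fun_upd_def)
  next
    case False
    have "put aSl e (s aSl e) s2 aSl = s aSl" using fr(1) by (simp add: put_self)
    moreover have "base e0 t0 (put aSl e (s aSl e) s2)"
      using b2 s(1) e(2) calculation by (simp add: base_def ready_def put_other)
    ultimately show ?thesis using False fr(3) s(4) unfolding run by (simp add: put_other)
  qed
qed

definition locally_optimal :: "nat \<Rightarrow> (nat \<Rightarrow> nat) \<Rightarrow> bool" where
  "locally_optimal e0 sl \<longleftrightarrow> (\<forall>e<n. e \<noteq> e0 \<longrightarrow> (\<forall>t<horizon I. cost e0 sl \<le> cost e0 (sl(e := Suc t))))"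

text \<open>A pass ends either with unchanged slots and every move rejected, or with a strictly
  smaller cost. The clause on \<open>locally_optimal\<close> records that the latter happens only if
  the start was not a local optimum, so a local optimum is never left.\<close>

definition scanned :: "nat \<Rightarrow> nat \<Rightarrow> (nat \<Rightarrow> nat) \<Rightarrow> nat \<Rightarrow> nat \<Rightarrow> state \<Rightarrow> bool" where
  "scanned e0 t0 sl f t s \<longleftrightarrow> base e0 t0 s \<and> s vCur 0 = cost e0 (s aSl) \<and>
     (s aSl = sl \<and> (\<forall>e t'. e < f \<or> e = f \<and> t' < t \<longrightarrow> e \<noteq> e0 \<longrightarrow> t' < horizon I \<longrightarrow> cost e0 sl \<le> cost e0 (sl(e := Suc t')))
      \<or> cost e0 (s aSl) < cost e0 sl \<and> \<not> locally_optimal e0 sl)"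

lemma scanned_put: "x \<notin> {0, vE0, aSl, aW, vScale, vCur} \<Longrightarrow> scanned e0 t0 sl f t (put x 0 v s) \<longleftrightarrow> scanned e0 t0 sl f t s"
  by (simp add: scanned_def base_def ready_def put_other)

lemma scanned_move:
  assumes "scanned e0 t0 sl f t s" "s vF 0 = f" "s vT 0 = t" "f < n" "f \<noteq> e0" "t < horizon I"
  shows "scanned e0 t0 sl f (Suc t) (run inp move_stmt s)"
proof -
  let ?s = "run inp move_stmt s"
  have s: "base e0 t0 s" "s vCur 0 = cost e0 (s aSl)" using assms(1) by (simp_all add: scanned_def)
  have m: "base e0 t0 ?s" "?s vCur 0 = cost e0 (?s aSl)"
    "?s aSl = (if cost e0 ((s aSl)(f := Suc t)) < cost e0 (s aSl) then (s aSl)(f := Suc t) else s aSl)"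
    using run_move_stmt[OF s(1) assms(2,3) s(2) assms(4-6)] by blast+
  show ?thesis
  proof (cases "s aSl = sl \<and> (\<forall>e t'. e < f \<or> e = f \<and> t' < t \<longrightarrow> e \<noteq> e0 \<longrightarrow> t' < horizon I \<longrightarrow> cost e0 sl \<le> cost e0 (sl(e := Suc t')))")
    case True
    show ?thesis
    proof (cases "cost e0 (sl(f := Suc t)) < cost e0 sl")
      case less: True
      then have "\<not> locally_optimal e0 sl" using assms(4-6) by (auto simp: locally_optimal_def not_le)
      then show ?thesis using m less True by (simp add: scanned_def)
    next
      case False
      then have "?s aSl = sl" using m(3) True by simp
      moreover have "cost e0 sl \<le> cost e0 (sl(e := Suc t'))"
        if "e < f \<or> e = f \<and> t' < Suc t" "e \<noteq> e0" "t' < horizon I" for e t'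
      proof (cases "e = f \<and> t' = t")
        case True
        then show ?thesis using False by simp
      next
        case ne: False
        then have "e < f \<or> e = f \<and> t' < t" using that(1) by (auto simp: less_Suc_eq)
        then show ?thesis using True that(2,3) by blast
      qed
      ultimately show ?thesis using m(1,2) unfolding scanned_def by blast
    qed
  next
    case False
    then have less: "cost e0 (s aSl) < cost e0 sl" "\<not> locally_optimal e0 sl" using assms(1) unfolding scanned_def by blast+
    have "cost e0 (?s aSl) \<le> cost e0 (s aSl)" using m(3) by simp
    then have "cost e0 (?s aSl) < cost e0 sl" using less(1) by simp
    then show ?thesis using m(1,2) less(2) unfolding scanned_def by blast
  qed
qed

lemma scanned_next:
  assumes "scanned e0 t0 sl f t s" "f = e0 \<or> horizon I \<le> t"
  shows "scanned e0 t0 sl (Suc f) 0 s"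
proof -
  have "e < Suc f \<or> e = Suc f \<and> t' < 0 \<Longrightarrow> e \<noteq> e0 \<Longrightarrow> t' < horizon I \<Longrightarrow> e < f \<or> e = f \<and> t' < t" for e t'
    using assms(2) by (auto simp: less_Suc_eq)
  then show ?thesis using assms(1) unfolding scanned_def by blast
qed

lemma run_pass_stmt:
  assumes "base e0 t0 s" "s vCur 0 = cost e0 (s aSl)"
  shows "scanned e0 t0 (s aSl) n 0 (run inp pass_stmt s)"
  unfolding pass_stmt_def
proof (rule ForTo_rule[of "\<lambda>f. scanned e0 t0 (s aSl) f 0"])
  show "scanned e0 t0 (s aSl) 0 0 s" using assms by (simp add: scanned_def)
  show "n \<le> M" using code_bounds(1) by simp
  show "scanned e0 t0 (s aSl) i 0 (put vF 0 v s')" if "scanned e0 t0 (s aSl) i 0 s'" for i s' v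
    using that by (simp add: scanned_put)
  show "val_of inp eCount s' = n" for s' by simp
  fix f s' assume f: "f < n" "s' vF 0 = f" and P: "scanned e0 t0 (s aSl) f 0 s'"
  have e0: "s' vE0 0 = e0" using P by (simp add: scanned_def base_def)
  show "scanned e0 t0 (s aSl) (Suc f) 0 (run inp (IfNeq (Var vF) (Var vE0) (ForTo vT (Inp (Num 1)) move_stmt)) s')"
  proof (cases "f = e0")
    case True
    then show ?thesis using scanned_next[OF P] f(2) e0 by (simp add: run_IfNeq)
  next
    case False
    let ?Q = "\<lambda>t s'. scanned e0 t0 (s aSl) f t s' \<and> s' vF 0 = f"
    have "?Q (horizon I) (run inp (ForTo vT (Inp (Num 1)) move_stmt) s')"
    proof (rule ForTo_rule[of ?Q])
      show "?Q i (put vT 0 v s'')" if "?Q i s''" for i s'' v using that by (simp add: scanned_put put_other)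
      fix t s'' assume t: "t < horizon I" "s'' vT 0 = t" and Q: "?Q t s''"
      have "run inp move_stmt s'' vF = s'' vF" by (simp add: run_frame)
      then show "?Q (Suc t) (run inp move_stmt s'')"
        using scanned_move[OF conjunct1[OF Q] conjunct2[OF Q] t(2) f(1) False t(1)] Q by simp
    qed (use P f in simp_all)
    then have "scanned e0 t0 (s aSl) f (horizon I) (run inp (ForTo vT (Inp (Num 1)) move_stmt) s')" by blast
    from scanned_next[OF this] show ?thesis using False f(2) e0 by (simp add: run_IfNeq)
  qed
qed

text \<open>Each of at most \<open>M\<close> levels contributes a weight at most
  \<open>M ^ 4\<close> and an averaged waste at most \<open>M ^ 2\<close>, in total
  \<open>M ^ 7\<close>. This is why eight nested loops suffice in
  \<open>search_stmt\<close>.\<close>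

lemma cost_less:
  assumes "1 \<le> n"
  shows "cost e0 sl < M ^ 8"
proof -
  have w: "wsum (include_weight levels e0 k) (exclude_weight levels e0 k) (events I) (\<lambda>E. waste I (\<Union>e\<in>E. window I e (sl e)))
      \<le> levels ^ n * (M * M)" if k: "k \<le> levels" for k
  proof -
    let ?u = "include_weight levels e0 k" and ?v = "exclude_weight levels e0 k"
    have "wsum ?u ?v (events I) (\<lambda>E. waste I (\<Union>e\<in>E. window I e (sl e))) \<le> wsum ?u ?v (events I) (\<lambda>_. M * M)"
      unfolding wsum_def using less_imp_le[OF waste_less] by (intro sum_mono mult_le_mono2)
    also have "\<dots> = (\<Prod>e\<in>events I. ?u e + ?v e) * (M * M)" by (rule wsum_const) simp
    also have "(\<Prod>e\<in>events I. ?u e + ?v e) = (\<Prod>e\<in>events I. levels)"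
      using k by (intro prod.cong) (simp_all add: include_weight_def exclude_weight_def)
    finally show ?thesis by (simp add: events_def)
  qed
  have "potential I levels level e0 sl \<le> (\<Sum>k=1..levels. M ^ 4 * (levels ^ n * (M * M)))"
    unfolding potential_def by (intro sum_mono mult_le_mono w level_le) simp_all
  also have "\<dots> = levels ^ n * (levels * (M ^ 4 * (M * M)))" by simp
  finally have "cost e0 sl \<le> levels * (M ^ 4 * (M * M))"
    unfolding cost_def using levels_pos[of 0] assms div_le_mono[of "potential I levels level e0 sl" _ "levels ^ n"] by force
  also have "\<dots> \<le> M * (M ^ 4 * (M * M))" using levels_le by (rule mult_le_mono1)
  also have "\<dots> = M ^ 7" by (simp add: numeral_eq_Suc)
  also have "\<dots> < M ^ 8" using code_bounds(4) by (intro power_strict_increasing) simp_all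
  finally show ?thesis .
qed

lemma run_search_stmt:
  assumes s: "ready s" "s vE0 0 = e0" "\<forall>k. 1 \<le> k \<and> k \<le> levels \<longrightarrow> s aW k = level k" "s vScale 0 = levels ^ n"
    and e0: "e0 < n" "s vT0 0 = t" "t < horizon I"
  shows "base e0 (Suc t) (run inp search_stmt s) \<and> locally_optimal e0 (run inp search_stmt s aSl)"
proof -
  let ?A = "{vI, aSl}"
  define s1 where "s1 = run inp (ForTo vI eCount (Upd aSl (Var vI) (Num 1))) s"
  define s2 where "s2 = put aSl e0 (Suc t) s1"
  define s3 where "s3 = run inp potential_stmt s2"
  define s4 where "s4 = put vCur 0 (cost e0 (s3 aSl)) s3"
  let ?Q = "\<lambda>k s'. (\<forall>e<k. s' aSl e = 1)"
  have "?Q n s1" unfolding s1_def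
    by (rule ForTo_rule[of ?Q]) (use code_bounds(1) in \<open>simp_all add: put_other put_self less_Suc_eq\<close>)
  moreover have "1 \<in> slots I" "Suc t \<in> slots I" using e0(3) by (simp_all add: slots_def)
  ultimately have v: "valid (s2 aSl)" by (simp add: valid_def s2_def put_self)
  have fr1: "s1 j = s j" if "j \<noteq> vI" "j \<noteq> aSl" for j using that by (simp add: s1_def run_frame)
  have b2: "base e0 (Suc t) s2"
    unfolding base_def using v s fr1 by (simp add: s2_def put_other put_self ready_def)
  have b3: "base e0 (Suc t) s3" using b2 by (simp add: s3_def base_potential)
  have sl3: "s3 aSl = s2 aSl" by (simp add: s3_def run_frame)
  have acc: "s3 vAcc 0 div s3 vScale 0 = cost e0 (s3 aSl)"
    using run_potential_stmt[OF b2] b3 sl3 by (simp add: s3_def[symmetric] cost_def base_def)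
  have "run inp (Upd aSl (Var vE0) (Add (Var vT0) (Num 1))) s1 = s2"
    using s(2) e0(2) fr1 by (simp add: s2_def)
  moreover have "run inp (Upd vCur (Num 0) (Quot (Var vAcc) (Var vScale))) s3 = s4" using acc by (simp add: s4_def)
  ultimately have run: "run inp search_stmt s = run inp (Repeat [42, 43, 44, 45, 46, 47, 48, 49] pass_stmt) s4"
    unfolding search_stmt_def run.simps(3) s1_def[symmetric] by (simp only: s3_def)
  have b4: "base e0 (Suc t) s4" "s4 vCur 0 = cost e0 (s4 aSl)"
    using b3 base_cong[of s4 s3] by (simp_all add: s4_def put_other put_self)
  \<comment> \<open>Until a local optimum is reached each pass lowers the cost by at least one;
    \<open>M ^ 8\<close> such passes would exceed the initial cost.\<close>
  let ?P = "\<lambda>k s'. base e0 (Suc t) s' \<and> s' vCur 0 = cost e0 (s' aSl) \<and>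
    (locally_optimal e0 (s' aSl) \<or> cost e0 (s' aSl) + k \<le> cost e0 (s4 aSl))"
  have "?P (0 + M ^ length [42::nat, 43, 44, 45, 46, 47, 48, 49]) (run inp (Repeat [42, 43, 44, 45, 46, 47, 48, 49] pass_stmt) s4)"
  proof (rule Repeat_rule[of ?P])
    show "?P 0 s4" using b4 by simp
    fix i s' v x assume x: "x \<in> set [42::nat, 43, 44, 45, 46, 47, 48, 49]" and P: "?P i s'"
    have ne: "0 \<noteq> x" "vE0 \<noteq> x" "aSl \<noteq> x" "aW \<noteq> x" "vScale \<noteq> x" "vCur \<noteq> x" using x by auto
    have "base e0 (Suc t) (put x 0 v s') \<longleftrightarrow> base e0 (Suc t) s'" using ne by (intro base_cong) (simp_all add: put_other)
    then show "?P i (put x 0 v s')" using P ne by (simp add: put_other)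
  next
    fix i s' assume P: "?P i s'"
    then have sc: "scanned e0 (Suc t) (s' aSl) n 0 (run inp pass_stmt s')" by (intro run_pass_stmt) simp_all
    let ?s = "run inp pass_stmt s'"
    have b: "base e0 (Suc t) ?s" "?s vCur 0 = cost e0 (?s aSl)" using sc by (simp_all add: scanned_def)
    show "?P (Suc i) ?s"
    proof (cases "cost e0 (?s aSl) < cost e0 (s' aSl) \<and> \<not> locally_optimal e0 (s' aSl)")
      case True
      then have "cost e0 (s' aSl) + i \<le> cost e0 (s4 aSl)" using P by blast
      then have "cost e0 (?s aSl) + Suc i \<le> cost e0 (s4 aSl)" using True by linarith
      then show ?thesis using b by blast
    next
      case False
      then have "?s aSl = s' aSl" "locally_optimal e0 (s' aSl)"
        using sc unfolding scanned_def locally_optimal_def by blast+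
      then show ?thesis using b by simp
    qed
  qed
  moreover have "\<not> cost e0 sl + (0 + M ^ length [42::nat, 43, 44, 45, 46, 47, 48, 49]) \<le> cost e0 (s4 aSl)" for sl
  proof -
    have "length [42::nat, 43, 44, 45, 46, 47, 48, 49] = 8" by simp
    moreover have "cost e0 (s4 aSl) < M ^ 8" using e0(1) by (intro cost_less) simp
    ultimately show ?thesis by (simp only:)
  qed
  ultimately show ?thesis unfolding run by blast
qed

end

lemma assigned_weights_stmt [simp]: "assigned weights_stmt = {vK, aW}"
  by (auto simp: weights_stmt_def)

lemma assigned_scale_stmt [simp]: "assigned scale_stmt = {vI, vScale}"
  by (auto simp: scale_stmt_def)

context psba_run
begin

definition weights_ready :: "state \<Rightarrow> bool" where
  "weights_ready s \<longleftrightarrow> ready s \<and> (\<forall>k. 1 \<le> k \<and> k \<le> levels \<longrightarrow> s aW k = level k) \<and> s vScale 0 = levels ^ n"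

lemma weights_ready_cong: "s' 0 = s 0 \<Longrightarrow> s' aW = s aW \<Longrightarrow> s' vScale = s vScale \<Longrightarrow> weights_ready s' \<longleftrightarrow> weights_ready s"
  by (simp add: weights_ready_def ready_def)

lemma run_weights_stmt:
  assumes s: "ready s" and k: "1 \<le> k" "k \<le> levels"
  shows "run inp weights_stmt s aW k = level k"
proof -
  let ?d = "Sub (Sub eLevels (Num 1)) (Var vK)"
  let ?e = "Quot (Mul (Mul (Arr aW (Sub eLevels (Var vK))) eLevels) (Sub eLevels (Var vK))) (Mul (Add eLevels (Num 1)) ?d)"
  let ?s0 = "put aW levels (levels ^ 3) s"
  let ?P = "\<lambda>i s'. ready s' \<and> (\<forall>k. levels - i \<le> k \<and> k \<le> levels \<longrightarrow> s' aW k = level k)"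
  have small: "levels \<le> 2 ^ (M * M)" using levels_le M_le_power by linarith
  have "val_of inp (Mul (Mul eLevels eLevels) eLevels) s = levels ^ 3"
    using s small by (simp add: val_Mul power3_eq_cube)
  then have run: "run inp weights_stmt s = run inp (ForTo vK (Sub eLevels (Num 1)) (Upd aW ?d ?e)) ?s0"
    unfolding weights_stmt_def by simp
  have "?P (levels - 1) (run inp (ForTo vK (Sub eLevels (Num 1)) (Upd aW ?d ?e)) ?s0)"
  proof (rule ForTo_rule[of ?P])
    show "?P 0 ?s0"
    proof (intro conjI allI impI)
      show "ready ?s0" using s by (simp add: ready_def put_other)
      fix k assume "levels - 0 \<le> k \<and> k \<le> levels"
      then have "k = levels" by simp
      then show "?s0 aW k = level k" by (simp add: put_self level_weight_top)
    qed
    show "levels - 1 \<le> M" using levels_le by simp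
    show "?P i (put vK 0 v s')" if "?P i s'" for i s' v using that by (simp add: ready_def put_other)
    show "val_of inp (Sub eLevels (Num 1)) s' = levels - 1" for s' by simp
    fix i s' assume i: "i < levels - 1" "s' vK 0 = i" and P: "?P i s'"
    let ?k = "levels - 1 - i"
    have k: "1 \<le> ?k" "?k < levels" "levels - i = Suc ?k" using i(1) by auto
    have "s' aW (Suc ?k) = level (Suc ?k)" using P k by simp
    then have e: "val_of inp ?e s' = (level (Suc ?k) * levels * Suc ?k) div ((levels + 1) * ?k)"
      using P i(2) k small by (simp add: val_Mul)
    have "(level (Suc ?k) * levels * Suc ?k) div ((levels + 1) * ?k) = level ?k"
      unfolding level_weight_rec[OF k(1,2)] by (simp only: ac_simps)
    moreover have "val_of inp ?d s' = ?k" using i(2) by simp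
    ultimately have run: "run inp (Upd aW ?d ?e) s' = put aW ?k (level ?k) s'" using e by (simp only: run.simps)
    have "put aW ?k (level ?k) s' aW k = level k" if "levels - Suc i \<le> k" "k \<le> levels" for k
    proof (cases "k = ?k")
      case False
      then have "levels - i \<le> k" using that(1) by simp
      then show ?thesis using P that(2) False by (simp add: put_self)
    qed (simp add: put_self)
    moreover have "ready (put aW ?k (level ?k) s')" using P by (simp add: ready_def put_other)
    ultimately show "?P (Suc i) (run inp (Upd aW ?d ?e) s')" unfolding run by blast
  qed
  then show ?thesis using k unfolding run by simp
qed

lemma run_scale_stmt:
  assumes s: "ready s"
  shows "run inp scale_stmt s vScale 0 = levels ^ n"
proof -
  have small: "levels \<le> 2 ^ (M * M)" using levels_le M_le_power by linarith
  let ?P = "\<lambda>i s'. ready s' \<and> s' vScale 0 = levels ^ i"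
  have "?P n (run inp (ForTo vI eCount (Upd vScale (Num 0) (Mul (Var vScale) eLevels))) (put vScale 0 1 s))"
    by (rule ForTo_rule[of ?P])
      (use s small code_bounds(1) in \<open>simp_all add: ready_def[THEN iffD2] val_Mul put_other put_self, simp_all add: ready_def put_other\<close>)
  then show ?thesis by (simp add: scale_stmt_def)
qed

lemma run_check_stmt:
  assumes s: "ready s" "valid (s aSl)"
  defines "w \<equiv> waste I (\<Union>e\<in>events I. window I e (s aSl e))"
  shows "(if w < s vGlobal 0 then run inp check_stmt s vGlobal 0 = w \<and> (\<forall>e<n. run inp check_stmt s aBest e = s aSl e)
    else run inp check_stmt s vGlobal = s vGlobal \<and> run inp check_stmt s aBest = s aBest)"
proof -
  let ?c = "Then (Upd aInc (Var vI) (Num 1)) (Upd aExc (Var vI) (Num 0))"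
  define s1 where "s1 = run inp (ForTo vI eCount ?c) s"
  define s2 where "s2 = put vAcc 0 0 (put vW 0 1 s1)"
  define s3 where "s3 = run inp eval_stmt s2"
  let ?P = "\<lambda>i s'. \<forall>e<i. s' aInc e = 1 \<and> s' aExc e = 0"
  have inc: "?P n s1" unfolding s1_def
    by (rule ForTo_rule[of ?P]) (use code_bounds(1) in \<open>simp_all add: put_other put_self less_Suc_eq\<close>)
  have fr1: "s1 j = s j" if "j \<noteq> vI" "j \<noteq> aInc" "j \<noteq> aExc" for j using that by (simp add: s1_def run_frame)
  have "sched (events I) s2"
    using inc s fr1 by (simp add: sched_def s2_def put_other put_self ready_def events_def valid_def)
  then have "s3 vAcc 0 = waste I (\<Union>e\<in>events I. window I e (s2 aSl e))"
    unfolding s3_def by (rule run_waste) (simp add: s2_def put_self)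
  then have acc: "s3 vAcc 0 = w" using fr1 by (simp add: w_def s2_def put_other)
  have fr3: "s3 vGlobal = s vGlobal" "s3 aBest = s aBest" "s3 aSl = s aSl"
    using fr1 by (simp_all add: s3_def run_frame s2_def put_other)
  let ?d = "Upd aBest (Var vI) (Arr aSl (Var vI))"
  have "run inp (Upd vAcc (Num 0) (Num 0)) (run inp (Upd vW (Num 0) (Num 1)) s1) = s2" by (simp add: s2_def)
  then have run: "run inp check_stmt s = (if w < s vGlobal 0 then run inp (ForTo vI eCount ?d) (put vGlobal 0 w s3) else s3)"
    unfolding check_stmt_def run.simps(3) s1_def[symmetric] using acc fr3 by (simp add: s3_def[symmetric])
  show ?thesis
  proof (cases "w < s vGlobal 0")
    case True
    let ?Q = "\<lambda>i s'. s' vGlobal 0 = w \<and> s' aSl = s aSl \<and> (\<forall>e<i. s' aBest e = s aSl e)"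
    have "?Q n (run inp (ForTo vI eCount ?d) (put vGlobal 0 w s3))"
      by (rule ForTo_rule[of ?Q]) (use code_bounds(1) fr3 in \<open>simp_all add: put_other put_self less_Suc_eq\<close>)
    then show ?thesis using True unfolding run by simp
  next
    case False
    then show ?thesis using fr3 unfolding run by simp
  qed
qed

abbreviation total_waste :: "(nat \<Rightarrow> nat) \<Rightarrow> nat" where
  "total_waste sl \<equiv> waste I (\<Union>e\<in>events I. window I e (sl e))"

text \<open>Guesses are processed in lexicographic order; each one done leaves as witness a local
  optimum with the guessed pair that is no better than the recorded schedule.\<close>

definition explored :: "nat \<Rightarrow> nat \<Rightarrow> state \<Rightarrow> bool" where
  "explored f t s \<longleftrightarrow> weights_ready s \<and>
     (\<forall>e0 t0. (e0 < f \<or> e0 = f \<and> t0 < t) \<and> e0 < n \<and> t0 < horizon I \<longrightarrow>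
        (\<exists>sl. valid sl \<and> sl e0 = Suc t0 \<and> locally_optimal e0 sl \<and> s vGlobal 0 \<le> total_waste sl)) \<and>
     (s vGlobal 0 = M * M \<or> valid (s aBest) \<and> s vGlobal 0 = total_waste (s aBest))"

lemma explored_cong:
  "s' 0 = s 0 \<Longrightarrow> s' aW = s aW \<Longrightarrow> s' vScale = s vScale \<Longrightarrow> s' vGlobal = s vGlobal \<Longrightarrow> s' aBest = s aBest \<Longrightarrow>
    explored f t s' \<longleftrightarrow> explored f t s"
  by (simp add: explored_def weights_ready_def ready_def)

lemma total_waste_cong: "(\<And>e. e < n \<Longrightarrow> sl e = sl' e) \<Longrightarrow> total_waste sl = total_waste sl'"
  by (intro arg_cong[of _ _ "waste I"] SUP_cong) (simp_all add: events_def)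

lemma explored_step:
  assumes "explored f t s" "s vE0 0 = f" "s vT0 0 = t" "f < n" "t < horizon I"
  shows "explored f (Suc t) (run inp check_stmt (run inp search_stmt s))"
proof -
  define s1 where "s1 = run inp search_stmt s"
  define s2 where "s2 = run inp check_stmt s1"
  have wr: "weights_ready s" using assms(1) by (simp add: explored_def)
  have b: "base f (Suc t) s1 \<and> locally_optimal f (s1 aSl)"
    unfolding s1_def by (rule run_search_stmt) (use wr assms in \<open>simp_all add: weights_ready_def\<close>)
  then have v: "ready s1" "valid (s1 aSl)" "s1 aSl f = Suc t" by (simp_all add: base_def)
  have fr1: "s1 vGlobal = s vGlobal" "s1 aBest = s aBest" "s1 0 = s 0" "s1 aW = s aW" "s1 vScale = s vScale"
    by (simp_all add: s1_def run_frame)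
  have fr2: "s2 0 = s1 0" "s2 aW = s1 aW" "s2 vScale = s1 vScale" by (simp_all add: s2_def run_frame)
  let ?w = "total_waste (s1 aSl)"
  note ch = run_check_stmt[OF v(1,2), folded s2_def]
  have le: "s2 vGlobal 0 \<le> s vGlobal 0" "s2 vGlobal 0 \<le> ?w" using ch fr1 by (auto split: if_splits)
  have "s2 vGlobal 0 = M * M \<or> valid (s2 aBest) \<and> s2 vGlobal 0 = total_waste (s2 aBest)"
  proof (cases "?w < s1 vGlobal 0")
    case True
    then have *: "s2 vGlobal 0 = ?w" "\<And>e. e < n \<Longrightarrow> s2 aBest e = s1 aSl e" using ch by simp_all
    have "valid (s2 aBest)" using v(2) *(2) by (simp add: valid_def)
    moreover have "total_waste (s2 aBest) = ?w" using *(2) by (rule total_waste_cong)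
    ultimately show ?thesis using *(1) by simp
  next
    case False
    then have "s2 vGlobal = s vGlobal" "s2 aBest = s aBest" using ch fr1 by simp_all
    then show ?thesis using assms(1) by (simp add: explored_def)
  qed
  moreover have "weights_ready s2" using wr fr1 fr2 weights_ready_cong[of s2 s] by simp
  moreover have "\<exists>sl. valid sl \<and> sl e0 = Suc t0 \<and> locally_optimal e0 sl \<and> s2 vGlobal 0 \<le> total_waste sl"
    if "e0 < f \<or> e0 = f \<and> t0 < Suc t" "e0 < n" "t0 < horizon I" for e0 t0
  proof (cases "e0 = f \<and> t0 = t")
    case True
    then show ?thesis using v b le(2) by (intro exI[of _ "s1 aSl"]) simp
  next
    case False
    then have lt: "e0 < f \<or> e0 = f \<and> t0 < t" using that(1) by (auto simp: less_Suc_eq)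
    have en: "e0 < n" "t0 < horizon I" by (rule that)+
    from lt obtain sl where "valid sl" "sl e0 = Suc t0" "locally_optimal e0 sl" "s vGlobal 0 \<le> total_waste sl"
      using assms(1) en unfolding explored_def by blast
    then show ?thesis using le(1) by (intro exI[of _ sl]) simp
  qed
  ultimately show ?thesis unfolding s1_def[symmetric] s2_def[symmetric] explored_def by blast
qed

lemma explored_next: "explored f (horizon I) s \<Longrightarrow> explored (Suc f) 0 s"
  unfolding explored_def less_Suc_eq by auto

lemma ratio:
  assumes ex: "explored n 0 s" and n: "1 \<le> n"
  shows "valid (s aBest)"
    and "\<And>opt. valid opt \<Longrightarrow> (1 - 1 / exp 1) * real (tr I (\<Union>e\<in>events I. window I e (opt e)))
      \<le> real (tr I (\<Union>e\<in>events I. window I e (s aBest e)))"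
proof -
  have pos: "0 < horizon I" using inst by (simp add: psba_instance_def)
  have ex': "\<exists>sl. valid sl \<and> sl e0 = Suc t0 \<and> locally_optimal e0 sl \<and> s vGlobal 0 \<le> total_waste sl"
    if "e0 < n" "t0 < horizon I" for e0 t0
    using ex that unfolding explored_def by blast
  have "0 < n" using n by linarith
  from ex'[OF this pos] obtain sl where "s vGlobal 0 \<le> total_waste sl" by (elim exE conjE) (rule that)
  then have "s vGlobal 0 < M * M" using waste_less le_less_trans by blast
  then have best: "valid (s aBest)" "s vGlobal 0 = total_waste (s aBest)" using ex unfolding explored_def by auto
  show "valid (s aBest)" by (rule best(1))
  fix opt assume opt: "valid opt"
  have "0 \<in> events I" using \<open>0 < n\<close> by (simp add: events_def)
  then have "events I \<noteq> {}" by blast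
  \<comment> \<open>Among the explored guesses is the pair that a heavy event \<open>e0\<close> has
    in the competing schedule; slots are counted from \<open>1\<close>, guesses from
    \<open>0\<close>.\<close>
  from exists_heavy_event[OF inst this, of opt] obtain e0 where e0: "e0 \<in> events I"
      "tr I (\<Union>e\<in>events I. window I e (opt e)) \<le> card (events I) * tr I (window I e0 (opt e0))" by (elim bexE)
  have "opt e0 \<in> slots I" using opt e0(1) by (simp add: valid_def events_def)
  then have o: "e0 < n" "opt e0 - 1 < horizon I" "Suc (opt e0 - 1) = opt e0" using e0(1) by (auto simp: slots_def events_def)
  from ex'[OF o(1,2)] obtain sl where sl: "valid sl" "sl e0 = opt e0" "locally_optimal e0 sl" "s vGlobal 0 \<le> total_waste sl"
    unfolding o(3) by (elim exE conjE)
  have cardE: "n = card (events I)" by (simp add: events_def)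
  have "(1 - 1 / exp 1) * real (tr I (\<Union>e\<in>events I. window I e (opt e))) \<le> real (tr I (\<Union>e\<in>events I. window I e (sl e)))"
  proof (rule local_search_ratio[OF inst e0(1) cardE levels_def _ _ _ refl])
    show "sl e \<in> slots I" if "e \<in> events I" for e using sl(1) that by (simp add: valid_def events_def)
    show "opt e \<in> slots I" if "e \<in> events I" for e using opt that by (simp add: valid_def events_def)
    show "opt e0 = sl e0" using sl(2) by simp
    show "potential I levels level e0 sl div levels ^ n \<le> potential I levels level e0 (sl(e := t)) div levels ^ n"
      if "e \<in> events I" "e \<noteq> e0" "t \<in> slots I" for e t
    proof -
      have "e < n" "t - 1 < horizon I" "Suc (t - 1) = t" using that(1,3) by (auto simp: events_def slots_def)
      then show ?thesis using sl(3) that(2) unfolding locally_optimal_def cost_def by metis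
    qed
    show "tr I (\<Union>e\<in>events I. window I e (opt e)) \<le> n * tr I (window I e0 (opt e0))" using e0(2) unfolding cardE .
  qed
  also have "real (tr I (\<Union>e\<in>events I. window I e (sl e))) \<le> real (tr I (\<Union>e\<in>events I. window I e (s aBest e)))"
  proof -
    have sub: "(\<Union>e\<in>events I. window I e (f e)) \<subseteq> slots I" for f by (auto simp: window_def)
    have "total_waste (s aBest) \<le> total_waste sl" using sl(4) best(2) by simp
    then show ?thesis using tr_add_waste[OF inst sub, of sl] tr_add_waste[OF inst sub, of "s aBest"] by linarith
  qed
  finally show "(1 - 1 / exp 1) * real (tr I (\<Union>e\<in>events I. window I e (opt e)))
      \<le> real (tr I (\<Union>e\<in>events I. window I e (s aBest e)))" .
qed

lemma run_local_stmt:
  assumes s: "ready s"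
  shows "\<exists>xs. approximates (1 - 1 / exp 1) I (set xs) \<and> run inp local_stmt s vLen 0 = 2 * n \<and>
    map (run inp local_stmt s aOut) [0..<2 * n] = encode_schedule xs"
proof -
  define s1 where "s1 = run inp weights_stmt s"
  define s2 where "s2 = run inp scale_stmt s1"
  define s3 where "s3 = put vGlobal 0 (M * M) s2"
  let ?b = "Then search_stmt check_stmt"
  define s4 where "s4 = run inp (ForTo vE0 eCount (ForTo vT0 (Inp (Num 1)) ?b)) s3"
  let ?o = "Then (Upd aOut (Add (Var vI) (Var vI)) (Var vI)) (Upd aOut (Add (Add (Var vI) (Var vI)) (Num 1)) (Arr aBest (Var vI)))"
  define s5 where "s5 = run inp (ForTo vI eCount ?o) s4"
  have fr: "s1 0 = s 0" "s2 0 = s1 0" "s2 aW = s1 aW"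
    by (simp_all add: s1_def s2_def run_frame)
  have r: "ready s1" "ready s2" using s fr by (simp_all add: ready_def)
  have "s1 aW k = level k" if "1 \<le> k" "k \<le> levels" for k unfolding s1_def using s that by (rule run_weights_stmt)
  moreover have "s2 vScale 0 = levels ^ n" unfolding s2_def using r(1) by (rule run_scale_stmt)
  ultimately have "weights_ready s2" using r(2) fr by (simp add: weights_ready_def)
  then have "weights_ready s3" using weights_ready_cong[of s3 s2] by (simp add: s3_def put_other)
  then have ex3: "explored 0 0 s3" by (simp add: explored_def s3_def put_self)
  have put: "explored f t (put x 0 v s') \<longleftrightarrow> explored f t s'" if "x = vE0 \<or> x = vT0" for f t x v s'
    using that by (intro explored_cong) (auto simp: put_other)
  have ex4: "explored n 0 s4" unfolding s4_def
  proof (rule ForTo_rule[of "\<lambda>f. explored f 0"])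
    show "n \<le> M" using code_bounds(1) by simp
    show "explored i 0 (put vE0 0 v s')" if "explored i 0 s'" for i s' v using that put by simp
    fix f s' assume f: "f < n" "s' vE0 0 = f" and P: "explored f 0 s'"
    let ?Q = "\<lambda>t s'. explored f t s' \<and> s' vE0 0 = f"
    have "?Q (horizon I) (run inp (ForTo vT0 (Inp (Num 1)) ?b) s')"
    proof (rule ForTo_rule[of ?Q])
      show "?Q i (put vT0 0 v s'')" if "?Q i s''" for i s'' v using that put by (simp add: put_other)
      fix t s'' assume t: "t < horizon I" "s'' vT0 0 = t" and Q: "?Q t s''"
      have "run inp ?b s'' vE0 = s'' vE0" by (rule run_frame) simp
      then show "?Q (Suc t) (run inp ?b s'')"
        using explored_step[OF conjunct1[OF Q] conjunct2[OF Q] t(2) f(1) t(1)] Q by simp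
    qed (use P f in simp_all)
    then show "explored (Suc f) 0 (run inp (ForTo vT0 (Inp (Num 1)) ?b) s')" using explored_next by blast
  qed (use ex3 in simp_all)
  let ?xs = "map (\<lambda>e. (e, s4 aBest e)) [0..<n]"
  let ?P = "\<lambda>i s'. s' aBest = s4 aBest \<and> (\<forall>j<2 * i. s' aOut j = encode_schedule (map (\<lambda>e. (e, s4 aBest e)) [0..<i]) ! j)"
  have P5: "?P n s5" unfolding s5_def
  proof (rule ForTo_rule[of ?P])
    show "n \<le> M" using code_bounds(1) by simp
    show "?P i (put vI 0 v s')" if "?P i s'" for i s' v using that by (simp add: put_other)
    fix i s' assume i: "s' vI 0 = i" and P: "?P i s'"
    let ?l = "encode_schedule (map (\<lambda>e. (e, s4 aBest e)) [0..<i])"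
    have len: "length ?l = i + i" by (simp add: length_encode_schedule)
    have enc: "encode_schedule (map (\<lambda>e. (e, s4 aBest e)) [0..<Suc i]) = ?l @ [i, s4 aBest i]" by (simp add: encode_schedule_def)
    have run: "run inp ?o s' = put aOut (Suc (i + i)) (s4 aBest i) (put aOut (i + i) i s')"
      using i P by (simp add: put_other)
    have "run inp ?o s' aOut j = (?l @ [i, s4 aBest i]) ! j" if "j < 2 * Suc i" for j
    proof -
      have "j < i + i \<or> j = i + i \<or> j = Suc (i + i)" using that by arith
      then consider "j < i + i" | "j = i + i" | "j = Suc (i + i)" by blast
      then show ?thesis unfolding run using P len by cases (simp_all add: put_self nth_append)
    qed
    moreover have "run inp ?o s' aBest = s4 aBest" unfolding run using P by (simp add: put_other)
    ultimately show "?P (Suc i) (run inp ?o s')" unfolding enc by blast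
  qed simp_all
  have g: "run inp (Upd vGlobal (Num 0) (Mul Bound Bound)) s2 = s3"
  proof -
    have "val_of inp (Mul Bound Bound) s2 = M * M" using r(2) M_le_power by (subst val_Mul) simp_all
    then show ?thesis by (simp add: s3_def)
  qed
  have run: "run inp local_stmt s = put vLen 0 (2 * n) s5"
    unfolding local_stmt_def run.simps(3) s1_def[symmetric] s2_def[symmetric] g s4_def[symmetric] s5_def[symmetric]
    by (simp add: mult_2)
  have set: "set ?xs = assign_of (s4 aBest) (events I)" by (auto simp: assign_of_def events_def)
  have "approximates (1 - 1 / exp 1) I (assign_of (s4 aBest) (events I))"
  proof (rule approximatesI[OF inst complete_assign_of])
    show "s4 aBest e \<in> slots I" if "e \<in> events I" for e
      using ratio(1)[OF ex4] that by (auto simp: valid_def events_def)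
    fix opt assume "\<And>e. e \<in> events I \<Longrightarrow> opt e \<in> slots I"
    then have "valid opt" by (simp add: valid_def events_def)
    show "(1 - 1 / exp 1) * real (tr I (\<Union>e\<in>events I. window I e (opt e))) \<le> real (tr I (cover I (assign_of (s4 aBest) (events I))))"
    proof (cases "n = 0")
      \<comment> \<open>Without events there is no guess to rely on, but the competing schedule
        covers nothing.\<close>
      case True
      then have "events I = {}" by (simp add: events_def)
      then show ?thesis by (simp add: tr_empty[OF inst])
    next
      case False
      then have "1 \<le> n" by linarith
      from ratio(2)[OF ex4 this \<open>valid opt\<close>] show ?thesis unfolding cover_assign_of .
    qed
  qed
  then have "approximates (1 - 1 / exp 1) I (set ?xs)" unfolding set .
  moreover have "map (put vLen 0 (2 * n) s5 aOut) [0..<2 * n] = encode_schedule ?xs"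
    using P5 by (intro nth_equalityI) (simp_all add: length_encode_schedule put_other)
  ultimately show ?thesis unfolding run by (intro exI[of _ ?xs]) (simp add: put_self)
qed

end

abbreviation "local_program \<equiv> program 64 aOut vLen local_stmt"

lemma scoped_local_stmt: "scoped 64 local_stmt" "0 \<notin> assigned local_stmt"
proof -
  have pot: "scoped 64 potential_stmt" by (auto simp: potential_stmt_def level_stmt_def mix_stmt_def)
  have pass: "scoped 64 pass_stmt" using pot by (auto simp: pass_stmt_def move_stmt_def)
  have "scoped 64 (Repeat [42, 43, 44, 45, 46, 47, 48, 49] pass_stmt)" by (rule scoped_Repeat) (use pass in auto)
  then have "scoped 64 search_stmt" using pot by (auto simp: search_stmt_def)
  moreover have "scoped 64 check_stmt" by (auto simp: check_stmt_def)
  ultimately show "scoped 64 local_stmt" by (auto simp: local_stmt_def weights_stmt_def scale_stmt_def)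
  show "0 \<notin> assigned local_stmt" by (auto simp: local_stmt_def weights_stmt_def scale_stmt_def)
qed

lemma local_final:
  assumes "psba_instance I"
  shows "\<exists>xs. approximates (1 - 1 / exp 1) I (set xs) \<and>
    final_state (encode_instance I) local_stmt vLen 0 = 2 * length (ev_lengths I) \<and>
    2 * length (ev_lengths I) \<le> 8 * length (encode_instance I) \<and>
    map (final_state (encode_instance I) local_stmt aOut) [0..<2 * length (ev_lengths I)] = encode_schedule xs"
proof -
  interpret psba_run I using assms by unfold_locales
  show ?thesis unfolding final_state_def using run_local_stmt[OF ready_power_stage] code_bounds(5) by blast
qed

theorem local_program_approximates: "approximation_algorithm (1 - 1 / exp 1) local_program (bounded_instances q)"
  unfolding approximation_algorithm_def
proof
  fix I assume "I \<in> bounded_instances q"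
  then have I: "psba_instance I" by (simp add: bounded_instances_def)
  obtain xs where xs: "approximates (1 - 1 / exp 1) I (set xs)"
    "final_state (encode_instance I) local_stmt vLen 0 = 2 * length (ev_lengths I)"
    "2 * length (ev_lengths I) \<le> 8 * length (encode_instance I)"
    "map (final_state (encode_instance I) local_stmt aOut) [0..<2 * length (ev_lengths I)] = encode_schedule xs"
    using local_final[OF I] by (elim exE conjE)
  have "outputs local_program I xs"
    by (rule outputs_program[OF scoped_local_stmt]) (simp_all add: xs)
  then show "\<exists>xs. outputs local_program I xs \<and> approximates (1 - 1 / exp 1) I (set xs)" using xs(1) by blast
qed

theorem local_program_polynomial: "polynomial_time local_program (bounded_instances q)"
proof (rule polynomial_time_program[OF scoped_local_stmt])
  fix I assume "I \<in> bounded_instances q"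
  then have "psba_instance I" by (simp add: bounded_instances_def)
  from local_final[OF this] show "final_state (encode_instance I) local_stmt vLen 0 \<le> 8 * length (encode_instance I)"
    by (elim exE conjE) simp
qed simp_all

theorem theorem2:
  shows "(\<exists>G. implements_greedy G \<and> (\<forall>q. polynomial_time G (bounded_instances q)))
    \<and> (\<forall>q. \<forall>I\<in>bounded_instances q. \<forall>xs. greedy_run I xs \<longrightarrow> approximates (1 / 2) I (set xs))
    \<and> (\<forall>q. \<exists>P. polynomial_time P (bounded_instances q) \<and>
              approximation_algorithm (1 - 1 / exp 1) P (bounded_instances q))"
  using greedy_program_correct greedy_program_polynomial greedy_half
    local_program_polynomial local_program_approximates
  unfolding bounded_instances_def by blast

end
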